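(* Let $\Gamma\subset\mathrm{PGL}(2,K)$ be a finitely generated discrete subgroup such that $T^\ast_\Gamma=\Gamma\backslash\mathcal T^\ast_\Gamma$ is a tree, and let $\iota_\Gamma\colon T^\ast_\Gamma\hookrightarrow\mathcal T^\ast_\Gamma$ be a section of the quotient map. Then the tree of groups $(T^\ast_\Gamma,\Gamma_\bullet)$ induced by $\iota_\Gamma$ is $\ast$-admissible.
   Context: Notation. $K$ is a finite extension of $\mathbb Q_p$. $\mathcal T_K$ is the Bruhat–Tits tree of $\mathrm{PGL}(2,K)$: vertices are similarity classes of $\mathcal O_K$-lattices in $K^2$, two being adjacent when represented by lattices with quotient of length one. Its ends (equivalence classes of half-lines) are canonically and equivariantly identified with $\mathbb P^1(K)$; for a subtree, its set of ends is regarded as a subset of $\mathbb P^1(K)$. For a tree $T$: $\mathrm{Vert}(T)$, $\mathrm{Edge}(T)$ are the sets of vertices and unoriented edges; $v\vdash\sigma$ means that the edge $\sigma$ emanates from the vertex $v$; $\mathrm{Star}_v(T)$ is the set of edges emanating from $v$; $]z,w[$ is the straight line joining two ends. Convention: $K$ is taken large enough that every element $\ne1$ of the discrete subgroups of $\mathrm{PGL}(2,K)$ considered has its fixed points of $\mathbb P^1$ in $\mathbb P^1(K)$; such groups act on $\mathcal T_K$ without inversion. Trees from groups. For a compact $\mathcal L\subseteq\mathbb P^1(K)$, $\mathcal T(\mathcal L)$ is the minimal subtree of $\mathcal T_K$ with set of ends $\mathcal L$ (the union of the lines $]z,w[$, $z\neq w\in\mathcal L$; empty if $\mathcal L$ has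 fewer than 2 points). For a finitely generated discrete $\Gamma\subset\mathrm{PGL}(2,K)$, let $\mathcal F_\Gamma$ be the set of fixed points of elements $\neq1$ of $\Gamma$, $\overline{\mathcal F}_\Gamma$ its closure, and $\mathcal T^\ast_\Gamma=\mathcal T(\overline{\mathcal F}_\Gamma)$, on which $\Gamma$ acts; $T^\ast_\Gamma=\Gamma\backslash\mathcal T^\ast_\Gamma$. An element of $\mathrm{PGL}(2,K)$ is elliptic if it has two distinct eigenvalues of equal valuation; if its fixed points are $z,w\in\mathbb P^1(K)$, its mirror is $M(\gamma)=\,]z,w[$. For $G$ finite, $\mathcal T^\ast_G$ is the minimal subtree containing all mirrors of elements $\neq1$ of $G$. $\Gamma_v$, $\Gamma_\sigma$ denote stabilizers of vertices and (oriented) edges; these are finite since $\Gamma$ is discrete. When $T^\ast_\Gamma$ is a tree, a section $\iota_\Gamma$ of the quotient map induces a tree of groups $(T^\ast_\Gamma,\Gamma_\bullet)$ by attaching to vertices and edges of $T^\ast_\Gamma$ the stabilizers in $\Gamma$ of their images under $\iota_\Gamma$. Trees of groups. An abstract tree of groups $(T,G_\bullet)$ is a tree $T$ with finite groups $G_v$ ($v\in\mathrm{Vert}(T)$), $G_\sigma$ ($\sigma\in\mathrm{Edge}(T)$) and injective homomorphisms $G_\sigma\hookrightarrow G_v$ for $v\vdash\sigma$; $\varinjlim(T,G_\bullet)$ is the associated amalgam (direct limit of this system of groups). Given embeddings $G_v\hookrightarrow\mathrm{PGL}(2,K)$ for all $v$, compatible with all $G_\sigma\hookrightarrow G_v$,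 let $\widetilde{\mathcal T}_{G_\bullet}$ be the minimal subtree of $\mathcal T_K$ containing all $\mathcal T^\ast_{G_v}$, $v\in\mathrm{Vert}(T)$. For $w\in\mathrm{Vert}(\widetilde{\mathcal T}_{G_\bullet})$, let $\widetilde G_w$ be the subgroup of $\mathrm{PGL}(2,K)$ generated by the stabilizers $(G_u)_w$ for all $u\in\mathrm{Vert}(T)$; for an edge $\sigma$, $\widetilde G_\sigma$ is defined similarly with the stabilizers $(G_u)_\sigma$ (for edges of $\iota(T)$ under condition (iii) below, it is just the intersection of the $\widetilde G_w$ at the two extremities of $\sigma$). Admissible embedding. It is an embedding of trees $\iota\colon T\hookrightarrow\mathcal T_K$ together with embeddings $G_v\hookrightarrow\mathrm{PGL}(2,K)$, $v\in\mathrm{Vert}(T)$, compatible with $G_\sigma\hookrightarrow G_v$ for all $v\vdash\sigma$, such that: (i) $\iota(T)\subset\widetilde{\mathcal T}_{G_\bullet}$; (ii) for any $v\in\mathrm{Vert}(T)$ and $1\ne\gamma\in G_v$ there is $\delta\in\Gamma$ such that $M(\delta\gamma\delta^{-1})\cap\iota(T)$ contains an edge, where $\Gamma$ is the subgroup generated by all $G_v$; (iii) $\widetilde G_{\iota(v)}=G_v$ for all $v\in\mathrm{Vert}(T)$; (iv) $\widetilde G_{\iota(\sigma)}=G_\sigma$ for all $\sigma\in\mathrm{Edge}(T)$; (v) for any $v\in\mathrm{Vert}(T)$, $\iota$ followed by projection gives a bijection $\mathrm{Star}_v(T)\cong G_v\backslash(G_v\cdot\mathrm{Star}_{\iota(v)}(\widetilde{\mathcal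 T}_{G_\bullet}))$. The tree of groups $(T,G_\bullet)$ is $\ast$-admissible if it has an admissible embedding and $\varinjlim(T,G_\bullet)$ is finitely generated. *)

theory Defs
  imports
    "HOL-Algebra.Generated_Groups"
    "HOL-Algebra.Group_Action"
    "HOL-Algebra.Algebraic_Closure_Type"
    "HOL-Analysis.Analysis"
    "HOL-Computational_Algebra.Primes"
begin

section \<open>Finite extensions of the field of p-adic numbers\<close>

text \<open>
  The field \<open>\<rat>\<^sub>p\<close> is the completion of \<open>\<rat>\<close> for the p-adic absolute value, i.e. a complete valued field
  in which \<open>\<rat>\<close>, with that absolute value, is dense. A finite extension carries a unique absolute
  value extending the one of \<open>\<rat>\<^sub>p\<close>; it is \<open>\<nu>\<close> below, and the copy of \<open>\<rat>\<^sub>p\<close> is the closure of \<open>\<rat>\<close>.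
\<close>

definition (in ab_group_add) abs_dist :: "('a \<Rightarrow> real) \<Rightarrow> 'a \<Rightarrow> 'a \<Rightarrow> real" where
  "abs_dist \<nu> x y = \<nu> (x - y)"

definition (in field_char_0) rat_closure :: "('a \<Rightarrow> real) \<Rightarrow> 'a set" where
  "rat_closure \<nu> = Metric_space.mtopology UNIV (abs_dist \<nu>) closure_of \<rat>"

definition (in field_char_0) finite_extension_Qp :: "nat \<Rightarrow> ('a \<Rightarrow> real) \<Rightarrow> bool" where
  "finite_extension_Qp p \<nu> \<longleftrightarrow>
     Factorial_Ring.prime p \<and>
     (\<forall>x. 0 \<le> \<nu> x) \<and> (\<forall>x. \<nu> x = 0 \<longleftrightarrow> x = 0) \<and>
     (\<forall>x y. \<nu> (x * y) = \<nu> x * \<nu> y) \<and>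
     (\<forall>x y. \<nu> (x + y) \<le> max (\<nu> x) (\<nu> y)) \<and>
     (\<forall>n::int. n \<noteq> 0 \<longrightarrow> \<nu> (of_int n) = 1 / real p ^ multiplicity (int p) n) \<and>
     Metric_space.mcomplete (rat_closure \<nu>) (abs_dist \<nu>) \<and>
     (\<exists>B. finite B \<and>
        (\<forall>x. \<exists>c. (\<forall>b\<in>B. c b \<in> rat_closure \<nu>) \<and> x = (\<Sum>b\<in>B. c b * b)))"

class padic_field = field_char_0 +
  fixes absv :: "'a \<Rightarrow> real"
  assumes finite_extension_absv: "\<exists>p. finite_extension_Qp p absv"

definition valuation_ring :: "'a::padic_field set" where
  "valuation_ring = {x. absv x \<le> 1}"


section \<open>Graphs and trees\<close>

text \<open>
  Unoriented graphs, loops and multiple edges allowed: \<open>endpoints G e\<close> has one element for a loop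
  and two elements otherwise. The empty graph counts as a tree, in accordance with the convention
  that the minimal subtree containing nothing is empty.
\<close>

record ('v, 'e) ugraph =
  verts :: "'v set"
  edges :: "'e set"
  endpoints :: "'e \<Rightarrow> 'v set"

definition is_graph :: "('v, 'e) ugraph \<Rightarrow> bool" where
  "is_graph G \<longleftrightarrow> (\<forall>e\<in>edges G. \<exists>u\<in>verts G. \<exists>v\<in>verts G. endpoints G e = {u, v})"

definition connected_graph :: "('v, 'e) ugraph \<Rightarrow> bool" where
  "connected_graph G \<longleftrightarrow>
     (\<forall>u\<in>verts G. \<forall>v\<in>verts G. (u, v) \<in> {(x, y). \<exists>e\<in>edges G. endpoints G e = {x, y}}\<^sup>*)"

text \<open>A circuit of length 1 is a loop, one of length 2 is a pair of parallel edges.\<close>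

definition circuit :: "('v, 'e) ugraph \<Rightarrow> 'v list \<Rightarrow> 'e list \<Rightarrow> bool" where
  "circuit G vs es \<longleftrightarrow>
     es \<noteq> [] \<and> length vs = length es \<and> distinct vs \<and> distinct es \<and>
     set vs \<subseteq> verts G \<and> set es \<subseteq> edges G \<and>
     (\<forall>i<length es. endpoints G (es ! i) = {vs ! i, vs ! ((i + 1) mod length es)})"

definition is_tree :: "('v, 'e) ugraph \<Rightarrow> bool" where
  "is_tree G \<longleftrightarrow> is_graph G \<and> connected_graph G \<and> (\<nexists>vs es. circuit G vs es)"

definition star :: "('v, 'e) ugraph \<Rightarrow> 'v \<Rightarrow> 'e set" where
  "star G v = {e \<in> edges G. v \<in> endpoints G e}"

definition is_subgraph :: "('v, 'e) ugraph \<Rightarrow> ('v, 'e) ugraph \<Rightarrow> bool" where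
  "is_subgraph H G \<longleftrightarrow>
     is_graph H \<and> verts H \<subseteq> verts G \<and> edges H \<subseteq> edges G \<and>
     (\<forall>e\<in>edges H. endpoints H e = endpoints G e)"

definition is_subtree :: "('v, 'e) ugraph \<Rightarrow> ('v, 'e) ugraph \<Rightarrow> bool" where
  "is_subtree H G \<longleftrightarrow> is_subgraph H G \<and> is_tree H"


section \<open>The group PGL(2,K)\<close>

definition GL2 :: "('a::field^2^2) monoid" where
  "GL2 = \<lparr>carrier = {A. invertible A}, monoid.mult = (**), one = mat 1\<rparr>"

definition scalar_matrices :: "('a::field^2^2) set" where
  "scalar_matrices = {mat c | c. c \<noteq> 0}"

text \<open>An element of PGL(2,K) is a coset: the set of all matrices representing it.\<close>

definition PGL2 :: "('a::field^2^2) set monoid" where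
  "PGL2 = GL2 Mod scalar_matrices"

definition matrix_dist :: "'a::padic_field^2^2 \<Rightarrow> 'a^2^2 \<Rightarrow> real" where
  "matrix_dist A B = Max (range (\<lambda>(i, j). absv (A $ i $ j - B $ i $ j)))"

text \<open>
  The quotient topology from GL(2,K), which is open in the space of matrices; \<open>\<Union>U\<close> is the
  preimage of \<open>U\<close> in GL(2,K).
\<close>

definition PGL2_topology :: "('a::padic_field^2^2) set topology" where
  "PGL2_topology = topology (\<lambda>U. U \<subseteq> carrier PGL2 \<and>
     openin (Metric_space.mtopology UNIV matrix_dist) (\<Union>U))"

definition discrete_subgroup :: "('a::padic_field^2^2) set set \<Rightarrow> bool" where
  "discrete_subgroup \<Gamma> \<longleftrightarrow>
     subgroup \<Gamma> PGL2 \<and> subtopology PGL2_topology \<Gamma> = discrete_topology \<Gamma>"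

definition finitely_generated_group :: "('g, 'b) monoid_scheme \<Rightarrow> bool" where
  "finitely_generated_group G \<longleftrightarrow>
     (\<exists>S. finite S \<and> S \<subseteq> carrier G \<and> generate G S = carrier G)"


section \<open>The projective line\<close>

type_synonym 'a ppoint = "('a^2) set"

definition P1 :: "'a::field ppoint set" where
  "P1 = {z. vec.subspace z \<and> vec.dim z = 1}"

definition vector_dist :: "'a::padic_field^2 \<Rightarrow> 'a^2 \<Rightarrow> real" where
  "vector_dist u v = Max (range (\<lambda>i. absv (u $ i - v $ i)))"

text \<open>The quotient topology from the space of nonzero vectors.\<close>

definition P1_topology :: "'a::padic_field ppoint topology" where
  "P1_topology = topology (\<lambda>U. U \<subseteq> P1 \<and>
     openin (Metric_space.mtopology UNIV vector_dist) (\<Union>U - {0}))"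

definition P1_act :: "('a::field^2^2) set \<Rightarrow> 'a ppoint \<Rightarrow> 'a ppoint" where
  "P1_act g z = (\<Union>A\<in>g. (*v) A ` z)"

definition fixed_points :: "('a::field^2^2) set \<Rightarrow> 'a ppoint set" where
  "fixed_points g = {z \<in> P1. P1_act g z = z}"

text \<open>
  All fixed points, over an algebraic closure, of nontrivial elements are already points over \<open>K\<close>.
\<close>

definition fixed_points_rational :: "('a::field^2^2) set set \<Rightarrow> bool" where
  "fixed_points_rational \<Gamma> \<longleftrightarrow>
     (\<forall>\<gamma>\<in>\<Gamma> - {\<one>\<^bsub>PGL2\<^esub>}. \<forall>A\<in>\<gamma>. \<forall>v :: 'a alg_closure^2.
        v \<noteq> 0 \<and> (\<exists>c. (\<chi> i j. to_ac (A $ i $ j)) *v v = c *s v) \<longrightarrow>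
        (\<exists>c u. c \<noteq> 0 \<and> v = c *s (\<chi> i. to_ac (u $ i))))"


section \<open>The Bruhat--Tits tree\<close>

definition O_submodule :: "('a::padic_field^2) set \<Rightarrow> bool" where
  "O_submodule M \<longleftrightarrow>
     0 \<in> M \<and> (\<forall>x\<in>M. \<forall>y\<in>M. x + y \<in> M) \<and> (\<forall>c\<in>valuation_ring. \<forall>x\<in>M. c *s x \<in> M)"

definition O_span :: "('a::padic_field^2) set \<Rightarrow> ('a^2) set" where
  "O_span S = {\<Sum>s\<in>S. c s *s s | c. c ` S \<subseteq> valuation_ring}"

definition is_lattice :: "('a::padic_field^2) set \<Rightarrow> bool" where
  "is_lattice L \<longleftrightarrow> (\<exists>S. finite S \<and> L = O_span S) \<and> vec.span L = UNIV"

text \<open>A vertex is a similarity class of lattices.\<close>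

type_synonym 'a vertex = "('a^2) set set"

definition similarity_class :: "('a::padic_field^2) set \<Rightarrow> 'a vertex" where
  "similarity_class L = {(*s) c ` L | c. c \<noteq> 0}"

text \<open>\<open>L' \<subseteq> L\<close>, and \<open>L / L'\<close> is a module of length one, i.e. simple.\<close>

definition quotient_length_one :: "('a::padic_field^2) set \<Rightarrow> ('a^2) set \<Rightarrow> bool" where
  "quotient_length_one L L' \<longleftrightarrow>
     L' \<subset> L \<and> (\<forall>M. O_submodule M \<and> L' \<subseteq> M \<and> M \<subseteq> L \<longrightarrow> M = L' \<or> M = L)"

text \<open>
  An edge of the tree is the set of its two extremities. Subtrees are graphs of the same type.
\<close>

type_synonym 'a btgraph = "('a vertex, 'a vertex set) ugraph"

definition bt_tree :: "'a::padic_field btgraph" where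
  "bt_tree = \<lparr>
     verts = {similarity_class L | L. is_lattice L},
     edges = {{similarity_class L, similarity_class L'} | L L'.
                is_lattice L \<and> is_lattice L' \<and> quotient_length_one L L'},
     endpoints = id\<rparr>"

definition vertex_act :: "('a::field^2^2) set \<Rightarrow> 'a vertex \<Rightarrow> 'a vertex" where
  "vertex_act g \<Lambda> = {(*v) A ` L | A L. A \<in> g \<and> L \<in> \<Lambda>}"

definition edge_act :: "('a::field^2^2) set \<Rightarrow> 'a vertex set \<Rightarrow> 'a vertex set" where
  "edge_act g \<sigma> = vertex_act g ` \<sigma>"

text \<open>
  Equivariant identification of the ends with \<open>P1\<close>: a half-line is represented by a decreasing
  sequence of lattices \<open>L 0 \<supset> L 1 \<supset> \<dots>\<close> with successive quotients of length one, unique up to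
  a common homothety. Its intersection is a module of rank one, and the line which it spans is the
  point of \<open>P1\<close> corresponding to the end.
\<close>

definition halfline :: "(nat \<Rightarrow> 'a::padic_field vertex) \<Rightarrow> bool" where
  "halfline r \<longleftrightarrow> inj r \<and> (\<forall>n. {r n, r (Suc n)} \<in> edges bt_tree)"

definition halfline_to :: "(nat \<Rightarrow> 'a::padic_field vertex) \<Rightarrow> 'a ppoint \<Rightarrow> bool" where
  "halfline_to r z \<longleftrightarrow> halfline r \<and>
     (\<exists>L. (\<forall>n. L n \<in> r n \<and> quotient_length_one (L n) (L (Suc n))) \<and> vec.span (\<Inter>n. L n) = z)"

definition straight_line :: "(int \<Rightarrow> 'a::padic_field vertex) \<Rightarrow> 'a ppoint \<Rightarrow> 'a ppoint \<Rightarrow> bool" where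
  "straight_line f z w \<longleftrightarrow>
     inj f \<and> halfline_to (\<lambda>n. f (- int n)) z \<and> halfline_to (\<lambda>n. f (int n)) w"

text \<open>For compact \<open>\<L>\<close> this is the minimal subtree whose set of ends is \<open>\<L>\<close>.\<close>

definition tree_of_ends :: "'a::padic_field ppoint set \<Rightarrow> 'a btgraph" where
  "tree_of_ends \<L> = \<lparr>
     verts = {f n | f n z w. z \<in> \<L> \<and> w \<in> \<L> \<and> z \<noteq> w \<and> straight_line f z w},
     edges = {{f n, f (n + 1)} | f n z w. z \<in> \<L> \<and> w \<in> \<L> \<and> z \<noteq> w \<and> straight_line f z w},
     endpoints = id\<rparr>"

definition minimal_subtree :: "'a::padic_field btgraph set \<Rightarrow> 'a btgraph" where
  "minimal_subtree \<M> = (let \<H> = {H. is_subtree H bt_tree \<and> (\<forall>Y\<in>\<M>. is_subgraph Y H)} in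
     \<lparr>verts = (\<Inter>H\<in>\<H>. verts H), edges = (\<Inter>H\<in>\<H>. edges H), endpoints = id\<rparr>)"


section \<open>Trees from groups\<close>

abbreviation PGL2_sub :: "('a::field^2^2) set set \<Rightarrow> ('a^2^2) set monoid" where
  "PGL2_sub H \<equiv> PGL2\<lparr>carrier := H\<rparr>"

definition T_star :: "('a::padic_field^2^2) set set \<Rightarrow> 'a btgraph" where
  "T_star \<Gamma> = tree_of_ends
     (P1_topology closure_of (\<Union>\<gamma>\<in>\<Gamma> - {\<one>\<^bsub>PGL2\<^esub>}. fixed_points \<gamma>))"

definition quotient_graph ::
    "('a::padic_field^2^2) set set \<Rightarrow> 'a btgraph \<Rightarrow> ('a vertex set, 'a vertex set set) ugraph" where
  "quotient_graph \<Gamma> Y = \<lparr>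
     verts = orbits (PGL2_sub \<Gamma>) (verts Y) vertex_act,
     edges = orbits (PGL2_sub \<Gamma>) (edges Y) edge_act,
     endpoints = (\<lambda>e. {orbit (PGL2_sub \<Gamma>) vertex_act v | v \<sigma>. \<sigma> \<in> e \<and> v \<in> \<sigma>})\<rparr>"

text \<open>
  Morphisms of graphs to the Bruhat--Tits tree are given by their effect \<open>\<iota>\<close> on vertices, since an
  edge there is the set of its extremities: the image of \<open>e\<close> is \<open>\<iota> ` endpoints G e\<close>.
\<close>

definition is_section ::
    "('a::padic_field^2^2) set set \<Rightarrow> 'a btgraph \<Rightarrow> ('a vertex set \<Rightarrow> 'a vertex) \<Rightarrow> bool" where
  "is_section \<Gamma> Y \<iota> \<longleftrightarrow>
     (\<forall>v\<in>verts (quotient_graph \<Gamma> Y). \<iota> v \<in> verts Y \<and> orbit (PGL2_sub \<Gamma>) vertex_act (\<iota> v) = v) \<and>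
     (\<forall>e\<in>edges (quotient_graph \<Gamma> Y).
        \<iota> ` endpoints (quotient_graph \<Gamma> Y) e \<in> edges Y \<and>
        orbit (PGL2_sub \<Gamma>) edge_act (\<iota> ` endpoints (quotient_graph \<Gamma> Y) e) = e)"

definition vertex_stabilizer ::
    "('a::field^2^2) set set \<Rightarrow> 'a vertex \<Rightarrow> ('a^2^2) set set" where
  "vertex_stabilizer H w = stabilizer (PGL2_sub H) vertex_act w"

text \<open>The stabilizer of an oriented edge fixes both extremities.\<close>

definition edge_stabilizer ::
    "('a::field^2^2) set set \<Rightarrow> 'a vertex set \<Rightarrow> ('a^2^2) set set" where
  "edge_stabilizer H \<sigma> = (\<Inter>w\<in>\<sigma>. vertex_stabilizer H w) \<inter> H"

definition elliptic :: "('a::padic_field^2^2) set \<Rightarrow> bool" where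
  "elliptic \<gamma> \<longleftrightarrow> (\<exists>A\<in>\<gamma>. \<exists>a b. a \<noteq> b \<and> absv a = absv b \<and>
     (\<exists>v. v \<noteq> 0 \<and> A *v v = a *s v) \<and> (\<exists>w. w \<noteq> 0 \<and> A *v w = b *s w))"

text \<open>
  Only to be used for elliptic \<open>\<gamma>\<close>, which have exactly two fixed points \<open>z\<close> and \<open>w\<close>: the mirror is
  then the line joining them.
\<close>

definition mirror :: "('a::padic_field^2^2) set \<Rightarrow> 'a btgraph" where
  "mirror \<gamma> = tree_of_ends (fixed_points \<gamma>)"

definition T_star_finite :: "('a::padic_field^2^2) set set \<Rightarrow> 'a btgraph" where
  "T_star_finite G = minimal_subtree {mirror \<gamma> | \<gamma>. \<gamma> \<in> G - {\<one>\<^bsub>PGL2\<^esub>} \<and> elliptic \<gamma>}"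


section \<open>Trees of groups and their amalgams\<close>

record ('v, 'e, 'g, 'h) tree_of_groups =
  base :: "('v, 'e) ugraph"
  vgroup :: "'v \<Rightarrow> 'g monoid"
  egroup :: "'e \<Rightarrow> 'h monoid"
  incl :: "'e \<Rightarrow> 'v \<Rightarrow> 'h \<Rightarrow> 'g"

definition is_tree_of_groups :: "('v, 'e, 'g, 'h) tree_of_groups \<Rightarrow> bool" where
  "is_tree_of_groups \<G> \<longleftrightarrow>
     is_tree (base \<G>) \<and>
     (\<forall>v\<in>verts (base \<G>). group (vgroup \<G> v) \<and> finite (carrier (vgroup \<G> v))) \<and>
     (\<forall>e\<in>edges (base \<G>). group (egroup \<G> e) \<and> finite (carrier (egroup \<G> e)) \<and>
        (\<forall>v\<in>endpoints (base \<G>) e. incl \<G> e v \<in> mon (egroup \<G> e) (vgroup \<G> v)))"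

text \<open>
  The amalgam consists of the words in elements of the vertex groups, modulo the congruence generated
  by the relations of the vertex groups and by the identifications along the edges.
\<close>

definition amalgam_words :: "('v, 'e, 'g, 'h) tree_of_groups \<Rightarrow> ('v \<times> 'g) list set" where
  "amalgam_words \<G> = lists (SIGMA v:verts (base \<G>). carrier (vgroup \<G> v))"

inductive amalgam_eq ::
    "('v, 'e, 'g, 'h) tree_of_groups \<Rightarrow> ('v \<times> 'g) list \<Rightarrow> ('v \<times> 'g) list \<Rightarrow> bool"
  for \<G> where
  refl: "x \<in> amalgam_words \<G> \<Longrightarrow> amalgam_eq \<G> x x"
| sym: "amalgam_eq \<G> x y \<Longrightarrow> amalgam_eq \<G> y x"
| trans: "amalgam_eq \<G> x y \<Longrightarrow> amalgam_eq \<G> y z \<Longrightarrow> amalgam_eq \<G> x z"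
| cong: "amalgam_eq \<G> x y \<Longrightarrow> a \<in> amalgam_words \<G> \<Longrightarrow> b \<in> amalgam_words \<G> \<Longrightarrow>
     amalgam_eq \<G> (a @ x @ b) (a @ y @ b)"
| one: "v \<in> verts (base \<G>) \<Longrightarrow> amalgam_eq \<G> [(v, \<one>\<^bsub>vgroup \<G> v\<^esub>)] []"
| mult: "v \<in> verts (base \<G>) \<Longrightarrow> g \<in> carrier (vgroup \<G> v) \<Longrightarrow> h \<in> carrier (vgroup \<G> v) \<Longrightarrow>
     amalgam_eq \<G> [(v, g), (v, h)] [(v, g \<otimes>\<^bsub>vgroup \<G> v\<^esub> h)]"
| edge: "e \<in> edges (base \<G>) \<Longrightarrow> v \<in> endpoints (base \<G>) e \<Longrightarrow> w \<in> endpoints (base \<G>) e \<Longrightarrow>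
     s \<in> carrier (egroup \<G> e) \<Longrightarrow> amalgam_eq \<G> [(v, incl \<G> e v s)] [(w, incl \<G> e w s)]"

definition amalgam :: "('v, 'e, 'g, 'h) tree_of_groups \<Rightarrow> ('v \<times> 'g) list set monoid" where
  "amalgam \<G> = \<lparr>
     carrier = amalgam_words \<G> // {(x, y). amalgam_eq \<G> x y},
     monoid.mult = (\<lambda>C D. {z. \<exists>x\<in>C. \<exists>y\<in>D. amalgam_eq \<G> (x @ y) z}),
     one = {z. amalgam_eq \<G> [] z}\<rparr>"


section \<open>Admissible embeddings\<close>

definition image_graph :: "('v \<Rightarrow> 'a::padic_field vertex) \<Rightarrow> ('v, 'e) ugraph \<Rightarrow> 'a btgraph" where
  "image_graph \<iota> G = \<lparr>verts = \<iota> ` verts G, edges = (\<lambda>e. \<iota> ` endpoints G e) ` edges G, endpoints = id\<rparr>"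

text \<open>
  Below, \<open>V\<close> is the vertex set of the tree of groups and \<open>G v\<close> is the image of the vertex group at
  \<open>v\<close> in PGL(2,K). In \<open>admissible_embedding\<close>, \<open>G' e\<close> is the image of the edge group at \<open>e\<close>; by
  compatibility it is the same for both extremities of \<open>e\<close>.
\<close>

definition T_tilde :: "'v set \<Rightarrow> ('v \<Rightarrow> ('a::padic_field^2^2) set set) \<Rightarrow> 'a btgraph" where
  "T_tilde V G = minimal_subtree ((\<lambda>v. T_star_finite (G v)) ` V)"

definition G_tilde_vertex ::
    "'v set \<Rightarrow> ('v \<Rightarrow> ('a::field^2^2) set set) \<Rightarrow> 'a vertex \<Rightarrow> ('a^2^2) set set" where
  "G_tilde_vertex V G w = generate PGL2 (\<Union>u\<in>V. vertex_stabilizer (G u) w)"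

definition G_tilde_edge ::
    "'v set \<Rightarrow> ('v \<Rightarrow> ('a::field^2^2) set set) \<Rightarrow> 'a vertex set \<Rightarrow> ('a^2^2) set set" where
  "G_tilde_edge V G \<sigma> = generate PGL2 (\<Union>u\<in>V. edge_stabilizer (G u) \<sigma>)"

definition admissible_embedding ::
    "('v, 'e, 'g, 'h) tree_of_groups \<Rightarrow> ('v \<Rightarrow> 'a::padic_field vertex) \<Rightarrow>
     ('v \<Rightarrow> 'g \<Rightarrow> ('a^2^2) set) \<Rightarrow> bool" where
  "admissible_embedding \<G> \<iota> \<rho> \<longleftrightarrow>
     (let T = base \<G>;
          V = verts T;
          G = (\<lambda>v. \<rho> v ` carrier (vgroup \<G> v));
          G' = (\<lambda>e. \<Union>v\<in>endpoints T e. (\<lambda>s. \<rho> v (incl \<G> e v s)) ` carrier (egroup \<G> e));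
          \<Gamma> = generate PGL2 (\<Union>v\<in>V. G v);
          TT = T_tilde V G
      in
       inj_on \<iota> V \<and> is_subgraph (image_graph \<iota> T) bt_tree \<and>
       (\<forall>v\<in>V. \<rho> v \<in> mon (vgroup \<G> v) PGL2) \<and>
       (\<forall>e\<in>edges T. \<forall>v\<in>endpoints T e. \<forall>w\<in>endpoints T e. \<forall>s\<in>carrier (egroup \<G> e).
          \<rho> v (incl \<G> e v s) = \<rho> w (incl \<G> e w s)) \<and>
       is_subgraph (image_graph \<iota> T) TT \<and>
       (\<forall>v\<in>V. \<forall>\<gamma>\<in>G v - {\<one>\<^bsub>PGL2\<^esub>}. \<exists>\<delta>\<in>\<Gamma>.
          elliptic (\<delta> \<otimes>\<^bsub>PGL2\<^esub> \<gamma> \<otimes>\<^bsub>PGL2\<^esub> inv\<^bsub>PGL2\<^esub> \<delta>) \<and>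
          edges (mirror (\<delta> \<otimes>\<^bsub>PGL2\<^esub> \<gamma> \<otimes>\<^bsub>PGL2\<^esub> inv\<^bsub>PGL2\<^esub> \<delta>)) \<inter> edges (image_graph \<iota> T) \<noteq> {}) \<and>
       (\<forall>v\<in>V. G_tilde_vertex V G (\<iota> v) = G v) \<and>
       (\<forall>e\<in>edges T. G_tilde_edge V G (\<iota> ` endpoints T e) = G' e) \<and>
       (\<forall>v\<in>V. bij_betw
          (\<lambda>e. orbit (PGL2_sub (G v)) edge_act (\<iota> ` endpoints T e))
          (star T v)
          (orbits (PGL2_sub (G v))
             (\<Union>\<tau>\<in>star TT (\<iota> v). orbit (PGL2_sub (G v)) edge_act \<tau>) edge_act)))"

text \<open>The argument of type \<open>'a itself\<close> specifies the field \<open>K\<close>.\<close>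

definition star_admissible ::
    "'a::padic_field itself \<Rightarrow> ('v, 'e, 'g, 'h) tree_of_groups \<Rightarrow> bool" where
  "star_admissible K \<G> \<longleftrightarrow>
     is_tree_of_groups \<G> \<and>
     (\<exists>(\<iota> :: 'v \<Rightarrow> 'a vertex) \<rho>. admissible_embedding \<G> \<iota> \<rho>) \<and>
     finitely_generated_group (amalgam \<G>)"

definition induced_tree_of_groups ::
    "('a::padic_field^2^2) set set \<Rightarrow> ('a vertex set \<Rightarrow> 'a vertex) \<Rightarrow>
     ('a vertex set, 'a vertex set set, ('a^2^2) set, ('a^2^2) set) tree_of_groups" where
  "induced_tree_of_groups \<Gamma> \<iota> = (let T = quotient_graph \<Gamma> (T_star \<Gamma>) in \<lparr>
     base = T,
     vgroup = (\<lambda>v. PGL2_sub (vertex_stabilizer \<Gamma> (\<iota> v))),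
     egroup = (\<lambda>e. PGL2_sub (edge_stabilizer \<Gamma> (\<iota> ` endpoints T e))),
     incl = (\<lambda>e v s. s)\<rparr>)"

end

theory Submission
  imports Defs
begin

text \<open>
  The tree of the group \<open>\<Gamma>\<close> is the union of the lines \<open>]z,w[\<close> with \<open>z\<close>, \<open>w\<close> fixed points of nontrivial
  elements; passing to the closure of the set of fixed points adds no vertex, because an edge of
  \<open>]z,w[\<close> lies on \<open>]z',w'[\<close> as soon as \<open>z'\<close>, \<open>w'\<close> are close to \<open>z\<close>, \<open>w\<close>. The quotient being a tree with a
  section, \<open>\<Gamma>\<close> is generated by the stabilizers of the vertices of the section and is their amalgam
  (Bass--Serre), which settles finite generation. All conditions of an admissible embedding are
  formal, except that the section lies in the tree generated by the mirrors of these stabilizers. If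
  an edge of the section were missing there, the stabilizers of the vertices beyond it would fix it;
  so the translates of the rest of the section would form an invariant subtree through all mirrors.
  This subtree also contains the axes of the hyperbolic elements, hence by convexity everything.
\<close>

section \<open>Forests\<close>

text \<open>Three obstacles shape the proof. The definition of the field provides only an absolute
  value and a finite spanning set over the closure of the rationals; a uniformizer and finite
  residues have to be won by bounding linearly independent families. Both are needed: the first
  makes the tree computable in bases, the second makes vertex stabilizers in a discrete group
  finite. Next, an edge of the section may lie in the tree only because of hyperbolic elements,
  which belong to no vertex group. Such an edge still lies on a line whose ends are fixed points;
  near each end this line coincides with the mirror or axis of an element fixing that end, and this
  is enough to apply convexity. Finally, the amalgam consists of classes of words and no tree comes
  with it. Instead of building one, pairs of a word and a vertex are used as its vertices, and walks
  among them are projected to the tree of the group, where they can be shortened. Acyclicity is used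
  in the form that every edge is a bridge, so arguments about paths become arguments about the two
  sides of an edge.\<close>

definition adj :: "'v set set \<Rightarrow> ('v \<times> 'v) set" where
  "adj E = {(x, y). {x, y} \<in> E}"

text \<open>Every edge is a bridge.\<close>

definition forest :: "'v set set \<Rightarrow> bool" where
  "forest E \<longleftrightarrow> (\<forall>x y. {x, y} \<in> E \<longrightarrow> x \<noteq> y \<and> (x, y) \<notin> (adj (E - {{x, y}}))\<^sup>*)"

definition gdist :: "'v set set \<Rightarrow> 'v \<Rightarrow> 'v \<Rightarrow> nat" where
  "gdist E x y = (LEAST n. (x, y) \<in> adj E ^^ n)"

lemma adj_iff: "(x, y) \<in> adj E \<longleftrightarrow> {x, y} \<in> E"
  by (simp add: adj_def)

lemma adj_mono: "D \<subseteq> E \<Longrightarrow> adj D \<subseteq> adj E"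
  by (auto simp: adj_def)

lemma adj_rtrancl_mono: "(x, y) \<in> (adj D)\<^sup>* \<Longrightarrow> D \<subseteq> E \<Longrightarrow> (x, y) \<in> (adj E)\<^sup>*"
  using rtrancl_mono[OF adj_mono] by blast

lemma adj_rtrancl_sym: "(x, y) \<in> (adj E)\<^sup>* \<Longrightarrow> (y, x) \<in> (adj E)\<^sup>*"
proof -
  have "sym (adj E)" by (auto simp: sym_def adj_def insert_commute)
  then show "(x, y) \<in> (adj E)\<^sup>* \<Longrightarrow> (y, x) \<in> (adj E)\<^sup>*" by (rule symD[OF sym_rtrancl])
qed

lemma adj_rtrancl_finite:
  assumes "(x, y) \<in> (adj E)\<^sup>*"
  shows "\<exists>D. finite D \<and> D \<subseteq> E \<and> (x, y) \<in> (adj D)\<^sup>*"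
  using assms
proof (induction rule: rtrancl_induct)
  case base
  then show ?case by (intro exI[of _ "{}"]) auto
next
  case (step y z)
  then obtain D where D: "finite D" "D \<subseteq> E" "(x, y) \<in> (adj D)\<^sup>*" by auto
  have "(x, y) \<in> (adj (insert {y, z} D))\<^sup>*" by (rule adj_rtrancl_mono[OF D(3)]) auto
  moreover have "(y, z) \<in> adj (insert {y, z} D)" by (simp add: adj_iff)
  ultimately have "(x, z) \<in> (adj (insert {y, z} D))\<^sup>*" by simp
  then show ?case using D step(2) by (intro exI[of _ "insert {y, z} D"]) (auto simp: adj_iff)
qed

lemma adj_rtrancl_image:
  assumes "(x, y) \<in> (adj D)\<^sup>*" "\<And>e. e \<in> D \<Longrightarrow> h ` e \<in> E"
  shows "(h x, h y) \<in> (adj E)\<^sup>*"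
  using assms(1)
proof (induction rule: rtrancl_induct)
  case base
  then show ?case by simp
next
  case (step y z)
  have "(h y, h z) \<in> adj E" using step(2) assms(2)[of "{y, z}"] by (simp add: adj_iff)
  then show ?case using step(3) by simp
qed

lemma walk_rtrancl:
  assumes "\<And>i. i < n \<Longrightarrow> (p i, p (Suc i)) \<in> adj E"
  shows "(p 0, p n) \<in> (adj E)\<^sup>*"
  using assms by (metis relpow_fun_conv relpow_imp_rtrancl)

section \<open>Distances and geodesics in graphs given by their edge sets\<close>

lemma gdist_le: "(x, y) \<in> adj E ^^ n \<Longrightarrow> gdist E x y \<le> n"
  by (simp add: gdist_def Least_le)

lemma gdist_relpow: "(x, y) \<in> (adj E)\<^sup>* \<Longrightarrow> (x, y) \<in> adj E ^^ gdist E x y"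
  unfolding gdist_def by (rule LeastI_ex) (simp add: rtrancl_imp_relpow)

lemma gdist_self [simp]: "gdist E x x = 0"
  using gdist_le[of x x 0 E] by simp

lemma gdist_eq_0: "(x, y) \<in> (adj E)\<^sup>* \<Longrightarrow> gdist E x y = 0 \<Longrightarrow> x = y"
  using gdist_relpow[of x y E] by simp

lemma geodesic_ex:
  assumes "(x, y) \<in> (adj E)\<^sup>*"
  obtains p where "p 0 = x" "p (gdist E x y) = y"
    "\<And>i. i < gdist E x y \<Longrightarrow> (p i, p (Suc i)) \<in> adj E"
proof -
  from gdist_relpow[OF assms] obtain f where "f 0 = x \<and> f (gdist E x y) = y \<and>
    (\<forall>i<gdist E x y. (f i, f (Suc i)) \<in> adj E)"
    unfolding relpow_fun_conv by blast
  then show ?thesis using that[of f] by blast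
qed

lemma walk_relpow:
  assumes "\<And>i. a \<le> i \<Longrightarrow> i < b \<Longrightarrow> (p i, p (Suc i)) \<in> adj E" "a \<le> b"
  shows "(p a, p b) \<in> adj E ^^ (b - a)"
  unfolding relpow_fun_conv using assms by (intro exI[of _ "\<lambda>i. p (a + i)"]) auto

text \<open>A shorter walk to \<open>p i\<close>, followed by the rest of \<open>p\<close>, would
  join the ends in fewer than \<open>n\<close> steps.\<close>

lemma geodesic_gdist:
  assumes walk: "\<And>i. i < n \<Longrightarrow> (p i, p (Suc i)) \<in> adj E"
    and n: "n \<le> gdist E (p 0) (p n)" and "i \<le> n"
  shows "gdist E (p 0) (p i) = i"
proof -
  have 1: "(p 0, p i) \<in> adj E ^^ i" "(p i, p n) \<in> adj E ^^ (n - i)"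
    using walk_relpow[of 0 i p E] walk_relpow[of i n p E] walk \<open>i \<le> n\<close> by auto
  then have "(p 0, p i) \<in> adj E ^^ gdist E (p 0) (p i)"
    using gdist_relpow relpow_imp_rtrancl by metis
  with 1 have "(p 0, p n) \<in> adj E ^^ (gdist E (p 0) (p i) + (n - i))"
    by (auto simp: relpow_add)
  from gdist_le[OF this] have "n \<le> gdist E (p 0) (p i) + (n - i)" using n by simp
  moreover have "gdist E (p 0) (p i) \<le> i" using 1(1) by (rule gdist_le)
  ultimately show ?thesis using \<open>i \<le> n\<close> by linarith
qed

lemma walk_uses_bridge:
  assumes "\<And>i. i < n \<Longrightarrow> (p i, p (Suc i)) \<in> adj E" "(p 0, p n) \<notin> (adj (E - {s}))\<^sup>*"
  obtains i where "i < n" "{p i, p (Suc i)} = s"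
proof -
  have "\<exists>i<n. {p i, p (Suc i)} = s"
  proof (rule ccontr)
    assume *: "\<not> ?thesis"
    have "(p 0, p n) \<in> (adj (E - {s}))\<^sup>*"
      using assms(1) * by (intro walk_rtrancl) (auto simp: adj_iff)
    with assms(2) show False by simp
  qed
  then show ?thesis using that by blast
qed

text \<open>A shortest walk from \<open>r\<close> to \<open>y\<close> must cross the separating
  edge. It meets \<open>y\<close> only at its end, because distances from \<open>r\<close> grow by
  one along it; so the crossing is the last step and starts at \<open>x\<close>.\<close>

lemma gdist_beyond_bridge:
  assumes "(r, y) \<in> (adj E)\<^sup>*" "(r, y) \<notin> (adj (E - {{x, y}}))\<^sup>*"
  shows "gdist E r y = Suc (gdist E r x)"
proof -
  from geodesic_ex[OF assms(1)] obtain p where p: "p 0 = r" "p (gdist E r y) = y"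
    "\<And>i. i < gdist E r y \<Longrightarrow> (p i, p (Suc i)) \<in> adj E" by blast
  have d: "gdist E r (p i) = i" if "i \<le> gdist E r y" for i
    using geodesic_gdist[of "gdist E r y" p E i] p that by simp
  obtain i where i: "i < gdist E r y" "{p i, p (Suc i)} = {x, y}"
    using walk_uses_bridge[of "gdist E r y" p E "{x, y}"] p assms(2) by metis
  have "p i \<noteq> y" using d[of i] i(1) by auto
  then have "p i = x" "p (Suc i) = y" using i(2) by (auto simp: doubleton_eq_iff)
  then show ?thesis using d[of i] d[of "Suc i"] i(1) by auto
qed

text \<open>Without the edge, \<open>x\<close> and \<open>y\<close> lie in different components, so
  \<open>r\<close> reaches at most one of them; one that it does not reach is one step farther away
  than the other.\<close>

lemma forest_gdist_adj:
  assumes "forest E" "{x, y} \<in> E" "(r, x) \<in> (adj E)\<^sup>*"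
  shows "gdist E r y = Suc (gdist E r x) \<or> gdist E r x = Suc (gdist E r y)"
proof -
  have ry: "(r, y) \<in> (adj E)\<^sup>*" using assms by (meson adj_iff rtrancl.rtrancl_into_rtrancl)
  have "(x, y) \<notin> (adj (E - {{x, y}}))\<^sup>*" using assms by (auto simp: forest_def)
  then have "(r, x) \<notin> (adj (E - {{x, y}}))\<^sup>* \<or> (r, y) \<notin> (adj (E - {{x, y}}))\<^sup>*"
    by (meson adj_rtrancl_sym rtrancl_trans)
  then show ?thesis
    using gdist_beyond_bridge[OF ry] gdist_beyond_bridge[OF assms(3), of y] by (auto simp: insert_commute)
qed

text \<open>The edge from \<open>x\<close> to \<open>y\<close> separates \<open>r\<close> from
  \<open>y\<close>. A geodesic to \<open>y\<close> whose last step starts at \<open>x'\<close> has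
  to cross it, and by distances it can do so only in that last step.\<close>

lemma forest_parent_unique:
  assumes "forest E" "{x, y} \<in> E" "{x', y} \<in> E" "(r, y) \<in> (adj E)\<^sup>*"
    and "gdist E r y = Suc (gdist E r x)" "gdist E r y = Suc (gdist E r x')"
  shows "x = x'"
proof -
  have rx: "(r, x) \<in> (adj E)\<^sup>*" and rx': "(r, x') \<in> (adj E)\<^sup>*" using assms
    by (metis adj_iff insert_commute rtrancl.rtrancl_into_rtrancl)+
  have "(x, y) \<notin> (adj (E - {{x, y}}))\<^sup>*" using assms by (auto simp: forest_def)
  moreover have "(r, x) \<in> (adj (E - {{x, y}}))\<^sup>*"
    using gdist_beyond_bridge[OF rx, of y] assms(5) by (auto simp: insert_commute)
  ultimately have nr: "(r, y) \<notin> (adj (E - {{x, y}}))\<^sup>*"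
    by (meson adj_rtrancl_sym rtrancl_trans)
  let ?n = "gdist E r x'"
  from geodesic_ex[OF rx'] obtain p where p: "p 0 = r" "p ?n = x'"
    "\<And>i. i < ?n \<Longrightarrow> (p i, p (Suc i)) \<in> adj E" by blast
  \<comment> \<open>Prolonging a geodesic to \<open>x'\<close> by one step gives a geodesic to
    \<open>y\<close>, by the assumption on distances.\<close>
  define q where "q = p (Suc ?n := y)"
  have q: "q 0 = r" "q (Suc ?n) = y" "q ?n = x'" using p by (auto simp: q_def)
  have qw: "(q i, q (Suc i)) \<in> adj E" if "i < Suc ?n" for i
    using that p assms(3) by (cases "i = ?n") (auto simp: q_def adj_iff)
  have d: "gdist E r (q i) = i" if "i \<le> Suc ?n" for i
    using geodesic_gdist[of "Suc ?n" q E i] q qw that assms(6) by simp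
  obtain i where i: "i < Suc ?n" "{q i, q (Suc i)} = {x, y}"
    using walk_uses_bridge[of "Suc ?n" q E "{x, y}"] q qw nr by metis
  have "q i \<noteq> y" using d[of i] i(1) assms(6) by auto
  then have "q i = x" using i(2) by (auto simp: doubleton_eq_iff)
  then have "i = ?n" using d[of i] i(1) assms(5,6) by auto
  then show ?thesis using \<open>q i = x\<close> q by simp
qed

text \<open>A map that preserves edges and fixes \<open>x\<close> and \<open>y\<close> sends a
  geodesic between them to another one. Both cross the separating edge, and the distances from
  \<open>x\<close> leave only one place and one direction for the crossing.\<close>

lemma bridge_fixed:
  assumes "(x, y) \<in> (adj E)\<^sup>*" "(x, y) \<notin> (adj (E - {{a, b}}))\<^sup>*"
    and h: "\<And>e. e \<in> E \<Longrightarrow> h ` e \<in> E" "h x = x" "h y = y"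
  shows "h a = a" "h b = b"
proof -
  let ?n = "gdist E x y"
  from geodesic_ex[OF assms(1)] obtain p where p: "p 0 = x" "p ?n = y"
    "\<And>i. i < ?n \<Longrightarrow> (p i, p (Suc i)) \<in> adj E" by blast
  define q where "q = h \<circ> p"
  have q: "q 0 = x" "q ?n = y" using p h by (auto simp: q_def)
  have qw: "(q i, q (Suc i)) \<in> adj E" if "i < ?n" for i
    using p(3)[OF that] h(1)[of "{p i, p (Suc i)}"] by (auto simp: q_def adj_iff)
  have dp: "gdist E x (p i) = i" if "i \<le> ?n" for i
    using geodesic_gdist[of ?n p E i] p that by simp
  have dq: "gdist E x (q i) = i" if "i \<le> ?n" for i
    using geodesic_gdist[of ?n q E i] q qw that by simp
  obtain i where i: "i < ?n" "{p i, p (Suc i)} = {a, b}"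
    using walk_uses_bridge[of ?n p E "{a, b}"] p assms(2) by metis
  obtain j where j: "j < ?n" "{q j, q (Suc j)} = {a, b}"
    using walk_uses_bridge[of ?n q E "{a, b}"] q qw assms(2) by metis
  have eq: "{p i, p (Suc i)} = {q j, q (Suc j)}" using i j by simp
  then have "{i, Suc i} = {j, Suc j}"
    using dp[of i] dp[of "Suc i"] dq[of j] dq[of "Suc j"] i(1) j(1)
    by (auto simp: doubleton_eq_iff)
  then have "i = j" by (auto simp: doubleton_eq_iff)
  then have "p i = q i" "p (Suc i) = q (Suc i)"
    using eq dp[of i] dp[of "Suc i"] dq[of j] dq[of "Suc j"] i(1) j(1)
    by (metis Suc_leI doubleton_eq_iff n_not_Suc_n order_less_imp_le)+
  then show "h a = a" "h b = b" using i(2) by (auto simp: q_def doubleton_eq_iff)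
qed

text \<open>This is how acyclicity of the Bruhat-Tits tree is checked: no walk without backtracking
  closes up. A shortest detour around an edge that is not a bridge, closed by the edge itself, would
  be such a walk.\<close>

lemma forestI:
  assumes reduced: "\<And>n p. n \<ge> 1 \<Longrightarrow> (\<And>i. i < n \<Longrightarrow> {p i, p (Suc i)} \<in> E) \<Longrightarrow>
      (\<And>i. Suc (Suc i) \<le> n \<Longrightarrow> p i \<noteq> p (Suc (Suc i))) \<Longrightarrow> p n \<noteq> p (0::nat)"
  shows "forest E"
  unfolding forest_def
proof (intro allI impI conjI notI)
  fix x y assume "{x, y} \<in> E" "x = y"
  then show False using reduced[of 1 "\<lambda>_. x"] by simp
next
  fix x y assume xy: "{x, y} \<in> E" "(x, y) \<in> (adj (E - {{x, y}}))\<^sup>*"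
  let ?D = "E - {{x, y}}"
  let ?n = "gdist ?D x y"
  from geodesic_ex[OF xy(2)] obtain q where q: "q 0 = x" "q ?n = y"
    "\<And>i. i < ?n \<Longrightarrow> (q i, q (Suc i)) \<in> adj ?D" by blast
  have d: "gdist ?D x (q i) = i" if "i \<le> ?n" for i
    using geodesic_gdist[of ?n q ?D i] q that by simp
  have "x \<noteq> y" using xy(1) reduced[of 1 "\<lambda>_. x"] by auto
  then have "?n \<noteq> 0" using gdist_eq_0[OF xy(2)] by auto
  have "?n \<noteq> 1" using q by (auto simp: adj_iff)
  with \<open>?n \<noteq> 0\<close> have n2: "?n \<ge> 2" by linarith
  \<comment> \<open>Return from \<open>y\<close> to \<open>x\<close> along the removed edge.
    Backtracking at the junction is excluded because the detour has at least two steps.\<close>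
  define p where "p i = (if i \<le> ?n then q i else x)" for i
  have "p (Suc ?n) \<noteq> p 0"
  proof (rule reduced)
    show "1 \<le> Suc ?n" by simp
    show "{p i, p (Suc i)} \<in> E" if "i < Suc ?n" for i
      using that q(3)[of i] xy(1) q(2)
      by (cases "i = ?n") (auto simp: p_def adj_iff insert_commute)
    show "p i \<noteq> p (Suc (Suc i))" if "Suc (Suc i) \<le> Suc ?n" for i
    proof (cases "Suc (Suc i) \<le> ?n")
      case True
      then show ?thesis using d[of i] d[of "Suc (Suc i)"] by (auto simp: p_def)
    next
      case False
      then have "Suc i = ?n" using that by simp
      then show ?thesis using d[of i] n2 by (auto simp: p_def)
    qed
  qed
  then show False using q(1) by (simp add: p_def)
qed

lemma forest_subset: "forest E \<Longrightarrow> D \<subseteq> E \<Longrightarrow> forest D"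
  unfolding forest_def
proof (intro allI impI)
  fix x y assume *: "\<forall>x y. {x, y} \<in> E \<longrightarrow> x \<noteq> y \<and> (x, y) \<notin> (adj (E - {{x, y}}))\<^sup>*" "D \<subseteq> E" "{x, y} \<in> D"
  then have "x \<noteq> y \<and> (x, y) \<notin> (adj (E - {{x, y}}))\<^sup>*" by auto
  then show "x \<noteq> y \<and> (x, y) \<notin> (adj (D - {{x, y}}))\<^sup>*"
    using adj_rtrancl_mono[of x y "D - {{x, y}}" "E - {{x, y}}"] *(2) by auto
qed

lemma forest_no_circuit:
  assumes "forest E" "edges G \<subseteq> E" "endpoints G = id"
  shows "\<not> circuit G vs es"
proof
  assume c: "circuit G vs es"
  let ?n = "length es"
  have n: "?n > 0" "length vs = ?n" "distinct es" and es: "set es \<subseteq> edges G" using c by (auto simp: circuit_def)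
  have e: "es ! i = {vs ! i, vs ! ((i + 1) mod ?n)}" if "i < ?n" for i
    using c that assms(3) by (auto simp: circuit_def)
  have E: "es ! i \<in> E" if "i < ?n" for i using that es assms(2) by (meson nth_mem subsetD)
  \<comment> \<open>The shifted numbering starts just after the first edge, so the walk uses all
    edges of the circuit but that one and returns to its other end.\<close>
  define p where "p i = vs ! ((i + 1) mod ?n)" for i
  have "(p 0, p (?n - 1)) \<in> (adj (E - {es ! 0}))\<^sup>*"
  proof (rule walk_rtrancl)
    fix i assume i: "i < ?n - 1"
    then have "es ! (i + 1) = {p i, p (Suc i)}" using e[of "i + 1"] by (simp add: p_def)
    moreover have "es ! (i + 1) \<noteq> es ! 0" using n i by (simp add: nth_eq_iff_index_eq)
    ultimately show "(p i, p (Suc i)) \<in> adj (E - {es ! 0})"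
      using E[of "i + 1"] i by (auto simp: adj_iff)
  qed
  moreover have "p (?n - 1) = vs ! 0" using n by (simp add: p_def)
  moreover have "es ! 0 = {vs ! 0, p 0}" using e[of 0] n by (simp add: p_def)
  ultimately have "(vs ! 0, p 0) \<in> (adj (E - {{vs ! 0, p 0}}))\<^sup>*" "{vs ! 0, p 0} \<in> E"
    using E[of 0] n(1) by (auto intro: adj_rtrancl_sym)
  then show False using assms(1) unfolding forest_def by blast
qed

section \<open>Lines in a forest and invariant subtrees\<close>

definition line_edge :: "(int \<Rightarrow> 'v) \<Rightarrow> int \<Rightarrow> 'v set" where
  "line_edge f n = {f n, f (n + 1)}"

lemma line_edge_inj: "inj f \<Longrightarrow> line_edge f i = line_edge f j \<longleftrightarrow> i = j"
  unfolding line_edge_def doubleton_eq_iff inj_eq by linarith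

lemma line_reach:
  assumes "a \<le> b" "\<And>i. a \<le> i \<Longrightarrow> i < b \<Longrightarrow> line_edge f i \<in> E"
  shows "(f a, f b) \<in> (adj E)\<^sup>*"
  using assms
proof (induction b rule: int_ge_induct)
  case base
  then show ?case by simp
next
  case (step b)
  have "(f a, f b) \<in> (adj E)\<^sup>*" using step by auto
  moreover have "(f b, f (b + 1)) \<in> adj E" using step by (auto simp: line_edge_def adj_iff)
  ultimately show ?case by simp
qed

lemma line_sides:
  assumes "inj f" "\<And>n. line_edge f n \<in> E"
  shows "m \<le> i \<Longrightarrow> (f m, f i) \<in> (adj (E - {line_edge f i}))\<^sup>*"
    and "i < m \<Longrightarrow> (f m, f (i + 1)) \<in> (adj (E - {line_edge f i}))\<^sup>*"
proof -
  note inj = line_edge_inj[OF assms(1)]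
  show "m \<le> i \<Longrightarrow> (f m, f i) \<in> (adj (E - {line_edge f i}))\<^sup>*"
    by (rule line_reach) (auto simp: inj assms(2))
  show "i < m \<Longrightarrow> (f m, f (i + 1)) \<in> (adj (E - {line_edge f i}))\<^sup>*"
    by (rule adj_rtrancl_sym, rule line_reach) (auto simp: inj assms(2))
qed

lemma forest_line_sides:
  assumes "forest E" "\<And>n. line_edge f n \<in> E"
    and "(x, f i) \<in> (adj (E - {line_edge f i}))\<^sup>*" "(x, f (i + 1)) \<in> (adj (E - {line_edge f i}))\<^sup>*"
  shows False
proof -
  have "(f i, f (i + 1)) \<in> (adj (E - {line_edge f i}))\<^sup>*"
    using assms(3,4) by (meson adj_rtrancl_sym rtrancl_trans)
  then show False using assms(1,2) unfolding forest_def line_edge_def by blast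
qed

text \<open>A missing edge of the line would separate \<open>f a\<close> from \<open>f b\<close>,
  which \<open>D\<close> joins.\<close>

lemma forest_convex_line:
  assumes "forest E" "inj f" "\<And>n. line_edge f n \<in> E" "D \<subseteq> E"
    and "(f a, f b) \<in> (adj D)\<^sup>*" "a \<le> n" "n < b"
  shows "line_edge f n \<in> D"
proof (rule ccontr)
  assume "line_edge f n \<notin> D"
  then have "(f a, f b) \<in> (adj (E - {line_edge f n}))\<^sup>*"
    using assms(4,5) by (auto intro: adj_rtrancl_mono)
  then show False
    using forest_line_sides[OF assms(1,3), of "f a" n] line_sides[OF assms(2,3)] assms(6,7)
    by (meson adj_rtrancl_sym rtrancl_trans)
qed

text \<open>
  If an edge of the axis were missing from \<open>D\<close>, then so would be its translates; but \<open>y\<close> lies on one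
  side of a remote translate and on the other side of the opposite one, and translating moves \<open>y\<close>
  inside \<open>D\<close> from one side to the other.
\<close>

lemma invariant_contains_axis:
  fixes k :: int
  assumes E: "forest E" and f: "inj f" "\<And>n. line_edge f n \<in> E" and D: "D \<subseteq> E"
    and k: "k > 0"
    and h: "\<And>n. h (f n) = f (n - k)" "\<And>e. e \<in> E \<Longrightarrow> h ` e \<in> E" 
    and h': "\<And>n. h' (f n) = f (n + k)" "\<And>e. e \<in> D \<Longrightarrow> h' ` e \<in> D" "\<And>e. e \<in> D \<Longrightarrow> h ` e \<in> D"
    and inj: "inj_on h (\<Union> E)"
    and W: "\<And>x. x \<in> W \<Longrightarrow> h x \<in> W" "\<And>x y. x \<in> W \<Longrightarrow> y \<in> W \<Longrightarrow> (x, y) \<in> (adj D)\<^sup>*"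
    and y: "y \<in> W" "(y, f 0) \<in> (adj E)\<^sup>*"
  shows "line_edge f n \<in> D"
proof (rule ccontr)
  assume n: "line_edge f n \<notin> D"
  have im: "h ` line_edge f i = line_edge f (i - k)" "h' ` line_edge f i = line_edge f (i + k)" for i
    by (auto simp: line_edge_def h h' algebra_simps)
  \<comment> \<open>A translate lying in \<open>D\<close> could be moved back inside
    \<open>D\<close>, so every translate of the missing edge is missing too.\<close>
  have up: "line_edge f (n + int j * k) \<notin> D" for j
  proof (induction j)
    case 0
    then show ?case using n by simp
  next
    case (Suc j)
    show ?case
    proof
      assume "line_edge f (n + int (Suc j) * k) \<in> D"
      from h'(3)[OF this] show False using Suc by (simp add: im algebra_simps)
    qed
  qed
  have down: "line_edge f (n - int j * k) \<notin> D" for j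
  proof (induction j)
    case 0
    then show ?case using n by simp
  next
    case (Suc j)
    show ?case
    proof
      assume "line_edge f (n - int (Suc j) * k) \<in> D"
      from h'(2)[OF this] show False using Suc by (simp add: im algebra_simps)
    qed
  qed
  \<comment> \<open>A finite path from \<open>y\<close> to the line uses only finitely many edges of
    it; cutting an edge of index at least \<open>N\<close> in absolute value does not affect this
    path.\<close>
  obtain P where P: "finite P" "P \<subseteq> E" "(y, f 0) \<in> (adj P)\<^sup>*"
    using adj_rtrancl_finite[OF y(2)] by blast
  have "finite {i. line_edge f i \<in> P}"
  proof (rule finite_imageD)
    show "finite (line_edge f ` {i. line_edge f i \<in> P})" using P(1) by (rule rev_finite_subset) auto
    show "inj_on (line_edge f) {i. line_edge f i \<in> P}" using line_edge_inj[OF f(1)] by (auto simp: inj_on_def)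
  qed
  then have fin: "finite (insert 0 (abs ` {i. line_edge f i \<in> P}))" by simp
  define N where "N = Max (insert 0 (abs ` {i. line_edge f i \<in> P})) + 1"
  have N: "\<bar>i\<bar> < N" if "line_edge f i \<in> P" for i
    using Max_ge[OF fin, of "\<bar>i\<bar>"] that by (auto simp: N_def)
  define j where "j = nat (\<bar>N\<bar> + \<bar>n\<bar> + 1)"
  have jk: "int j * k \<ge> \<bar>N\<bar> + \<bar>n\<bar> + 1"
  proof -
    have "int j * 1 \<le> int j * k" using k by (intro mult_left_mono) auto
    then show ?thesis by (simp add: j_def)
  qed
  define i where "i = n + int j * k"
  define i' where "i' = n - int j * k"
  have i: "i \<ge> N" "i \<ge> 0" "i' \<le> - N" "i' < 0" using jk unfolding i_def i'_def by linarith+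
  have "(y, f 0) \<in> (adj (E - {line_edge f i}))\<^sup>*" "(y, f 0) \<in> (adj (E - {line_edge f i'}))\<^sup>*"
    using P N[of i] N[of i'] i by (auto intro!: adj_rtrancl_mono[OF P(3)])
  then have yi: "(y, f i) \<in> (adj (E - {line_edge f i}))\<^sup>*"
    and yi': "(y, f (i' + 1)) \<in> (adj (E - {line_edge f i'}))\<^sup>*"
    using line_sides[OF f] i by (meson rtrancl_trans)+
  \<comment> \<open>Applying \<open>h\<close> carries the point and the cut along together:
    \<open>(h ^^ m) y\<close> stays on the lower side of the edge shifted down \<open>m\<close>
    times.\<close>
  have "((h ^^ m) y, f (i - int m * k)) \<in> (adj (E - {line_edge f (i - int m * k)}))\<^sup>* \<and> (h ^^ m) y \<in> W" for m
  proof (induction m)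
    case 0
    then show ?case using yi y by simp
  next
    case (Suc m)
    let ?s = "i - int m * k"
    have "(h ((h ^^ m) y), h (f ?s)) \<in> (adj (E - {line_edge f (?s - k)}))\<^sup>*"
    proof (rule adj_rtrancl_image[where h = h])
      show "((h ^^ m) y, f ?s) \<in> (adj (E - {line_edge f ?s}))\<^sup>*" using Suc by simp
      show "h ` e \<in> E - {line_edge f (?s - k)}" if "e \<in> E - {line_edge f ?s}" for e
        using that h(2) f(2)[of ?s] inj_on_image_eq_iff[OF inj, of e "line_edge f ?s"]
        by (auto simp flip: im(1))
    qed
    moreover have "?s - k = i - int (Suc m) * k" by (simp add: algebra_simps)
    ultimately show ?case using h(1)[of ?s] Suc W(1) by simp
  qed
  \<comment> \<open>Since \<open>i'\<close> equals \<open>i - 2 * j * k\<close>, exactly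
    \<open>2 * j\<close> applications move the upper cut to the lower one. There \<open>y\<close>
    lies above the cut and its image below, although \<open>D\<close> joins them without using that
    edge.\<close>
  from this[of "2 * j"] have *: "((h ^^ (2 * j)) y, f i') \<in> (adj (E - {line_edge f i'}))\<^sup>*" "(h ^^ (2 * j)) y \<in> W"
    by (simp_all add: i_def i'_def algebra_simps)
  have "(y, (h ^^ (2 * j)) y) \<in> (adj (E - {line_edge f i'}))\<^sup>*"
    using W(2)[OF y(1) *(2)] down[of j] D by (auto simp: i'_def intro: adj_rtrancl_mono)
  with *(1) have "(y, f i') \<in> (adj (E - {line_edge f i'}))\<^sup>*" by (meson rtrancl_trans)
  then show False using forest_line_sides[OF E f(2) _ yi'] by blast
qed

section \<open>Groups acting on forests with a fundamental domain\<close>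

text \<open>By \<open>S_unique\<close> the two ends of an edge of \<open>SE\<close>, which are
  distinct in a forest, lie in different orbits; this rules out inversions. That \<open>S\<close> is
  connected is derived in \<open>S_connected\<close>.\<close>

locale forest_action = group G for G (structure) +
  fixes act :: "'a \<Rightarrow> 'v \<Rightarrow> 'v" and XV :: "'v set" and XE :: "'v set set"
    and S :: "'v set" and SE :: "'v set set"
  assumes act_one: "x \<in> XV \<Longrightarrow> act \<one> x = x"
    and act_mult: "g \<in> carrier G \<Longrightarrow> h \<in> carrier G \<Longrightarrow> x \<in> XV \<Longrightarrow> act (g \<otimes> h) x = act g (act h x)"
    and act_closed: "g \<in> carrier G \<Longrightarrow> x \<in> XV \<Longrightarrow> act g x \<in> XV"
    and act_edge: "g \<in> carrier G \<Longrightarrow> e \<in> XE \<Longrightarrow> act g ` e \<in> XE"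
    and XE_subset: "e \<in> XE \<Longrightarrow> e \<subseteq> XV"
    and XE_doubleton: "e \<in> XE \<Longrightarrow> \<exists>x y. e = {x, y}"
    and XE_forest: "forest XE"
    and X_connected: "x \<in> XV \<Longrightarrow> y \<in> XV \<Longrightarrow> (x, y) \<in> (adj XE)\<^sup>*"
    and S_subset: "S \<subseteq> XV"
    and S_exists: "x \<in> XV \<Longrightarrow> \<exists>g\<in>carrier G. \<exists>s\<in>S. x = act g s"
    and S_unique: "s \<in> S \<Longrightarrow> t \<in> S \<Longrightarrow> g \<in> carrier G \<Longrightarrow> t = act g s \<Longrightarrow> s = t"
    and SE_subset: "SE \<subseteq> XE"
    and SE_in: "e \<in> SE \<Longrightarrow> e \<subseteq> S"
    and SE_exists: "e \<in> XE \<Longrightarrow> \<exists>g\<in>carrier G. \<exists>e'\<in>SE. e = act g ` e'"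
begin

definition Stab :: "'v \<Rightarrow> 'a set" where
  "Stab x = {g \<in> carrier G. act g x = x}"

lemma act_inv: "g \<in> carrier G \<Longrightarrow> x \<in> XV \<Longrightarrow> act (inv g) (act g x) = x"
  by (metis act_mult act_one inv_closed l_inv)

lemma act_inv': "g \<in> carrier G \<Longrightarrow> x \<in> XV \<Longrightarrow> act g (act (inv g) x) = x"
  by (metis act_mult act_one inv_closed r_inv)

lemma Stab_one: "x \<in> XV \<Longrightarrow> \<one> \<in> Stab x"
  by (simp add: Stab_def act_one)

lemma Stab_mult: "x \<in> XV \<Longrightarrow> g \<in> Stab x \<Longrightarrow> h \<in> Stab x \<Longrightarrow> g \<otimes> h \<in> Stab x"
  by (simp add: Stab_def act_mult)

lemma Stab_inv: "x \<in> XV \<Longrightarrow> g \<in> Stab x \<Longrightarrow> inv g \<in> Stab x"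
  using act_inv[of g x] by (simp add: Stab_def)

lemma Stab_carrier: "g \<in> Stab x \<Longrightarrow> g \<in> carrier G"
  by (simp add: Stab_def)

lemma S_XV: "s \<in> S \<Longrightarrow> s \<in> XV"
  using S_subset by blast

text \<open>The element carrying a domain edge onto \<open>e\<close> carries one end of it to
  \<open>s\<close>. By uniqueness that end is \<open>s\<close> itself, so the element lies in the
  stabilizer.\<close>

lemma edge_at_S:
  assumes "s \<in> S" "e \<in> XE" "s \<in> e"
  shows "\<exists>g\<in>Stab s. \<exists>e'\<in>SE. s \<in> e' \<and> e = act g ` e'"
proof -
  obtain g e' where g: "g \<in> carrier G" "e' \<in> SE" "e = act g ` e'" using SE_exists[OF assms(2)] by blast
  then obtain t where t: "t \<in> e'" "s = act g t" using assms(3) by blast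
  then have "t = s" using S_unique[OF _ assms(1) g(1) t(2)] SE_in[OF g(2)] by blast
  then show ?thesis using g t by (intro bexI[of _ g] bexI[of _ e']) (auto simp: Stab_def)
qed

text \<open>Sending every vertex to the representative of its orbit folds the whole tree onto the
  domain, and a folded path is still a path.\<close>

lemma S_connected: "s \<in> S \<Longrightarrow> t \<in> S \<Longrightarrow> (s, t) \<in> (adj SE)\<^sup>*"
proof -
  assume s: "s \<in> S" and t: "t \<in> S"
  define r where "r x = (SOME u. u \<in> S \<and> (\<exists>g\<in>carrier G. x = act g u))" for x
  have r: "r (act g u) = u" if "g \<in> carrier G" "u \<in> S" for g u
  proof -
    have *: "r (act g u) \<in> S \<and> (\<exists>h\<in>carrier G. act g u = act h (r (act g u)))"
      unfolding r_def by (rule someI_ex) (use that in blast)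
    then obtain h where h: "h \<in> carrier G" "act g u = act h (r (act g u))" by blast
    have "act (inv g \<otimes> h) (r (act g u)) = act (inv g) (act h (r (act g u)))"
      using * h that S_XV by (simp add: act_mult)
    also have "\<dots> = u" using h(2) that S_XV act_inv by metis
    finally have eq: "act (inv g \<otimes> h) (r (act g u)) = u" .
    from S_unique[OF _ _ _ eq[symmetric]] show ?thesis using * that h(1) by simp
  qed
  have "r ` e \<in> SE" if e: "e \<in> XE" for e
  proof -
    obtain g e' where g: "g \<in> carrier G" "e' \<in> SE" "e = act g ` e'" using SE_exists[OF e] by blast
    have "r ` e = (\<lambda>u. u) ` e'"
      unfolding g(3) image_image by (rule image_cong) (use r[OF g(1)] SE_in[OF g(2)] in auto)
    then have "r ` e = e'" by simp
    then show ?thesis using g by simp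
  qed
  then have "(r s, r t) \<in> (adj SE)\<^sup>*"
    using adj_rtrancl_image[OF X_connected[of s t], of r SE] s t S_XV by blast
  moreover have "r u = u" if "u \<in> S" for u using r[of \<one> u] that act_one S_XV by simp
  ultimately show ?thesis using s t by simp
qed

text \<open>Along a path from \<open>s0\<close> every vertex is an \<open>H\<close>-translate of a
  point of \<open>S\<close>: at the translate of \<open>s\<close> by \<open>h\<close>, the next edge
  comes from a domain edge by \<open>h\<close> and an element of \<open>Stab s\<close>. Comparing
  the image of \<open>s0\<close> under \<open>g\<close> with such a translate then puts
  \<open>g\<close> itself in \<open>H\<close>.\<close>

lemma subgroup_contains_stabilizers:
  assumes H: "subgroup H G" and st: "\<And>s. s \<in> S \<Longrightarrow> Stab s \<subseteq> H" and "S \<noteq> {}"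
  shows "H = carrier G"
proof
  show "H \<subseteq> carrier G" using H by (simp add: subgroup.subset)
  obtain s0 where s0: "s0 \<in> S" using assms(3) by blast
  have *: "\<exists>h\<in>H. \<exists>s\<in>S. x = act h s" if "(s0, x) \<in> (adj XE)\<^sup>*" for x
    using that
  proof (induction rule: rtrancl_induct)
    case base
    then show ?case using s0 subgroup.one_closed[OF H] act_one S_XV by metis
  next
    case (step x y)
    then obtain h s where h: "h \<in> H" "s \<in> S" "x = act h s" by blast
    have hG: "h \<in> carrier G" using h H by (simp add: subgroup.mem_carrier)
    have xy: "{x, y} \<in> XE" using step by (simp add: adj_iff)
    then have yV: "y \<in> XV" using XE_subset by blast
    have "s \<in> act (inv h) ` {x, y}" using h hG act_inv S_XV by force
    then obtain g e' where g: "g \<in> Stab s" "e' \<in> SE" "act (inv h) ` {x, y} = act g ` e'"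
      using edge_at_S[OF h(2) act_edge[OF _ xy, of "inv h"]] hG by auto
    then obtain t where t: "t \<in> e'" "act (inv h) y = act g t" by blast
    have tS: "t \<in> S" using t g SE_in by blast
    have gG: "g \<in> carrier G" using g Stab_carrier by blast
    have "y = act h (act (inv h) y)" using act_inv' hG yV by simp
    also have "\<dots> = act (h \<otimes> g) t" using t hG gG tS S_XV by (simp add: act_mult)
    finally have "y = act (h \<otimes> g) t" .
    moreover have "h \<otimes> g \<in> H" using h g st subgroup.m_closed[OF H] by blast
    ultimately show ?case using tS by blast
  qed
  show "carrier G \<subseteq> H"
  proof
    fix g assume g: "g \<in> carrier G"
    have "act g s0 \<in> XV" using s0 S_XV act_closed g by simp
    then obtain h s where h: "h \<in> H" "s \<in> S" "act g s0 = act h s"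
      using *[OF X_connected[of s0 "act g s0"]] S_XV[OF s0] by blast
    have hG: "h \<in> carrier G" using h H by (simp add: subgroup.mem_carrier)
    have eq: "act (inv h \<otimes> g) s0 = s" using h hG g s0 S_XV by (simp add: act_mult act_inv)
    then have "s0 = s" using S_unique[OF s0 h(2) _ eq[symmetric]] hG g by simp
    then have "inv h \<otimes> g \<in> H" using eq st[OF s0] hG g by (auto simp: Stab_def)
    then have "h \<otimes> (inv h \<otimes> g) \<in> H" using h subgroup.m_closed[OF H] by blast
    then show "g \<in> H" using hG g by (simp flip: m_assoc)
  qed
qed

lemma generate_stabilizers:
  assumes "S \<noteq> {}"
  shows "generate G (\<Union>s\<in>S. Stab s) = carrier G"
  using assms by (intro subgroup_contains_stabilizers generate_is_subgroup)
    (auto simp: Stab_def intro: generate.incl)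

end

text \<open>
  If a subtree through all mirrors of the stabilizers of \<open>S\<close> missed the edge \<open>s0\<close> of the fundamental
  domain, it would lie on one side of \<open>s0\<close>. Let \<open>B\<close> be the part of \<open>S\<close> on the other side, which
  meets no mirror. A stabilizer of a vertex of \<open>B\<close> fixes a mirror on the far side, hence also \<open>s0\<close>, so
  the translates of \<open>S - B\<close> already form an invariant subtree containing all mirrors.
\<close>

lemma (in forest_action) cut_off_edge:
  assumes E: "forest E" "XE \<subseteq> E" "D \<subseteq> E" and s0: "s0 \<in> SE" "s0 \<notin> D"
    and DV: "\<And>x y. x \<in> DV \<Longrightarrow> y \<in> DV \<Longrightarrow> (x, y) \<in> (adj D)\<^sup>*"
    and M: "\<And>g x. g \<in> carrier G - {\<one>} \<Longrightarrow> x \<in> M g \<Longrightarrow> x \<in> XV \<and> act g x = x"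
    and conj: "\<And>g h x. g \<in> carrier G - {\<one>} \<Longrightarrow> h \<in> carrier G \<Longrightarrow> x \<in> M g \<Longrightarrow>
        act h x \<in> M (h \<otimes> g \<otimes> inv h)"
    and nonempty: "\<And>s g. s \<in> S \<Longrightarrow> g \<in> Stab s - {\<one>} \<Longrightarrow> M g \<noteq> {} \<and> M g \<subseteq> DV"
  shows "\<exists>Y YE. Y \<subseteq> XV \<and> YE \<subseteq> XE - {s0} \<and> Y \<noteq> {} \<and>
      (\<forall>g\<in>carrier G. \<forall>x\<in>Y. act g x \<in> Y) \<and> (\<forall>g\<in>carrier G. \<forall>e\<in>YE. act g ` e \<in> YE) \<and>
      (\<forall>e\<in>YE. e \<subseteq> Y) \<and> (\<forall>x\<in>Y. \<forall>y\<in>Y. (x, y) \<in> (adj YE)\<^sup>*) \<and> (\<forall>g\<in>carrier G - {\<one>}. M g \<subseteq> Y)"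
proof -
  have s0E: "s0 \<in> E" "s0 \<in> XE" using s0 SE_subset E by auto
  let ?E0 = "E - {s0}"
  have nsep: False if "s0 = {a, b}" "(x, a) \<in> (adj ?E0)\<^sup>*" "(x, b) \<in> (adj ?E0)\<^sup>*" for a b x
  proof -
    have "(a, b) \<in> (adj (E - {{a, b}}))\<^sup>*" using that by (metis adj_rtrancl_sym rtrancl_trans)
    then show False using E(1) s0E that(1) by (auto simp: forest_def)
  qed
  \<comment> \<open>The ends are named so that \<open>b\<close> is cut off from \<open>DV\<close>.
    If one point of \<open>DV\<close> is on the side of \<open>b\<close>, all of \<open>DV\<close>
    is, being connected without \<open>s0\<close>; in that case the names are exchanged.\<close>
  have "\<exists>a b. s0 = {a, b} \<and> (\<forall>x\<in>DV. (x, b) \<notin> (adj ?E0)\<^sup>*)"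
  proof -
    obtain a b where ab: "s0 = {a, b}" using XE_doubleton[OF s0E(2)] by blast
    show ?thesis
    proof (cases "\<exists>x\<in>DV. (x, b) \<in> (adj ?E0)\<^sup>*")
      case True
      then obtain x where x: "x \<in> DV" "(x, b) \<in> (adj ?E0)\<^sup>*" by blast
      have "(y, a) \<notin> (adj ?E0)\<^sup>*" if "y \<in> DV" for y
      proof
        assume *: "(y, a) \<in> (adj ?E0)\<^sup>*"
        have "(x, y) \<in> (adj ?E0)\<^sup>*" using adj_rtrancl_mono[OF DV[OF x(1) that], of ?E0] E(3) s0(2) by auto
        then show False using nsep[OF ab, of x] x(2) * by (meson rtrancl_trans)
      qed
      then show ?thesis using ab by (metis insert_commute)
    next
      case False
      then show ?thesis using ab by blast
    qed
  qed
  then obtain a b where ab: "s0 = {a, b}" and DVb: "\<And>x. x \<in> DV \<Longrightarrow> (x, b) \<notin> (adj ?E0)\<^sup>*" by blast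
  let ?S0 = "SE - {s0}"
  have S0E0: "?S0 \<subseteq> ?E0" using SE_subset E(2) by auto
  have abS: "a \<in> S" "b \<in> S" using SE_in[OF s0(1)] ab by auto
  define B where "B = {s \<in> S. (s, b) \<in> (adj ?S0)\<^sup>*}"
  define A where "A = S - B"
  define SA where "SA = {e \<in> SE. e \<subseteq> A}"
  have nsepS: "\<not> ((s, a) \<in> (adj ?S0)\<^sup>* \<and> (s, b) \<in> (adj ?S0)\<^sup>*)" for s
    using nsep[OF ab, of s] adj_rtrancl_mono[OF _ S0E0] by blast
  have aA: "a \<in> A" using nsepS[of a] abS by (auto simp: A_def B_def)
  have "(s, a) \<in> (adj ?S0)\<^sup>* \<or> (s, b) \<in> (adj ?S0)\<^sup>*" if "s \<in> S" for s
  proof -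
    have "(a, s) \<in> (adj SE)\<^sup>*" using S_connected abS that by blast
    then have "(a, s) \<in> (adj ?S0)\<^sup>* \<or> (b, s) \<in> (adj ?S0)\<^sup>*"
    proof (induction rule: rtrancl_induct)
      case base
      then show ?case by simp
    next
      case (step s t)
      show ?case
      proof (cases "{s, t} = s0")
        case True
        then show ?thesis using ab by (auto simp: doubleton_eq_iff)
      next
        case False
        then have "(s, t) \<in> adj ?S0" using step by (simp add: adj_iff)
        then show ?thesis using step(3) by (meson rtrancl.rtrancl_into_rtrancl)
      qed
    qed
    then show ?thesis using adj_rtrancl_sym by meson
  qed
  then have A_a: "(a, s) \<in> (adj ?S0)\<^sup>*" if "s \<in> A" for s
    using that by (auto simp: A_def B_def intro: adj_rtrancl_sym)
  have A_conn: "(a, s) \<in> (adj SA)\<^sup>*" if "s \<in> A" for s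
    using A_a[OF that]
  proof (induction rule: rtrancl_induct)
    case base
    then show ?case by simp
  next
    case (step s t)
    have "{s, t} \<in> SE" using step by (simp add: adj_iff)
    moreover have "s \<notin> B" "t \<notin> B"
      using step(1) rtrancl.rtrancl_into_rtrancl[OF step(1,2)] nsepS adj_rtrancl_sym by (fastforce simp: B_def)+
    ultimately have "{s, t} \<in> SA" using SE_in by (auto simp: SA_def A_def)
    then show ?case using step(3) by (meson adj_iff rtrancl.rtrancl_into_rtrancl)
  qed
  have B_b: "(s, b) \<in> (adj ?E0)\<^sup>*" "s \<in> S" if "s \<in> B" for s
    using that adj_rtrancl_mono[OF _ S0E0] by (auto simp: B_def)
  have StabB: "Stab s \<subseteq> Stab a" if s: "s \<in> B" for s
  proof
    fix g assume g: "g \<in> Stab s"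
    show "g \<in> Stab a"
    proof (cases "g = \<one>")
      case True
      then show ?thesis using Stab_one abS S_XV by blast
    next
      case False
      then have g1: "g \<in> carrier G - {\<one>}" using g Stab_carrier by blast
      obtain m where m: "m \<in> M g" "m \<in> DV" using nonempty[of s g] B_b[OF s] g False by blast
      have mX: "m \<in> XV" "act g m = m" using M[OF g1 m(1)] by auto
      have "act g a = a"
      proof (rule bridge_fixed(1)[of s m XE a b "act g"])
        show "(s, m) \<in> (adj XE)\<^sup>*" using X_connected mX S_XV B_b[OF s] by blast
        show "(s, m) \<notin> (adj (XE - {{a, b}}))\<^sup>*"
        proof
          assume "(s, m) \<in> (adj (XE - {{a, b}}))\<^sup>*"
          then have "(s, m) \<in> (adj ?E0)\<^sup>*" using adj_rtrancl_mono[of s m "XE - {{a, b}}" ?E0] E(2) ab by auto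
          then show False using DVb[OF m(2)] B_b(1)[OF s] by (meson adj_rtrancl_sym rtrancl_trans)
        qed
        show "act g ` e \<in> XE" if "e \<in> XE" for e using that act_edge g1 by blast
        show "act g s = s" using g by (simp add: Stab_def)
        show "act g m = m" by (rule mX)
      qed
      then show ?thesis using g by (simp add: Stab_def)
    qed
  qed
  define Y where "Y = {act g s | g s. g \<in> carrier G \<and> s \<in> A}"
  define YE where "YE = {act g ` e | g e. g \<in> carrier G \<and> e \<in> SA}"
  have AS: "A \<subseteq> S" by (auto simp: A_def)
  have SAX: "SA \<subseteq> XE" using SE_subset by (auto simp: SA_def)
  have YEinv: "act g ` e \<in> YE" if g: "g \<in> carrier G" and e: "e \<in> YE" for g e
  proof -
    obtain h d where h: "h \<in> carrier G" "d \<in> SA" "e = act h ` d" using e by (auto simp: YE_def)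
    have "act g ` e = act (g \<otimes> h) ` d"
      using h g XE_subset[of d] SAX by (auto simp: image_image act_mult subset_iff)
    then show ?thesis using h g by (auto simp: YE_def)
  qed
  have Yinv: "act g y \<in> Y" if g: "g \<in> carrier G" and y: "y \<in> Y" for g y
  proof -
    obtain h s where h: "h \<in> carrier G" "s \<in> A" "y = act h s" using y by (auto simp: Y_def)
    have "act g y = act (g \<otimes> h) s" using h g AS S_XV by (auto simp: act_mult)
    then show ?thesis using h g by (auto simp: Y_def)
  qed
  have YXE: "YE \<subseteq> XE" using SAX act_edge by (auto simp: YE_def)
  have tr: "(act g x, act g y) \<in> (adj YE)\<^sup>*" if "g \<in> carrier G" "(x, y) \<in> (adj YE)\<^sup>*" for g x y
    using adj_rtrancl_image[OF that(2), of "act g" YE] YEinv that(1) by blast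
  have SAYE: "SA \<subseteq> YE"
  proof
    fix e assume e: "e \<in> SA"
    then have "act \<one> ` e = e" using XE_subset[of e] SAX act_one by (force simp: subset_iff)
    then show "e \<in> YE" using e by (auto simp: YE_def)
  qed
  have A_Y: "(a, s) \<in> (adj YE)\<^sup>*" if "s \<in> A" for s
    using adj_rtrancl_mono[OF A_conn[OF that] SAYE] .
  \<comment> \<open>For the connectedness of \<open>Y\<close>: the elements that keep
    \<open>a\<close> in its component form a subgroup. It contains the stabilizers on
    \<open>A\<close> directly and those on \<open>B\<close> through \<open>StabB\<close>, hence is
    the whole group.\<close>
  define K where "K = {g \<in> carrier G. (a, act g a) \<in> (adj YE)\<^sup>*}"
  have aX: "a \<in> XV" using abS S_XV by blast
  have K: "subgroup K G"
  proof (rule subgroupI)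
    show "K \<subseteq> carrier G" "K \<noteq> {}" using act_one[OF aX] by (auto simp: K_def intro!: exI[of _ \<one>])
    show "inv g \<in> K" if "g \<in> K" for g
      using that tr[of "inv g" a "act g a"] act_inv[of g a] aX by (auto simp: K_def intro: adj_rtrancl_sym)
    show "g \<otimes> h \<in> K" if "g \<in> K" "h \<in> K" for g h
      using that tr[of g a "act h a"] aX by (auto simp: K_def act_mult)
  qed
  have KA: "Stab s \<subseteq> K" if s: "s \<in> A" for s
  proof
    fix g assume g: "g \<in> Stab s"
    then have "(act g a, s) \<in> (adj YE)\<^sup>*" using tr[OF _ A_Y[OF s], of g] by (simp add: Stab_def)
    then have "(a, act g a) \<in> (adj YE)\<^sup>*" using A_Y[OF s] by (meson adj_rtrancl_sym rtrancl_trans)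
    then show "g \<in> K" using g by (simp add: K_def Stab_def)
  qed
  have "K = carrier G"
  proof (rule subgroup_contains_stabilizers[OF K])
    show "Stab s \<subseteq> K" if "s \<in> S" for s using KA StabB aA that by (cases "s \<in> B") (auto simp: A_def)
    show "S \<noteq> {}" using abS by blast
  qed
  then have Ka: "(a, act g a) \<in> (adj YE)\<^sup>*" if "g \<in> carrier G" for g using that by (auto simp: K_def)
  have Yconn: "(a, y) \<in> (adj YE)\<^sup>*" if y: "y \<in> Y" for y
  proof -
    obtain h s where h: "h \<in> carrier G" "s \<in> A" "y = act h s" using y by (auto simp: Y_def)
    show ?thesis using tr[OF h(1) A_Y[OF h(2)]] Ka[OF h(1)] h(3) by (meson rtrancl_trans)
  qed
  \<comment> \<open>Otherwise \<open>b\<close> would be a translate of a vertex of \<open>A\<close>,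
    and so that vertex itself.\<close>
  have "s0 \<notin> YE"
  proof
    assume "s0 \<in> YE"
    then obtain g e t where g: "g \<in> carrier G" "e \<in> SA" "t \<in> e" "b = act g t"
      unfolding YE_def using ab by blast
    then have "t \<in> A" by (auto simp: SA_def)
    then have "t = b" using S_unique[OF _ abS(2) g(1) g(4)] AS by blast
    then show False using \<open>t \<in> A\<close> abS by (auto simp: A_def B_def)
  qed
  moreover have "M g \<subseteq> Y" if g: "g \<in> carrier G - {\<one>}" for g
  proof
    fix x assume x: "x \<in> M g"
    have xX: "x \<in> XV" "act g x = x" using M[OF g x] by auto
    \<comment> \<open>Moving \<open>x\<close> into the domain conjugates \<open>g\<close> to an
      element \<open>g'\<close> of the stabilizer of \<open>s\<close>. Its mirror contains
      \<open>s\<close> and lies in \<open>DV\<close>, so \<open>s\<close> is not on the side of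
      \<open>b\<close>.\<close>
    obtain h s where h: "h \<in> carrier G" "s \<in> S" "x = act h s" using S_exists[OF xX(1)] by blast
    have sx: "s = act (inv h) x" using h act_inv S_XV by simp
    define g' where "g' = inv h \<otimes> g \<otimes> h"
    have g'c: "g' \<in> carrier G" using g h by (simp add: g'_def)
    have s_m: "s \<in> M g'" using conj[OF g _ x, of "inv h"] h(1) sx by (simp add: g'_def)
    have "h \<otimes> g' \<otimes> inv h = g"
      using g h(1) by (simp add: g'_def m_assoc) (simp flip: m_assoc)
    then have g'1: "g' \<noteq> \<one>" using g h by auto
    then have "g' \<in> Stab s" using M[OF _ s_m] g'c by (simp add: Stab_def)
    then have "s \<in> DV" using nonempty[OF h(2), of g'] g'1 s_m by blast
    then have "s \<notin> B" using B_b DVb by blast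
    then show "x \<in> Y" using h by (auto simp: Y_def A_def)
  qed
  moreover have "Y \<subseteq> XV" using AS S_XV act_closed by (auto simp: Y_def)
  moreover have "a \<in> Y" using aA act_one[OF aX] by (force simp: Y_def)
  moreover have "\<forall>e\<in>YE. e \<subseteq> Y" by (auto simp: YE_def Y_def SA_def)
  moreover have "(x, y) \<in> (adj YE)\<^sup>*" if "x \<in> Y" "y \<in> Y" for x y
    using Yconn that by (meson adj_rtrancl_sym rtrancl_trans)
  ultimately show ?thesis using Yinv YEinv YXE by (intro exI[of _ Y] exI[of _ YE] conjI ballI) auto
qed

section \<open>The amalgam of the stabilizers\<close>

locale forest_action_amalgam =
  forest_action G act XV XE "\<iota> ` verts (base \<G>)" "(\<lambda>e. \<iota> ` endpoints (base \<G>) e) ` edges (base \<G>)"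
  for G :: "('g, 'm) monoid_scheme" (structure) and act :: "'g \<Rightarrow> 'v \<Rightarrow> 'v" and XV XE
    and \<G> :: "('w, 'e, 'g, 'g) tree_of_groups" and \<iota> :: "'w \<Rightarrow> 'v" +
  assumes \<iota>_inj: "inj_on \<iota> (verts (base \<G>))"
    and base_graph: "is_graph (base \<G>)"
    and vgroup: "v \<in> verts (base \<G>) \<Longrightarrow> carrier (vgroup \<G> v) = Stab (\<iota> v)"
      "\<one>\<^bsub>vgroup \<G> v\<^esub> = \<one>" "g \<otimes>\<^bsub>vgroup \<G> v\<^esub> h = g \<otimes> h"
    and egroup: "e \<in> edges (base \<G>) \<Longrightarrow>
      carrier (egroup \<G> e) = {g \<in> carrier G. \<forall>v\<in>endpoints (base \<G>) e. act g (\<iota> v) = \<iota> v}"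
    and incl: "incl \<G> e v g = g"
begin

abbreviation "V \<equiv> verts (base \<G>)"
abbreviation "W \<equiv> amalgam_words \<G>"
abbreviation am_eq (infix "\<sim>" 50) where "x \<sim> y \<equiv> amalgam_eq \<G> x y"

text \<open>The canonical map from the amalgam to \<open>G\<close>, before passing to classes of
  words.\<close>

fun ev :: "('w \<times> 'g) list \<Rightarrow> 'g" where
  "ev [] = \<one>"
| "ev ((v, g) # w) = g \<otimes> ev w"

lemma W_Nil: "[] \<in> W"
  by (simp add: amalgam_words_def)

lemma W_Cons: "(v, g) # w \<in> W \<longleftrightarrow> v \<in> V \<and> g \<in> Stab (\<iota> v) \<and> w \<in> W"
  using vgroup(1) by (auto simp: amalgam_words_def)

lemma W_append: "x @ y \<in> W \<longleftrightarrow> x \<in> W \<and> y \<in> W"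
  by (auto simp: amalgam_words_def)

lemmas W_simps = W_Nil W_Cons W_append

lemma \<iota>_XV: "v \<in> V \<Longrightarrow> \<iota> v \<in> XV"
  using S_XV by blast

lemma ev_closed [simp]: "w \<in> W \<Longrightarrow> ev w \<in> carrier G"
  by (induction w rule: ev.induct) (auto simp: W_Cons Stab_def)

lemma ev_append: "x \<in> W \<Longrightarrow> y \<in> W \<Longrightarrow> ev (x @ y) = ev x \<otimes> ev y"
  by (induction x rule: ev.induct) (auto simp: W_Cons Stab_def m_assoc)

lemma endpoints_V: "e \<in> edges (base \<G>) \<Longrightarrow> v \<in> endpoints (base \<G>) e \<Longrightarrow> v \<in> V"
  using base_graph by (auto simp: is_graph_def)

lemma am_eq_sound: "x \<sim> y \<Longrightarrow> x \<in> W \<and> y \<in> W \<and> ev x = ev y"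
proof (induction rule: amalgam_eq.induct)
  case (edge e v w s)
  then show ?case using endpoints_V by (auto simp: W_simps incl egroup Stab_def)
next
  case (one v)
  then show ?case using \<iota>_XV by (simp add: W_simps vgroup Stab_one)
next
  case (mult v g h)
  then show ?case using \<iota>_XV
    by (auto simp: W_simps vgroup Stab_mult dest: Stab_carrier) (simp add: Stab_def m_assoc)
qed (auto simp: W_simps ev_append)

lemma am_cong_left: "x \<sim> y \<Longrightarrow> a \<in> W \<Longrightarrow> a @ x \<sim> a @ y"
  using amalgam_eq.cong[of \<G> x y a "[]"] by (simp add: W_Nil)

lemma am_cong_right: "x \<sim> y \<Longrightarrow> a \<in> W \<Longrightarrow> x @ a \<sim> y @ a"
  using amalgam_eq.cong[of \<G> x y "[]" a] by (simp add: W_Nil)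

lemma am_one: "w \<in> W \<Longrightarrow> v \<in> V \<Longrightarrow> w @ [(v, \<one>)] \<sim> w"
  using am_cong_left[OF amalgam_eq.one[of v \<G>], of w] by (simp add: vgroup)

lemma am_mult: "w \<in> W \<Longrightarrow> v \<in> V \<Longrightarrow> g \<in> Stab (\<iota> v) \<Longrightarrow> h \<in> Stab (\<iota> v) \<Longrightarrow>
    w @ [(v, g), (v, h)] \<sim> w @ [(v, g \<otimes> h)]"
  using am_cong_left[OF amalgam_eq.mult[of v \<G> g h], of w] by (simp add: vgroup)

text \<open>
  A pair \<open>(w, v)\<close> stands for the vertex \<open>w G\<^sub>v\<close> of the tree on which the amalgam acts, which maps to
  \<open>XV\<close> by \<open>pos\<close>; \<open>same\<close> and \<open>nbrs\<close> are equality and adjacency of such vertices.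
\<close>

fun pos :: "('w \<times> 'g) list \<times> 'w \<Rightarrow> 'v" where
  "pos (w, v) = act (ev w) (\<iota> v)"

definition points :: "(('w \<times> 'g) list \<times> 'w) set" where
  "points = W \<times> V"

definition same :: "('w \<times> 'g) list \<times> 'w \<Rightarrow> ('w \<times> 'g) list \<times> 'w \<Rightarrow> bool" where
  "same P Q \<longleftrightarrow> snd P = snd Q \<and> P \<in> points \<and> Q \<in> points \<and>
     (\<exists>g\<in>Stab (\<iota> (snd P)). fst P @ [(snd P, g)] \<sim> fst Q)"

definition nbrs :: "((('w \<times> 'g) list \<times> 'w) \<times> (('w \<times> 'g) list \<times> 'w)) set" where
  "nbrs = {((w, v), (w', v')). w \<in> W \<and> w' \<in> W \<and> v \<in> V \<and> v' \<in> V \<and>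
     (\<exists>e\<in>edges (base \<G>). endpoints (base \<G>) e = {v, v'}) \<and>
     (\<exists>g\<in>Stab (\<iota> v). \<exists>g'\<in>Stab (\<iota> v'). w @ [(v, g)] \<sim> w' @ [(v', g')])}"

text \<open>If \<open>w'\<close> stands for \<open>w k\<close>, then \<open>w g\<close> is
  \<open>w'\<close> followed by \<open>inv k \<otimes> g\<close>. This makes \<open>same\<close>
  symmetric and \<open>nbrs\<close> compatible with it.\<close>

lemma am_shift:
  assumes "w \<in> W" "v \<in> V" "g \<in> Stab (\<iota> v)" "k \<in> Stab (\<iota> v)" "w @ [(v, k)] \<sim> w'"
  shows "w @ [(v, g)] \<sim> w' @ [(v, inv k \<otimes> g)]"
proof -
  have k: "inv k \<otimes> g \<in> Stab (\<iota> v)" "k \<in> carrier G" "g \<in> carrier G"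
    using assms \<iota>_XV by (auto simp: Stab_mult Stab_inv Stab_carrier)
  then have "w @ [(v, k), (v, inv k \<otimes> g)] \<sim> w @ [(v, g)]"
    using am_mult[OF assms(1,2,4), of "inv k \<otimes> g"] by (simp flip: m_assoc)
  moreover have "w @ [(v, k)] @ [(v, inv k \<otimes> g)] \<sim> w' @ [(v, inv k \<otimes> g)]"
    using am_cong_right[OF assms(5), of "[(v, inv k \<otimes> g)]"] k assms by (simp add: W_simps)
  ultimately show ?thesis by (auto intro: amalgam_eq.sym amalgam_eq.trans)
qed

lemma same_refl: "P \<in> points \<Longrightarrow> same P P"
  using am_one \<iota>_XV by (force simp: same_def points_def intro: Stab_one)

lemma same_sym: "same P Q \<Longrightarrow> same Q P"
proof -
  assume PQ: "same P Q"
  obtain w v w' where P: "P = (w, v)" "Q = (w', v)" using PQ by (cases P; cases Q) (auto simp: same_def)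
  obtain k where k: "k \<in> Stab (\<iota> v)" "w @ [(v, k)] \<sim> w'" and wv: "w \<in> W" "v \<in> V" "w' \<in> W"
    using PQ by (auto simp: same_def P points_def)
  have "w @ [(v, \<one>)] \<sim> w' @ [(v, inv k \<otimes> \<one>)]"
    by (rule am_shift) (use k wv \<iota>_XV in \<open>auto intro: Stab_one\<close>)
  then have "w' @ [(v, inv k)] \<sim> w"
    using am_one[OF wv(1,2)] k Stab_carrier by (auto intro: amalgam_eq.sym amalgam_eq.trans)
  then show ?thesis using k wv \<iota>_XV by (auto simp: same_def P points_def intro: Stab_inv)
qed

lemma nbrs_sym: "(P, Q) \<in> nbrs \<Longrightarrow> (Q, P) \<in> nbrs"
  by (cases P; cases Q) (auto simp: nbrs_def insert_commute intro: amalgam_eq.sym)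

lemma nbrs_same: "(P, Q) \<in> nbrs \<Longrightarrow> same Q Q' \<Longrightarrow> (P, Q') \<in> nbrs"
proof -
  assume PQ: "(P, Q) \<in> nbrs" and QQ': "same Q Q'"
  obtain w v w1 v1 w2 where P: "P = (w, v)" "Q = (w1, v1)" "Q' = (w2, v1)"
    using QQ' by (cases P; cases Q; cases Q') (auto simp: same_def)
  obtain k where k: "k \<in> Stab (\<iota> v1)" "w1 @ [(v1, k)] \<sim> w2" "w2 \<in> W"
    using QQ' by (auto simp: same_def P points_def)
  obtain g g' where g: "g \<in> Stab (\<iota> v)" "g' \<in> Stab (\<iota> v1)" "w @ [(v, g)] \<sim> w1 @ [(v1, g')]"
    and *: "w \<in> W" "w1 \<in> W" "v \<in> V" "v1 \<in> V" "\<exists>e\<in>edges (base \<G>). endpoints (base \<G>) e = {v, v1}"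
    using PQ by (auto simp: nbrs_def P)
  have "w1 @ [(v1, g')] \<sim> w2 @ [(v1, inv k \<otimes> g')]" by (rule am_shift) (use * g k in auto)
  with g(3) have "w @ [(v, g)] \<sim> w2 @ [(v1, inv k \<otimes> g')]" by (rule amalgam_eq.trans)
  moreover have "inv k \<otimes> g' \<in> Stab (\<iota> v1)" using k g * \<iota>_XV by (auto intro: Stab_mult Stab_inv)
  ultimately show ?thesis using * g(1) k(3) by (auto simp: nbrs_def P)
qed

lemma pos_XV: "P \<in> points \<Longrightarrow> pos P \<in> XV"
  using \<iota>_XV by (cases P) (auto simp: points_def intro: act_closed)

lemma nbrs_points: "(P, Q) \<in> nbrs \<Longrightarrow> P \<in> points \<and> Q \<in> points"
  by (auto simp: nbrs_def points_def)

lemma act_word_stab: "w \<in> W \<Longrightarrow> v \<in> V \<Longrightarrow> g \<in> Stab (\<iota> v) \<Longrightarrow> act (ev (w @ [(v, g)])) (\<iota> v) = act (ev w) (\<iota> v)"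
proof -
  assume *: "w \<in> W" "v \<in> V" "g \<in> Stab (\<iota> v)"
  then have g: "g \<in> carrier G" "act g (\<iota> v) = \<iota> v" by (auto simp: Stab_def)
  have "ev (w @ [(v, g)]) = ev w \<otimes> g" using * g by (simp add: ev_append W_simps)
  then show ?thesis using * g \<iota>_XV by (simp add: act_mult)
qed

lemma same_pos: "same P Q \<Longrightarrow> pos P = pos Q"
proof -
  assume PQ: "same P Q"
  obtain w v w' where P: "P = (w, v)" "Q = (w', v)" using PQ by (cases P; cases Q) (auto simp: same_def)
  obtain k where k: "k \<in> Stab (\<iota> v)" "w @ [(v, k)] \<sim> w'" and wv: "w \<in> W" "v \<in> V" "w' \<in> W"
    using PQ by (auto simp: same_def P points_def)
  show ?thesis using am_eq_sound[OF k(2)] act_word_stab[OF wv(1,2) k(1)] by (simp add: P)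
qed

lemma nbrs_pos:
  assumes "(P, Q) \<in> nbrs"
  shows "{pos P, pos Q} \<in> XE"
proof -
  obtain w v w1 v1 where P: "P = (w, v)" "Q = (w1, v1)" by (cases P; cases Q) auto
  obtain g g' e where g: "g \<in> Stab (\<iota> v)" "g' \<in> Stab (\<iota> v1)" "w @ [(v, g)] \<sim> w1 @ [(v1, g')]"
    and *: "w \<in> W" "w1 \<in> W" "v \<in> V" "v1 \<in> V" "e \<in> edges (base \<G>)" "endpoints (base \<G>) e = {v, v1}"
    using assms by (auto simp: nbrs_def P)
  have "{pos P, pos Q} = act (ev (w @ [(v, g)])) ` \<iota> ` endpoints (base \<G>) e"
    using am_eq_sound[OF g(3)] act_word_stab[OF *(1,3) g(1)] act_word_stab[OF *(2,4) g(2)] *(6)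
    by (simp add: P)
  also have "\<dots> \<in> XE" using am_eq_sound[OF g(3)] *(5) SE_subset by (intro act_edge) auto
  finally show ?thesis .
qed

text \<open>Local injectivity of the projection to \<open>XV\<close>, the point where the edge
  identifications do their work. Two neighbours of \<open>Q\<close> at the same position differ by
  an element \<open>k\<close> fixing both ends of a domain edge; as a member of the edge group it
  can be rewritten from a letter at \<open>v\<close> into a letter at \<open>v1\<close>.\<close>

lemma nbrs_locally_injective:
  assumes "(Q, P) \<in> nbrs" "(Q, P') \<in> nbrs" "pos P = pos P'"
  shows "same P P'"
proof -
  obtain w v w1 v1 w2 v2 where P: "Q = (w, v)" "P = (w1, v1)" "P' = (w2, v2)"
    by (cases P; cases Q; cases P') auto
  obtain g g1 e where g: "g \<in> Stab (\<iota> v)" "g1 \<in> Stab (\<iota> v1)" "w @ [(v, g)] \<sim> w1 @ [(v1, g1)]"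
    and *: "w \<in> W" "w1 \<in> W" "v \<in> V" "v1 \<in> V" "e \<in> edges (base \<G>)" "endpoints (base \<G>) e = {v, v1}"
    using assms(1) by (auto simp: nbrs_def P)
  obtain h g2 where h: "h \<in> Stab (\<iota> v)" "g2 \<in> Stab (\<iota> v2)" "w @ [(v, h)] \<sim> w2 @ [(v2, g2)]"
    and w2: "w2 \<in> W" "v2 \<in> V"
    using assms(2) by (auto simp: nbrs_def P)
  have eq0: "act (ev w1) (\<iota> v1) = act (ev w2) (\<iota> v2)" using assms(3) by (simp add: P)
  \<comment> \<open>Equal positions lie in one orbit, so both neighbours belong to the same domain
    vertex.\<close>
  have "act (inv (ev w2) \<otimes> ev w1) (\<iota> v1) = \<iota> v2"
    using eq0 *(2,4) w2 \<iota>_XV by (simp add: act_mult act_inv)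
  from S_unique[OF _ _ _ this[symmetric]] have "\<iota> v1 = \<iota> v2" using *(2,4) w2 by simp
  then have v2: "v2 = v1" using \<iota>_inj * w2 by (auto dest: inj_onD)
  have G: "g \<in> carrier G" "h \<in> carrier G" "g1 \<in> carrier G" "g2 \<in> carrier G"
    using g h Stab_carrier by blast+
  define k where "k = inv g \<otimes> h"
  have kv: "k \<in> Stab (\<iota> v)" using g h * \<iota>_XV by (auto simp: k_def intro: Stab_mult Stab_inv)
  have "act (ev w \<otimes> g) (\<iota> v1) = act (ev w \<otimes> h) (\<iota> v1)"
  proof -
    have "ev w \<otimes> g = ev (w1 @ [(v1, g1)])" "ev w \<otimes> h = ev (w2 @ [(v1, g2)])"
      using am_eq_sound[OF g(3)] am_eq_sound[OF h(3)] * g h w2 G by (auto simp: ev_append W_simps v2)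
    then show ?thesis using eq0 act_word_stab * w2 g h by (simp add: v2)
  qed
  then have "act g (\<iota> v1) = act h (\<iota> v1)"
    using * G \<iota>_XV by (metis act_closed act_inv act_mult ev_closed)
  then have kv1: "k \<in> Stab (\<iota> v1)" using G * \<iota>_XV by (auto simp: k_def Stab_def act_mult act_inv)
       (metis act_inv)
  have kG: "k \<in> carrier G" using G by (simp add: k_def)
  have "k \<in> carrier (egroup \<G> e)" using kv kv1 *(5,6) by (auto simp: egroup Stab_def)
  then have "[(v, k)] \<sim> [(v1, k)]" using amalgam_eq.edge[of e \<G> v v1 k] *(5,6) by (simp add: incl)
  \<comment> \<open>The chain of congruences: split \<open>h\<close> into \<open>g\<close> and
    \<open>k\<close> at \<open>v\<close>, move \<open>k\<close> to \<open>v1\<close>, replace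
    \<open>w g\<close> by \<open>w1 g1\<close>, and collect the letters at
    \<open>v1\<close>.\<close>
  have "w @ [(v, g)] @ [(v, k)] \<sim> w @ [(v, h)]"
    using am_mult[OF *(1,3) g(1) kv] G by (simp add: k_def flip: m_assoc)
  moreover have "w @ [(v, g)] @ [(v, k)] \<sim> w @ [(v, g)] @ [(v1, k)]"
    using am_cong_left[OF \<open>[(v, k)] \<sim> [(v1, k)]\<close>, of "w @ [(v, g)]"] * g by (simp add: W_simps)
  moreover have "w @ [(v, g)] @ [(v1, k)] \<sim> w1 @ [(v1, g1)] @ [(v1, k)]"
    using am_cong_right[OF g(3), of "[(v1, k)]"] kv1 * by (simp add: W_simps)
  moreover have "w1 @ [(v1, g1)] @ [(v1, k)] \<sim> w1 @ [(v1, g1 \<otimes> k)]"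
    using am_mult[OF *(2,4) g(2) kv1] by simp
  ultimately have 1: "w1 @ [(v1, g1 \<otimes> k)] \<sim> w2 @ [(v1, g2)]"
    using h(3) unfolding v2 by (meson amalgam_eq.sym amalgam_eq.trans)
  have st: "g1 \<otimes> k \<in> Stab (\<iota> v1)" "inv g2 \<in> Stab (\<iota> v1)"
    using g(2) h(2) kv1 * \<iota>_XV by (auto simp: v2 intro: Stab_mult Stab_inv)
  have "w1 @ [(v1, g1 \<otimes> k \<otimes> inv g2)] \<sim> w1 @ [(v1, g1 \<otimes> k)] @ [(v1, inv g2)]"
    using amalgam_eq.sym[OF am_mult[OF *(2,4) st]] by simp
  moreover have "w1 @ [(v1, g1 \<otimes> k)] @ [(v1, inv g2)] \<sim> w2 @ [(v1, g2)] @ [(v1, inv g2)]"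
    using am_cong_right[OF 1, of "[(v1, inv g2)]"] st * by (simp add: W_simps)
  moreover have "w2 @ [(v1, g2)] @ [(v1, inv g2)] \<sim> w2 @ [(v1, \<one>)]"
    using am_mult[OF w2(1) *(4) _ st(2), of g2] h(2) G by (simp add: v2)
  moreover have "w2 @ [(v1, \<one>)] \<sim> w2" using am_one w2(1) *(4) by blast
  ultimately have "w1 @ [(v1, g1 \<otimes> k \<otimes> inv g2)] \<sim> w2" by (meson amalgam_eq.trans)
  moreover have "g1 \<otimes> k \<otimes> inv g2 \<in> Stab (\<iota> v1)" using st * \<iota>_XV by (auto intro: Stab_mult)
  ultimately show ?thesis using * w2 by (auto simp: same_def P v2 points_def)
qed

lemma nbrs_relpow_pos: "(P, Q) \<in> nbrs ^^ n \<Longrightarrow> (pos P, pos Q) \<in> adj XE ^^ n"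
proof (induction n arbitrary: Q)
  case 0
  then show ?case by simp
next
  case (Suc n)
  then obtain R where R: "(P, R) \<in> nbrs ^^ n" "(R, Q) \<in> nbrs" by auto
  have "(pos R, pos Q) \<in> adj XE" using nbrs_pos[OF R(2)] by (simp add: adj_iff)
  then show ?case using Suc.IH[OF R(1)] by auto
qed

text \<open>
  Walks starting at \<open>P\<close> can be straightened: when a step decreases the distance of the positions,
  it leads to the previous vertex of the walk, by local injectivity.
\<close>

lemma nbrs_straighten:
  assumes P: "P \<in> points"
    and Q: "same Q' Q" "(P, Q') \<in> nbrs ^^ gdist XE (pos P) (pos Q)" and nb: "(Q, R) \<in> nbrs"
  shows "\<exists>R'. same R' R \<and> (P, R') \<in> nbrs ^^ gdist XE (pos P) (pos R)"
proof -
  let ?d = "\<lambda>x. gdist XE (pos P) x"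
  have nb': "(Q', R) \<in> nbrs" using nb nbrs_same nbrs_sym same_sym Q(1) by blast
  have R: "R \<in> points" "Q \<in> points" using nbrs_points nb by auto
  have E: "{pos Q, pos R} \<in> XE" using nbrs_pos[OF nb] .
  have conn: "(pos P, x) \<in> (adj XE)\<^sup>*" if "x \<in> XV" for x using that X_connected pos_XV P by blast
  from forest_gdist_adj[OF XE_forest E conn] R pos_XV
  consider "?d (pos R) = Suc (?d (pos Q))" | "?d (pos Q) = Suc (?d (pos R))" by blast
  then show ?thesis
  proof cases
    case 1
    have "(P, R) \<in> nbrs ^^ Suc (?d (pos Q))" using Q(2) nb' by auto
    then show ?thesis using 1 R same_refl by auto
  next
    case 2
    then obtain Z where Z: "(P, Z) \<in> nbrs ^^ ?d (pos R)" "(Z, Q') \<in> nbrs" using Q(2) by auto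
    have E': "{pos Z, pos Q} \<in> XE" using nbrs_pos[OF Z(2)] same_pos[OF Q(1)] by simp
    have "?d (pos Z) \<le> ?d (pos R)" using gdist_le[OF nbrs_relpow_pos[OF Z(1)]] .
    moreover have ZX: "pos Z \<in> XV" using E' XE_subset by blast
    ultimately have "?d (pos Q) = Suc (?d (pos Z))"
      using forest_gdist_adj[OF XE_forest E' conn[OF ZX]] 2 by linarith
    \<comment> \<open>Both positions are neighbours of \<open>pos Q\<close> one step closer to the
      start, and a forest has only one such neighbour.\<close>
    then have "pos Z = pos R"
      using forest_parent_unique[OF XE_forest E', of "pos R"] E conn[OF pos_XV[OF R(2)]] 2
      by (simp add: insert_commute)
    then have "same Z R" using nbrs_locally_injective[OF nbrs_sym[OF Z(2)] nb'] by simp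
    then show ?thesis using Z by blast
  qed
qed

lemma same_trans: "same P Q \<Longrightarrow> same Q R \<Longrightarrow> same P R"
proof -
  assume PQ: "same P Q" and QR: "same Q R"
  obtain w v w1 w2 where P: "P = (w, v)" "Q = (w1, v)" "R = (w2, v)"
  proof -
    show thesis if "\<And>w v w1 w2. P = (w, v) \<Longrightarrow> Q = (w1, v) \<Longrightarrow> R = (w2, v) \<Longrightarrow> thesis"
      using PQ QR that by (metis prod.collapse same_def)
  qed
  obtain g h where g: "g \<in> Stab (\<iota> v)" "w @ [(v, g)] \<sim> w1" "h \<in> Stab (\<iota> v)" "w1 @ [(v, h)] \<sim> w2"
    and *: "w \<in> W" "v \<in> V" "w1 \<in> W" "w2 \<in> W"
    using PQ QR by (auto simp: same_def P points_def)
  have "w @ [(v, g), (v, h)] \<sim> w1 @ [(v, h)]"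
    using am_cong_right[OF g(2), of "[(v, h)]"] g * by (simp add: W_simps)
  then have "w @ [(v, g), (v, h)] \<sim> w2" using g(4) by (rule amalgam_eq.trans)
  then have "w @ [(v, g \<otimes> h)] \<sim> w2"
    by (rule amalgam_eq.trans[OF amalgam_eq.sym[OF am_mult[OF *(1,2) g(1,3)]]])
  moreover have "g \<otimes> h \<in> Stab (\<iota> v)" using g * \<iota>_XV by (auto intro: Stab_mult)
  ultimately show ?thesis using * by (auto simp: same_def P points_def)
qed

text \<open>The trivial letter may be appended at any vertex, so a path in the domain lifts to its
  translate by the word \<open>w\<close>.\<close>

lemma nbrs_tree:
  assumes "w \<in> W" "u \<in> V" "v \<in> V"
  shows "((w, u), (w, v)) \<in> nbrs\<^sup>*"
proof -
  have "(\<iota> u, \<iota> v) \<in> (adj ((\<lambda>e. \<iota> ` endpoints (base \<G>) e) ` edges (base \<G>)))\<^sup>*"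
    using S_connected assms by blast
  then have "\<forall>v\<in>V. \<iota> v = s \<longrightarrow> ((w, u), (w, v)) \<in> nbrs\<^sup>*" if "s = \<iota> v" for s
    unfolding that[symmetric]
  proof (induction rule: rtrancl_induct)
    case base
    then show ?case using \<iota>_inj assms by (auto dest: inj_onD)
  next
    case (step s t)
    show ?case
    proof (intro ballI impI)
      fix y assume y: "y \<in> V" "\<iota> y = t"
      obtain e where e: "e \<in> edges (base \<G>)" "\<iota> ` endpoints (base \<G>) e = {s, t}"
        using step(2) by (auto simp: adj_iff)
      obtain p q where pq: "endpoints (base \<G>) e = {p, q}" "p \<in> V" "q \<in> V"
        using base_graph e(1) by (auto simp: is_graph_def)
      have "{\<iota> p, \<iota> q} = {s, t}" using e pq by simp
      then obtain x where x: "x \<in> V" "\<iota> x = s" "endpoints (base \<G>) e = {x, y}"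
        using pq y \<iota>_inj by (auto simp: doubleton_eq_iff insert_commute dest: inj_onD)
      have "w @ [(x, \<one>)] \<sim> w @ [(y, \<one>)]"
        by (rule amalgam_eq.trans[OF am_one amalgam_eq.sym[OF am_one]]) (use assms(1) x y in auto)
      then have "((w, x), (w, y)) \<in> nbrs"
        using assms(1) x y e Stab_one[OF \<iota>_XV[OF x(1)]] Stab_one[OF \<iota>_XV[OF y(1)]] by (auto simp: nbrs_def)
      moreover have "((w, u), (w, x)) \<in> nbrs\<^sup>*" using step(3) x by blast
      ultimately show "((w, u), (w, y)) \<in> nbrs\<^sup>*" by (rule rtrancl.rtrancl_into_rtrancl[rotated])
    qed
  qed
  then show ?thesis using assms by blast
qed

text \<open>If \<open>w\<close> evaluates to \<open>\<one>\<close>, then \<open>(w, v0)\<close> and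
  \<open>([], v0)\<close> have the same position. A walk between them straightens to length 0, so
  they are the same vertex; hence \<open>w\<close> is congruent to a single letter at
  \<open>v0\<close>, and that letter is \<open>\<one>\<close>.\<close>

lemma am_eq_complete_Nil:
  assumes w: "w \<in> W" and "ev w = \<one>"
  shows "w \<sim> []"
proof (cases "V = {}")
  case True
  then have "w = []" using w by (cases w) (auto simp: W_Cons)
  then show ?thesis by (simp add: amalgam_eq.refl W_Nil)
next
  case False
  then obtain v0 where v0: "v0 \<in> V" by blast
  let ?P = "([], v0)"
  have P: "?P \<in> points" using v0 by (simp add: points_def W_Nil)
  define reach where "reach Q \<longleftrightarrow> (\<exists>Q'. same Q' Q \<and> (?P, Q') \<in> nbrs ^^ gdist XE (pos ?P) (pos Q))" for Q
  have step: "reach R" if "reach Q" "(Q, R) \<in> nbrs" for Q R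
    using that nbrs_straighten[OF P _ _ that(2)] unfolding reach_def by blast
  have steps: "reach R" if "(Q, R) \<in> nbrs\<^sup>*" "reach Q" for Q R
    using that by (induction rule: rtrancl_induct) (auto intro: step)
  have reach: "\<forall>v\<in>V. reach (w, v)" using w
  proof (induction w rule: rev_induct)
    case Nil
    have "reach ?P" using same_refl[OF P] by (auto simp: reach_def)
    then show ?case using steps nbrs_tree[OF W_Nil v0] by blast
  next
    case (snoc x w)
    obtain u g where x: "x = (u, g)" by (cases x)
    then have u: "w \<in> W" "u \<in> V" "g \<in> Stab (\<iota> u)" using snoc(2) by (auto simp: W_simps)
    obtain Q' where Q': "same Q' (w, u)" "(?P, Q') \<in> nbrs ^^ gdist XE (pos ?P) (pos (w, u))"
      using snoc u unfolding reach_def by blast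
    \<comment> \<open>Because \<open>x\<close> is a letter at \<open>u\<close>, the translates by
      \<open>w\<close> and by \<open>w @ [x]\<close> share the vertex at \<open>u\<close>; from
      there all of the new translate is reached.\<close>
    have s: "same (w, u) (w @ [x], u)" using u snoc(2) x amalgam_eq.refl[of "w @ [x]" \<G>]
      by (auto simp: same_def points_def)
    have "reach (w @ [x], u)" unfolding reach_def
      using same_trans[OF Q'(1) s] Q'(2) unfolding same_pos[OF s] by blast
    then show ?case using steps nbrs_tree[OF snoc(2) u(2)] by blast
  qed
  then obtain Q' where Q': "same Q' (w, v0)" "(?P, Q') \<in> nbrs ^^ gdist XE (pos ?P) (pos (w, v0))"
    using v0 unfolding reach_def by blast
  have "pos (w, v0) = pos ?P" using assms(2) by simp
  with Q'(2) have "Q' = ?P" by simp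
  then obtain g where g: "g \<in> Stab (\<iota> v0)" "[(v0, g)] \<sim> w" using Q'(1) by (auto simp: same_def)
  have "g = \<one>" using am_eq_sound[OF g(2)] assms(2) g(1) Stab_carrier by auto
  then show ?thesis using g(2) am_one[OF W_Nil v0] by (auto intro: amalgam_eq.sym amalgam_eq.trans)
qed

definition word_inv :: "('w \<times> 'g) list \<Rightarrow> ('w \<times> 'g) list" where
  "word_inv w = rev (map (\<lambda>(v, g). (v, inv g)) w)"

lemma word_inv: "w \<in> W \<Longrightarrow> word_inv w \<in> W \<and> ev (word_inv w) = inv (ev w)"
proof (induction w rule: ev.induct)
  case 1
  then show ?case by (simp add: word_inv_def)
next
  case (2 v g w)
  then have *: "v \<in> V" "g \<in> Stab (\<iota> v)" "w \<in> W" "inv g \<in> Stab (\<iota> v)"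
    using \<iota>_XV by (auto simp: W_Cons intro: Stab_inv)
  then have "word_inv w \<in> W" "ev (word_inv w) = inv (ev w)" using 2 by auto
  moreover have "word_inv ((v, g) # w) = word_inv w @ [(v, inv g)]" by (simp add: word_inv_def)
  ultimately show ?case using * Stab_carrier by (auto simp: W_simps ev_append inv_mult_group)
qed

lemma am_eq_iff: "x \<sim> y \<longleftrightarrow> x \<in> W \<and> y \<in> W \<and> ev x = ev y"
proof (intro iffI; (elim conjE)?)
  assume xy: "x \<in> W" "y \<in> W" "ev x = ev y"
  have "word_inv y @ y \<sim> []" "x @ word_inv y \<sim> []"
    using xy word_inv[of y] by (auto intro!: am_eq_complete_Nil simp: W_append ev_append)
  then have "x @ word_inv y @ y \<sim> x" "x @ word_inv y @ y \<sim> y"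
    using am_cong_left[of "word_inv y @ y" "[]" x] am_cong_right[of "x @ word_inv y" "[]" y] xy by auto
  then show "x \<sim> y" by (meson amalgam_eq.sym amalgam_eq.trans)
qed (use am_eq_sound in auto)

lemma ev_surj:
  assumes "V \<noteq> {} \<or> carrier G = {\<one>}" "g \<in> carrier G"
  shows "\<exists>w\<in>W. ev w = g"
proof (cases "V = {}")
  case True
  then have "g = \<one>" using assms by simp
  then show ?thesis by (intro bexI[of _ "[]"]) (simp_all add: W_Nil)
next
  case False
  have "g \<in> generate G (\<Union>s\<in>\<iota> ` V. Stab s)" using generate_stabilizers assms False by simp
  then show ?thesis
  proof (induction rule: generate.induct)
    case one
    then show ?case using W_Nil ev.simps(1) by blast
  next
    case (incl h)
    then obtain v where "v \<in> V" "h \<in> Stab (\<iota> v)" by blast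
    then show ?case using Stab_carrier by (intro bexI[of _ "[(v, h)]"]) (auto simp: W_simps)
  next
    case (inv h)
    then obtain v where "v \<in> V" "inv h \<in> Stab (\<iota> v)" using \<iota>_XV by (auto intro: Stab_inv)
    then show ?case using Stab_carrier by (intro bexI[of _ "[(v, inv h)]"]) (auto simp: W_simps)
  next
    case (eng h1 h2)
    then obtain w1 w2 where "w1 \<in> W" "w2 \<in> W" "ev w1 = h1" "ev w2 = h2" by blast
    then show ?case by (intro bexI[of _ "w1 @ w2"]) (auto simp: W_append ev_append)
  qed
qed

text \<open>Words are congruent exactly when their values agree, so the classes are the fibres of
  \<open>ev\<close>. The assumption on \<open>V\<close> ensures that no fibre is empty, and
  generators are then carried over by the isomorphism \<open>\<Phi>\<close>.\<close>

lemma finitely_generated_amalgam: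
  assumes V: "V \<noteq> {} \<or> carrier G = {\<one>}" and fg: "finitely_generated_group G"
  shows "finitely_generated_group (amalgam \<G>)"
proof -
  let ?A = "amalgam \<G>"
  define \<Phi> where "\<Phi> g = {w \<in> W. ev w = g}" for g
  have cls: "{(x, y). x \<sim> y} `` {x} = \<Phi> (ev x)" if "x \<in> W" for x
    using that by (auto simp: \<Phi>_def am_eq_iff)
  have carr: "carrier ?A = \<Phi> ` carrier G"
  proof -
    have "carrier ?A = (\<lambda>x. \<Phi> (ev x)) ` W" using cls by (auto simp: amalgam_def quotient_def)
    also have "\<dots> = \<Phi> ` ev ` W" by (simp add: image_image)
    also have "ev ` W = carrier G" using ev_surj[OF V] by force
    finally show ?thesis .
  qed
  have mult: "\<Phi> g \<otimes>\<^bsub>?A\<^esub> \<Phi> h = \<Phi> (g \<otimes> h)" if gh: "g \<in> carrier G" "h \<in> carrier G" for g h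
  proof -
    obtain x where x: "x \<in> \<Phi> g" using ev_surj[OF V gh(1)] by (auto simp: \<Phi>_def)
    obtain y where y: "y \<in> \<Phi> h" using ev_surj[OF V gh(2)] by (auto simp: \<Phi>_def)
    note xy = x y
    have "\<Phi> g \<otimes>\<^bsub>?A\<^esub> \<Phi> h = {z. \<exists>x\<in>\<Phi> g. \<exists>y\<in>\<Phi> h. x @ y \<sim> z}" by (simp add: amalgam_def)
    also have "\<dots> = \<Phi> (g \<otimes> h)"
    proof (intro Set.equalityI subsetI)
      fix z assume "z \<in> {z. \<exists>x\<in>\<Phi> g. \<exists>y\<in>\<Phi> h. x @ y \<sim> z}"
      then show "z \<in> \<Phi> (g \<otimes> h)" by (auto simp: \<Phi>_def am_eq_iff W_append ev_append)
    next
      fix z assume "z \<in> \<Phi> (g \<otimes> h)"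
      then have "x @ y \<sim> z" using xy by (auto simp: \<Phi>_def am_eq_iff W_append ev_append)
      then show "z \<in> {z. \<exists>x\<in>\<Phi> g. \<exists>y\<in>\<Phi> h. x @ y \<sim> z}" using xy by blast
    qed
    finally show ?thesis .
  qed
  have one: "\<one>\<^bsub>?A\<^esub> = \<Phi> \<one>" by (auto simp: amalgam_def \<Phi>_def am_eq_iff W_Nil)
  have hom: "\<Phi> \<in> hom G ?A" using mult carr by (auto simp: hom_def)
  have "inj_on \<Phi> (carrier G)"
  proof (rule inj_onI)
    fix g h assume gh: "g \<in> carrier G" "h \<in> carrier G" "\<Phi> g = \<Phi> h"
    obtain x where "x \<in> \<Phi> g" using ev_surj[OF V gh(1)] by (auto simp: \<Phi>_def)
    then show "g = h" using gh(3) by (auto simp: \<Phi>_def)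
  qed
  then have iso: "\<Phi> \<in> iso G ?A" using hom carr by (auto simp: iso_def bij_betw_def)
  have "monoid ?A"
  proof
    show "\<one>\<^bsub>?A\<^esub> \<in> carrier ?A" using one carr by blast
  qed (auto simp: carr one mult m_assoc)
  then have "group ?A" using iso by (intro iso_imp_group is_isoI)
  then interpret \<Phi>: group_hom G ?A \<Phi> using hom is_group by (simp add: group_hom_def group_hom_axioms_def)
  obtain U where U: "finite U" "U \<subseteq> carrier G" "generate G U = carrier G"
    using fg by (auto simp: finitely_generated_group_def)
  have "generate ?A (\<Phi> ` U) = carrier ?A" using \<Phi>.generate_img[OF U(2)] U(3) carr by simp
  moreover have "finite (\<Phi> ` U)" "\<Phi> ` U \<subseteq> carrier ?A" using U carr by auto
  ultimately show ?thesis unfolding finitely_generated_group_def by blast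
qed

end

section \<open>The valuation of a finite extension of the p-adic numbers\<close>

lemma absv_facts:
  obtains p where "finite_extension_Qp p (absv :: 'a::padic_field \<Rightarrow> real)"
  using finite_extension_absv by blast

lemma absv_nonneg [simp]: "0 \<le> absv (x :: 'a::padic_field)"
  and absv_eq_0 [simp]: "absv x = 0 \<longleftrightarrow> x = 0"
  and absv_mult: "absv (x * y) = absv x * absv y"
  and absv_add: "absv (x + y) \<le> max (absv x) (absv y)"
  using absv_facts unfolding finite_extension_Qp_def by metis+

lemma absv_0 [simp]: "absv (0 :: 'a::padic_field) = 0"
  by simp

lemma absv_pos [simp]: "0 < absv x \<longleftrightarrow> (x :: 'a::padic_field) \<noteq> 0"
  using absv_nonneg[of x] absv_eq_0[of x] by linarith

lemma absv_1 [simp]: "absv (1 :: 'a::padic_field) = 1"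
  using absv_mult[of 1 "1::'a"] absv_eq_0[of "1::'a"] by simp

lemma absv_minus_1 [simp]: "absv (- 1 :: 'a::padic_field) = 1"
proof -
  have "absv (- 1 :: 'a) ^ 2 = 1" using absv_mult[of "-1" "-1::'a"] by (simp add: power2_eq_square)
  then show ?thesis using absv_nonneg[of "-1::'a"] by (auto simp: power2_eq_1_iff)
qed

lemma absv_minus [simp]: "absv (- x :: 'a::padic_field) = absv x"
  using absv_mult[of "-1" x] by simp

lemma absv_diff: "absv (x - y :: 'a::padic_field) \<le> max (absv x) (absv y)"
  using absv_add[of x "- y"] by simp

lemma absv_diff_commute: "absv (x - y :: 'a::padic_field) = absv (y - x)"
  using absv_minus[of "x - y"] by simp

lemma absv_inverse: "absv (inverse x :: 'a::padic_field) = inverse (absv x)"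
proof (cases "x = 0")
  case False
  then have "absv x * absv (inverse x) = 1" by (simp flip: absv_mult)
  then show ?thesis by (metis inverse_unique)
qed simp

lemma absv_divide: "absv (x / y :: 'a::padic_field) = absv x / absv y"
  by (simp add: divide_inverse absv_mult absv_inverse)

lemma absv_power: "absv (x ^ n :: 'a::padic_field) = absv x ^ n"
  by (induction n) (auto simp: absv_mult)

lemma absv_power_int: "absv (x powi n :: 'a::padic_field) = absv x powi n"
  by (auto simp: power_int_def absv_power absv_inverse)

lemma absv_add_le: "absv x \<le> c \<Longrightarrow> absv y \<le> c \<Longrightarrow> absv (x + y :: 'a::padic_field) \<le> c"
  using absv_add[of x y] by linarith

lemma absv_diff_le: "absv x \<le> c \<Longrightarrow> absv y \<le> c \<Longrightarrow> absv (x - y :: 'a::padic_field) \<le> c"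
  using absv_diff[of x y] by linarith

lemma absv_add_less: "absv x < c \<Longrightarrow> absv y < c \<Longrightarrow> absv (x + y :: 'a::padic_field) < c"
  using absv_add[of x y] by linarith

lemma absv_diff_less: "absv x < c \<Longrightarrow> absv y < c \<Longrightarrow> absv (x - y :: 'a::padic_field) < c"
  using absv_diff[of x y] by linarith

lemma absv_mult_le: "absv x \<le> 1 \<Longrightarrow> absv y \<le> c \<Longrightarrow> absv (x * y :: 'a::padic_field) \<le> c"
  using mult_mono[of "absv x" 1 "absv y" c] absv_nonneg[of y] by (simp add: absv_mult)

lemma absv_eqI:
  assumes "absv (x - y :: 'a::padic_field) < absv x"
  shows "absv y = absv x"
  using absv_diff[of x "x - y"] absv_add[of y "x - y"] assms by auto

lemma absv_sum_less:
  assumes "\<And>i. i \<in> I \<Longrightarrow> absv (f i :: 'a::padic_field) < c" "0 < c"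
  shows "absv (sum f I) < c"
  using assms by (induction I rule: infinite_finite_induct) (auto intro: absv_add_less)

lemma absv_of_int_le: "absv (of_int n :: 'a::padic_field) \<le> 1"
proof -
  have "absv (of_nat k :: 'a) \<le> 1" for k by (induction k) (auto intro: absv_add_le)
  then show ?thesis by (cases n rule: int_cases2) auto
qed

lemma finite_maximizer:
  assumes "finite I" "I \<noteq> {}"
  shows "\<exists>m\<in>I. \<forall>i\<in>I. g i \<le> (g m :: real)"
proof -
  have "Max (g ` I) \<in> g ` I" using assms by (intro Max_in) auto
  then obtain m where "m \<in> I" "Max (g ` I) = g m" by blast
  then show ?thesis using assms Max_ge[of "g ` I"] by (metis finite_imageI imageI)
qed

text \<open>The term of largest absolute value cannot be cancelled by strictly smaller ones.\<close>

lemma sum_distinct_absv_nonzero: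
  fixes f :: "'i \<Rightarrow> 'a::padic_field"
  assumes I: "finite I" "I \<noteq> {}" and f: "\<And>i. i \<in> I \<Longrightarrow> f i \<noteq> 0" "inj_on (\<lambda>i. absv (f i)) I"
  shows "sum f I \<noteq> 0"
proof
  assume 0: "sum f I = 0"
  obtain m where m: "m \<in> I" "\<And>i. i \<in> I \<Longrightarrow> absv (f i) \<le> absv (f m)"
    using finite_maximizer[OF I, of "\<lambda>i. absv (f i)"] by blast
  have "absv (sum f (I - {m})) < absv (f m)"
  proof (rule absv_sum_less)
    fix i assume "i \<in> I - {m}"
    then have "absv (f i) \<le> absv (f m)" "absv (f i) \<noteq> absv (f m)" using m f(2) by (auto dest: inj_onD)
    then show "absv (f i) < absv (f m)" by simp
  qed (use m f in auto)
  moreover have "sum f (I - {m}) = - f m" using 0 I m by (simp add: sum_diff1)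
  ultimately show False by simp
qed

interpretation absv_metric: Metric_space UNIV "abs_dist (absv :: 'a::padic_field \<Rightarrow> real)"
proof
  fix x y z :: 'a
  have "absv (x - z) \<le> absv (x - y) \<or> absv (x - z) \<le> absv (y - z)"
    using absv_add[of "x - y" "y - z"] by (simp add: le_max_iff_disj)
  then show "abs_dist absv x z \<le> abs_dist absv x y + abs_dist absv y z"
    using absv_nonneg[of "x - y"] absv_nonneg[of "y - z"] unfolding abs_dist_def by linarith
qed (auto simp: abs_dist_def absv_diff_commute)

section \<open>The closure of the rationals is a subfield\<close>

lemma rat_closure_iff:
  "x \<in> rat_closure (absv :: 'a::padic_field \<Rightarrow> real) \<longleftrightarrow> (\<forall>e>0. \<exists>q\<in>\<rat>. absv (x - q) < e)"
  unfolding rat_closure_def absv_metric.metric_closure_of by (auto simp: abs_dist_def)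

lemma rat_closure_approx:
  assumes "x \<in> rat_closure (absv :: 'a::padic_field \<Rightarrow> real)" "e > 0"
  obtains q where "q \<in> \<rat>" "absv (x - q) < e"
  using assms by (auto simp: rat_closure_iff)

lemma Rats_rat_closure: "x \<in> \<rat> \<Longrightarrow> x \<in> rat_closure (absv :: 'a::padic_field \<Rightarrow> real)"
  by (force simp: rat_closure_iff)

lemma rat_closure_add:
  assumes "x \<in> rat_closure absv" "y \<in> rat_closure (absv :: 'a::padic_field \<Rightarrow> real)"
  shows "x + y \<in> rat_closure absv"
  unfolding rat_closure_iff
proof (intro allI impI)
  fix e :: real assume e: "e > 0"
  obtain q where q: "q \<in> \<rat>" "absv (x - q) < e" using rat_closure_approx[OF assms(1) e] .
  obtain r where r: "r \<in> \<rat>" "absv (y - r) < e" using rat_closure_approx[OF assms(2) e] .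
  show "\<exists>q\<in>\<rat>. absv (x + y - q) < e"
    using absv_add_less[OF q(2) r(2)] q(1) r(1)
    by (intro bexI[of _ "q + r"]) (auto simp: algebra_simps)
qed

lemma rat_closure_mult:
  assumes "x \<in> rat_closure absv" "y \<in> rat_closure (absv :: 'a::padic_field \<Rightarrow> real)"
  shows "x * y \<in> rat_closure absv"
  unfolding rat_closure_iff
proof (intro allI impI)
  fix e :: real assume e: "e > 0"
  \<comment> \<open>A common bound for \<open>x\<close>, \<open>y\<close> and the approximation
    \<open>q\<close>; the error of \<open>q * r\<close> splits as
    \<open>(x - q) * y + q * (y - r)\<close>.\<close>
  define c where "c = 1 + absv x + absv y"
  have c: "c > 0" "absv x < c" "absv y < c" using absv_nonneg[of x] absv_nonneg[of y] unfolding c_def by linarith+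
  obtain q where q: "q \<in> \<rat>" "absv (x - q) < min c (e / c)"
    using rat_closure_approx[OF assms(1), of "min c (e / c)"] e c by auto
  obtain r where r: "r \<in> \<rat>" "absv (y - r) < e / c"
    using rat_closure_approx[OF assms(2), of "e / c"] e c by auto
  have "absv q < c" using absv_diff_less[of x c "x - q"] c q by simp
  then have "absv (q * (y - r)) < c * (e / c)"
    unfolding absv_mult using r(2) c by (intro mult_strict_mono) auto
  moreover have "absv ((x - q) * y) < (e / c) * c"
    unfolding absv_mult using q(2) c by (intro mult_strict_mono') auto
  ultimately have "absv ((x - q) * y + q * (y - r)) < e" using c by (intro absv_add_less) auto
  then show "\<exists>q\<in>\<rat>. absv (x * y - q) < e"
    using q(1) r(1) by (intro bexI[of _ "q * r"]) (auto simp: algebra_simps)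
qed

lemma rat_closure_uminus: "x \<in> rat_closure absv \<Longrightarrow> - x \<in> rat_closure (absv :: 'a::padic_field \<Rightarrow> real)"
  using rat_closure_mult[of "- 1" x] Rats_rat_closure[of "- 1"] by simp

lemma rat_closure_inverse:
  assumes "x \<in> rat_closure (absv :: 'a::padic_field \<Rightarrow> real)"
  shows "inverse x \<in> rat_closure absv"
proof (cases "x = 0")
  case False
  show ?thesis unfolding rat_closure_iff
  proof (intro allI impI)
    fix e :: real assume e: "e > 0"
    obtain q where q: "q \<in> \<rat>" "absv (x - q) < min (absv x) (e * absv x ^ 2)"
      using rat_closure_approx[OF assms, of "min (absv x) (e * absv x ^ 2)"] e False by auto
    then have qx: "absv q = absv x" by (intro absv_eqI) auto
    then have q0: "q \<noteq> 0" using False absv_eq_0 by metis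
    have "inverse x - inverse q = (q - x) / (x * q)" using False q0 by (simp add: field_simps)
    then have "absv (inverse x - inverse q) = absv (x - q) / absv x ^ 2"
      by (simp add: absv_divide absv_mult qx power2_eq_square absv_diff_commute)
    also have "\<dots> < e" using q(2) False by (simp add: pos_divide_less_eq)
    finally show "\<exists>q\<in>\<rat>. absv (inverse x - q) < e" using q(1) by (intro bexI[of _ "inverse q"]) auto
  qed
qed (use assms in simp)

text \<open>Elimination over a subfield that is a set and not a type: the generator \<open>b\<close>
  is removed by subtracting multiples of a pivot \<open>x j\<close> whose coefficient at
  \<open>b\<close> is nonzero.\<close>

lemma linear_dependence:
  fixes x :: "'i \<Rightarrow> 'a::field"
  assumes Q: "0 \<in> Q" "1 \<in> Q" "\<And>a b. a \<in> Q \<Longrightarrow> b \<in> Q \<Longrightarrow> a + b \<in> Q" "\<And>a b. a \<in> Q \<Longrightarrow> b \<in> Q \<Longrightarrow> a * b \<in> Q"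
      "\<And>a. a \<in> Q \<Longrightarrow> - a \<in> Q" "\<And>a. a \<in> Q \<Longrightarrow> inverse a \<in> Q"
    and B: "finite B" "finite I" "card B < card I"
    and x: "\<And>i. i \<in> I \<Longrightarrow> \<exists>c. (\<forall>b\<in>B. c b \<in> Q) \<and> x i = (\<Sum>b\<in>B. c b * b)"
  shows "\<exists>d. (\<forall>i\<in>I. d i \<in> Q) \<and> (\<exists>i\<in>I. d i \<noteq> 0) \<and> (\<Sum>i\<in>I. d i * x i) = 0"
  using B x
proof (induction B arbitrary: I x rule: finite_induct)
  case empty
  then have "I \<noteq> {}" "\<forall>i\<in>I. x i = 0" by auto
  then show ?case using Q by (intro exI[of _ "\<lambda>_. 1"]) auto
next
  case (insert b B)
  obtain c where c: "\<And>i. i \<in> I \<Longrightarrow> (\<forall>b\<in>insert b B. c i b \<in> Q) \<and> x i = (\<Sum>b\<in>insert b B. c i b * b)"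
    using insert.prems(3) by metis
  have xi: "x i = c i b * b + (\<Sum>b\<in>B. c i b * b)" if "i \<in> I" for i using c[OF that] insert.hyps by simp
  show ?case
  proof (cases "\<exists>j\<in>I. c j b \<noteq> 0")
    case False
    have "\<exists>d. (\<forall>i\<in>I. d i \<in> Q) \<and> (\<exists>i\<in>I. d i \<noteq> 0) \<and> (\<Sum>i\<in>I. d i * x i) = 0"
    proof (rule insert.IH)
      show "finite I" "card B < card I" using insert by auto
      show "\<exists>c. (\<forall>b\<in>B. c b \<in> Q) \<and> x i = (\<Sum>b\<in>B. c b * b)" if "i \<in> I" for i
        using c[OF that] xi[OF that] False that by (intro exI[of _ "c i"]) auto
    qed
    then show ?thesis .
  next
    case True
    then obtain j where j: "j \<in> I" "c j b \<noteq> 0" by blast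
    define r where "r i = c i b * inverse (c j b)" for i
    have rQ: "r i \<in> Q" if "i \<in> I" for i using c[OF that] c[OF j(1)] Q by (auto simp: r_def)
    have "\<exists>d. (\<forall>i\<in>I - {j}. d i \<in> Q) \<and> (\<exists>i\<in>I - {j}. d i \<noteq> 0) \<and> (\<Sum>i\<in>I - {j}. d i * (x i - r i * x j)) = 0"
    proof (rule insert.IH)
      show "finite (I - {j})" "card B < card (I - {j})" using insert j by auto
      fix i assume i: "i \<in> I - {j}"
      define c' where "c' u = c i u + - (r i * c j u)" for u
      have "c' u \<in> Q" if "u \<in> B" for u 
        unfolding c'_def using c[of i] c[OF j(1)] rQ[of i] i that Q(3-5) by blast
      moreover have "x i - r i * x j = (\<Sum>b\<in>B. c' b * b)"
        using xi[of i] xi[OF j(1)] i j(2)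
        by (simp add: c'_def r_def algebra_simps sum.distrib sum_distrib_left sum_subtractf)
      ultimately show "\<exists>c. (\<forall>b\<in>B. c b \<in> Q) \<and> x i - r i * x j = (\<Sum>b\<in>B. c b * b)" by blast
    qed
    then obtain d where d: "\<And>i. i \<in> I - {j} \<Longrightarrow> d i \<in> Q" "\<exists>i\<in>I - {j}. d i \<noteq> 0"
        "(\<Sum>i\<in>I - {j}. d i * (x i - r i * x j)) = 0" by blast
    \<comment> \<open>The coefficient at the pivot collects what the reduction has
      subtracted.\<close>
    define d' where "d' = d (j := - (\<Sum>i\<in>I - {j}. d i * r i))"
    have sumQ: "(\<Sum>i\<in>I - {j}. d i * r i) \<in> Q"
    proof -
      have *: "sum f J \<in> Q" if "finite J" "\<And>i. i \<in> J \<Longrightarrow> f i \<in> Q" for f and J :: "'i set"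
        using that by (induction J rule: finite_induct) (auto simp: Q)
      show ?thesis by (rule *) (use insert.prems(1) d(1) rQ Q(4) in auto)
    qed
    have "(\<Sum>i\<in>I. d' i * x i) = d' j * x j + (\<Sum>i\<in>I - {j}. d' i * x i)"
      using insert.prems(1) j(1) by (simp add: sum.remove)
    also have "(\<Sum>i\<in>I - {j}. d' i * x i) = (\<Sum>i\<in>I - {j}. d i * x i)"
      by (rule sum.cong) (auto simp: d'_def)
    also have "d' j * x j + \<dots> = (\<Sum>i\<in>I - {j}. d i * (x i - r i * x j))"
      by (simp add: d'_def sum_distrib_left algebra_simps sum_subtractf)
    finally have "(\<Sum>i\<in>I. d' i * x i) = 0" using d(3) by simp
    moreover have "\<forall>i\<in>I. d' i \<in> Q" using d(1) sumQ Q(5) by (auto simp: d'_def)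
    moreover have "\<exists>i\<in>I. d' i \<noteq> 0" using d(2) by (auto simp: d'_def)
    ultimately show ?thesis by blast
  qed
qed

section \<open>Discreteness of the valuation and finiteness of the residue field\<close>

locale padic_setup =
  fixes p :: nat and B :: "'a::padic_field set"
  assumes p: "Factorial_Ring.prime p"
    and absv_of_int: "n \<noteq> 0 \<Longrightarrow> absv (of_int n :: 'a) = 1 / real p ^ multiplicity (int p) n"
    and B: "finite B" "\<exists>c. (\<forall>b\<in>B. c b \<in> rat_closure absv) \<and> (x :: 'a) = (\<Sum>b\<in>B. c b * b)"
begin

abbreviation "Qp \<equiv> rat_closure (absv :: 'a \<Rightarrow> real)"

lemma p_gt_1: "real p > 1"
  using p prime_gt_1_nat by auto

lemma dependent:
  assumes "finite I" "card B < card I"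
  shows "\<exists>d. (\<forall>i\<in>I. d i \<in> Qp) \<and> (\<exists>i\<in>I. d i \<noteq> 0) \<and> (\<Sum>i\<in>I. d i * x i) = 0"
  by (rule linear_dependence[OF _ _ _ _ _ _ B(1) assms])
    (auto intro: rat_closure_add rat_closure_mult rat_closure_uminus rat_closure_inverse Rats_rat_closure B)

text \<open>A rational number close to \<open>c\<close> has the same absolute value, and nonzero
  rationals have powers of \<open>p\<close> as absolute values.\<close>

lemma absv_Qp:
  assumes "c \<in> Qp" "c \<noteq> 0"
  obtains k :: int where "absv c = real p powi k"
proof -
  obtain q where q: "q \<in> \<rat>" "absv (c - q) < absv c"
    using rat_closure_approx[OF assms(1), of "absv c"] assms(2) by auto
  then have "absv q = absv c" by (intro absv_eqI)
  moreover obtain a b where ab: "b > 0" "q = of_int a / of_int b" using q(1) by (cases rule: Rats_cases')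
  ultimately have "absv c = absv (of_int a :: 'a) / absv (of_int b :: 'a)" "a \<noteq> 0"
    using assms(2) by (auto simp: absv_divide) 
  then have "absv c = real p ^ multiplicity (int p) b / real p ^ multiplicity (int p) a"
    using ab(1) by (simp add: absv_of_int)
  also have "\<dots> = real p powi (int (multiplicity (int p) b) - int (multiplicity (int p) a))"
    using p_gt_1 by (simp add: power_int_diff)
  finally show ?thesis using that by blast
qed

text \<open>Consecutive powers of \<open>p\<close> are too far apart to be made equal by factors
  from this half-open interval.\<close>

lemma powi_sep:
  fixes i j :: int and a b :: real
  assumes "1 / real p < a" "a \<le> 1" "1 / real p < b" "b \<le> 1" "real p powi i * a = real p powi j * b"
  shows "i = j"
proof -
  have *: False if "1 / real p < a" "b \<le> 1" "real p powi i * a = real p powi j * b" "j < i" for i j a b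
  proof -
    have "real p powi j * b \<le> real p powi j * 1" using that(2) by (intro mult_left_mono) auto
    also have "real p powi j * 1 \<le> real p powi (i - 1)" using that(4) p_gt_1 by (auto intro: power_int_increasing)
    also have "real p powi (i - 1) = real p powi i * (1 / real p)" using p_gt_1 by (simp add: power_int_diff)
    also have "\<dots> < real p powi i * a" using that(1) p_gt_1 by (intro mult_strict_left_mono) auto
    finally show False using that(3) by simp
  qed
  show ?thesis using *[of a b i j] *[of b a j i] assms by (metis linorder_neqE)
qed

text \<open>This bounds the ramification. Distinct values in this range stay distinct modulo powers
  of \<open>p\<close>. In a dependence over \<open>Qp\<close> between elements having these values,
  the nonzero terms would have different absolute values and could not cancel, so there are at most
  \<open>card B\<close> values.\<close>

lemma finite_values: "finite {absv x | x :: 'a. 1 / real p < absv x \<and> absv x \<le> 1}"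
proof (rule ccontr)
  let ?A = "{absv x | x :: 'a. 1 / real p < absv x \<and> absv x \<le> 1}"
  assume "infinite ?A"
  then obtain I where I: "I \<subseteq> ?A" "finite I" "card I = Suc (card B)"
    using infinite_arbitrarily_large by blast
  obtain x where x: "\<And>a. a \<in> ?A \<Longrightarrow> absv (x a :: 'a) = a" 
    by (atomize_elim, rule choice) auto
  obtain d where d: "\<forall>i\<in>I. d i \<in> Qp" "\<exists>i\<in>I. d i \<noteq> 0" "(\<Sum>i\<in>I. d i * x i) = 0"
    using dependent[OF I(2), of x] I(3) by auto
  let ?J = "{i \<in> I. d i \<noteq> 0}"
  have "(\<Sum>i\<in>?J. d i * x i) = (\<Sum>i\<in>I. d i * x i)"
    using I(2) by (intro sum.mono_neutral_left) auto
  moreover have "(\<Sum>i\<in>?J. d i * x i) \<noteq> 0"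
  proof (rule sum_distinct_absv_nonzero)
    have pos: "1 / real p < a" "a \<le> 1" if "a \<in> I" for a using I(1) that by auto
    have "0 < a" if "a \<in> I" for a using pos(1)[OF that] p_gt_1 by (smt (verit) divide_pos_pos)
    then have "x a \<noteq> 0" if "a \<in> I" for a using x[of a] I(1) that by force
    then show "d i * x i \<noteq> 0" if "i \<in> ?J" for i using that by auto
    show "inj_on (\<lambda>i. absv (d i * x i)) ?J"
    proof (rule inj_onI)
      fix a b assume a: "a \<in> ?J" and b: "b \<in> ?J" and eq: "absv (d a * x a) = absv (d b * x b)"
      obtain i where i: "absv (d a) = real p powi i" using absv_Qp[of "d a"] a d(1) by auto
      obtain j where j: "absv (d b) = real p powi j" using absv_Qp[of "d b"] b d(1) by auto
      have "absv (x a) = a" "absv (x b) = b" using x a b I(1) by blast+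
      then have "real p powi i * a = real p powi j * b" using eq i j by (simp add: absv_mult)
      moreover from this have "i = j" using powi_sep pos a b by blast
      ultimately show "a = b" using p_gt_1 by auto
    qed
  qed (use I d in auto)
  ultimately show False using d(3) by simp
qed

lemma absv_p: "absv (of_nat p :: 'a) = 1 / real p"
  using absv_of_int[of "int p"] p p_gt_1 by (simp add: multiplicity_prime prime_int_nat_transfer)

text \<open>The largest absolute value below 1 is found among the finitely many above
  \<open>1 / p\<close>; if none of these is below 1, it is that of \<open>p\<close> itself.\<close>

lemma uniformizer_exists: "\<exists>u::'a. u \<noteq> 0 \<and> absv u < 1 \<and> (\<forall>x::'a. absv x < 1 \<longrightarrow> absv x \<le> absv u)"
proof -
  let ?A = "{absv x | x :: 'a. 1 / real p < absv x \<and> absv x \<le> 1}"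
  let ?B = "insert (1 / real p) {a \<in> ?A. a < 1}"
  have fin: "finite ?B" using finite_values by simp
  define m where "m = Max ?B"
  have m: "m \<in> ?B" "\<And>a. a \<in> ?B \<Longrightarrow> a \<le> m" using fin Max_in[OF fin] by (auto simp: m_def)
  obtain u :: 'a where u: "absv u = m" "absv u < 1" "absv u \<ge> 1 / real p"
    using m(1) absv_p p_gt_1 by (auto simp: less_imp_le)
  have "u \<noteq> 0" using u(3) p_gt_1 by (metis absv_0 divide_pos_pos less_numeral_extra(1) not_le order.strict_trans)
  moreover have "absv x \<le> absv u" if "absv x < 1" for x :: 'a
  proof (cases "absv x \<le> 1 / real p")
    case False
    then have "absv x \<in> ?B" using that by fastforce
    then show ?thesis using m(2) u(1) by simp
  qed (use u in simp)
  ultimately show ?thesis using u(2) by blast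
qed

lemma absv_of_int_less_1: "absv (of_int n :: 'a) < 1 \<longleftrightarrow> int p dvd n"
proof (cases "n = 0")
  case False
  have "absv (of_int n :: 'a) < 1 \<longleftrightarrow> real p ^ multiplicity (int p) n > 1"
    unfolding absv_of_int[OF False] using p_gt_1 by (auto simp: divide_less_eq)
  also have "\<dots> \<longleftrightarrow> multiplicity (int p) n > 0" using p_gt_1 by (cases "multiplicity (int p) n = 0") (auto intro: one_less_power)
  also have "\<dots> \<longleftrightarrow> int p dvd n"
    using False p by (intro prime_multiplicity_gt_zero_iff) auto
  finally show ?thesis .
qed simp

lemma inverse_mod_p:
  assumes "\<not> int p dvd n"
  obtains t where "int p dvd n * t - 1"
proof -
  have "Factorial_Ring.prime (int p)" using p by simp
  then have "coprime n (int p)" using assms prime_imp_coprime[of "int p" n] by (simp add: coprime_commute)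
  then obtain u v where "u * n + v * int p = 1" using bezout_int[of n "int p"] by auto
  then have "n * u - 1 = int p * (- v)" by (simp add: algebra_simps)
  then show ?thesis using that[of u] by (metis dvd_triv_left)
qed

text \<open>Approximate \<open>c\<close> by a reduced fraction \<open>a / b\<close>. Integrality
  makes \<open>b\<close> prime to \<open>p\<close>, and the digit is \<open>a\<close> times an
  inverse of \<open>b\<close> modulo \<open>p\<close>.\<close>

lemma residue_Qp:
  assumes "c \<in> Qp" "absv c \<le> 1"
  obtains a where "a < p" "absv (c - of_nat a :: 'a) < 1"
proof -
  obtain q where q: "q \<in> \<rat>" "absv (c - q) < 1" using rat_closure_approx[OF assms(1), of 1] by auto
  have q1: "absv q \<le> 1" using absv_diff_le[of c 1 "c - q"] q assms(2) by simp
  obtain a b where ab: "b > 0" "coprime a b" "q = of_int a / of_int b" using q(1) by (cases rule: Rats_cases')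
  have b: "\<not> int p dvd b"
  proof
    assume pb: "int p dvd b"
    have "\<not> int p dvd a"
    proof
      assume "int p dvd a"
      then have "int p dvd 1" using ab(2) pb coprime_common_divisor by blast
      then show False using p_gt_1 by simp
    qed
    then have "\<not> absv (of_int a :: 'a) < 1" "absv (of_int b :: 'a) < 1"
      using absv_of_int_less_1 pb by blast+
    moreover from this have "absv (of_int a :: 'a) = 1" using absv_of_int_le[of a] by (metis order.antisym not_less)
    ultimately have "absv (of_int a :: 'a) = 1" "absv (of_int b :: 'a) < 1" by auto
    then show False using q1 ab(1,3) by (auto simp: absv_divide divide_le_eq)
  qed
  then have b1: "absv (of_int b :: 'a) = 1" using absv_of_int_less_1 absv_of_int_le[of b] by (meson order.antisym not_less)
  obtain t where t: "int p dvd b * t - 1" using inverse_mod_p[OF b] .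
  define n where "n = nat ((a * t) mod int p)"
  have n: "n < p" "int n = (a * t) mod int p" using p_gt_1 by (auto simp: n_def nat_less_iff)
  have "int p dvd a - b * int n"
  proof -
    have "a - b * int n = b * (a * t - int n) - a * (b * t - 1)" by (simp add: algebra_simps)
    moreover have "int p dvd a * t - int n" unfolding n(2) by (simp add: dvd_minus_mod)
    ultimately show ?thesis using t by simp
  qed
  then have "absv (of_int (a - b * int n) :: 'a) < 1" using absv_of_int_less_1 by blast
  moreover have "q - of_nat n = of_int (a - b * int n) / of_int b" using ab(1,3) by (simp add: field_simps)
  ultimately have "absv (q - of_nat n) < 1" using b1 by (simp add: absv_divide)
  then have "absv (c - of_nat n) < 1" using absv_add_less[OF q(2)] by fastforce
  then show ?thesis using that n(1) by blast
qed

text \<open>Linear independence of the residue classes over the prime field, with digits below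
  \<open>p\<close> as coefficients, so that no residue field has to be constructed.\<close>

definition residue_independent :: "'a set \<Rightarrow> bool" where
  "residue_independent U \<longleftrightarrow> finite U \<and> (\<forall>u\<in>U. absv u \<le> 1) \<and>
     (\<forall>a. (\<forall>u\<in>U. a u < p) \<and> (\<exists>u\<in>U. a u \<noteq> 0) \<longrightarrow> \<not> absv (\<Sum>u\<in>U. of_nat (a u) * u) < 1)"

text \<open>This bounds the residue degree. A dependence over \<open>Qp\<close>, divided by its
  largest coefficient, has integral coefficients, one of which is 1; replacing them by digits gives
  a nontrivial dependence of residues.\<close>

lemma residue_independent_card:
  assumes U: "residue_independent U"
  shows "card U \<le> card B"
proof (rule ccontr)
  assume "\<not> card U \<le> card B"
  moreover have fin: "finite U" and U1: "\<And>u. u \<in> U \<Longrightarrow> absv u \<le> 1" using U by (auto simp: residue_independent_def)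
  ultimately obtain d where d: "\<forall>i\<in>U. d i \<in> Qp" "\<exists>i\<in>U. d i \<noteq> 0" "(\<Sum>i\<in>U. d i * i) = 0"
    using dependent[OF fin, of "\<lambda>x. x"] by auto
  have "U \<noteq> {}" using d(2) by auto
  then obtain m where m: "m \<in> U" "\<And>i. i \<in> U \<Longrightarrow> absv (d i) \<le> absv (d m)"
    using finite_maximizer[OF fin, of "\<lambda>i. absv (d i)"] by blast
  have "absv (d m) > 0" using d(2) m(2) by (metis absv_pos order.strict_trans2)
  then have dm: "d m \<noteq> 0" by simp
  define c where "c i = d i * inverse (d m)" for i
  have c: "c i \<in> Qp" "absv (c i) \<le> 1" if "i \<in> U" for i
  proof -
    show "c i \<in> Qp" using that d(1) m(1) by (auto simp: c_def intro: rat_closure_mult rat_closure_inverse)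
    show "absv (c i) \<le> 1" using m(2)[OF that] dm by (simp add: c_def absv_divide divide_le_eq flip: divide_inverse)
  qed
  have "\<exists>a. a < p \<and> absv (c i - of_nat a) < 1" if "i \<in> U" for i
    using residue_Qp[OF c[OF that]] by blast
  then obtain a where a: "\<And>i. i \<in> U \<Longrightarrow> a i < p \<and> absv (c i - of_nat (a i)) < 1" by metis
  have "c m = 1" using dm by (simp add: c_def)
  then have "a m \<noteq> 0" using a[OF m(1)] by (metis absv_1 diff_zero of_nat_0 order.irrefl)
  then have "\<not> absv (\<Sum>u\<in>U. of_nat (a u) * u) < 1" using U a m(1) unfolding residue_independent_def by blast
  moreover have "(\<Sum>u\<in>U. of_nat (a u) * u) = (\<Sum>u\<in>U. (of_nat (a u) - c u) * u)"
  proof -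
    have "(\<Sum>u\<in>U. c u * u) = inverse (d m) * (\<Sum>i\<in>U. d i * i)" by (simp add: c_def sum_distrib_left algebra_simps)
    then show ?thesis using d(3) by (simp add: left_diff_distrib sum_subtractf)
  qed
  moreover have "absv (\<Sum>u\<in>U. (of_nat (a u) - c u) * u) < 1"
  proof (rule absv_sum_less)
    fix u assume u: "u \<in> U"
    have "absv ((of_nat (a u) - c u) * u) \<le> absv (of_nat (a u) - c u) * 1"
      unfolding absv_mult using U1[OF u] by (intro mult_left_mono) auto
    then show "absv ((of_nat (a u) - c u) * u) < 1" using a[OF u] by (simp add: absv_diff_commute)
  qed simp
  ultimately show False by simp
qed

text \<open>Take a largest independent family \<open>U\<close>. Any further integral
  \<open>x\<close> satisfies a relation with a nonzero digit at \<open>x\<close>; this digit is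
  invertible modulo \<open>p\<close>, so \<open>x\<close> is congruent to a bounded integer times a
  digit combination of \<open>U\<close>.\<close>

lemma finite_residues: "\<exists>R. finite R \<and> (\<forall>x::'a. absv x \<le> 1 \<longrightarrow> (\<exists>r\<in>R. absv (x - r) < 1))"
proof -
  have "residue_independent {}" by (auto simp: residue_independent_def)
  then obtain U where U: "residue_independent U" and max: "\<And>U'. residue_independent U' \<Longrightarrow> card U' \<le> card U"
    using ex_has_greatest_nat[of residue_independent "{}" card "Suc (card B)"] residue_independent_card
    by (auto simp: less_Suc_eq_le)
  have fin: "finite U" and U1: "\<And>u. u \<in> U \<Longrightarrow> absv u \<le> 1" using U by (auto simp: residue_independent_def)
  let ?F = "\<lambda>s a. of_int s * (\<Sum>u\<in>U. of_nat (a u) * u)"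
  \<comment> \<open>\<open>U\<close> itself is included for the case that \<open>x\<close> already
    belongs to the family; the integer factor will be minus the inverse of the digit at
    \<open>x\<close>.\<close>
  let ?R = "U \<union> (\<lambda>(s, a). ?F s a) ` ({- int p..int p} \<times> (U \<rightarrow>\<^sub>E {..<p}))"
  have "finite ?R" using fin by (auto intro!: finite_PiE)
  moreover have "\<exists>r\<in>?R. absv (x - r) < 1" if x: "absv x \<le> 1" for x
  proof (cases "x \<in> U")
    case True
    then show ?thesis by force
  next
    case False
    have "\<not> residue_independent (insert x U)" using max[of "insert x U"] fin False by auto
    then obtain a where a: "\<forall>u\<in>insert x U. a u < p" "\<exists>u\<in>insert x U. a u \<noteq> 0"
      "absv (\<Sum>u\<in>insert x U. of_nat (a u) * u) < 1"
      using fin x U1 unfolding residue_independent_def by auto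
    have s: "absv (of_nat (a x) * x + (\<Sum>u\<in>U. of_nat (a u) * u)) < 1" using a(3) fin False by simp
    have ax: "a x \<noteq> 0"
    proof
      assume 0: "a x = 0"
      then have "absv (\<Sum>u\<in>U. of_nat (a u) * u) < 1" using s by simp
      then show False using U a 0 unfolding residue_independent_def by auto
    qed
    have "\<not> int p dvd int (a x)" using ax a(1) by (auto dest: zdvd_imp_le)
    then obtain t0 where t0: "int p dvd int (a x) * t0 - 1" by (rule inverse_mod_p)
    define t where "t = t0 mod int p"
    have t: "0 \<le> t" "t < int p" using p_gt_1 by (auto simp: t_def)
    have "int (a x) * t - 1 = (int (a x) * t0 - 1) - int (a x) * (t0 - t0 mod int p)" by (simp add: t_def algebra_simps)
    moreover have "int p dvd t0 - t0 mod int p" by (simp add: dvd_minus_mod)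
    ultimately have "int p dvd int (a x) * t - 1" using t0 by (metis dvd_diff dvd_mult)
    then have tp: "absv (of_int (int (a x) * t - 1) :: 'a) < 1" using absv_of_int_less_1 by blast
    let ?r = "?F (- t) (restrict a U)"
    have "(- t, restrict a U) \<in> {- int p..int p} \<times> (U \<rightarrow>\<^sub>E {..<p})" using t a(1) by auto
    then have rR: "?r \<in> ?R" by (rule UnI2[OF image_eqI[rotated]]) simp
    have "x - ?r = of_int t * (of_nat (a x) * x + (\<Sum>u\<in>U. of_nat (a u) * u)) - of_int (int (a x) * t - 1) * x"
      by (simp add: algebra_simps)
    moreover have "absv (of_int t * (of_nat (a x) * x + (\<Sum>u\<in>U. of_nat (a u) * u))) < 1"
      using absv_mult_le[OF absv_of_int_le[of t] order_refl] s by (rule order.strict_trans1)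
    moreover have "absv (of_int (int (a x) * t - 1) * x) < 1"
      using absv_mult_le[OF x order_refl, of "of_int (int (a x) * t - 1)"] tp by (simp add: mult.commute)
    ultimately have "absv (x - ?r) < 1" by (simp only: absv_diff_less)
    then show ?thesis using rR by blast
  qed
  ultimately show ?thesis by blast
qed

end

lemma padic_setup_exists: "\<exists>p B. padic_setup p (B :: 'a::padic_field set)"
proof -
  obtain p where p: "finite_extension_Qp p (absv :: 'a \<Rightarrow> real)" using absv_facts .
  then obtain B :: "'a set" where "finite B"
    "\<forall>x. \<exists>c. (\<forall>b\<in>B. c b \<in> rat_closure absv) \<and> x = (\<Sum>b\<in>B. c b * b)"
    unfolding finite_extension_Qp_def by (elim conjE exE)
  with p have "padic_setup p B" by (simp add: padic_setup_def finite_extension_Qp_def)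
  then show ?thesis by blast
qed

section \<open>The uniformizer and expansions in its powers\<close>

definition unif :: "'a::padic_field" where
  "unif = (SOME u. u \<noteq> 0 \<and> absv u < 1 \<and> (\<forall>x::'a. absv x < 1 \<longrightarrow> absv x \<le> absv u))"

lemma unif_nonzero [simp]: "unif \<noteq> (0 :: 'a::padic_field)"
  and absv_unif: "absv (unif :: 'a) < 1"
  and absv_le_unif: "absv (x :: 'a) < 1 \<Longrightarrow> absv x \<le> absv (unif :: 'a)"
proof -
  obtain p and B :: "'a set" where "padic_setup p B" using padic_setup_exists by blast
  then have "\<exists>u::'a. u \<noteq> 0 \<and> absv u < 1 \<and> (\<forall>x::'a. absv x < 1 \<longrightarrow> absv x \<le> absv u)"
    by (rule padic_setup.uniformizer_exists)
  from someI_ex[OF this] show "unif \<noteq> (0 :: 'a)" "absv (unif :: 'a) < 1"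
    "absv (x :: 'a) < 1 \<Longrightarrow> absv x \<le> absv (unif :: 'a)"
    unfolding unif_def by blast+
qed

text \<open>One more digit: divide the error \<open>x - r\<close> by \<open>unif ^ n\<close> and
  approximate the quotient modulo the maximal ideal.\<close>

lemma finite_residue_system:
  "\<exists>R. finite R \<and> (\<forall>x::'a::padic_field. absv x \<le> 1 \<longrightarrow> (\<exists>r\<in>R. absv (x - r) \<le> absv (unif :: 'a) ^ n))"
proof (induction n)
  case 0
  then show ?case by (intro exI[of _ "{0}"]) auto
next
  case (Suc n)
  then obtain R where "finite R" and R': "\<forall>x::'a. absv x \<le> 1 \<longrightarrow> (\<exists>r\<in>R. absv (x - r) \<le> absv (unif :: 'a) ^ n)"
    by (elim exE conjE) (rule that)
  then have R: "finite R" "\<And>x::'a. absv x \<le> 1 \<Longrightarrow> \<exists>r\<in>R. absv (x - r) \<le> absv (unif :: 'a) ^ n" by simp_all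
  obtain p and B :: "'a set" where "padic_setup p B" using padic_setup_exists by blast
  from padic_setup.finite_residues[OF this] obtain R1
    where "finite R1" and R1': "\<forall>x::'a. absv x \<le> 1 \<longrightarrow> (\<exists>r\<in>R1. absv (x - r) < 1)"
    by (elim exE conjE) (rule that)
  then have R1: "finite R1" "\<And>x::'a. absv x \<le> 1 \<Longrightarrow> \<exists>r\<in>R1. absv (x - r) < 1" by simp_all
  have "\<exists>s\<in>(\<lambda>(r, s). r + unif ^ n * s) ` (R \<times> R1). absv (x - s) \<le> absv (unif :: 'a) ^ Suc n" if x: "absv x \<le> 1" for x :: 'a
  proof -
    obtain r where r: "r \<in> R" "absv (x - r) \<le> absv (unif :: 'a) ^ n" using R(2)[OF x] by blast
    have "absv ((x - r) / unif ^ n) \<le> 1" using r(2) by (simp add: absv_divide absv_power divide_le_eq)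
    then obtain s where s: "s \<in> R1" "absv ((x - r) / unif ^ n - s) < 1" using R1(2) by blast
    have "x - (r + unif ^ n * s) = unif ^ n * ((x - r) / unif ^ n - s)"
      by (simp add: right_diff_distrib diff_divide_distrib)
    then have "absv (x - (r + unif ^ n * s)) = absv (unif :: 'a) ^ n * absv ((x - r) / unif ^ n - s)"
      by (simp only: absv_mult absv_power)
    also have "\<dots> \<le> absv (unif :: 'a) ^ n * absv (unif :: 'a)"
      by (intro mult_left_mono absv_le_unif s) auto
    finally show ?thesis using r(1) s(1) by (intro bexI[of _ "r + unif ^ n * s"]) (auto simp: mult.commute)
  qed
  then show ?case using R(1) R1(1) by (intro exI[of _ "(\<lambda>(r, s). r + unif ^ n * s) ` (R \<times> R1)"]) auto
qed

lemma unif_power_small: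
  assumes "e > 0"
  obtains n where "absv (unif :: 'a::padic_field) ^ n < e"
  using real_arch_pow_inv[OF assms absv_unif] by blast

lemma unif_decomposition:
  assumes "x \<noteq> (0 :: 'a::padic_field)"
  obtains n :: int and u where "absv u = 1" "x = u * unif powi n"
proof -
  have main: "\<exists>n u. absv u = 1 \<and> x = u * unif ^ n" if x: "absv x \<le> 1" "x \<noteq> 0" for x :: 'a
  proof -
    \<comment> \<open>Repeated division by \<open>unif\<close> reaches a unit, and \<open>N\<close>
      bounds the number of divisions.\<close>
    obtain N where N: "absv (unif :: 'a) ^ N < absv x" using unif_power_small[of "absv x"] x by auto
    have "\<exists>n u. absv u = 1 \<and> x = u * unif ^ n" if "absv (unif :: 'a) ^ N < absv x" "absv x \<le> 1" for N and x :: 'a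
      using that
    proof (induction N arbitrary: x)
      case 0
      then show ?case by simp
    next
      case (Suc N)
      show ?case
      proof (cases "absv x = 1")
        case True
        then show ?thesis by (intro exI[of _ 0] exI[of _ x]) simp
      next
        case False
        then have "absv (x / unif) \<le> 1" using absv_le_unif[of x] Suc.prems by (simp add: absv_divide divide_le_eq)
        moreover have "absv (unif :: 'a) ^ N < absv (x / unif)"
          using Suc.prems by (simp add: absv_divide less_divide_eq mult.commute)
        ultimately obtain n u where "absv u = 1" "x / unif = u * unif ^ n" using Suc.IH by blast
        then show ?thesis by (intro exI[of _ "Suc n"] exI[of _ u]) (auto simp: field_simps)
      qed
    qed
    then show ?thesis using N x by blast
  qed
  show ?thesis
  proof (cases "absv x \<le> 1")
    case True
    then obtain n u where "absv u = 1" "x = u * unif ^ n" using main assms by blast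
    then show ?thesis using that[of u "int n"] by simp
  next
    case False
    then have "absv (inverse x) \<le> 1" by (simp add: absv_inverse inverse_le_1_iff)
    then obtain n u where nu: "absv u = 1" "inverse x = u * unif ^ n" using main[of "inverse x"] assms by auto
    then have "x = inverse u * unif powi (- int n)"
      by (metis inverse_inverse_eq inverse_mult_distrib power_int_minus power_int_of_nat)
    then show ?thesis using that[of "inverse u" "- int n"] nu(1) by (simp add: absv_inverse)
  qed
qed

section \<open>Lattices and the Bruhat--Tits tree\<close>

definition cr :: "'a::field^2 \<Rightarrow> 'a^2 \<Rightarrow> 'a" where
  "cr u v = u $ 1 * v $ 2 - u $ 2 * v $ 1"

lemma cr_simps [simp]:
  "cr (u + v) w = cr u w + cr v w" "cr u (v + w) = cr u v + cr u w"
  "cr (u - v) w = cr u w - cr v w" "cr u (v - w) = cr u v - cr u w"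
  "cr (c *s u) v = c * cr u v" "cr u (c *s v) = c * cr u v"
  "cr u u = 0" "cr 0 u = 0" "cr u 0 = 0"
  by (simp_all add: cr_def algebra_simps)

lemma cr_swap: "cr v u = - cr u v"
  by (simp add: cr_def)

text \<open>Cramer's rule, with \<open>cr\<close> as the determinant of a pair of vectors. All later
  coordinate computations rest on it.\<close>

lemma cr_coords:
  assumes "cr u v \<noteq> 0"
  shows "x = (cr x v / cr u v) *s u + (cr u x / cr u v) *s v"
proof -
  have "cr u v * x $ i = cr x v * u $ i + cr u x * v $ i" for i
    using exhaust_2[of i] by (auto simp: cr_def algebra_simps)
  then show ?thesis using assms by (simp add: vec_eq_iff field_simps)
qed

lemma cr_eq_0_iff:
  assumes "u \<noteq> 0"
  shows "cr u v = 0 \<longleftrightarrow> (\<exists>c. v = c *s u)"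
proof
  assume 0: "cr u v = 0"
  from assms obtain i where i: "u $ i \<noteq> 0" by (auto simp: vec_eq_iff)
  have "v = (v $ i / u $ i) *s u"
    using 0 i exhaust_2[of i] by (auto simp: vec_eq_iff forall_2 cr_def field_simps)
  then show "\<exists>c. v = c *s u" by blast
qed auto

lemma cr_exists: "u \<noteq> 0 \<Longrightarrow> \<exists>v. cr u v \<noteq> (0 :: 'a::field)"
proof -
  assume u: "u \<noteq> 0"
  show ?thesis
  proof (cases "u $ 1 = 0")
    case True
    then have "cr u (vector [1, 0]) \<noteq> 0" using u by (auto simp: cr_def vec_eq_iff forall_2)
    then show ?thesis by blast
  next
    case False
    then have "cr u (vector [0, 1]) \<noteq> 0" by (auto simp: cr_def)
    then show ?thesis by blast
  qed
qed

section \<open>Lattices in terms of bases\<close>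

definition lat :: "'a::padic_field^2 \<Rightarrow> 'a^2 \<Rightarrow> ('a^2) set" where
  "lat u v = {a *s u + b *s v | a b. absv a \<le> 1 \<and> absv b \<le> 1}"

lemma latI: "absv a \<le> 1 \<Longrightarrow> absv b \<le> 1 \<Longrightarrow> a *s u + b *s v \<in> lat u v"
  unfolding lat_def by blast

lemma lat_basis [simp]: "u \<in> lat u v" "v \<in> lat u v"
  using latI[of 1 0 u v] latI[of 0 1 u v] by simp_all

lemma lat_iff:
  assumes "cr u v \<noteq> 0"
  shows "x \<in> lat u v \<longleftrightarrow> absv (cr x v) \<le> absv (cr u v) \<and> absv (cr u x) \<le> absv (cr u v)"
proof
  assume "x \<in> lat u v"
  then obtain a b where ab: "x = a *s u + b *s v" "absv a \<le> 1" "absv b \<le> 1" unfolding lat_def by blast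
  then have "cr x v = a * cr u v" "cr u x = b * cr u v" by simp_all
  then show "absv (cr x v) \<le> absv (cr u v) \<and> absv (cr u x) \<le> absv (cr u v)"
    using ab by (simp add: absv_mult mult_left_le_one_le)
next
  assume "absv (cr x v) \<le> absv (cr u v) \<and> absv (cr u x) \<le> absv (cr u v)"
  then have "absv (cr x v / cr u v) \<le> 1" "absv (cr u x / cr u v) \<le> 1"
    using assms by (simp_all add: absv_divide divide_le_eq)
  from latI[OF this, of u v] show "x \<in> lat u v" using cr_coords[OF assms, of x] by simp
qed

lemma lat_iff_coords:
  assumes "cr u v \<noteq> 0"
  shows "a *s u + b *s v \<in> lat u v \<longleftrightarrow> absv a \<le> 1 \<and> absv b \<le> 1"
  using assms by (simp add: lat_iff absv_mult mult_le_cancel_right1)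

lemma lat_submodule: "O_submodule (lat u v)"
  unfolding O_submodule_def valuation_ring_def
proof (intro conjI ballI)
  show "0 \<in> lat u v" using latI[of 0 0 u v] by simp
next
  fix x y assume "x \<in> lat u v" "y \<in> lat u v"
  then obtain a b c d where *: "x = a *s u + b *s v" "y = c *s u + d *s v"
    "absv a \<le> 1" "absv b \<le> 1" "absv c \<le> 1" "absv d \<le> 1" unfolding lat_def by blast
  have "x + y = (a + c) *s u + (b + d) *s v" using * by (simp add: vec_eq_iff algebra_simps)
  then show "x + y \<in> lat u v" using * by (simp only: latI absv_add_le)
next
  fix c :: 'a and x assume c: "c \<in> {x. absv x \<le> 1}" and "x \<in> lat u v"
  then obtain a b where *: "x = a *s u + b *s v" "absv a \<le> 1" "absv b \<le> 1" unfolding lat_def by blast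
  have "c *s x = (c * a) *s u + (c * b) *s v" using * by (simp add: vec_eq_iff algebra_simps)
  then show "c *s x \<in> lat u v" using * c by (simp only: latI absv_mult_le mem_Collect_eq)
qed

lemma submodule_comb:
  assumes "O_submodule M" "x \<in> M" "y \<in> M" "absv a \<le> 1" "absv b \<le> 1"
  shows "a *s x + b *s y \<in> M"
  using assms by (auto simp: O_submodule_def valuation_ring_def)

lemma submodule_scale: "O_submodule M \<Longrightarrow> x \<in> M \<Longrightarrow> absv a \<le> 1 \<Longrightarrow> a *s x \<in> M"
  by (auto simp: O_submodule_def valuation_ring_def)

lemma lat_subset: "O_submodule M \<Longrightarrow> x \<in> M \<Longrightarrow> y \<in> M \<Longrightarrow> lat x y \<subseteq> M"
  by (auto simp: lat_def intro: submodule_comb)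

lemma lat_eqI: "x \<in> lat u v \<Longrightarrow> y \<in> lat u v \<Longrightarrow> u \<in> lat x y \<Longrightarrow> v \<in> lat x y \<Longrightarrow> lat x y = lat u v"
  by (intro equalityI lat_subset lat_submodule)

lemma lat_commute: "lat u v = lat v u"
  by (intro lat_eqI) simp_all

lemma lat_scale: "(*s) c ` lat u v = lat (c *s u) (c *s v)"
proof -
  have "c *s (a *s u + b *s v) = a *s (c *s u) + b *s (c *s v)" for a b
    by (simp add: vec_eq_iff algebra_simps)
  then show ?thesis unfolding lat_def by (force simp: image_iff)
qed

lemma lat_units: "absv a = 1 \<Longrightarrow> absv b = 1 \<Longrightarrow> lat (a *s u) (b *s v) = lat u v"
proof (intro lat_eqI)
  assume a: "absv a = 1" "absv b = 1"
  then have nz: "a \<noteq> 0" "b \<noteq> 0" by auto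
  show "a *s u \<in> lat u v" "b *s v \<in> lat u v" using a by (auto intro: submodule_scale lat_submodule)
  have "inverse a *s (a *s u) \<in> lat (a *s u) (b *s v)"
    by (rule submodule_scale[OF lat_submodule lat_basis(1)]) (simp add: absv_inverse a)
  moreover have "inverse b *s (b *s v) \<in> lat (a *s u) (b *s v)"
    by (rule submodule_scale[OF lat_submodule lat_basis(2)]) (simp add: absv_inverse a)
  ultimately show "u \<in> lat (a *s u) (b *s v)" "v \<in> lat (a *s u) (b *s v)" using nz by (simp_all add: vector_smult_assoc)
qed

lemma O_span_pair: "u \<noteq> v \<Longrightarrow> O_span {u, v} = lat u v"
proof -
  assume uv: "u \<noteq> v"
  have "\<exists>c. a *s u + b *s v = (\<Sum>s\<in>{u, v}. c s *s s) \<and> c ` {u, v} \<subseteq> valuation_ring"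
    if "absv a \<le> 1" "absv b \<le> 1" for a b
    using uv that by (intro exI[of _ "\<lambda>x. if x = u then a else b"]) (auto simp: valuation_ring_def)
  then show ?thesis using uv unfolding O_span_def lat_def by (auto simp: valuation_ring_def)
qed

lemma O_span_submodule: "finite S \<Longrightarrow> O_submodule (O_span S)"
  unfolding O_submodule_def
proof (intro conjI ballI)
  show "0 \<in> O_span S" unfolding O_span_def
    by (intro CollectI exI[of _ "\<lambda>_. 0"]) (auto simp: valuation_ring_def)
next
  fix x y assume "x \<in> O_span S" "y \<in> O_span S"
  then obtain c d where *: "x = (\<Sum>s\<in>S. c s *s s)" "y = (\<Sum>s\<in>S. d s *s s)"
    "c ` S \<subseteq> valuation_ring" "d ` S \<subseteq> valuation_ring" unfolding O_span_def by blast
  have "x + y = (\<Sum>s\<in>S. (c s + d s) *s s)" using * by (simp add: sum.distrib vec.scale_left_distrib)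
  moreover have "(\<lambda>s. c s + d s) ` S \<subseteq> valuation_ring" using *(3,4) by (auto simp: valuation_ring_def intro!: absv_add_le)
  ultimately show "x + y \<in> O_span S" unfolding O_span_def by (intro CollectI exI conjI)
next
  fix a :: 'a and x assume a: "a \<in> valuation_ring" and "x \<in> O_span S"
  then obtain c where *: "x = (\<Sum>s\<in>S. c s *s s)" "c ` S \<subseteq> valuation_ring" unfolding O_span_def by blast
  have "a *s x = (\<Sum>s\<in>S. (a * c s) *s s)" using * by (simp add: vec.scale_sum_right vector_smult_assoc)
  moreover have "(\<lambda>s. a * c s) ` S \<subseteq> valuation_ring" using *(2) a by (auto simp: valuation_ring_def intro!: absv_mult_le)
  ultimately show "a *s x \<in> O_span S" unfolding O_span_def by (intro CollectI exI conjI)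
qed

lemma O_span_base: "finite S \<Longrightarrow> s \<in> S \<Longrightarrow> s \<in> O_span S"
proof -
  assume S: "finite S" "s \<in> S"
  have "(\<Sum>t\<in>S. (if t = s then 1 else 0) *s t) = s"
    using S by (subst sum.remove[of _ s]) auto
  moreover have "(\<lambda>t. if t = s then 1 else 0) ` S \<subseteq> valuation_ring" by (auto simp: valuation_ring_def)
  ultimately show ?thesis unfolding O_span_def
    by (intro CollectI exI[of _ "\<lambda>t. if t = s then 1 else 0"] conjI) simp_all
qed

lemma O_span_least: "O_submodule M \<Longrightarrow> S \<subseteq> M \<Longrightarrow> O_span S \<subseteq> M"
proof
  fix x assume M: "O_submodule M" "S \<subseteq> M" and "x \<in> O_span S"
  then obtain c where *: "x = (\<Sum>s\<in>S. c s *s s)" "c ` S \<subseteq> valuation_ring" unfolding O_span_def by blast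
  have "(\<Sum>s\<in>T. c s *s s) \<in> M" if "T \<subseteq> S" for T
    using that
  proof (induction T rule: infinite_finite_induct)
    case (insert t T)
    then have "c t \<in> valuation_ring" "t \<in> M" using M *(2) by auto
    then have "c t *s t \<in> M" using M(1) unfolding O_submodule_def by blast
    then show ?case using insert M by (auto simp: O_submodule_def)
  qed (use M in \<open>auto simp: O_submodule_def\<close>)
  then show "x \<in> M" using *(1) by simp
qed

lemma is_lattice_lat: "cr u v \<noteq> 0 \<Longrightarrow> is_lattice (lat u v)"
proof -
  assume uv: "cr u v \<noteq> 0"
  then have "u \<noteq> v" by auto
  moreover have "vec.span (lat u v) = UNIV"
  proof -
    have "x \<in> vec.span (lat u v)" for x
    proof -
      have "(cr x v / cr u v) *s u + (cr u x / cr u v) *s v \<in> vec.span (lat u v)"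
        by (intro vec.span_add vec.span_scale vec.span_base) simp_all
      then show ?thesis using cr_coords[OF uv, of x] by simp
    qed
    then show ?thesis by blast
  qed
  ultimately show ?thesis unfolding is_lattice_def using O_span_pair[of u v]
    by (intro conjI exI[of _ "{u, v}"]) simp_all
qed

text \<open>Among finitely many generators, a pair with determinant of maximal absolute value is a basis.\<close>

lemma is_lattice_iff: "is_lattice L \<longleftrightarrow> (\<exists>u v. cr u v \<noteq> 0 \<and> L = lat u v)"
proof
  assume L: "is_lattice L"
  then obtain S where S: "finite S" "L = O_span S" and sp: "vec.span L = UNIV" by (auto simp: is_lattice_def)
  have spS: "vec.span S = UNIV"
  proof -
    have "L \<subseteq> vec.span S" unfolding S(2) O_span_def by (auto intro!: vec.span_sum vec.span_scale intro: vec.span_base)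
    then have "vec.span L \<subseteq> vec.span S" by (simp add: vec.span_minimal)
    then show ?thesis using sp by blast
  qed
  have "\<exists>s\<in>S. s \<noteq> 0"
  proof (rule ccontr)
    assume "\<not> ?thesis"
    then have "S \<subseteq> {0}" by blast
    then have "vec.span S \<subseteq> {0}" by (metis vec.span_mono vec.span_empty vec.span_insert_0)
    moreover have "axis 1 1 \<noteq> (0 :: 'a^2)" by (simp add: axis_eq_0_iff)
    ultimately show False using spS by blast
  qed
  then obtain s0 where s0: "s0 \<in> S" "s0 \<noteq> 0" by blast
  have "\<exists>t\<in>S. cr s0 t \<noteq> 0"
  proof (rule ccontr)
    assume *: "\<not> ?thesis"
    have "vec.subspace {x. cr s0 x = 0}" by (auto simp: vec.subspace_def)
    then have "vec.span S \<subseteq> {x. cr s0 x = 0}" using * by (intro vec.span_minimal) auto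
    then show False using spS cr_exists[OF s0(2)] by blast
  qed
  then obtain t0 where t0: "t0 \<in> S" "cr s0 t0 \<noteq> 0" by blast
  have "finite (S \<times> S)" "S \<times> S \<noteq> {}" using S(1) s0 by auto
  from finite_maximizer[OF this, of "\<lambda>(s, t). absv (cr s t)"]
  obtain u v where uv: "u \<in> S" "v \<in> S" "\<And>s t. s \<in> S \<Longrightarrow> t \<in> S \<Longrightarrow> absv (cr s t) \<le> absv (cr u v)" by fastforce
  have "absv (cr u v) > 0" using uv(3)[OF s0(1) t0(1)] t0(2) by (metis absv_pos order.strict_trans2)
  then have nz: "cr u v \<noteq> 0" by simp
  have "O_span S \<subseteq> lat u v" using uv nz by (intro O_span_least lat_submodule) (auto simp: lat_iff)
  moreover have "lat u v \<subseteq> O_span S" using uv S(1) by (intro lat_subset O_span_submodule O_span_base)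
  ultimately show "\<exists>u v. cr u v \<noteq> 0 \<and> L = lat u v" using nz S(2) by blast
qed (auto simp: is_lattice_lat)

lemma unif_lat_iff:
  assumes "cr u v \<noteq> 0"
  shows "a *s u + b *s v \<in> (*s) unif ` lat u v \<longleftrightarrow> absv a < 1 \<and> absv b < 1"
proof -
  let ?q = "a *s u + b *s v"
  have "?q \<in> (*s) unif ` lat u v \<longleftrightarrow> (a / unif) *s u + (b / unif) *s v \<in> lat u v"
  proof -
    have "?q = unif *s ((a / unif) *s u + (b / unif) *s v)"
      by (simp add: vec_eq_iff algebra_simps)
    moreover have "inj ((*s) (unif :: 'a))" by (auto simp: inj_on_def)
    ultimately show ?thesis by (metis inj_image_mem_iff)
  qed
  also have "\<dots> \<longleftrightarrow> absv a \<le> absv (unif :: 'a) \<and> absv b \<le> absv (unif :: 'a)"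
    using assms by (simp add: lat_iff_coords absv_divide divide_le_eq)
  also have "\<dots> \<longleftrightarrow> absv a < 1 \<and> absv b < 1" using absv_unif[where 'a = 'a] absv_le_unif by force
  finally show ?thesis .
qed

text \<open>A primitive vector has a unit coordinate and can replace the corresponding basis
  vector.\<close>

lemma lat_extend_basis:
  assumes "cr u v \<noteq> 0" "x \<in> lat u v" "x \<notin> (*s) unif ` lat u v"
  obtains y where "cr x y \<noteq> 0" "lat x y = lat u v"
proof -
  obtain a b where ab: "x = a *s u + b *s v" "absv a \<le> 1" "absv b \<le> 1" using assms(2) unfolding lat_def by blast
  have *: "\<exists>y. cr x y \<noteq> 0 \<and> lat x y = lat u v"
    if "cr u v \<noteq> 0" "x = a *s u + b *s v" "absv a = 1" "absv b \<le> 1" for a b u v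
  proof (intro exI[of _ v] conjI lat_eqI)
    have a: "a \<noteq> 0" using that by auto
    show "cr x v \<noteq> 0" using that a by simp
    show "x \<in> lat u v" using that by (simp add: latI)
    have "u = inverse a *s x + (- b / a) *s v" using that(2) a by (simp add: vec_eq_iff field_simps)
    then show "u \<in> lat x v" using that latI[of "inverse a" "- b / a" x v] by (simp add: absv_inverse absv_divide)
  qed simp_all
  have "absv a = 1 \<or> absv b = 1" using assms(3) unfolding ab(1) unif_lat_iff[OF assms(1)] using ab by linarith
  then show ?thesis
  proof
    assume "absv a = 1"
    then show ?thesis using * assms(1) ab that by blast
  next
    assume "absv b = 1"
    then show ?thesis using *[of v u b a] assms(1) ab that
      by (auto simp: add.commute lat_commute[of v u] cr_swap[of v u])
  qed
qed

lemma lat_absorb: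
  assumes "cr u v \<noteq> 0" "cr x y \<noteq> 0"
  shows "\<exists>k. (*s) (unif ^ k) ` lat u v \<subseteq> lat x y"
proof -
  define c where "c = Max {absv (cr u y), absv (cr x u), absv (cr v y), absv (cr x v), 1}"
  have c: "absv (cr u y) \<le> c" "absv (cr x u) \<le> c" "absv (cr v y) \<le> c" "absv (cr x v) \<le> c" "1 \<le> c"
    unfolding c_def by (auto intro: Max_ge)
  obtain k where k: "absv (unif :: 'a) ^ k < absv (cr x y) / c"
    using unif_power_small[where 'a = 'a, of "absv (cr x y) / c"] assms(2) c(5) by auto
  have *: "absv (unif ^ k * z) \<le> absv (cr x y)" if "absv z \<le> c" for z :: 'a
  proof -
    have "absv (unif ^ k * z) \<le> absv (unif :: 'a) ^ k * c"
      unfolding absv_mult absv_power using that by (intro mult_left_mono) auto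
    also have "\<dots> \<le> absv (cr x y) / c * c" using k c(5) by (intro mult_right_mono) auto
    finally show ?thesis using c(5) by simp
  qed
  have "unif ^ k *s u \<in> lat x y" "unif ^ k *s v \<in> lat x y"
    using c by (simp_all add: lat_iff[OF assms(2)] *)
  then show ?thesis unfolding lat_scale using lat_subset[OF lat_submodule] by blast
qed

section \<open>Sublattices with simple quotient\<close>

lemma unif_lat_subset: "(*s) unif ` lat u v \<subseteq> lat u v"
  using absv_unif[where 'a = 'a] unfolding lat_scale
  by (intro lat_subset lat_submodule submodule_scale) auto

text \<open>A module between the two that is not the smaller one contains a vector whose coordinate
  at \<open>y\<close> is a unit; together with \<open>x\<close> this gives \<open>y\<close>.\<close>

lemma quotient_length_one_lat:
  assumes "cr x y \<noteq> 0"
  shows "quotient_length_one (lat x y) (lat x (unif *s y))"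
  unfolding quotient_length_one_def
proof (intro conjI allI impI)
  have sub: "lat x (unif *s y) \<subseteq> lat x y"
    using absv_unif[where 'a = 'a] by (intro lat_subset lat_submodule submodule_scale) auto
  have nz: "cr x (unif *s y) \<noteq> 0" using assms by simp
  have "y \<notin> lat x (unif *s y)" using absv_unif[where 'a = 'a] assms by (simp add: lat_iff[OF nz] absv_mult mult_le_cancel_right1)
  then show "lat x (unif *s y) \<subset> lat x y" using sub lat_basis by blast
  fix M assume M: "O_submodule M \<and> lat x (unif *s y) \<subseteq> M \<and> M \<subseteq> lat x y"
  show "M = lat x (unif *s y) \<or> M = lat x y"
  proof (cases "M \<subseteq> lat x (unif *s y)")
    case True
    then show ?thesis using M by blast
  next
    case False
    then obtain z where z: "z \<in> M" "z \<notin> lat x (unif *s y)" by blast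
    then obtain a b where ab: "z = a *s x + b *s y" "absv a \<le> 1" "absv b \<le> 1" using M unfolding lat_def by blast
    have "absv b = 1"
    proof (rule ccontr)
      assume "absv b \<noteq> 1"
      then have "absv (b / unif) \<le> 1" using ab(3) absv_le_unif[of b] by (simp add: absv_divide divide_le_eq)
      moreover have "z = a *s x + (b / unif) *s (unif *s y)" by (simp add: ab(1) vector_smult_assoc)
      ultimately show False using z(2) latI[of a "b / unif" x "unif *s y"] ab(2) by simp
    qed
    then have b: "b \<noteq> 0" "absv (inverse b) = 1" by (auto simp: absv_inverse)
    have xM: "x \<in> M" using M lat_basis by blast
    have "y = inverse b *s z + (- a / b) *s x" using b by (simp add: ab(1) vec_eq_iff field_simps)
    moreover have "inverse b *s z + (- a / b) *s x \<in> M"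
      using M z(1) xM b ab(2) \<open>absv b = 1\<close> by (intro submodule_comb) (auto simp: absv_divide)
    ultimately have "y \<in> M" by simp
    then have "lat x y \<subseteq> M" using M xM by (intro lat_subset) auto
    then show ?thesis using M by blast
  qed
qed

text \<open>Nakayama's argument. The module \<open>M\<close>, the sum of the smaller lattice and
  \<open>unif\<close> times the larger, lies between the two. Were it the larger one, iteration
  would replace \<open>unif\<close> by any power of it, and by \<open>lat_absorb\<close> both
  lattices would be equal. The inclusion is strict because otherwise
  \<open>lat u (unif *s v)\<close> would fit strictly in between.\<close>

lemma quotient_length_one_contains_unif:
  assumes L: "cr u v \<noteq> 0" "cr u' v' \<noteq> 0" and q: "quotient_length_one (lat u v) (lat u' v')"
  shows "(*s) unif ` lat u v \<subset> lat u' v'"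
proof
  let ?L = "lat u v" and ?L' = "lat u' v'"
  define M where "M = {x + unif *s y | x y. x \<in> ?L' \<and> y \<in> ?L}"
  have sub: "?L' \<subset> ?L" using q by (simp add: quotient_length_one_def)
  have M: "O_submodule M" unfolding O_submodule_def
  proof (intro conjI ballI)
    have "0 + unif *s 0 \<in> M" unfolding M_def using lat_submodule O_submodule_def by blast
    then show "0 \<in> M" by simp
  next
    fix x y assume "x \<in> M" "y \<in> M"
    then obtain a b c d where *: "x = a + unif *s b" "y = c + unif *s d" "a \<in> ?L'" "c \<in> ?L'" "b \<in> ?L" "d \<in> ?L"
      unfolding M_def by blast
    have "x + y = (a + c) + unif *s (b + d)" using * by (simp add: vec_eq_iff algebra_simps)
    moreover have "a + c \<in> ?L'" "b + d \<in> ?L" using * lat_submodule by (auto simp: O_submodule_def)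
    ultimately show "x + y \<in> M" unfolding M_def by blast
  next
    fix e :: 'a and x assume e: "e \<in> valuation_ring" and "x \<in> M"
    then obtain a b where *: "x = a + unif *s b" "a \<in> ?L'" "b \<in> ?L" unfolding M_def by blast
    have "e *s x = e *s a + unif *s (e *s b)" using * by (simp add: vec_eq_iff algebra_simps)
    moreover have "e *s a \<in> ?L'" "e *s b \<in> ?L"
      using * e lat_submodule by (auto simp: valuation_ring_def intro!: submodule_scale)
    ultimately show "e *s x \<in> M" unfolding M_def by blast
  qed
  have "x + unif *s 0 \<in> M" if "x \<in> ?L'" for x
    unfolding M_def using that lat_submodule O_submodule_def by blast
  then have L'_M: "?L' \<subseteq> M" by force
  have "0 + unif *s y \<in> M" if "y \<in> ?L" for y
    unfolding M_def using that lat_submodule O_submodule_def by blast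
  then have L_M: "(*s) unif ` ?L \<subseteq> M" by auto
  have M_L: "M \<subseteq> ?L"
  proof
    fix z assume "z \<in> M"
    then obtain x y where "z = x + unif *s y" "x \<in> ?L" "unif *s y \<in> ?L"
      unfolding M_def using sub unif_lat_subset by fast
    then show "z \<in> ?L" using lat_submodule O_submodule_def by blast
  qed
  have "M \<noteq> ?L"
  proof
    assume eq: "M = ?L"
    have step: "\<exists>x\<in>?L'. \<exists>y\<in>?L. z = x + unif ^ k *s y" if "z \<in> ?L" for z k
    proof (induction k)
      case 0
      have "z = 0 + unif ^ 0 *s z" by simp
      moreover have "0 \<in> ?L'" using lat_submodule O_submodule_def by blast
      ultimately show ?case using that by blast
    next
      case (Suc k)
      then obtain x y where xy: "x \<in> ?L'" "y \<in> ?L" "z = x + unif ^ k *s y" by blast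
      then have "y \<in> M" using eq by simp
      then obtain x' y' where xy': "x' \<in> ?L'" "y' \<in> ?L" "y = x' + unif *s y'" unfolding M_def by blast
      have "z = (x + unif ^ k *s x') + unif ^ Suc k *s y'"
        unfolding xy(3) xy'(3) by (simp add: vec_eq_iff algebra_simps)
      moreover have "unif ^ k *s x' \<in> ?L'"
        using xy'(1) absv_unif[where 'a = 'a] by (auto intro!: submodule_scale lat_submodule simp: absv_power power_le_one)
      then have "x + unif ^ k *s x' \<in> ?L'" using xy(1) lat_submodule O_submodule_def by blast
      ultimately show ?case using xy'(2) by blast
    qed
    obtain k where k: "(*s) (unif ^ k) ` ?L \<subseteq> ?L'" using lat_absorb[OF L] by blast
    have "z \<in> ?L'" if "z \<in> ?L" for z
    proof -
      obtain x y where "x \<in> ?L'" "y \<in> ?L" "z = x + unif ^ k *s y" using step[OF \<open>z \<in> ?L\<close>, of k] by blast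
      moreover from this k have "unif ^ k *s y \<in> ?L'" by blast
      ultimately show ?thesis using lat_submodule O_submodule_def by blast
    qed
    then show False using sub by blast
  qed
  then have "M = ?L'" using q M L'_M M_L unfolding quotient_length_one_def by blast
  then show sub': "(*s) unif ` ?L \<subseteq> ?L'" using L_M by simp
  show "(*s) unif ` ?L \<noteq> ?L'"
  proof
    assume eq: "(*s) unif ` ?L = ?L'"
    let ?N = "lat u (unif *s v)"
    have nz: "cr u (unif *s v) \<noteq> 0" using L by simp
    have 1: "?L' \<subseteq> ?N" unfolding eq[symmetric] lat_scale
      by (intro lat_subset lat_submodule lat_basis submodule_scale) (simp add: absv_unif less_imp_le)
    have qN: "?N \<subset> ?L" using quotient_length_one_lat[OF L(1)] by (simp add: quotient_length_one_def)
    have "?N = ?L'" using q 1 qN lat_submodule unfolding quotient_length_one_def by blast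
    then have "1 *s u + 0 *s v \<in> (*s) unif ` lat u v" using eq lat_basis(1)[of u "unif *s v"] by simp
    then show False unfolding unif_lat_iff[OF L(1)] by simp
  qed
qed

text \<open>Extend \<open>x\<close> to a basis of the larger lattice. The smaller one contains
  \<open>unif\<close> times the second basis vector, and simplicity of the quotient leaves no
  choice.\<close>

lemma quotient_length_one_basis:
  assumes L: "cr u v \<noteq> 0" "cr u' v' \<noteq> 0" and q: "quotient_length_one (lat u v) (lat u' v')"
    and x: "x \<in> lat u' v'" "x \<notin> (*s) unif ` lat u v"
  shows "\<exists>y. cr x y \<noteq> 0 \<and> lat u v = lat x y \<and> lat u' v' = lat x (unif *s y)"
proof -
  have sub: "lat u' v' \<subset> lat u v" using q by (simp add: quotient_length_one_def)
  then obtain y where y: "cr x y \<noteq> 0" "lat x y = lat u v" using lat_extend_basis[OF L(1) _ x(2)] x(1) by blast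
  have "unif *s y \<in> lat u' v'"
    using quotient_length_one_contains_unif[OF L q] lat_basis(2)[of y x] y(2) by blast
  then have "lat x (unif *s y) \<subseteq> lat u' v'" using x(1) by (intro lat_subset lat_submodule)
  then have "lat u' v' = lat x (unif *s y)"
    using quotient_length_one_lat[OF y(1)] sub lat_submodule unfolding y(2) quotient_length_one_def by blast
  then show ?thesis using y by blast
qed

text \<open>The elementary divisor form of a pair of lattices with quotient of length one;
  \<open>lat_step_iff\<close> shows the equivalence.\<close>

definition lat_step :: "('a::padic_field^2) set \<Rightarrow> ('a^2) set \<Rightarrow> bool" where
  "lat_step L L' \<longleftrightarrow> (\<exists>x y. cr x y \<noteq> 0 \<and> L = lat x y \<and> L' = lat x (unif *s y))"

lemma lat_step_iff: "lat_step L L' \<longleftrightarrow> is_lattice L \<and> is_lattice L' \<and> quotient_length_one L L'"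
proof
  assume "is_lattice L \<and> is_lattice L' \<and> quotient_length_one L L'"
  then obtain u v u' v' where *: "cr u v \<noteq> 0" "cr u' v' \<noteq> 0" "L = lat u v" "L' = lat u' v'"
    "quotient_length_one L L'" unfolding is_lattice_iff by blast
  then obtain x where "x \<in> L'" "x \<notin> (*s) unif ` L" using quotient_length_one_contains_unif[of u v u' v'] by blast
  then show "lat_step L L'" using quotient_length_one_basis[of u v u' v' x] * unfolding lat_step_def by blast
next
  assume "lat_step L L'"
  then obtain x y where *: "cr x y \<noteq> 0" "L = lat x y" "L' = lat x (unif *s y)" unfolding lat_step_def by blast
  then have "cr x (unif *s y) \<noteq> 0" by simp
  then show "is_lattice L \<and> is_lattice L' \<and> quotient_length_one L L'"
    using * is_lattice_lat quotient_length_one_lat by blast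
qed

lemma lat_step_basis:
  assumes "lat_step L L'" "x \<in> L'" "x \<notin> (*s) unif ` L"
  shows "\<exists>y. cr x y \<noteq> 0 \<and> L = lat x y \<and> L' = lat x (unif *s y)"
  using assms quotient_length_one_basis unfolding lat_step_iff is_lattice_iff by blast

text \<open>Exchanging the two basis vectors yields the next step down. Up to similarity this makes
  adjacency symmetric.\<close>

lemma lat_step_unif: "lat_step L L' \<Longrightarrow> lat_step L' ((*s) unif ` L)"
proof -
  assume "lat_step L L'"
  then obtain x y where *: "cr x y \<noteq> 0" "L = lat x y" "L' = lat x (unif *s y)" unfolding lat_step_def by blast
  then have "cr (unif *s y) x \<noteq> 0" by (simp add: cr_swap[of y])
  then show ?thesis unfolding lat_step_def using * by (metis lat_commute lat_scale)
qed

lemma lat_step_scale: "lat_step L L' \<Longrightarrow> c \<noteq> 0 \<Longrightarrow> lat_step ((*s) c ` L) ((*s) c ` L')"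
proof -
  assume "lat_step L L'" and c: "c \<noteq> 0"
  then obtain x y where *: "cr x y \<noteq> 0" "L = lat x y" "L' = lat x (unif *s y)" unfolding lat_step_def by blast
  have "(*s) c ` L = lat (c *s x) (c *s y)" "(*s) c ` L' = lat (c *s x) (unif *s (c *s y))"
    using * by (simp_all add: lat_scale vector_smult_assoc mult.commute)
  moreover have "cr (c *s x) (c *s y) \<noteq> 0" using * c by simp
  ultimately show ?thesis unfolding lat_step_def by blast
qed

lemma lat_step_subset: "lat_step L L' \<Longrightarrow> L' \<subset> L"
  by (simp add: lat_step_iff quotient_length_one_def)

lemma lattice_not_in_unif: "is_lattice L \<Longrightarrow> \<not> L \<subseteq> (*s) unif ` L"
proof
  assume "is_lattice L" and sub: "L \<subseteq> (*s) unif ` L"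
  then obtain u v where uv: "cr u v \<noteq> 0" "L = lat u v" unfolding is_lattice_iff by blast
  then have "1 *s u + 0 *s v \<in> (*s) unif ` lat u v" using sub lat_basis by auto
  then show False unfolding unif_lat_iff[OF uv(1)] by simp
qed

text \<open>Modulo \<open>unif\<close> times \<open>L\<close>, a sublattice of colength one is a
  line in a plane, hence determined by any nonzero vector in it.\<close>

lemma lat_step_meet:
  assumes "lat_step L A" "lat_step L B" "A \<noteq> B" "z \<in> A" "z \<in> B"
  shows "z \<in> (*s) unif ` L"
proof (rule ccontr)
  assume z: "z \<notin> (*s) unif ` L"
  have *: "C = {c *s z + w | c w. absv c \<le> 1 \<and> w \<in> (*s) unif ` L}" if C: "lat_step L C" "z \<in> C" for C
  proof -
    obtain y where y: "cr z y \<noteq> 0" "L = lat z y" "C = lat z (unif *s y)" using lat_step_basis[OF C z] by blast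
    have U: "(*s) unif ` L = lat (unif *s z) (unif *s y)" using y by (simp add: lat_scale)
    show ?thesis
    proof (intro Set.equalityI subsetI)
      fix x assume "x \<in> C"
      then obtain a b where ab: "x = a *s z + b *s (unif *s y)" "absv a \<le> 1" "absv b \<le> 1" unfolding y(3) lat_def by blast
      have "b *s (unif *s y) \<in> (*s) unif ` L" unfolding U
        by (rule submodule_scale[OF lat_submodule lat_basis(2) ab(3)])
      then show "x \<in> {c *s z + w | c w. absv c \<le> 1 \<and> w \<in> (*s) unif ` L}" using ab by blast
    next
      fix x assume "x \<in> {c *s z + w | c w. absv c \<le> 1 \<and> w \<in> (*s) unif ` L}"
      then obtain c w where cw: "x = c *s z + 1 *s w" "absv c \<le> 1" "w \<in> (*s) unif ` L" by auto
      have "w \<in> C" using cw(3) lat_step_subset[OF lat_step_unif[OF C(1)]] by blast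
      moreover have "O_submodule C" unfolding y(3) by (rule lat_submodule)
      ultimately show "x \<in> C" using cw(1,2) C(2) submodule_comb[of C z w c 1] by simp
    qed
  qed
  show False using *[OF assms(1,4)] *[OF assms(2,5)] assms(3) by simp
qed

lemma lat_chain_antimono:
  assumes "\<And>i. i < n \<Longrightarrow> lat_step (L i) (L (Suc i))" "i \<le> n"
  shows "L n \<subseteq> L i"
  using assms(2,1)
proof (induction n rule: dec_induct)
  case (step n)
  then show ?case using lat_step_subset by (meson less_Suc_eq order.trans psubset_imp_subset)
qed simp

text \<open>Induction on the chain without its first member. If the last lattice lay in
  \<open>unif\<close> times \<open>L 0\<close>, it would lie in two different lattices one step
  below \<open>L 1\<close>, hence in \<open>unif\<close> times \<open>L 1\<close> by
  \<open>lat_step_meet\<close>, against the induction hypothesis.\<close>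

lemma lat_chain_reduced:
  assumes "\<And>i. i < n \<Longrightarrow> lat_step (L i) (L (Suc i))" "is_lattice (L 0)"
    and "\<And>i. Suc (Suc i) \<le> n \<Longrightarrow> L (Suc (Suc i)) \<noteq> (*s) unif ` L i"
  shows "\<not> L n \<subseteq> (*s) unif ` L 0"
  using assms
proof (induction n arbitrary: L)
  case 0
  then show ?case using lattice_not_in_unif by blast
next
  case (Suc n)
  show ?case
  proof (cases "n = 0")
    case True
    then show ?thesis using lat_step_subset[OF lat_step_unif[OF Suc.prems(1)[of 0]]] by auto
  next
    case False
    show ?thesis
    proof
      assume sub: "L (Suc n) \<subseteq> (*s) unif ` L 0"
      have "L (Suc n) \<subseteq> L 2" using False lat_chain_antimono[of "Suc n" L 2] Suc.prems(1) by simp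
      moreover have s1: "lat_step (L 1) (L 2)" "lat_step (L 1) ((*s) unif ` L 0)"
        using Suc.prems(1)[of 0] Suc.prems(1)[of 1] False lat_step_unif by (auto simp: numeral_2_eq_2)
      moreover have "L 2 \<noteq> (*s) unif ` L 0" using Suc.prems(3)[of 0] False by (simp add: numeral_2_eq_2)
      ultimately have "L (Suc n) \<subseteq> (*s) unif ` L 1"
        using lat_step_meet[OF s1] sub by (meson subset_iff)
      moreover have "\<not> L (Suc n) \<subseteq> (*s) unif ` L 1"
        using Suc.IH[of "\<lambda>i. L (Suc i)"] Suc.prems(1,3) s1(1) by (auto simp: lat_step_iff)
      ultimately show False by blast
    qed
  qed
qed

section \<open>Similarity classes and the absence of circuits\<close>

lemma similarity_class_refl: "L \<in> similarity_class L"
proof -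
  have "L = (*s) 1 ` L" by simp
  then show ?thesis unfolding similarity_class_def by (intro CollectI exI[of _ 1] conjI) simp_all
qed

lemma scale_image: "(*s) a ` (*s) b ` L = (*s) (a * b) ` (L :: ('a::field^2) set)"
  by (simp add: image_image vector_smult_assoc)

lemma similarity_class_eq: "L' \<in> similarity_class L \<Longrightarrow> similarity_class L' = similarity_class L"
proof -
  assume "L' \<in> similarity_class L"
  then obtain c where c: "c \<noteq> 0" "L' = (*s) c ` L" unfolding similarity_class_def by blast
  have "(*s) d ` L' = (*s) (d * c) ` L" for d using c by (simp add: scale_image)
  moreover have "(*s) d ` L = (*s) (d / c) ` L'" for d using c by (simp add: scale_image)
  ultimately have "(\<exists>d. N = (*s) d ` L' \<and> d \<noteq> 0) \<longleftrightarrow> (\<exists>d. N = (*s) d ` L \<and> d \<noteq> 0)" for N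
    using c(1) by (metis divide_eq_0_iff mult_eq_0_iff)
  then show ?thesis unfolding similarity_class_def by (simp only:)
qed

lemma similarity_class_scale: "c \<noteq> 0 \<Longrightarrow> similarity_class ((*s) c ` L) = similarity_class L"
  by (rule similarity_class_eq) (auto simp: similarity_class_def)

lemma edges_bt_iff: "e \<in> edges bt_tree \<longleftrightarrow>
    (\<exists>L L'. lat_step L L' \<and> e = {similarity_class L, similarity_class L'})"
  unfolding bt_tree_def lat_step_iff by auto

text \<open>Both orientations of an edge are possible: if the given step leads down to the class of
  \<open>L\<close>, \<open>lat_step_unif\<close> supplies the step that continues down from
  \<open>L\<close>.\<close>

lemma edge_lat_step:
  assumes "{\<Lambda>, \<Lambda>'} \<in> edges bt_tree" "L \<in> \<Lambda>"
  shows "\<exists>L'\<in>\<Lambda>'. lat_step L L'"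
proof -
  obtain M M' where M: "lat_step M M'" "{\<Lambda>, \<Lambda>'} = {similarity_class M, similarity_class M'}"
    using assms(1) unfolding edges_bt_iff by blast
  have *: "\<exists>L'\<in>similarity_class M'. lat_step L L'" if L: "L \<in> similarity_class M" and st: "lat_step M M'" for M M'
  proof -
    obtain c where c: "c \<noteq> 0" "L = (*s) c ` M" using L unfolding similarity_class_def by blast
    then have "lat_step L ((*s) c ` M')" using lat_step_scale[OF st] by simp
    then show ?thesis using c(1) by (intro bexI[of _ "(*s) c ` M'"]) (auto simp: similarity_class_def)
  qed
  consider "\<Lambda> = similarity_class M" "\<Lambda>' = similarity_class M'" | "\<Lambda> = similarity_class M'" "\<Lambda>' = similarity_class M"
    using M(2) by (auto simp: doubleton_eq_iff)
  then show ?thesis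
  proof cases
    case 1
    then show ?thesis using * M(1) assms(2) by blast
  next
    case 2
    then show ?thesis using *[OF _ lat_step_unif[OF M(1)]] assms(2) similarity_class_scale[of unif M] by simp
  qed
qed

text \<open>A walk without backtracking lifts to a descending chain of lattices. If the walk were
  closed, the last lattice would be \<open>c\<close> times the first and properly contained in it.
  Then \<open>absv c < 1\<close>, so the last lattice lies in \<open>unif\<close> times the first,
  which \<open>lat_chain_reduced\<close> forbids.\<close>

theorem bt_forest: "forest (edges (bt_tree :: 'a::padic_field btgraph))"
proof (rule forestI)
  fix n and p :: "nat \<Rightarrow> 'a vertex"
  assume n: "n \<ge> 1" and p: "\<And>i. i < n \<Longrightarrow> {p i, p (Suc i)} \<in> edges bt_tree"
    and red: "\<And>i. Suc (Suc i) \<le> n \<Longrightarrow> p i \<noteq> p (Suc (Suc i))"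
  obtain L0 where L0: "p 0 = similarity_class L0" "is_lattice L0"
    using p[of 0] n unfolding edges_bt_iff lat_step_iff by (auto simp: doubleton_eq_iff)
  define L where "L = rec_nat L0 (\<lambda>i M. SOME M'. M' \<in> p (Suc i) \<and> lat_step M M')"
  have L_0: "L 0 = L0" and L_Suc: "L (Suc i) = (SOME M'. M' \<in> p (Suc i) \<and> lat_step (L i) M')" for i
    by (simp_all add: L_def)
  have next_L: "L (Suc i) \<in> p (Suc i) \<and> lat_step (L i) (L (Suc i))" if "L i \<in> p i" "i < n" for i
    unfolding L_Suc by (rule someI_ex) (use edge_lat_step[OF p[OF that(2)] that(1)] in blast)
  have Lp: "L i \<in> p i" if "i \<le> n" for i
    using that next_L by (induction i) (auto simp: L_0 L0 similarity_class_refl)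
  have step: "lat_step (L i) (L (Suc i))" if "i < n" for i using next_L Lp that by simp
  have cls: "p i = similarity_class (L i)" if "i \<le> n" for i
  proof -
    have "\<exists>M. p i = similarity_class M"
    proof (cases "i < n")
      case True
      then show ?thesis using p[of i] unfolding edges_bt_iff by (auto simp: doubleton_eq_iff)
    next
      case False
      then show ?thesis using p[of "n - 1"] n that unfolding edges_bt_iff
        by (auto simp: doubleton_eq_iff dest!: le_neq_implies_less)
    qed
    then show ?thesis using Lp[OF that] similarity_class_eq by metis
  qed
  show "p n \<noteq> p 0"
  proof
    assume "p n = p 0"
    then obtain c where c: "c \<noteq> 0" "L n = (*s) c ` L 0"
      using Lp[of n] L0 L_0 unfolding similarity_class_def by auto
    have sub: "L n \<subset> L 0"
      using lat_chain_antimono[of n L 1] step n lat_step_subset[of "L 0" "L 1"] step[of 0] by auto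
    obtain u v where uv: "cr u v \<noteq> 0" "L 0 = lat u v" using L0 L_0 unfolding is_lattice_iff by blast
    have "c *s u \<in> L n" using c(2) uv(2) lat_basis(1) by blast
    then have "c *s u + 0 *s v \<in> lat u v" using sub uv(2) by auto
    then have c1: "absv c \<le> 1" unfolding lat_iff_coords[OF uv(1)] by simp
    have "absv c \<noteq> 1" using sub c uv lat_units[of c c u v] by (auto simp: lat_scale)
    then have "absv (c / unif) \<le> 1" using c1 absv_le_unif[of c] by (simp add: absv_divide divide_le_eq)
    then have "(*s) (c / unif) ` L 0 \<subseteq> L 0" using uv lat_submodule submodule_scale by blast
    then have "(*s) unif ` (*s) (c / unif) ` L 0 \<subseteq> (*s) unif ` L 0" by blast
    then have "L n \<subseteq> (*s) unif ` L 0" using c by (simp add: scale_image)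
    moreover have "\<not> L n \<subseteq> (*s) unif ` L 0"
    proof (rule lat_chain_reduced)
      show "lat_step (L i) (L (Suc i))" if "i < n" for i by (rule step[OF that])
      show "is_lattice (L 0)" using L0 L_0 by simp
      show "L (Suc (Suc i)) \<noteq> (*s) unif ` L i" if "Suc (Suc i) \<le> n" for i
        using red[OF that] cls[of i] cls[of "Suc (Suc i)"] that similarity_class_scale[of unif "L i"] by auto
    qed
    ultimately show False by blast
  qed
qed

section \<open>Lines of the tree\<close>

definition vtx :: "'a::padic_field^2 \<Rightarrow> 'a^2 \<Rightarrow> 'a vertex" where
  "vtx u v = similarity_class (lat u v)"

lemma vtx_commute: "vtx u v = vtx v u"
  by (simp add: vtx_def lat_commute)

lemma vtx_scale: "c \<noteq> 0 \<Longrightarrow> vtx (c *s u) (c *s v) = vtx u v"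
  unfolding vtx_def lat_scale[symmetric] by (rule similarity_class_scale)

text \<open>Scaling both vectors by \<open>unif ^ n\<close> moves the power to the other one: the
  same line, read from its other end.\<close>

lemma vtx_flip: "vtx u (unif powi (- int n) *s v) = vtx v (unif ^ n *s (u :: 'a::padic_field^2))"
proof -
  have "vtx (unif ^ n *s u) (unif ^ n *s (unif powi (- int n) *s v)) = vtx u (unif powi (- int n) *s v)"
    by (rule vtx_scale) simp
  moreover have "unif ^ n *s (unif powi (- int n) *s v) = v"
    by (simp add: vector_smult_assoc power_int_minus)
  ultimately show ?thesis by (simp add: vtx_commute)
qed

lemma lat_in_vtx: "lat u v \<in> vtx u v"
  by (simp add: vtx_def similarity_class_refl)

lemma verts_bt_iff: "\<Lambda> \<in> verts bt_tree \<longleftrightarrow> (\<exists>u v. cr u v \<noteq> 0 \<and> \<Lambda> = vtx u v)"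
  by (auto simp: bt_tree_def is_lattice_iff vtx_def)

lemma edges_bt_vtx: "e \<in> edges bt_tree \<longleftrightarrow> (\<exists>u v. cr u v \<noteq> 0 \<and> e = {vtx u v, vtx u (unif *s v)})"
  unfolding edges_bt_iff lat_step_def vtx_def by blast

lemma bt_graph: "is_graph bt_tree"
proof -
  have "vtx u v \<in> verts bt_tree" "vtx u (unif *s v) \<in> verts bt_tree" if "cr u v \<noteq> 0" for u v :: "'a^2"
    using that unfolding verts_bt_iff by (metis, metis cr_simps(6) mult_eq_0_iff unif_nonzero)
  note vt = this
  have "\<exists>x\<in>verts bt_tree. \<exists>y\<in>verts bt_tree. e = {x, y}" if e: "e \<in> edges bt_tree" for e :: "'a vertex set"
  proof -
    obtain u v where uv: "cr u v \<noteq> 0" "e = {vtx u v, vtx u (unif *s v)}" using e unfolding edges_bt_vtx by blast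
    show ?thesis using vt[OF uv(1)] uv(2) by (intro bexI[of _ "vtx u v"] bexI[of _ "vtx u (unif *s v)"])
  qed
  then show ?thesis unfolding is_graph_def by (simp add: bt_tree_def)
qed

lemma lat_step_unique:
  "lat_step L A \<Longrightarrow> lat_step L B \<Longrightarrow> z \<in> A \<Longrightarrow> z \<in> B \<Longrightarrow> z \<notin> (*s) unif ` L \<Longrightarrow> A = B"
  using lat_step_meet by blast

lemma lat_step_power: "cr u v \<noteq> 0 \<Longrightarrow> lat_step (lat u (unif ^ n *s v)) (lat u (unif ^ Suc n *s v))"
  unfolding lat_step_def by (intro exI[of _ u] exI[of _ "unif ^ n *s v"]) (simp add: vector_smult_assoc)

text \<open>The vector \<open>x\<close> lies in every member of the chain and is primitive there, so
  \<open>lat_step_unique\<close> leaves one possible continuation.\<close>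

lemma lat_chain_form:
  assumes L: "\<And>i. i < N \<Longrightarrow> lat_step (L i) (L (Suc i))"
    and x: "x \<in> L N" "x \<notin> (*s) unif ` L 0" and y: "cr x y \<noteq> 0" "L 0 = lat x y"
  shows "i \<le> N \<Longrightarrow> L i = lat x (unif ^ i *s y)"
proof (induction i)
  case 0
  then show ?case using y by simp
next
  case (Suc i)
  have st: "lat_step (L i) (L (Suc i))" using L Suc.prems by simp
  have "x \<in> L (Suc i)" using lat_chain_antimono[of N L "Suc i"] L Suc.prems x(1) by blast
  moreover have "L i \<subseteq> L 0" using lat_chain_antimono[of i L 0] L Suc.prems by simp
  then have "x \<notin> (*s) unif ` L i" using x(2) by blast
  moreover have "lat_step (L i) (lat x (unif ^ Suc i *s y))" using Suc lat_step_power[OF y(1)] by simp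
  ultimately show ?case using lat_step_unique[OF st] lat_basis(1) by blast
qed

section \<open>Points of the projective line\<close>

definition pt :: "'a::field^2 \<Rightarrow> 'a ppoint" where
  "pt u = range (\<lambda>c. c *s u)"

lemma pt_span: "pt u = vec.span {u}"
  by (auto simp: pt_def vec.span_singleton)

lemma P1_iff: "z \<in> P1 \<longleftrightarrow> (\<exists>u. u \<noteq> 0 \<and> z = pt u)"
proof
  assume z: "z \<in> P1"
  then have sz: "vec.subspace z" "vec.dim z = 1" by (auto simp: P1_def)
  obtain B where B: "B \<subseteq> z" "vec.independent B" "z \<subseteq> vec.span B" "card B = vec.dim z"
    using vec.basis_exists by blast
  then obtain u where u: "B = {u}" using sz(2) by (metis card_1_singletonE)
  have "vec.span B = z" using B sz(1) by (metis vec.span_minimal subset_antisym)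
  moreover have "u \<noteq> 0" using B(2) u by (simp add: vec.dependent_single)
  ultimately show "\<exists>u. u \<noteq> 0 \<and> z = pt u" using u pt_span by blast
next
  assume "\<exists>u. u \<noteq> 0 \<and> z = pt u"
  then obtain u where u: "u \<noteq> 0" "z = pt u" by blast
  have "vec.dim (vec.span {u}) = 1" using u(1) by (simp add: vec.dim_span vec.dim_singleton)
  then show "z \<in> P1" using u by (simp add: P1_def pt_span vec.subspace_span)
qed

lemma pt_mem: "u \<in> pt u"
  unfolding pt_def by (rule range_eqI[of _ _ 1]) simp

lemma pt_iff: "x \<in> pt u \<longleftrightarrow> (\<exists>c. x = c *s u)"
  by (auto simp: pt_def)

lemma pt_scale: "c \<noteq> 0 \<Longrightarrow> pt (c *s u) = pt u"
proof -
  assume c: "c \<noteq> 0"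
  show ?thesis
  proof (intro Set.equalityI subsetI)
    fix x assume "x \<in> pt u"
    then obtain d where "x = d *s u" by (auto simp: pt_iff)
    then have "x = (d / c) *s (c *s u)" using c by (simp add: vector_smult_assoc)
    then show "x \<in> pt (c *s u)" unfolding pt_iff by blast
  qed (auto simp: pt_iff vector_smult_assoc)
qed

lemma P1_pt: "z \<in> P1 \<Longrightarrow> u \<in> z \<Longrightarrow> u \<noteq> 0 \<Longrightarrow> z = pt u"
  unfolding P1_iff pt_iff by (metis pt_iff pt_scale vector_smult_lzero)

lemma P1_scale: "z \<in> P1 \<Longrightarrow> u \<in> z \<Longrightarrow> c *s u \<in> z"
  by (auto simp: P1_def vec.subspace_def)

lemma P1_cr: "z \<in> P1 \<Longrightarrow> u \<in> z \<Longrightarrow> v \<in> z \<Longrightarrow> cr u v = 0"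
  by (auto simp: P1_iff pt_iff)

lemma lat_normalize:
  assumes "cr s t \<noteq> 0" "w \<noteq> (0 :: 'a::padic_field^2)"
  obtains c where "c \<noteq> 0" "c *s w \<in> lat s t" "c *s w \<notin> (*s) unif ` lat s t"
proof -
  define a b where "a = cr w t / cr s t" and "b = cr s w / cr s t"
  have w: "w = a *s s + b *s t" unfolding a_def b_def by (rule cr_coords[OF assms(1)])
  define m where "m = (if absv a \<le> absv b then b else a)"
  have m: "absv a \<le> absv m" "absv b \<le> absv m" "m = a \<or> m = b" by (auto simp: m_def)
  have m0: "m \<noteq> 0"
  proof
    assume "m = 0"
    then have "a = 0" "b = 0" using m(1,2) absv_nonneg[of a] absv_nonneg[of b] by (auto simp flip: absv_eq_0)
    then show False using w assms(2) by simp
  qed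
  have eq: "inverse m *s w = (a / m) *s s + (b / m) *s t" by (simp add: w vec_eq_iff field_simps)
  have "absv (a / m) \<le> 1" "absv (b / m) \<le> 1" using m m0 by (simp_all add: absv_divide divide_le_eq)
  moreover have "\<not> (absv (a / m) < 1 \<and> absv (b / m) < 1)" using m(3) m0 by auto
  ultimately show ?thesis
    using that[of "inverse m"] m0 unfolding eq lat_iff_coords[OF assms(1)] unif_lat_iff[OF assms(1)] by auto
qed

section \<open>Half-lines and straight lines in coordinates\<close>

lemma edge_vertex_class:
  assumes "{\<Lambda>, \<Lambda>'} \<in> edges bt_tree" "L \<in> \<Lambda>"
  shows "is_lattice L \<and> \<Lambda> = similarity_class L"
proof -
  have "\<Lambda> \<in> verts bt_tree" using assms(1) bt_graph by (auto simp: is_graph_def bt_tree_def doubleton_eq_iff)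
  then obtain M where M: "is_lattice M" "\<Lambda> = similarity_class M" by (auto simp: bt_tree_def)
  then obtain c where "c \<noteq> 0" "L = (*s) c ` M" using assms(2) by (auto simp: similarity_class_def)
  then have "is_lattice L" using M(1) unfolding is_lattice_iff
    by (metis cr_simps(5,6) lat_scale mult_eq_0_iff)
  then show ?thesis using M(2) assms(2) similarity_class_eq by blast
qed

text \<open>A half-line is determined by its first lattice and a vector that is primitive there and
  lies in all lattices of the chain. What is given is only some nonzero vector \<open>w\<close> in
  the intersection; the point is that its primitive multiple \<open>u\<close> still lies in every
  lattice.\<close>

lemma halfline_to_form:
  assumes r: "halfline_to r z" and z: "z \<in> P1" and L0: "L0 \<in> r 0"
  shows "\<exists>u y. u \<in> z \<and> cr u y \<noteq> 0 \<and> L0 = lat u y \<and> (\<forall>n. r n = vtx u (unif ^ n *s y))"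
proof -
  have inj: "inj r" and e: "\<And>n. {r n, r (Suc n)} \<in> edges bt_tree" using r by (auto simp: halfline_to_def halfline_def)
  obtain L' where L': "\<And>n. L' n \<in> r n" "\<And>n. quotient_length_one (L' n) (L' (Suc n))" "vec.span (\<Inter>n. L' n) = z"
    using r by (auto simp: halfline_to_def)
  have cls': "is_lattice (L' n)" "r n = similarity_class (L' n)" for n
    using edge_vertex_class[OF e L'(1)] by auto
  \<comment> \<open>Rescale the given chain so that it starts with the prescribed
    \<open>L0\<close>.\<close>
  obtain d where d: "d \<noteq> 0" "L0 = (*s) d ` L' 0" using L0 unfolding cls'(2)[of 0] similarity_class_def by blast
  define L where "L n = (*s) d ` L' n" for n
  have L_0: "L 0 = L0" by (simp add: L_def d)
  have step: "lat_step (L n) (L (Suc n))" for n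
    unfolding L_def by (rule lat_step_scale[OF _ d(1)]) (simp add: lat_step_iff L' cls')
  have cls: "r n = similarity_class (L n)" for n unfolding L_def cls' by (rule similarity_class_scale[OF d(1), symmetric])
  have "\<exists>w\<in>(\<Inter>n. L' n). w \<noteq> 0"
  proof (rule ccontr)
    assume "\<not> ?thesis"
    then have "(\<Inter>n. L' n) \<subseteq> {0}" by blast
    then have "z \<subseteq> {0}" using L'(3) by (metis vec.span_mono vec.span_empty vec.span_insert_0)
    then show False using z pt_mem unfolding P1_iff by blast
  qed
  then obtain w' where w': "\<And>n. w' \<in> L' n" "w' \<noteq> 0" by blast
  have w'z: "w' \<in> z" using L'(3) w'(1) vec.span_base by blast
  define w where "w = d *s w'"
  have w: "w \<in> L n" "w \<in> z" "w \<noteq> 0" for n using w' d(1) w'z P1_scale[OF z] by (auto simp: w_def L_def)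
  obtain s t where st: "cr s t \<noteq> 0" "L 0 = lat s t" using step[of 0] unfolding lat_step_iff is_lattice_iff by blast
  obtain c where c: "c \<noteq> 0" "c *s w \<in> L 0" "c *s w \<notin> (*s) unif ` L 0" using lat_normalize[OF st(1) w(3)] st(2) by metis
  define u where "u = c *s w"
  have uz: "u \<in> z" using P1_scale[OF z w(2)] by (simp add: u_def)
  have u_L: "u \<in> L n" for n
  proof -
    \<comment> \<open>The vector \<open>u\<close> is \<open>c\<close> times \<open>w\<close>, and
      \<open>c\<close> may have a denominator. Describing the chain by a primitive vector
      \<open>x\<close> of the lattice number \<open>n + k\<close>, that is, \<open>k\<close> steps
      beyond \<open>n\<close>, compensates for it.\<close>
    obtain k where k: "absv (unif :: 'a) ^ k < absv (inverse c)" using unif_power_small[where 'a = 'a, of "absv (inverse c)"] c(1) by auto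
    define N where "N = n + k"
    have "\<not> L N \<subseteq> (*s) unif ` L 0"
    proof (rule lat_chain_reduced)
      show "is_lattice (L 0)" using step[of 0] by (simp add: lat_step_iff)
      show "L (Suc (Suc i)) \<noteq> (*s) unif ` L i" for i
        using injD[OF inj, of "Suc (Suc i)" i] similarity_class_scale[of unif "L i"] cls by auto
    qed (rule step)
    then obtain x where x: "x \<in> L N" "x \<notin> (*s) unif ` L 0" by blast
    have x0: "x \<in> L 0" using x(1) lat_chain_antimono[of N L 0] step by blast
    obtain y where y: "cr x y \<noteq> 0" "lat x y = L 0" using lat_extend_basis[OF st(1), of x] x0 x(2) st(2) by metis
    have form: "L i = lat x (unif ^ i *s y)" if "i \<le> N" for i
      by (rule lat_chain_form[OF step x y(1) y(2)[symmetric] that])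
    obtain a b where ab: "w = a *s x + b *s (unif ^ N *s y)" "absv a \<le> 1" "absv b \<le> 1"
      using w(1)[of N] unfolding form[OF order_refl] lat_def by blast
    have "u = (c * a) *s x + (c * b * unif ^ N) *s y" unfolding u_def ab(1) by (simp add: vec_eq_iff algebra_simps)
    moreover have "u \<in> lat x y" using c(2) y(2) by (simp add: u_def)
    ultimately have ca: "absv (c * a) \<le> 1" using lat_iff_coords[OF y(1)] by blast
    have "u = (c * a) *s x + (c * b * unif ^ k) *s (unif ^ n *s y)"
      unfolding u_def ab(1) N_def by (simp add: vec_eq_iff algebra_simps power_add)
    moreover have "absv (c * b * unif ^ k) \<le> 1"
    proof -
      have "absv (c * b * unif ^ k) = absv b * (absv c * absv (unif :: 'a) ^ k)" by (simp add: absv_mult absv_power)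
      also have "\<dots> \<le> 1 * (absv c * absv (inverse c))" using k ab(3) by (intro mult_mono mult_left_mono) auto
      also have "\<dots> = 1" using c(1) by (simp add: absv_inverse)
      finally show ?thesis .
    qed
    ultimately have "u \<in> lat x (unif ^ n *s y)" using latI[OF ca, of "c * b * unif ^ k" x "unif ^ n *s y"] by simp
    then show ?thesis using form[of n] by (simp add: N_def)
  qed
  obtain y where y: "cr u y \<noteq> 0" "lat u y = L 0" using lat_extend_basis[OF st(1), of u] u_L[of 0] c(3) st(2) u_def by metis
  have "L n = lat u (unif ^ n *s y)" for n
    by (rule lat_chain_form[OF step u_L _ y(1) y(2)[symmetric] order_refl]) (use c(3) in \<open>simp add: u_def\<close>)
  then show ?thesis using uz y L_0 cls by (intro exI[of _ u] exI[of _ y]) (auto simp: vtx_def)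
qed

lemma lat_power_cong:
  assumes "lat u y = lat u y'" "absv c \<le> 1"
  shows "lat u (c *s y) = lat u (c *s y')"
proof -
  have *: "c *s y' \<in> lat u (c *s y)" if "lat u y = lat u y'" for y y'
  proof -
    have "y' \<in> lat u y" using that lat_basis by blast
    then obtain a b where ab: "y' = a *s u + b *s y" "absv a \<le> 1" "absv b \<le> 1" unfolding lat_def by blast
    have "c *s y' = (c * a) *s u + b *s (c *s y)" by (simp add: ab vec_eq_iff algebra_simps)
    then show ?thesis using latI[OF absv_mult_le[OF assms(2) ab(2)] ab(3), of u "c *s y"] by (simp only:)
  qed
  show ?thesis using *[OF assms(1)] *[OF assms(1)[symmetric]] by (intro lat_eqI lat_basis)
qed

lemma absv_unif_power: "absv ((unif :: 'a::padic_field) ^ n) \<le> 1"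
  using absv_unif[where 'a = 'a] by (simp add: absv_power power_le_one)

text \<open>Both halves can be written from one lattice \<open>L0\<close>. Since the line does not
  turn back at its origin, their first steps differ, and this forces the vectors of the two ends to
  form a basis of \<open>L0\<close>.\<close>

lemma straight_line_form:
  assumes f: "straight_line f z w" and z: "z \<in> P1" and w: "w \<in> P1"
  shows "\<exists>u\<in>w. \<exists>v\<in>z. cr u v \<noteq> 0 \<and> (\<forall>n. f n = vtx u (unif powi n *s v))"
proof -
  have inj: "inj f" and hz: "halfline_to (\<lambda>n. f (- int n)) z" and hw: "halfline_to (\<lambda>n. f (int n)) w"
    using f by (auto simp: straight_line_def)
  obtain L0 where L0: "L0 \<in> f 0" using hz unfolding halfline_to_def by (metis of_nat_0 minus_zero)
  obtain u y where u: "u \<in> w" "cr u y \<noteq> 0" "L0 = lat u y" "\<And>n. f (int n) = vtx u (unif ^ n *s y)"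
    using halfline_to_form[OF hw w, of L0] L0 by auto
  obtain v x where v: "v \<in> z" "cr v x \<noteq> 0" "L0 = lat v x" "\<And>n. f (- int n) = vtx v (unif ^ n *s x)"
    using halfline_to_form[OF hz z, of L0] L0 by auto
  have "v \<in> lat u y" using u v lat_basis by blast
  then obtain a b where ab: "v = a *s u + b *s y" "absv a \<le> 1" "absv b \<le> 1" unfolding lat_def by blast
  have v_nu: "v \<notin> (*s) unif ` L0"
    using unif_lat_iff[OF v(2), of 1 0] v(3) by simp
  \<comment> \<open>If \<open>b\<close> were not a unit, the first step towards \<open>w\<close>
    would contain \<open>v\<close> and hence agree with the first step towards \<open>z\<close>,
    against the injectivity of \<open>f\<close>.\<close>
  have b1: "absv b = 1"
  proof (rule ccontr)
    assume "absv b \<noteq> 1"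
    then have "absv (b / unif) \<le> 1" using ab(3) absv_le_unif[of b] by (simp add: absv_divide divide_le_eq)
    moreover have "v = a *s u + (b / unif) *s (unif *s y)" by (simp add: ab(1) vector_smult_assoc)
    ultimately have "v \<in> lat u (unif *s y)" using latI[OF ab(2), of "b / unif" u "unif *s y"] by simp
    moreover have "lat_step L0 (lat u (unif *s y))" "lat_step L0 (lat v (unif *s x))"
      using lat_step_power[OF u(2), of 0] lat_step_power[OF v(2), of 0] u(3) v(3) by auto
    ultimately have "lat u (unif *s y) = lat v (unif *s x)" using lat_step_unique[OF _ _ _ _ v_nu] lat_basis by blast
    then have "f 1 = f (- 1)" using u(4)[of 1] v(4)[of 1] by (simp add: vtx_def)
    then show False using inj by (auto dest: injD)
  qed
  then have b0: "b \<noteq> 0" by auto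
  have "y = (- a / b) *s u + inverse b *s v" using b0 by (simp add: ab(1) vec_eq_iff field_simps)
  then have "y \<in> lat u v" using latI[of "- a / b" "inverse b" u v] ab b1 by (simp add: absv_divide absv_inverse)
  then have L_uv: "lat u y = lat u v" using ab by (intro lat_eqI[symmetric]) (auto intro: latI)
  have cruv: "cr u v \<noteq> 0" using u(2) b0 by (simp add: ab(1))
  have pos: "f (int n) = vtx u (unif powi (int n) *s v)" for n
    using u(4)[of n] lat_power_cong[OF L_uv absv_unif_power[of n]] by (simp add: vtx_def)
  have L_vu: "lat v x = lat v u" using u(3) v(3) L_uv lat_commute by metis
  have "f (- int n) = vtx v (unif ^ n *s u)" for n
    using v(4)[of n] lat_power_cong[OF L_vu absv_unif_power[of n]] by (simp add: vtx_def)
  then have neg: "f (- int n) = vtx u (unif powi (- int n) *s v)" for n unfolding vtx_flip .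
  have "f n = vtx u (unif powi n *s v)" for n using pos neg by (cases n rule: int_cases2) auto
  then show ?thesis using u(1) v(1) cruv by blast
qed

text \<open>The homothety between the two lattices is by a unit, because \<open>u\<close> is a basis
  vector of both.\<close>

lemma vtx_eq_absv:
  assumes "cr u v \<noteq> 0" "b \<noteq> 0" "d \<noteq> 0" "vtx u (b *s v) = vtx u (d *s v)"
  shows "absv b = absv d"
proof -
  have "lat u (b *s v) \<in> similarity_class (lat u (d *s v))" using assms(4) lat_in_vtx unfolding vtx_def by blast
  then obtain c where c: "c \<noteq> 0" "lat u (b *s v) = lat (c *s u) (c *s (d *s v))"
    unfolding similarity_class_def lat_scale by blast
  have nz: "cr u (b *s v) \<noteq> 0" "cr (c *s u) (c *s (d *s v)) \<noteq> 0" using assms c by auto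
  have "c *s u \<in> lat u (b *s v)" "c *s (d *s v) \<in> lat u (b *s v)" using c(2) lat_basis by blast+
  then have 1: "absv c \<le> 1" "absv (c * d) \<le> absv b"
    unfolding lat_iff[OF nz(1)] using assms by (auto simp: absv_mult mult_le_cancel_right1 mult_le_cancel_right)
  have "u \<in> lat (c *s u) (c *s (d *s v))" "b *s v \<in> lat (c *s u) (c *s (d *s v))" using c(2) lat_basis by blast+
  then have 2: "1 \<le> absv c" "absv b \<le> absv (c * d)"
    unfolding lat_iff[OF nz(2)] using assms c(1) by (auto simp: absv_mult mult.commute)
  show ?thesis using 1 2 by (simp add: absv_mult mult.commute)
qed

lemma unif_powi_inj: "absv (unif powi m :: 'a::padic_field) = absv (unif powi n :: 'a) \<Longrightarrow> m = n"
proof -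
  have *: "absv (unif powi n :: 'a) < absv (unif powi m :: 'a)" if "m < n" for m n :: int
    unfolding absv_power_int using that absv_unif[where 'a = 'a] by (intro power_int_strict_decreasing) auto
  assume "absv (unif powi m :: 'a) = absv (unif powi n :: 'a)"
  then show "m = n" using *[of m n] *[of n m] by (metis linorder_neqE order.irrefl)
qed

lemma line_vtx_inj: "cr u v \<noteq> 0 \<Longrightarrow> inj (\<lambda>n. vtx u (unif powi n *s v))"
  by (intro injI unif_powi_inj) (rule vtx_eq_absv, auto)

lemma unif_powi_add_1: "unif powi (n + 1) *s v = unif *s (unif powi n *s (v :: 'a::padic_field^2))"
  by (simp add: vector_smult_assoc power_int_add_1')

text \<open>A vector in all these lattices has a determinant with \<open>u\<close> smaller than
  every power of \<open>unif\<close> allows, so it is a multiple of \<open>u\<close>.\<close>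

lemma halfline_to_vtx:
  assumes "w \<in> P1" "u \<in> w" "cr u v \<noteq> 0"
  shows "halfline_to (\<lambda>n. vtx u (unif ^ n *s v)) w"
  unfolding halfline_to_def halfline_def
proof (intro conjI allI exI)
  show "inj (\<lambda>n. vtx u (unif ^ n *s v))"
  proof (rule injI)
    fix m n assume "vtx u (unif ^ m *s v) = vtx u (unif ^ n *s v)"
    then have "int m = int n" using injD[OF line_vtx_inj[OF assms(3)], of "int m" "int n"] by simp
    then show "m = n" by simp
  qed
  show "{vtx u (unif ^ n *s v), vtx u (unif ^ Suc n *s v)} \<in> edges bt_tree" for n
    using lat_step_power[OF assms(3), of n] unfolding edges_bt_iff vtx_def by blast
  show "lat u (unif ^ n *s v) \<in> vtx u (unif ^ n *s v)" for n by (rule lat_in_vtx)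
  show "quotient_length_one (lat u (unif ^ n *s v)) (lat u (unif ^ Suc n *s v))" for n
    using lat_step_power[OF assms(3), of n] by (simp add: lat_step_iff)
  have u0: "u \<noteq> 0" using assms(3) by auto
  have w: "w = pt u" using P1_pt[OF assms(1,2) u0] .
  have "(\<Inter>n. lat u (unif ^ n *s v)) \<subseteq> w"
  proof
    fix x assume x: "x \<in> (\<Inter>n. lat u (unif ^ n *s v))"
    have "absv (cr u x) \<le> absv (unif :: 'a) ^ n * absv (cr u v)" for n
    proof -
      have nz: "cr u (unif ^ n *s v) \<noteq> 0" using assms(3) by simp
      have "x \<in> lat u (unif ^ n *s v)" using x by blast
      then show ?thesis unfolding lat_iff[OF nz] by (simp add: absv_mult absv_power)
    qed
    note bound = this
    have "cr u x = 0"
    proof (rule ccontr)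
      assume "cr u x \<noteq> 0"
      then obtain n where "absv (unif :: 'a) ^ n < absv (cr u x) / absv (cr u v)"
        using unif_power_small[where 'a = 'a, of "absv (cr u x) / absv (cr u v)"] assms(3) by auto
      then show False using bound[of n] assms(3) by (simp add: less_divide_eq)
    qed
    then show "x \<in> w" using cr_eq_0_iff[OF u0] by (auto simp: w pt_iff)
  qed
  moreover have "u \<in> (\<Inter>n. lat u (unif ^ n *s v))" by simp
  moreover have "vec.subspace w" using assms(1) by (simp add: P1_def)
  ultimately show "vec.span (\<Inter>n. lat u (unif ^ n *s v)) = w"
    by (metis (no_types, lifting) pt_span w vec.span_minimal vec.span_mono empty_subsetI insert_subset subset_antisym)
qed

lemma straight_line_vtx:
  assumes "z \<in> P1" "w \<in> P1" "u \<in> w" "v \<in> z" "cr u v \<noteq> 0"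
  shows "straight_line (\<lambda>n. vtx u (unif powi n *s v)) z w"
  unfolding straight_line_def
proof (intro conjI)
  show "inj (\<lambda>n. vtx u (unif powi n *s v))" by (rule line_vtx_inj[OF assms(5)])
  show "halfline_to (\<lambda>n. vtx u (unif powi int n *s v)) w" using halfline_to_vtx[OF assms(2,3,5)] by simp
  have "cr v u \<noteq> 0" using assms(5) by (simp add: cr_swap[of u v])
  then show "halfline_to (\<lambda>n. vtx u (unif powi (- int n) *s v)) z"
    unfolding vtx_flip by (rule halfline_to_vtx[OF assms(1,4)])
qed

text \<open>Meant for sets closed under scaling: letting \<open>u\<close> and \<open>v\<close> run
  through all their multiples gives every vertex of the line joining the two directions.\<close>

definition ends_verts :: "('a::padic_field^2) set \<Rightarrow> 'a vertex set" where
  "ends_verts U = {vtx u v | u v. u \<in> U \<and> v \<in> U \<and> cr u v \<noteq> 0}"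

definition ends_edges :: "('a::padic_field^2) set \<Rightarrow> 'a vertex set set" where
  "ends_edges U = {{vtx u v, vtx u (unif *s v)} | u v. u \<in> U \<and> v \<in> U \<and> cr u v \<noteq> 0}"

text \<open>By \<open>straight_line_form\<close> a vertex of a line is given by \<open>u\<close> and
  a power of \<open>unif\<close> times \<open>v\<close>; the power is absorbed into
  \<open>v\<close>, because points of \<open>P1\<close> are closed under scaling. So the integer
  parameter of lines disappears.\<close>

lemma tree_of_ends_eq:
  assumes "\<L> \<subseteq> P1"
  shows "tree_of_ends \<L> = \<lparr>verts = ends_verts (\<Union>\<L>), edges = ends_edges (\<Union>\<L>), endpoints = id\<rparr>"
proof -
  have scale: "c *s v \<in> \<Union>\<L>" if "v \<in> \<Union>\<L>" for c v using that assms P1_scale by blast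
  have form: "\<exists>u\<in>\<Union>\<L>. \<exists>v\<in>\<Union>\<L>. cr u v \<noteq> 0 \<and> f n = vtx u v \<and> f (n + 1) = vtx u (unif *s v)"
    if zw: "z \<in> \<L>" "w \<in> \<L>" and f: "straight_line f z w" for f n z w
  proof -
    obtain u v where uv: "u \<in> w" "v \<in> z" "cr u v \<noteq> 0" "\<And>n. f n = vtx u (unif powi n *s v)"
      using straight_line_form[OF f] zw assms by blast
    have "cr u (unif powi n *s v) \<noteq> 0" "f (n + 1) = vtx u (unif *s (unif powi n *s v))"
      using uv by (simp, simp only: unif_powi_add_1)
    then show ?thesis using uv zw scale[of v "unif powi n"]
      by (intro bexI[of _ u] bexI[of _ "unif powi n *s v"]) auto
  qed
  have conv: "\<exists>f z w. z \<in> \<L> \<and> w \<in> \<L> \<and> z \<noteq> w \<and> straight_line f z w \<and> f 0 = vtx u v \<and> f 1 = vtx u (unif *s v)"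
    if uv: "u \<in> \<Union>\<L>" "v \<in> \<Union>\<L>" "cr u v \<noteq> 0" for u v
  proof -
    obtain z w where zw: "z \<in> \<L>" "w \<in> \<L>" "u \<in> w" "v \<in> z" using uv by blast
    have "z \<noteq> w" using P1_cr[of w u v] zw uv(3) assms by blast
    then show ?thesis using straight_line_vtx[of z w u v] zw uv(3) assms
      by (intro exI[of _ "\<lambda>n. vtx u (unif powi n *s v)"] exI[of _ z] exI[of _ w]) auto
  qed
  have "verts (tree_of_ends \<L>) = ends_verts (\<Union>\<L>)"
  proof (intro Set.equalityI subsetI)
    fix x assume "x \<in> verts (tree_of_ends \<L>)"
    then obtain f n z w where "x = f n" "z \<in> \<L>" "w \<in> \<L>" "straight_line f z w" by (auto simp: tree_of_ends_def)
    then show "x \<in> ends_verts (\<Union>\<L>)" using form[of z w f n] unfolding ends_verts_def by blast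
  next
    fix x assume "x \<in> ends_verts (\<Union>\<L>)"
    then obtain u v where "x = vtx u v" "u \<in> \<Union>\<L>" "v \<in> \<Union>\<L>" "cr u v \<noteq> 0" unfolding ends_verts_def by blast
    then obtain f z w where f: "z \<in> \<L>" "w \<in> \<L>" "z \<noteq> w" "straight_line f z w" "x = f 0"
      using conv[of u v] by auto
    then show "x \<in> verts (tree_of_ends \<L>)" unfolding tree_of_ends_def by (simp only: ugraph.simps mem_Collect_eq) blast
  qed
  moreover have "edges (tree_of_ends \<L>) = ends_edges (\<Union>\<L>)"
  proof (intro Set.equalityI subsetI)
    fix x assume "x \<in> edges (tree_of_ends \<L>)"
    then obtain f n z w where "x = {f n, f (n + 1)}" "z \<in> \<L>" "w \<in> \<L>" "straight_line f z w" by (auto simp: tree_of_ends_def)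
    then show "x \<in> ends_edges (\<Union>\<L>)" using form[of z w f n] unfolding ends_edges_def by blast
  next
    fix x assume "x \<in> ends_edges (\<Union>\<L>)"
    then obtain u v where x: "x = {vtx u v, vtx u (unif *s v)}" "u \<in> \<Union>\<L>" "v \<in> \<Union>\<L>" "cr u v \<noteq> 0" unfolding ends_edges_def by blast
    from conv[OF x(2-4)] obtain f z w where f: "z \<in> \<L> \<and> w \<in> \<L> \<and> z \<noteq> w \<and> straight_line f z w \<and>
        f 0 = vtx u v \<and> f 1 = vtx u (unif *s v)"
      by (elim exE)
    then have "x = {f 0, f (0 + 1)}" using x(1) by simp
    with f show "x \<in> edges (tree_of_ends \<L>)" unfolding tree_of_ends_def by (simp only: ugraph.simps mem_Collect_eq) blast
  qed
  ultimately show ?thesis by (simp add: tree_of_ends_def)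
qed

section \<open>The action of PGL(2,K)\<close>

lemma mat_mult_left: "(mat c :: 'a::field^2^2) ** (A :: 'a^2^2) = (\<chi> i j. c * A $ i $ j)"
  by (simp add: vec_eq_iff forall_2 matrix_matrix_mult_def mat_def sum_2)

lemma mat_mult_right: "(A :: 'a^2^2) ** (mat c :: 'a::field^2^2) = (\<chi> i j. c * A $ i $ j)"
  by (simp add: vec_eq_iff forall_2 matrix_matrix_mult_def mat_def sum_2 mult.commute)

lemma mat_commute: "(mat c :: 'a::field^2^2) ** (A :: 'a^2^2) = A ** mat c"
  by (simp add: mat_mult_left mat_mult_right)

lemma mat_mult_mat: "(mat c :: 'a::field^2^2) ** mat d = mat (c * d)"
  unfolding mat_mult_left by (simp add: vec_eq_iff forall_2 mat_def)

lemma mat_mult_vec: "(mat c :: 'a::field^2^2) *v x = c *s x"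
  by (simp add: vec_eq_iff forall_2 matrix_vector_mult_def mat_def sum_2)

lemma invertible_mat: "c \<noteq> 0 \<Longrightarrow> invertible (mat c :: 'a::field^2^2)"
  unfolding invertible_def by (intro exI[of _ "mat (inverse c)"]) (simp add: mat_mult_mat)

lemma group_GL2: "group (GL2 :: ('a::field^2^2) monoid)"
proof (rule groupI)
  fix A :: "'a^2^2" assume "A \<in> carrier GL2"
  then obtain B where "A ** B = mat 1" "B ** A = mat 1" by (auto simp: GL2_def invertible_def)
  then show "\<exists>B\<in>carrier GL2. B \<otimes>\<^bsub>GL2\<^esub> A = \<one>\<^bsub>GL2\<^esub>"
    by (intro bexI[of _ B]) (auto simp: GL2_def invertible_def)
qed (auto simp: GL2_def invertible_mult invertible_mat matrix_mul_assoc)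

lemma normal_scalar: "scalar_matrices \<lhd> (GL2 :: ('a::field^2^2) monoid)"
proof -
  interpret GL2: group "GL2 :: ('a^2^2) monoid" by (rule group_GL2)
  have inv_mat: "inv\<^bsub>GL2\<^esub> (mat c) = (mat (inverse c) :: 'a^2^2)" if "c \<noteq> 0" for c :: 'a
    by (rule GL2.inv_equality) (use that in \<open>auto simp: GL2_def mat_mult_mat invertible_mat\<close>)
  have sub: "subgroup scalar_matrices (GL2 :: ('a^2^2) monoid)"
  proof (rule GL2.subgroupI)
    show "scalar_matrices \<subseteq> carrier (GL2 :: ('a^2^2) monoid)" "(scalar_matrices :: ('a^2^2) set) \<noteq> {}"
      by (auto simp: scalar_matrices_def GL2_def invertible_mat intro: exI[of _ 1])
    show "inv\<^bsub>GL2\<^esub> A \<in> scalar_matrices" if A: "A \<in> scalar_matrices" for A :: "'a^2^2"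
    proof -
      obtain c where "A = mat c" "c \<noteq> 0" using A by (auto simp: scalar_matrices_def)
      then show ?thesis using inv_mat unfolding scalar_matrices_def
        by (intro CollectI exI[of _ "inverse c"]) simp
    qed
    show "A \<otimes>\<^bsub>GL2\<^esub> B \<in> scalar_matrices" if "A \<in> scalar_matrices" "B \<in> scalar_matrices" for A B :: "'a^2^2"
      using that unfolding scalar_matrices_def by (auto simp: GL2_def mat_mult_mat)
  qed
  moreover have "A \<otimes>\<^bsub>GL2\<^esub> h \<otimes>\<^bsub>GL2\<^esub> inv\<^bsub>GL2\<^esub> A \<in> scalar_matrices"
    if A: "A \<in> carrier GL2" and h: "h \<in> scalar_matrices" for A h :: "'a^2^2"
  proof -
    obtain c where c: "h = mat c" "c \<noteq> 0" using h by (auto simp: scalar_matrices_def)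
    have "A \<otimes>\<^bsub>GL2\<^esub> h = h \<otimes>\<^bsub>GL2\<^esub> A" by (simp add: GL2_def c mat_commute)
    moreover have "h \<in> carrier GL2" using c by (simp add: GL2_def invertible_mat)
    ultimately have "A \<otimes>\<^bsub>GL2\<^esub> h \<otimes>\<^bsub>GL2\<^esub> inv\<^bsub>GL2\<^esub> A = h" using A by (simp add: GL2.m_assoc)
    then show ?thesis using h by simp
  qed
  ultimately show ?thesis using GL2.normal_inv_iff by blast
qed

lemma group_PGL2: "group (PGL2 :: ('a::field^2^2) set monoid)"
  unfolding PGL2_def by (rule normal.factorgroup_is_group[OF normal_scalar])

interpretation PGL2: group "PGL2 :: ('a::field^2^2) set monoid"
  by (rule group_PGL2)

definition cls :: "'a::field^2^2 \<Rightarrow> ('a^2^2) set" where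
  "cls A = {mat c ** A | c. c \<noteq> 0}"

lemma cls_rcoset: "cls A = scalar_matrices #>\<^bsub>GL2\<^esub> A"
  by (auto simp: cls_def r_coset_def scalar_matrices_def GL2_def)

lemma carrier_PGL2: "carrier PGL2 = cls ` {A. invertible A}"
  unfolding PGL2_def carrier_FactGroup cls_rcoset[abs_def] by (simp add: GL2_def)

lemma cls_mult: "invertible A \<Longrightarrow> invertible B \<Longrightarrow> cls A \<otimes>\<^bsub>PGL2\<^esub> cls B = cls (A ** B)"
  using normal.rcos_sum[OF normal_scalar, of A B]
  by (simp add: PGL2_def cls_rcoset FactGroup_def) (simp add: GL2_def)

lemma cls_one: "cls (mat 1) = \<one>\<^bsub>PGL2\<^esub>"
  by (auto simp: PGL2_def cls_def scalar_matrices_def mat_mult_mat)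

lemma mult_PGL2: "g \<otimes>\<^bsub>PGL2\<^esub> h = {A ** B | A B. A \<in> g \<and> B \<in> h}"
  by (auto simp: PGL2_def FactGroup_def set_mult_def GL2_def)

lemma PGL2_cases:
  assumes "g \<in> carrier PGL2"
  obtains A where "invertible A" "g = cls A"
  using assms by (auto simp: carrier_PGL2)

lemma cls_self: "A \<in> cls A"
  unfolding cls_def by (intro CollectI exI[of _ 1]) simp

lemma cls_scale: "c \<noteq> 0 \<Longrightarrow> cls (mat c ** A) = cls A"
proof -
  assume c: "c \<noteq> 0"
  have 1: "mat d ** A = mat (d / c) ** (mat c ** A)" for d
    using c by (simp add: matrix_mul_assoc mat_mult_mat)
  have 2: "mat d ** (mat c ** A) = mat (d * c) ** A" for d
    by (simp add: matrix_mul_assoc mat_mult_mat)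
  show ?thesis
  proof (intro Set.equalityI subsetI)
    fix x assume "x \<in> cls (mat c ** A)"
    then obtain d where "d \<noteq> 0" "x = mat d ** (mat c ** A)" unfolding cls_def by blast
    then show "x \<in> cls A" unfolding cls_def using 2 c by (intro CollectI exI[of _ "d * c"]) simp
  next
    fix x assume "x \<in> cls A"
    then obtain d where "d \<noteq> 0" "x = mat d ** A" unfolding cls_def by blast
    then show "x \<in> cls (mat c ** A)" unfolding cls_def using 1[of d] c by (intro CollectI exI[of _ "d / c"]) simp
  qed
qed

lemma cls_eqI: "g \<in> carrier PGL2 \<Longrightarrow> A \<in> g \<Longrightarrow> g = cls A \<and> invertible A"
proof -
  assume g: "g \<in> carrier PGL2" "A \<in> g"
  obtain B where B: "invertible B" "g = cls B" using g(1) by (rule PGL2_cases)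
  then obtain c where c: "c \<noteq> 0" "A = mat c ** B" using g(2) unfolding cls_def by blast
  then show ?thesis using B cls_scale invertible_mult invertible_mat by metis
qed

lemma cls_in_carrier: "invertible A \<Longrightarrow> cls A \<in> carrier PGL2"
  by (simp add: carrier_PGL2)

lemma cls_eq_one_iff: "cls A = \<one>\<^bsub>PGL2\<^esub> \<longleftrightarrow> (\<exists>c. c \<noteq> 0 \<and> A = mat c)"
proof
  assume "cls A = \<one>\<^bsub>PGL2\<^esub>"
  then have "A \<in> cls (mat 1)" using cls_self cls_one by metis
  then show "\<exists>c. c \<noteq> 0 \<and> A = mat c" by (auto simp: cls_def mat_mult_mat)
next
  assume "\<exists>c. c \<noteq> 0 \<and> A = mat c"
  then obtain c where c: "c \<noteq> 0" "A = mat c" by blast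
  then have "A = mat c ** mat 1" by simp
  then show "cls A = \<one>\<^bsub>PGL2\<^esub>" using cls_scale[OF c(1)] cls_one by metis
qed

lemma inv_cls: "invertible A \<Longrightarrow> \<exists>B. invertible B \<and> inv\<^bsub>PGL2\<^esub> (cls A) = cls B \<and> A ** B = mat 1 \<and> B ** A = mat 1"
proof -
  assume A: "invertible A"
  then obtain B where B: "A ** B = mat 1" "B ** A = mat 1" by (auto simp: invertible_def)
  then have iB: "invertible B" by (auto simp: invertible_def)
  have "cls B \<otimes>\<^bsub>PGL2\<^esub> cls A = \<one>\<^bsub>PGL2\<^esub>" using A iB B cls_one by (simp add: cls_mult)
  then have "inv\<^bsub>PGL2\<^esub> (cls A) = cls B" using A iB by (intro PGL2.inv_equality) (auto intro: cls_in_carrier)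
  then show ?thesis using iB B by blast
qed

section \<open>Action on vertices and on the projective line\<close>

lemma cr_matrix: "cr (A *v u) (A *v v) = det A * cr u v"
  by (simp add: cr_def det_2 matrix_vector_mult_def sum_2 algebra_simps)

lemma cr_matrix_nonzero: "invertible A \<Longrightarrow> cr (A *v u) (A *v v) \<noteq> 0 \<longleftrightarrow> cr u v \<noteq> (0 :: 'a::field)"
  by (simp add: cr_matrix invertible_det_nz)

lemma matrix_comb: "A *v (a *s u + b *s v) = a *s (A *v u) + b *s (A *v (v :: 'a::field^2))"
  by (simp add: matrix_vector_right_distrib vector_scalar_commute)

lemma matrix_lat: "(*v) A ` lat u v = lat (A *v u) (A *v v)"
  unfolding lat_def by (force simp: matrix_comb image_iff)

lemma vertex_act_mult: "vertex_act (g \<otimes>\<^bsub>PGL2\<^esub> h) \<Lambda> = vertex_act g (vertex_act h \<Lambda>)"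
proof -
  have "(*v) (A ** B) ` L = (*v) A ` (*v) B ` L" for A B :: "'a^2^2" and L
    by (simp add: image_image matrix_vector_mul_assoc)
  note comp = this
  show ?thesis
  proof (intro Set.equalityI subsetI)
    fix x assume "x \<in> vertex_act (g \<otimes>\<^bsub>PGL2\<^esub> h) \<Lambda>"
    then obtain A B L where "A \<in> g" "B \<in> h" "L \<in> \<Lambda>" "x = (*v) (A ** B) ` L"
      unfolding vertex_act_def mult_PGL2 by blast
    then show "x \<in> vertex_act g (vertex_act h \<Lambda>)" unfolding comp vertex_act_def by blast
  next
    fix x assume "x \<in> vertex_act g (vertex_act h \<Lambda>)"
    then obtain A B L where "A \<in> g" "B \<in> h" "L \<in> \<Lambda>" "x = (*v) (A ** B) ` L"
      unfolding comp vertex_act_def by blast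
    then show "x \<in> vertex_act (g \<otimes>\<^bsub>PGL2\<^esub> h) \<Lambda>" unfolding vertex_act_def mult_PGL2 by blast
  qed
qed

lemma vertex_act_cls:
  shows "vertex_act (cls A) (vtx u v) = vtx (A *v u) (A *v v)"
proof -
  have *: "(*v) (mat c ** A) ` (*s) d ` L = (*s) (c * d) ` (*v) A ` L" for c d and L :: "('a^2) set"
    by (simp add: image_image vector_scalar_commute vector_smult_assoc mult.commute mat_mult_vec flip: matrix_vector_mul_assoc)
  have "vertex_act (cls A) (similarity_class L) = similarity_class ((*v) A ` L)" for L
  proof (intro Set.equalityI subsetI)
    fix x assume "x \<in> vertex_act (cls A) (similarity_class L)"
    then obtain c d where "c \<noteq> 0" "d \<noteq> 0" "x = (*v) (mat c ** A) ` (*s) d ` L"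
      unfolding vertex_act_def cls_def similarity_class_def by blast
    then show "x \<in> similarity_class ((*v) A ` L)" unfolding * similarity_class_def
      by (intro CollectI exI[of _ "c * d"]) simp
  next
    fix x assume "x \<in> similarity_class ((*v) A ` L)"
    then obtain d where d: "d \<noteq> 0" "x = (*s) d ` (*v) A ` L" unfolding similarity_class_def by blast
    then have "x = (*v) (mat d ** A) ` (*s) 1 ` L" unfolding * by simp
    moreover have "mat d ** A \<in> cls A" using d(1) unfolding cls_def by blast
    moreover have "(*s) 1 ` L \<in> similarity_class L" using similarity_class_refl[of L] by simp
    ultimately show "x \<in> vertex_act (cls A) (similarity_class L)" unfolding vertex_act_def by blast
  qed
  then show ?thesis unfolding vtx_def by (simp add: matrix_lat)
qed

lemma vertex_act_one: "x \<in> verts bt_tree \<Longrightarrow> vertex_act \<one>\<^bsub>PGL2\<^esub> x = x"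
  unfolding cls_one[symmetric] by (auto simp: verts_bt_iff vertex_act_cls)

lemma P1_act_cls: "P1_act (cls A) (pt u) = pt (A *v u)"
proof -
  have *: "(mat c ** A) *v (d *s u) = (c * d) *s (A *v u)" for c d
    by (simp add: vector_scalar_commute vector_smult_assoc mult.commute mat_mult_vec flip: matrix_vector_mul_assoc)
  have "d *s (A *v u) = (mat 1 ** A) *v (d *s u)" for d unfolding * by simp
  then have "d *s (A *v u) \<in> P1_act (cls A) (pt u)" for d
    unfolding P1_act_def cls_def by (metis (mono_tags, lifting) UN_I image_eqI mem_Collect_eq one_neq_zero pt_iff)
  moreover have "P1_act (cls A) (pt u) \<subseteq> pt (A *v u)" unfolding P1_act_def cls_def by (auto simp: pt_iff *)
  ultimately show ?thesis by (auto simp: pt_iff)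
qed

lemma fixed_points_iff:
  assumes A: "invertible A" and x: "x \<noteq> (0 :: 'a::field^2)"
  shows "x \<in> \<Union>(fixed_points (cls A)) \<longleftrightarrow> (\<exists>c. A *v x = c *s x)"
proof
  assume "x \<in> \<Union>(fixed_points (cls A))"
  then obtain z where z: "z \<in> P1" "P1_act (cls A) z = z" "x \<in> z" by (auto simp: fixed_points_def)
  then have "pt (A *v x) = pt x" using P1_pt[OF z(1,3) x] P1_act_cls by metis
  then show "\<exists>c. A *v x = c *s x" using pt_mem pt_iff by metis
next
  assume "\<exists>c. A *v x = c *s x"
  then obtain c where c: "A *v x = c *s x" by blast
  have "c \<noteq> 0"
  proof
    assume "c = 0"
    then have "A *v x = 0" using c by simp
    moreover obtain B where "B ** A = mat 1" using A by (auto simp: invertible_def)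
    ultimately have "x = 0" by (metis matrix_vector_mul_assoc matrix_vector_mul_lid matrix_vector_mult_0_right)
    then show False using x by simp
  qed
  then have "P1_act (cls A) (pt x) = pt x" by (simp add: P1_act_cls c pt_scale)
  moreover have "pt x \<in> P1" using x P1_iff by blast
  ultimately show "x \<in> \<Union>(fixed_points (cls A))" using pt_mem unfolding fixed_points_def by blast
qed

lemma fixed_points_P1: "fixed_points g \<subseteq> P1"
  by (auto simp: fixed_points_def)

section \<open>Topologies\<close>

lemma vector_dist_less: "vector_dist u v < e \<longleftrightarrow> (\<forall>i. absv (u $ i - v $ i) < e)"
  unfolding vector_dist_def by (subst Max_less_iff) auto

lemma matrix_dist_less: "matrix_dist A B < e \<longleftrightarrow> (\<forall>i j. absv (A $ i $ j - B $ i $ j) < e)"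
  unfolding matrix_dist_def by (subst Max_less_iff) auto

lemma vector_dist_ge: "absv (u $ i - v $ i) \<le> vector_dist u v"
  unfolding vector_dist_def by (rule Max_ge) auto

lemma matrix_dist_ge: "absv (A $ i $ j - B $ i $ j) \<le> matrix_dist A B"
  unfolding matrix_dist_def by (rule Max_ge) auto

lemma vector_dist_le: "vector_dist u v \<le> e \<longleftrightarrow> (\<forall>i. absv (u $ i - v $ i) \<le> e)"
  unfolding vector_dist_def by (subst Max_le_iff) auto

lemma matrix_dist_le: "matrix_dist A B \<le> e \<longleftrightarrow> (\<forall>i j. absv (A $ i $ j - B $ i $ j) \<le> e)"
  unfolding matrix_dist_def by (subst Max_le_iff) auto

lemma absv_triangle: "absv (x - z :: 'a::padic_field) \<le> absv (x - y) + absv (y - z)"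
proof -
  have "absv (x - z) \<le> absv (x - y) \<or> absv (x - z) \<le> absv (y - z)"
    using absv_add[of "x - y" "y - z"] by (simp add: le_max_iff_disj)
  then show ?thesis using absv_nonneg[of "x - y"] absv_nonneg[of "y - z"] by linarith
qed

interpretation vector_metric: Metric_space UNIV "vector_dist :: 'a::padic_field^2 \<Rightarrow> 'a^2 \<Rightarrow> real"
proof
  fix x y z :: "'a^2"
  show "0 \<le> vector_dist x y" using vector_dist_ge[of x 1 y] absv_nonneg order_trans by blast
  show "vector_dist x y = vector_dist y x" unfolding vector_dist_def by (simp add: absv_diff_commute)
  show "vector_dist x y = 0 \<longleftrightarrow> x = y"
  proof
    assume "vector_dist x y = 0"
    then have "absv (x $ i - y $ i) = 0" for i using vector_dist_ge[of x i y] absv_nonneg[of "x $ i - y $ i"] by linarith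
    then show "x = y" by (simp add: vec_eq_iff)
  next
    assume "x = y"
    then have "vector_dist x y \<le> 0" by (simp add: vector_dist_le)
    then show "vector_dist x y = 0" using \<open>0 \<le> vector_dist x y\<close> by linarith
  qed
  show "vector_dist x z \<le> vector_dist x y + vector_dist y z"
    unfolding vector_dist_le
    using absv_triangle add_mono[OF vector_dist_ge[of x _ y] vector_dist_ge[of y _ z]] order_trans by blast
qed

interpretation matrix_metric: Metric_space UNIV "matrix_dist :: 'a::padic_field^2^2 \<Rightarrow> 'a^2^2 \<Rightarrow> real"
proof
  fix x y z :: "'a^2^2"
  show "0 \<le> matrix_dist x y" using matrix_dist_ge[of x 1 1 y] absv_nonneg order_trans by blast
  have sw: "matrix_dist A B \<le> matrix_dist B A" for A B :: "'a^2^2"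
    unfolding matrix_dist_le using matrix_dist_ge[of B _ _ A] by (subst absv_diff_commute) simp
  show "matrix_dist x y = matrix_dist y x" using sw[of x y] sw[of y x] by simp
  show "matrix_dist x y = 0 \<longleftrightarrow> x = y"
  proof
    assume "matrix_dist x y = 0"
    then have "absv (x $ i $ j - y $ i $ j) = 0" for i j
      using matrix_dist_ge[of x i j y] absv_nonneg[of "x $ i $ j - y $ i $ j"] by linarith
    then show "x = y" by (simp add: vec_eq_iff)
  next
    assume "x = y"
    then have "matrix_dist x y \<le> 0" by (simp add: matrix_dist_le)
    then show "matrix_dist x y = 0" using \<open>0 \<le> matrix_dist x y\<close> by linarith
  qed
  show "matrix_dist x z \<le> matrix_dist x y + matrix_dist y z"
    unfolding matrix_dist_le
    using absv_triangle add_mono[OF matrix_dist_ge[of x _ _ y] matrix_dist_ge[of y _ _ z]] order_trans by blast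
qed

text \<open>Cosets are disjoint, so forming the union of a family commutes with intersections; hence
  the defining condition is a topology.\<close>

lemma openin_PGL2_topology:
  "openin PGL2_topology (U :: ('a::padic_field^2^2) set set) \<longleftrightarrow> U \<subseteq> carrier PGL2 \<and> openin matrix_metric.mtopology (\<Union>U)"
proof -
  have "istopology (\<lambda>U :: ('a^2^2) set set. U \<subseteq> carrier PGL2 \<and> openin matrix_metric.mtopology (\<Union>U))"
    unfolding istopology_def
  proof (intro conjI allI impI)
    fix S T :: "('a^2^2) set set"
    assume S: "S \<subseteq> carrier PGL2 \<and> openin matrix_metric.mtopology (\<Union>S)"
      and T: "T \<subseteq> carrier PGL2 \<and> openin matrix_metric.mtopology (\<Union>T)"
    have "\<Union>(S \<inter> T) = \<Union>S \<inter> \<Union>T"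
    proof (intro Set.equalityI subsetI)
      fix A assume "A \<in> \<Union>S \<inter> \<Union>T"
      then obtain g h where gh: "g \<in> S" "h \<in> T" "A \<in> g" "A \<in> h" by blast
      then have "g = cls A" "h = cls A" using cls_eqI S T by blast+
      then show "A \<in> \<Union>(S \<inter> T)" using gh by blast
    qed blast
    then show "openin matrix_metric.mtopology (\<Union>(S \<inter> T))" using S T by (simp add: openin_Int)
    show "S \<inter> T \<subseteq> carrier PGL2" using S by blast
  next
    fix C :: "('a^2^2) set set set"
    assume C: "\<forall>K\<in>C. K \<subseteq> carrier PGL2 \<and> openin matrix_metric.mtopology (\<Union>K)"
    have "\<Union>(\<Union>C) = \<Union>(Union ` C)" by blast
    moreover have "openin matrix_metric.mtopology (\<Union>(Union ` C))" by (rule openin_Union) (use C in auto)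
    ultimately show "openin matrix_metric.mtopology (\<Union>(\<Union>C))" by simp
    show "\<Union>C \<subseteq> carrier PGL2" using C by blast
  qed
  then show ?thesis unfolding PGL2_topology_def by (simp add: topology_inverse')
qed

text \<open>As for matrices. Different points of \<open>P1\<close> meet only in 0, which is why 0 is
  taken out.\<close>

lemma openin_P1_topology:
  "openin P1_topology (U :: ('a::padic_field^2) set set) \<longleftrightarrow> U \<subseteq> P1 \<and> openin vector_metric.mtopology (\<Union>U - {0})"
proof -
  have "istopology (\<lambda>U. U \<subseteq> P1 \<and> openin vector_metric.mtopology (\<Union>U - {0 :: 'a^2}))"
    unfolding istopology_def
  proof (intro conjI allI impI)
    fix S T :: "('a^2) set set"
    assume S: "S \<subseteq> P1 \<and> openin vector_metric.mtopology (\<Union>S - {0})"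
      and T: "T \<subseteq> P1 \<and> openin vector_metric.mtopology (\<Union>T - {0})"
    have "\<Union>(S \<inter> T) - {0} = (\<Union>S - {0}) \<inter> (\<Union>T - {0})"
    proof (intro Set.equalityI subsetI)
      fix x assume "x \<in> (\<Union>S - {0}) \<inter> (\<Union>T - {0})"
      then obtain z w where zw: "z \<in> S" "w \<in> T" "x \<in> z" "x \<in> w" "x \<noteq> 0" by blast
      then have "z = pt x" "w = pt x" using P1_pt S T by blast+
      then show "x \<in> \<Union>(S \<inter> T) - {0}" using zw by blast
    qed blast
    then show "openin vector_metric.mtopology (\<Union>(S \<inter> T) - {0})" using S T by (simp add: openin_Int)
    show "S \<inter> T \<subseteq> P1" using S by blast
  next
    fix C :: "('a^2) set set set"
    assume C: "\<forall>K\<in>C. K \<subseteq> P1 \<and> openin vector_metric.mtopology (\<Union>K - {0})"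
    have "\<Union>(\<Union>C) - {0} = \<Union>((\<lambda>K. \<Union>K - {0}) ` C)" by blast
    moreover have "openin vector_metric.mtopology (\<Union>((\<lambda>K. \<Union>K - {0}) ` C))" by (rule openin_Union) (use C in auto)
    ultimately show "openin vector_metric.mtopology (\<Union>(\<Union>C) - {0})" by simp
    show "\<Union>C \<subseteq> P1" using C by blast
  qed
  then show ?thesis unfolding P1_topology_def by (simp add: topology_inverse')
qed

text \<open>An open set isolating the identity in the group has an open preimage among matrices,
  which contains a ball around \<open>mat 1\<close>.\<close>

lemma discrete_subgroup_gap:
  assumes "discrete_subgroup \<Gamma>"
  obtains e where "e > 0" "\<And>A. cls A \<in> \<Gamma> \<Longrightarrow> (\<And>i j. absv (A $ i $ j - mat 1 $ i $ j) < e) \<Longrightarrow> cls A = \<one>\<^bsub>PGL2\<^esub>"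
proof -
  have sub: "subgroup \<Gamma> PGL2" and top: "subtopology PGL2_topology \<Gamma> = discrete_topology \<Gamma>"
    using assms by (auto simp: discrete_subgroup_def)
  have 1: "\<one>\<^bsub>PGL2\<^esub> \<in> \<Gamma>" using sub by (rule subgroup.one_closed)
  then have "openin (subtopology PGL2_topology \<Gamma>) {\<one>\<^bsub>PGL2\<^esub>}" unfolding top by simp
  then obtain T where T: "openin PGL2_topology T" "{\<one>\<^bsub>PGL2\<^esub>} = T \<inter> \<Gamma>" by (auto simp: openin_subtopology)
  have "mat 1 \<in> \<Union>T" using T(2) cls_self[of "mat 1"] cls_one by blast
  then obtain e where e: "e > 0" "matrix_metric.mball (mat 1) e \<subseteq> \<Union>T"
    using T(1) unfolding openin_PGL2_topology matrix_metric.openin_mtopology by blast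
  show ?thesis
  proof (rule that[OF e(1)])
    fix A :: "'a^2^2" assume A: "cls A \<in> \<Gamma>" "\<And>i j. absv (A $ i $ j - mat 1 $ i $ j) < e"
    have "matrix_dist (mat 1) A < e" unfolding matrix_dist_less using A(2) by (simp add: absv_diff_commute)
    then have "A \<in> \<Union>T" using e(2) by auto
    then obtain g where g: "g \<in> T" "A \<in> g" by blast
    then have "g = cls A" using cls_eqI T(1) unfolding openin_PGL2_topology by blast
    then show "cls A = \<one>\<^bsub>PGL2\<^esub>" using g A(1) T(2) by blast
  qed
qed

lemma topspace_P1: "topspace P1_topology = (P1 :: 'a::padic_field ppoint set)"
proof -
  have "\<Union>(P1 :: 'a ppoint set) - {0} = UNIV - {0}"
  proof -
    have "x \<in> \<Union>P1" if "x \<noteq> 0" for x :: "'a^2" using that pt_mem P1_iff by blast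
    then show ?thesis by blast
  qed
  moreover have "openin vector_metric.mtopology (UNIV - {0 :: 'a^2})"
    using vector_metric.Hausdorff_space_mtopology closedin_Hausdorff_singleton
    by (metis closedin_def openin_closedin_eq vector_metric.topspace_mtopology UNIV_I)
  ultimately have "openin P1_topology (P1 :: 'a ppoint set)" by (simp add: openin_P1_topology)
  moreover have "topspace P1_topology \<subseteq> (P1 :: 'a ppoint set)" using openin_topspace[of P1_topology] openin_P1_topology by blast
  ultimately show ?thesis by (meson openin_subset subset_antisym)
qed

text \<open>The lines spanned by vectors near \<open>u\<close> form an open neighbourhood of
  \<open>z\<close>.\<close>

lemma P1_closure_approx:
  fixes u :: "'a::padic_field^2"
  assumes z: "z \<in> P1_topology closure_of F" and u: "u \<in> z" "u \<noteq> 0" and e: "e > 0"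
  obtains z' u' where "z' \<in> F" "u' \<in> z'" "\<And>i. absv (u $ i - u' $ i) < e"
proof -
  define T where "T = {pt u' | u'. u' \<noteq> 0 \<and> vector_dist u u' < e}"
  have TP: "T \<subseteq> P1" unfolding T_def using P1_iff by blast
  have "openin P1_topology T" unfolding openin_P1_topology vector_metric.openin_mtopology
  proof (intro conjI allI impI TP)
    fix x assume "x \<in> \<Union>T - {0}"
    then obtain u' c where u': "u' \<noteq> 0" "vector_dist u u' < e" "x = c *s u'" "x \<noteq> 0" by (auto simp: T_def pt_iff)
    then have c: "c \<noteq> 0" by auto
    \<comment> \<open>The first bound survives division by \<open>c\<close>, which brings
      \<open>x\<close> back to \<open>u'\<close>; the second keeps the ball away from 0.\<close>
    define d where "d = min (absv c * e) (vector_dist x 0)"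
    have "vector_dist x 0 > 0" using u'(4) vector_metric.mdist_pos_less by simp
    then have d: "d > 0" using c e by (simp add: d_def)
    have "y \<in> \<Union>T - {0}" if "y \<in> vector_metric.mball x d" for y
    proof -
      have xy: "vector_dist x y < d" using that by simp
      then have y0: "y \<noteq> 0" by (auto simp: d_def)
      define y' where "y' = inverse c *s y"
      have "absv (u $ i - y' $ i) < e" for i
      proof -
        have "absv (x $ i - y $ i) < absv c * e" using xy by (auto simp: vector_dist_less d_def)
        moreover have "x $ i - y $ i = c * (u' $ i - y' $ i)" using c u'(3) by (simp add: y'_def algebra_simps)
        ultimately have 1: "absv (u' $ i - y' $ i) < e" using c by (simp add: absv_mult)
        have 2: "absv (u $ i - u' $ i) < e" using u'(2) by (simp add: vector_dist_less)
        show ?thesis using absv_add_less[OF 2 1] by simp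
      qed
      then have "vector_dist u y' < e" by (simp add: vector_dist_less)
      moreover have "y' \<noteq> 0" using y0 c by (simp add: y'_def)
      ultimately have "pt y' \<in> T" unfolding T_def by blast
      moreover have "y \<in> pt y'" unfolding pt_iff y'_def using c by (intro exI[of _ c]) (simp add: vector_smult_assoc)
      ultimately show ?thesis using y0 by blast
    qed
    then show "\<exists>r>0. vector_metric.mball x r \<subseteq> \<Union>T - {0}" using d by blast
  qed simp
  moreover have "z \<in> T"
  proof -
    have "z \<in> P1" using z topspace_P1 by (metis in_closure_of)
    then have "z = pt u" using P1_pt u by blast
    moreover have "vector_dist u u < e" using e by (simp add: vector_dist_less)
    ultimately show ?thesis unfolding T_def using u(2) by blast
  qed
  ultimately obtain z' where "z' \<in> F" "z' \<in> T" using z by (metis in_closure_of)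
  then obtain u' where u': "pt u' \<in> F" "vector_dist u u' < e" by (auto simp: T_def)
  show ?thesis by (rule that[OF u'(1) pt_mem]) (use u'(2) in \<open>simp add: vector_dist_less\<close>)
qed

text \<open>The transition matrix is congruent to the identity modulo the maximal ideal, so its
  determinant is a unit.\<close>

lemma lat_perturb:
  assumes uv: "cr u v \<noteq> 0" and u': "u' = (1 + a) *s u + b *s v" and v': "v' = c *s u + (1 + d) *s v"
    and less: "absv a < 1" "absv b < 1" "absv c < 1" "absv d < 1"
  shows "cr u' v' \<noteq> 0 \<and> lat u' v' = lat u v"
proof -
  have ad: "absv (1 + a) = 1" "absv (1 + d) = 1"
    using absv_eqI[of 1 "1 + a"] absv_eqI[of 1 "1 + d"] less by simp_all
  define D where "D = (1 + a) * (1 + d) - b * c"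
  have cr: "cr u' v' = D * cr u v" by (simp add: u' v' D_def algebra_simps cr_swap[of u v])
  have "absv b * absv c < 1 * 1" using less by (intro mult_strict_mono) auto
  then have "absv D = absv ((1 + a) * (1 + d))"
    by (intro absv_eqI) (simp add: D_def absv_mult ad)
  then have D: "absv D = 1" by (simp add: absv_mult ad)
  then have nz: "cr u' v' \<noteq> 0" using uv by (auto simp: cr)
  have "lat u' v' = lat u v"
  proof (rule lat_eqI)
    show "u' \<in> lat u v" "v' \<in> lat u v" unfolding u' v' by (intro latI; use ad less in simp)+
    have "cr u v' = (1 + d) * cr u v" "cr u' u = - b * cr u v" "cr v v' = - c * cr u v" "cr u' v = (1 + a) * cr u v"
      by (simp_all add: u' v' cr_swap[of v u] algebra_simps)
    then show "u \<in> lat u' v'" "v \<in> lat u' v'"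
      unfolding lat_iff[OF nz] cr using ad less D by (auto simp: absv_mult mult_left_le_one_le)
  qed
  then show ?thesis using nz by blast
qed

lemma small_coordinates:
  fixes u v :: "'a::padic_field^2"
  assumes uv: "cr u v \<noteq> 0" and e: "e > 0"
  obtains d where "d > 0" "\<And>x :: 'a^2. (\<And>i. absv (x $ i) < d) \<Longrightarrow> absv (cr x v / cr u v) < e \<and> absv (cr u x / cr u v) < e"
proof -
  define K where "K = Max {absv (u $ 1), absv (u $ 2), absv (v $ 1), absv (v $ 2), 1}"
  have K: "absv (u $ 1) \<le> K" "absv (u $ 2) \<le> K" "absv (v $ 1) \<le> K" "absv (v $ 2) \<le> K" "1 \<le> K"
    unfolding K_def by (auto intro: Max_ge)
  define d where "d = e * absv (cr u v) / K"
  have d: "d > 0" "d * K = e * absv (cr u v)" using uv e K(5) by (auto simp: d_def)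
  have p: "absv (x * y) < e * absv (cr u v)" if "absv x < d" "absv y \<le> K" for x y :: 'a
  proof -
    have "absv (x * y) \<le> absv x * K" unfolding absv_mult using that by (intro mult_left_mono) auto
    also have "\<dots> < d * K" using that K(5) by (intro mult_strict_right_mono) auto
    finally show ?thesis by (simp add: d)
  qed
  have "absv (cr x v / cr u v) < e \<and> absv (cr u x / cr u v) < e" if x: "\<And>i. absv (x $ i) < d" for x :: "'a^2"
  proof -
    have cx: "cr x v = x $ 1 * v $ 2 - x $ 2 * v $ 1" "cr u x = x $ 2 * u $ 1 - x $ 1 * u $ 2"
      by (simp_all add: cr_def mult.commute)
    have "absv (cr x v) < e * absv (cr u v)" "absv (cr u x) < e * absv (cr u v)"
      unfolding cx by (intro absv_diff_less p x K)+
    then show ?thesis using uv by (simp add: absv_divide divide_less_eq)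
  qed
  then show ?thesis using that d(1) by blast
qed

lemma tree_of_ends_closure:
  assumes F: "F \<subseteq> P1"
  shows "tree_of_ends (P1_topology closure_of F) = tree_of_ends F"
proof -
  let ?C = "P1_topology closure_of F"
  have FC: "F \<subseteq> ?C" using F topspace_P1 by (metis closure_of_subset)
  have CP: "?C \<subseteq> P1" using topspace_P1 by (metis closure_of_subset_topspace)
  have main: "\<exists>u'\<in>\<Union>F. \<exists>v'\<in>\<Union>F. cr u' v' \<noteq> 0 \<and> vtx u v = vtx u' v' \<and> vtx u (unif *s v) = vtx u' (unif *s v')"
    if uv: "u \<in> \<Union>?C" "v \<in> \<Union>?C" "cr u v \<noteq> 0" for u v
  proof -
    obtain z w where zw: "z \<in> ?C" "w \<in> ?C" "u \<in> z" "v \<in> w" using uv by blast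
    have nz: "u \<noteq> 0" "v \<noteq> 0" using uv(3) by auto
    \<comment> \<open>The bound is \<open>absv unif\<close> and not 1, because the second vertex of
      the edge has the basis \<open>u\<close>, \<open>unif *s v\<close>, in which the coefficient
      \<open>b\<close> turns into \<open>b / unif\<close>.\<close>
    obtain d where d: "d > 0" "\<And>x :: 'a^2. (\<And>i. absv (x $ i) < d) \<Longrightarrow>
        absv (cr x v / cr u v) < absv (unif :: 'a) \<and> absv (cr u x / cr u v) < absv (unif :: 'a)"
      using small_coordinates[OF uv(3), of "absv (unif :: 'a)"] by auto
    obtain z' u' where u': "z' \<in> F" "u' \<in> z'" "\<And>i. absv (u $ i - u' $ i) < d"
      using P1_closure_approx[OF zw(1,3) nz(1) d(1)] by metis
    obtain w' v' where v': "w' \<in> F" "v' \<in> w'" "\<And>i. absv (v $ i - v' $ i) < d"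
      using P1_closure_approx[OF zw(2,4) nz(2) d(1)] by metis
    define a b where "a = cr (u' - u) v / cr u v" and "b = cr u (u' - u) / cr u v"
    define c e where "c = cr (v' - v) v / cr u v" and "e = cr u (v' - v) / cr u v"
    have "absv a < absv (unif :: 'a) \<and> absv b < absv (unif :: 'a)"
      unfolding a_def b_def by (rule d(2)) (use u'(3) in \<open>simp add: absv_diff_commute\<close>)
    moreover have "absv c < absv (unif :: 'a) \<and> absv e < absv (unif :: 'a)"
      unfolding c_def e_def by (rule d(2)) (use v'(3) in \<open>simp add: absv_diff_commute\<close>)
    ultimately have lt: "absv a < absv (unif :: 'a)" "absv b < absv (unif :: 'a)" "absv c < absv (unif :: 'a)" "absv e < absv (unif :: 'a)"
      by auto
    then have lt1: "absv a < 1" "absv b < 1" "absv c < 1" "absv e < 1" using absv_unif[where 'a = 'a] by linarith+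
    have "u' - u = a *s u + b *s v" "v' - v = c *s u + e *s v"
      unfolding a_def b_def c_def e_def by (rule cr_coords[OF uv(3)])+
    then have eq: "u' = (1 + a) *s u + b *s v" "v' = c *s u + (1 + e) *s v"
      by (simp_all add: vec_eq_iff algebra_simps)
    have 1: "cr u' v' \<noteq> 0" "lat u' v' = lat u v" using lat_perturb[OF uv(3) eq lt1] by auto
    have "lat u' (unif *s v') = lat u (unif *s v)"
    proof (rule conjunct2[OF lat_perturb])
      show "cr u (unif *s v) \<noteq> 0" using uv(3) by simp
      show "u' = (1 + a) *s u + (b / unif) *s (unif *s v)" by (simp add: eq vector_smult_assoc)
      show "unif *s v' = (unif * c) *s u + (1 + e) *s (unif *s v)" by (simp add: eq vec_eq_iff algebra_simps)
      show "absv (b / unif) < 1" using lt by (simp add: absv_divide divide_less_eq)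
      show "absv (unif * c) < 1" using absv_mult_le[of unif c "absv c"] lt1 absv_unif[where 'a = 'a] by simp
    qed (use lt1 in auto)
    then show ?thesis using 1 u' v' unfolding vtx_def by (intro bexI[of _ u'] bexI[of _ v']) auto
  qed
  have "ends_verts (\<Union>?C) = ends_verts (\<Union>F)"
  proof (intro Set.equalityI subsetI)
    fix x assume "x \<in> ends_verts (\<Union>?C)"
    then show "x \<in> ends_verts (\<Union>F)" using main unfolding ends_verts_def by blast
  qed (use FC in \<open>auto simp: ends_verts_def\<close>)
  moreover have "ends_edges (\<Union>?C) = ends_edges (\<Union>F)"
  proof (intro Set.equalityI subsetI)
    fix x assume "x \<in> ends_edges (\<Union>?C)"
    then obtain u v where x: "x = {vtx u v, vtx u (unif *s v)}" "u \<in> \<Union>?C" "v \<in> \<Union>?C" "cr u v \<noteq> 0"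
      unfolding ends_edges_def by blast
    from main[OF x(2-4)] obtain u' v' where "u' \<in> \<Union>F" "v' \<in> \<Union>F" "cr u' v' \<noteq> 0"
      "x = {vtx u' v', vtx u' (unif *s v')}" unfolding x(1) by auto
    then show "x \<in> ends_edges (\<Union>F)" unfolding ends_edges_def by blast
  next
    fix x assume "x \<in> ends_edges (\<Union>F)"
    then show "x \<in> ends_edges (\<Union>?C)" using FC unfolding ends_edges_def by blast
  qed
  ultimately show ?thesis using tree_of_ends_eq[OF CP] tree_of_ends_eq[OF F] by simp
qed

section \<open>Elements of a discrete group\<close>

lemma vertex_fix_lat:
  assumes "cr u v \<noteq> 0" "vertex_act (cls A) (vtx u v) = vtx u v"
  obtains c where "c \<noteq> 0" "(*v) A ` lat u v = (*s) c ` lat u v"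
proof -
  have "lat (A *v u) (A *v v) \<in> vtx u v" using lat_in_vtx assms(2) unfolding vertex_act_cls by metis
  then show ?thesis using that unfolding vtx_def similarity_class_def matrix_lat by blast
qed

lemma primitive_multiple:
  assumes "cr u v \<noteq> 0" "e \<notin> (*s) unif ` lat u v" "t *s e \<in> lat u v"
  shows "absv t \<le> 1"
proof (rule ccontr)
  assume "\<not> absv t \<le> 1"
  then have t: "t \<noteq> 0" "absv (inverse t) < 1" by (auto simp: absv_inverse inverse_less_1_iff)
  then have "absv (inverse t / unif) \<le> 1" using absv_le_unif[of "inverse t"] by (simp add: absv_divide divide_le_eq)
  from submodule_scale[OF lat_submodule assms(3) this] have "(inverse t / unif * t) *s e \<in> lat u v"
    by (simp add: vector_smult_assoc)
  then have "unif *s ((inverse t / unif * t) *s e) \<in> (*s) unif ` lat u v" by blast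
  then show False using t(1) assms(2) by (simp add: vector_smult_assoc)
qed

lemma matrix_inj: "invertible A \<Longrightarrow> A *v x = A *v y \<longleftrightarrow> x = (y :: 'a::field^2)"
  by (metis invertible_def matrix_vector_mul_assoc matrix_vector_mul_lid)

text \<open>A primitive multiple of \<open>e\<close> is multiplied by \<open>\<alpha>\<close>, and
  its image must be primitive in \<open>c\<close> times the lattice.\<close>

lemma vertex_fix_eigenvalue:
  assumes A: "invertible A" and uv: "cr u v \<noteq> 0" and c: "c \<noteq> 0" "(*v) A ` lat u v = (*s) c ` lat u v"
    and e: "e \<noteq> 0" "A *v e = \<alpha> *s e"
  shows "absv \<alpha> = absv c"
proof -
  obtain d where d: "d \<noteq> 0" "d *s e \<in> lat u v" "d *s e \<notin> (*s) unif ` lat u v"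
    using lat_normalize[OF uv e(1)] by metis
  define x where "x = d *s e"
  have x: "x \<in> lat u v" "x \<notin> (*s) unif ` lat u v" "A *v x = \<alpha> *s x" "x \<noteq> 0"
    using d e by (auto simp: x_def vector_scalar_commute vector_smult_assoc mult.commute)
  have a0: "\<alpha> \<noteq> 0"
  proof
    assume "\<alpha> = 0"
    then have "A *v x = A *v 0" using x(3) by simp
    then show False using matrix_inj[OF A] x(4) by blast
  qed
  have "\<alpha> *s x \<in> (*s) c ` lat u v" using x(1,3) c(2) by (metis imageI)
  then obtain y where y: "y \<in> lat u v" "\<alpha> *s x = c *s y" by blast
  then have "(\<alpha> / c) *s x = y"
  proof -
    have "(\<alpha> / c) *s x = inverse c *s (\<alpha> *s x)" by (simp add: vector_smult_assoc field_simps)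
    then show ?thesis using y(2) c(1) by (simp add: vector_smult_assoc)
  qed
  then have 1: "absv (\<alpha> / c) \<le> 1" using primitive_multiple[OF uv x(2)] y(1) by blast
  have "c *s x \<in> (*v) A ` lat u v" using x(1) c(2) by blast
  then obtain y where y: "y \<in> lat u v" "A *v y = c *s x" by auto
  have "A *v ((c / \<alpha>) *s x) = c *s x" using x(3) a0 by (simp add: vector_scalar_commute vector_smult_assoc)
  then have "(c / \<alpha>) *s x = y" using matrix_inj[OF A] y(2) by metis
  then have "absv (c / \<alpha>) \<le> 1" using primitive_multiple[OF uv x(2)] y(1) by blast
  then show ?thesis using 1 a0 c(1) by (simp add: absv_divide divide_le_eq)
qed

lemma small_matrix:
  fixes u v :: "'a::padic_field^2"
  assumes uv: "cr u v \<noteq> 0" and e: "e > 0"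
  obtains N where "\<And>D :: 'a^2^2. D *v u \<in> (*s) (unif ^ N) ` lat u v \<Longrightarrow> D *v v \<in> (*s) (unif ^ N) ` lat u v \<Longrightarrow>
      absv (D $ i $ j) < e"
proof -
  \<comment> \<open>\<open>K\<close> bounds the entries of \<open>u\<close> and \<open>v\<close>,
    and \<open>M\<close> the coordinates of the standard basis with respect to them; an entry of
    \<open>D\<close> is then at most \<open>M\<close> times \<open>K\<close> times the
    \<open>N\<close>-th power of \<open>absv unif\<close>.\<close>
  define K where "K = Max (insert 1 (range (\<lambda>k. absv (u $ k)) \<union> range (\<lambda>k. absv (v $ k))))"
  have K: "absv (u $ k) \<le> K" "absv (v $ k) \<le> K" "1 \<le> K" for k
    unfolding K_def by (rule Max_ge, simp, blast)+
  define M where "M = Max (insert 1 ((\<lambda>k. absv (cr (axis k 1) v / cr u v)) ` UNIV \<union> (\<lambda>k. absv (cr u (axis k 1) / cr u v)) ` UNIV))"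
  have M: "absv (cr (axis k 1) v / cr u v) \<le> M" "absv (cr u (axis k 1) / cr u v) \<le> M" "1 \<le> M" for k
    unfolding M_def by (rule Max_ge, simp, blast)+
  obtain N where N: "absv (unif :: 'a) ^ N < e / (M * K)"
    using unif_power_small[where 'a = 'a, of "e / (M * K)"] e M(3) K(3) by auto
  show ?thesis
  proof (rule that[of N])
    fix D :: "'a^2^2" and i j
    assume D: "D *v u \<in> (*s) (unif ^ N) ` lat u v" "D *v v \<in> (*s) (unif ^ N) ` lat u v"
    have bound: "absv (w $ i) \<le> absv (unif :: 'a) ^ N * K" if "w \<in> (*s) (unif ^ N) ` lat u v" for w :: "'a^2"
    proof -
      obtain a b where ab: "w = unif ^ N *s (a *s u + b *s v)" "absv a \<le> 1" "absv b \<le> 1"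
        using \<open>w \<in> _\<close> unfolding lat_def by blast
      have "absv (a * u $ i + b * v $ i) \<le> K" using ab K by (intro absv_add_le absv_mult_le)
      moreover have "w $ i = unif ^ N * (a * u $ i + b * v $ i)" unfolding ab(1) by (simp add: algebra_simps)
      ultimately show ?thesis by (simp only: absv_mult absv_power mult_left_mono zero_le_power absv_nonneg)
    qed
    let ?p = "cr (axis j 1) v / cr u v" and ?q = "cr u (axis j 1) / cr u v"
    have "axis j 1 = ?p *s u + ?q *s v" by (rule cr_coords[OF uv])
    then have "D *v axis j 1 = ?p *s (D *v u) + ?q *s (D *v v)" by (metis matrix_comb)
    moreover have "D $ i $ j = (D *v axis j 1) $ i" 
      using exhaust_2[of j] by (auto simp: matrix_vector_mult_def axis_def sum_2)
    ultimately have "D $ i $ j = ?p * (D *v u) $ i + ?q * (D *v v) $ i" by simp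
    moreover have le: "absv (x * y) \<le> M * (absv (unif :: 'a) ^ N * K)"
      if "absv x \<le> M" "absv y \<le> absv (unif :: 'a) ^ N * K" for x y :: 'a
      unfolding absv_mult using that M(3) by (intro mult_mono) auto
    ultimately have "absv (D $ i $ j) \<le> M * (absv (unif :: 'a) ^ N * K)"
      by (simp only:) (intro absv_add_le le M bound D)
    also have "\<dots> < e" using N M(3) K(3) by (simp add: less_divide_eq mult_ac)
    finally show "absv (D $ i $ j) < e" .
  qed
qed

text \<open>
  Two elements of the stabilizer of a lattice that agree modulo a high power of the uniformizer differ
  by an element close to 1; there are only finitely many possibilities modulo that power.
\<close>

lemma finite_stabilizer:
  assumes \<Gamma>: "discrete_subgroup \<Gamma>" and uv: "cr u v \<noteq> (0 :: 'a::padic_field)"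
  shows "finite {g \<in> \<Gamma>. vertex_act g (vtx u v) = vtx u v}"
proof -
  let ?L = "lat u v" and ?S = "{g \<in> \<Gamma>. vertex_act g (vtx u v) = vtx u v}"
  have sub: "subgroup \<Gamma> PGL2" using \<Gamma> by (simp add: discrete_subgroup_def)
  obtain e where e: "e > 0" "\<And>A. cls A \<in> \<Gamma> \<Longrightarrow> (\<And>i j. absv (A $ i $ j - mat 1 $ i $ j) < e) \<Longrightarrow> cls A = \<one>\<^bsub>PGL2\<^esub>"
    using discrete_subgroup_gap[OF \<Gamma>] by metis
  have "\<exists>N. \<forall>D :: 'a^2^2. D *v u \<in> (*s) (unif ^ N) ` ?L \<longrightarrow> D *v v \<in> (*s) (unif ^ N) ` ?L \<longrightarrow> absv (D $ i $ j) < e" for i j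
    using small_matrix[OF uv e(1), of i j] by metis
  then obtain N0 where N0: "\<And>i j. \<forall>D :: 'a^2^2. D *v u \<in> (*s) (unif ^ N0 i j) ` ?L \<longrightarrow> D *v v \<in> (*s) (unif ^ N0 i j) ` ?L \<longrightarrow> absv (D $ i $ j) < e"
    by metis
  define N where "N = Max (range (\<lambda>(i :: 2, j :: 2). N0 i j))"
  have NN: "N0 i j \<le> N" for i j unfolding N_def by (rule Max_ge) auto
  have mono: "(*s) (unif ^ N) ` ?L \<subseteq> (*s) (unif ^ N0 i j) ` ?L" for i j
  proof -
    have "unif ^ N = unif ^ N0 i j * (unif :: 'a) ^ (N - N0 i j)" using NN[of i j] by (simp flip: power_add)
    then have "(*s) (unif ^ N) ` ?L = (*s) (unif ^ N0 i j) ` (*s) (unif ^ (N - N0 i j)) ` ?L"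
      by (simp add: scale_image)
    moreover have "(*s) (unif ^ (N - N0 i j)) ` ?L \<subseteq> ?L"
      using submodule_scale[OF lat_submodule _ absv_unif_power] by blast
    ultimately show ?thesis by blast
  qed
  have N: "absv (D $ i $ j) < e" if "D *v u \<in> (*s) (unif ^ N) ` ?L" "D *v v \<in> (*s) (unif ^ N) ` ?L" for D :: "'a^2^2" and i j
    using N0[of i j] mono[of i j] that by blast
  have "\<exists>B. g = cls B \<and> invertible B \<and> (*v) B ` ?L = ?L" if g: "g \<in> ?S" for g
  proof -
    have "g \<in> carrier PGL2" using g subgroup.subset[OF sub] by blast
    then obtain A where A: "invertible A" "g = cls A" by (rule PGL2_cases)
    have "vertex_act (cls A) (vtx u v) = vtx u v" using g A(2) by simp
    then obtain c where c: "c \<noteq> 0" "(*v) A ` ?L = (*s) c ` ?L" by (rule vertex_fix_lat[OF uv])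
    \<comment> \<open>Division by the factor by which \<open>A\<close> scales the lattice gives a
      representative that maps the lattice onto itself.\<close>
    define B where "B = mat (inverse c) ** A"
    have "(*v) B ` ?L = (*s) (inverse c) ` (*v) A ` ?L"
      by (simp add: B_def image_image mat_mult_vec flip: matrix_vector_mul_assoc)
    also have "\<dots> = ?L" using c by (simp add: scale_image)
    finally have "(*v) B ` ?L = ?L" .
    moreover have "cls B = g" using cls_scale[of "inverse c" A] c(1) A(2) by (simp add: B_def)
    moreover have "invertible B" using A(1) c(1) by (simp add: B_def invertible_mult invertible_mat)
    ultimately show ?thesis by blast
  qed
  note ex = this
  define B where "B g = (SOME B. g = cls B \<and> invertible B \<and> (*v) B ` ?L = ?L)" for g
  have B: "g = cls (B g) \<and> invertible (B g) \<and> (*v) (B g) ` ?L = ?L" if "g \<in> ?S" for g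
    unfolding B_def by (rule someI_ex[OF ex[OF that]])
  obtain R where R: "finite R" "\<And>x::'a. absv x \<le> 1 \<Longrightarrow> \<exists>r\<in>R. absv (x - r) \<le> absv (unif :: 'a) ^ N"
    using finite_residue_system[of N] by auto
  obtain r where r: "\<And>x::'a. absv x \<le> 1 \<Longrightarrow> r x \<in> R \<and> absv (x - r x) \<le> absv (unif :: 'a) ^ N" using R(2) by metis
  define p where "p x = cr x v / cr u v" for x
  define q where "q x = cr u x / cr u v" for x
  have pq: "x = p x *s u + q x *s v" for x unfolding p_def q_def by (rule cr_coords[OF uv])
  have pq1: "absv (p x) \<le> 1" "absv (q x) \<le> 1" if "x \<in> ?L" for x
    using that lat_iff_coords[OF uv, of "p x" "q x"] pq[of x] by simp_all
  have BL: "B g *v u \<in> ?L" "B g *v v \<in> ?L" if "g \<in> ?S" for g using B[OF that] lat_basis by blast+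
  have close: "x - y \<in> (*s) (unif ^ N) ` ?L" if x: "x \<in> ?L" and y: "y \<in> ?L" and eq: "r (p x) = r (p y)" "r (q x) = r (q y)" for x y
  proof -
    have c: "absv ((a - b) / unif ^ N) \<le> 1" if "absv a \<le> 1" "absv b \<le> 1" "r a = r b" for a b
    proof -
      have "absv (a - b) \<le> absv (unif :: 'a) ^ N"
        using absv_diff_le[of "a - r a" _ "b - r b"] r[of a] r[of b] that by simp
      then show ?thesis by (simp add: absv_divide absv_power divide_le_eq)
    qed
    have "x - y = (p x - p y) *s u + (q x - q y) *s v"
      using pq[of x] pq[of y] by (metis (no_types, lifting) add_diff_add vec.scale_left_diff_distrib)
    moreover have "unif ^ N *s ((a / unif ^ N) *s u + (b / unif ^ N) *s v) = a *s u + b *s v" for a b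
      by (simp add: vec.scale_right_distrib vector_smult_assoc)
    ultimately have "x - y = unif ^ N *s (((p x - p y) / unif ^ N) *s u + ((q x - q y) / unif ^ N) *s v)"
      by (simp only:)
    moreover have "((p x - p y) / unif ^ N) *s u + ((q x - q y) / unif ^ N) *s v \<in> ?L"
      using c pq1[OF x] pq1[OF y] eq by (intro latI) auto
    ultimately show ?thesis by blast
  qed
  \<comment> \<open>The coordinates of the images of \<open>u\<close> and \<open>v\<close>, recorded
    modulo \<open>unif ^ N\<close>, take only finitely many values.\<close>
  define f where "f g = (r (p (B g *v u)), r (q (B g *v u)), r (p (B g *v v)), r (q (B g *v v)))" for g
  have "inj_on f ?S"
  proof (rule inj_onI)
    fix g h assume gh: "g \<in> ?S" "h \<in> ?S" "f g = f h"
    have Bg: "g = cls (B g)" "invertible (B g)" and Bh: "h = cls (B h)" "invertible (B h)" "(*v) (B h) ` ?L = ?L"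
      using B[OF gh(1)] B[OF gh(2)] by auto
    obtain C where C: "invertible C" "inv\<^bsub>PGL2\<^esub> (cls (B h)) = cls C" "C ** B h = mat 1"
      using inv_cls[OF Bh(2)] by blast
    \<comment> \<open>Here \<open>C ** B g\<close> represents the quotient of \<open>g\<close> by
      \<open>h\<close>. Equal records put the difference of \<open>B g\<close> and
      \<open>B h\<close> on basis vectors into \<open>unif ^ N\<close> times the lattice, and
      \<open>C\<close> keeps it there because it preserves the lattice.\<close>
    define D where "D = C ** B g - mat 1"
    have Dx: "D *v x = C *v (B g *v x - B h *v x)" for x
      by (simp add: D_def matrix_vector_mult_diff_rdistrib matrix_vector_mult_diff_distrib matrix_vector_mul_assoc C(3))
    have CL: "C *v y \<in> (*s) (unif ^ N) ` ?L" if y: "y \<in> (*s) (unif ^ N) ` ?L" for y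
    proof -
      obtain w where w: "w \<in> ?L" "y = unif ^ N *s w" using y by blast
      then have "w \<in> (*v) (B h) ` ?L" using Bh(3) by simp
      then obtain z where "z \<in> ?L" "y = unif ^ N *s (B h *v z)" using w(2) by blast
      moreover from this have "C *v y = unif ^ N *s z"
        by (simp add: vector_scalar_commute matrix_vector_mul_assoc C(3))
      ultimately show ?thesis by blast
    qed
    have "D *v u \<in> (*s) (unif ^ N) ` ?L" "D *v v \<in> (*s) (unif ^ N) ` ?L"
      unfolding Dx by (rule CL, rule close[OF BL(1)[OF gh(1)] BL(1)[OF gh(2)]], use gh(3) in \<open>simp_all add: f_def\<close>)
        (rule CL, rule close[OF BL(2)[OF gh(1)] BL(2)[OF gh(2)]], use gh(3) in \<open>simp_all add: f_def\<close>)
    then have small: "absv ((C ** B g) $ i $ j - mat 1 $ i $ j) < e" for i j using N[of D i j] by (simp add: D_def)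
    have eq: "cls (C ** B g) = inv\<^bsub>PGL2\<^esub> h \<otimes>\<^bsub>PGL2\<^esub> g" 
      using cls_mult[OF C(1) Bg(2)] C(2) Bg(1) Bh(1) by metis
    moreover have "inv\<^bsub>PGL2\<^esub> h \<otimes>\<^bsub>PGL2\<^esub> g \<in> \<Gamma>"
      using gh sub by (simp add: subgroup.m_closed subgroup.m_inv_closed)
    ultimately have "inv\<^bsub>PGL2\<^esub> h \<otimes>\<^bsub>PGL2\<^esub> g = \<one>\<^bsub>PGL2\<^esub>" using e(2)[OF _ small] by simp
    moreover have "g \<in> carrier PGL2" "h \<in> carrier PGL2" using gh sub subgroup.subset by blast+
    ultimately show "g = h" by (metis PGL2.inv_equality PGL2.inv_inv PGL2.inv_closed)
  qed
  moreover have "f ` ?S \<subseteq> R \<times> R \<times> R \<times> R" unfolding f_def using r pq1 BL by blast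
  ultimately show ?thesis using R(1) by (meson finite_SigmaI finite_imageD finite_subset)
qed

section \<open>Eigenvectors and diagonalizability\<close>

lemma eigenvector_over_closure:
  fixes A :: "'a::alg_closed_field^2^2"
  obtains c v where "v \<noteq> 0" "A *v v = c *s v"
proof -
  \<comment> \<open>The characteristic polynomial. For a root \<open>c\<close>, any nonzero row of
    the matrix minus \<open>c\<close> yields a kernel vector.\<close>
  define P where "P = [:A $ 1 $ 1 * A $ 2 $ 2 - A $ 1 $ 2 * A $ 2 $ 1, - (A $ 1 $ 1 + A $ 2 $ 2), 1:]"
  obtain c where "poly P c = 0" using alg_closed_imp_poly_has_root[of P] by (auto simp: P_def)
  then have c: "(A $ 1 $ 1 - c) * (A $ 2 $ 2 - c) = A $ 1 $ 2 * A $ 2 $ 1" by (simp add: P_def algebra_simps)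
  have ev: "A *v x = c *s x" if "(A $ 1 $ 1 - c) * x $ 1 + A $ 1 $ 2 * x $ 2 = 0" "A $ 2 $ 1 * x $ 1 + (A $ 2 $ 2 - c) * x $ 2 = 0" for x :: "'a^2"
    using that by (auto simp: vec_eq_iff forall_2 matrix_vector_mult_def sum_2 algebra_simps add_eq_0_iff)
  show ?thesis
  proof (cases "A $ 1 $ 2 = 0 \<and> A $ 1 $ 1 = c")
    case False
    then have "vector [A $ 1 $ 2, c - A $ 1 $ 1] \<noteq> (0 :: 'a^2)" by (auto simp: vec_eq_iff forall_2)
    moreover have "A *v vector [A $ 1 $ 2, c - A $ 1 $ 1] = c *s vector [A $ 1 $ 2, c - A $ 1 $ 1]"
      by (rule ev) (use c in \<open>simp_all add: algebra_simps\<close>)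
    ultimately show ?thesis using that by blast
  next
    case True
    show ?thesis
    proof (cases "A $ 2 $ 1 = 0 \<and> A $ 2 $ 2 = c")
      case False
      then have "vector [c - A $ 2 $ 2, A $ 2 $ 1] \<noteq> (0 :: 'a^2)" by (auto simp: vec_eq_iff forall_2)
      moreover have "A *v vector [c - A $ 2 $ 2, A $ 2 $ 1] = c *s vector [c - A $ 2 $ 2, A $ 2 $ 1]"
        by (rule ev) (use True in \<open>simp_all add: algebra_simps\<close>)
      ultimately show ?thesis using that by blast
    next
      case False': True
      have "A *v axis 1 1 = c *s axis 1 1" by (rule ev) (use True False' in auto)
      then show ?thesis using that[of "axis 1 1" c] by (simp add: axis_eq_0_iff)
    qed
  qed
qed

text \<open>By assumption an eigenvector over the closure is a multiple of a vector over the field;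
  comparing one nonzero coordinate shows that the eigenvalue lies in the field too.\<close>

lemma rational_eigenvector:
  fixes A :: "'a::padic_field^2^2"
  assumes \<Gamma>: "fixed_points_rational \<Gamma>" and A: "cls A \<in> \<Gamma>" "cls A \<noteq> \<one>\<^bsub>PGL2\<^esub>"
  obtains e \<alpha> where "e \<noteq> 0" "A *v e = \<alpha> *s e"
proof -
  let ?A = "(\<chi> i j. to_ac (A $ i $ j)) :: 'a alg_closure^2^2"
  obtain c v where v: "v \<noteq> 0" "?A *v v = c *s v" by (rule eigenvector_over_closure)
  have "cls A \<in> \<Gamma> - {\<one>\<^bsub>PGL2\<^esub>}" using A by simp
  moreover have "v \<noteq> 0 \<and> (\<exists>c. ?A *v v = c *s v)" using v by blast
  ultimately have "\<exists>c u. c \<noteq> 0 \<and> v = c *s (\<chi> i. to_ac (u $ i))"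
    by (rule \<Gamma>[unfolded fixed_points_rational_def, rule_format, OF _ cls_self])
  then obtain d u where u: "d \<noteq> 0" "v = d *s (\<chi> i. to_ac (u $ i))" by (elim exE conjE)
  let ?u = "(\<chi> i. to_ac (u $ i)) :: 'a alg_closure^2"
  have Au: "?A *v ?u = (\<chi> i. to_ac ((A *v u) $ i))"
    by (simp add: vec_eq_iff forall_2 matrix_vector_mult_def sum_2)
  have "d *s (?A *v ?u) = d *s (c *s ?u)"
    using v(2) unfolding u(2) by (simp add: vector_scalar_commute vector_smult_assoc mult.commute)
  then have eq: "?A *v ?u = c *s ?u" using u(1) vec.scale_left_imp_eq by blast
  have "u \<noteq> 0" using v(1) u(2) by (auto simp: vec_eq_iff)
  then obtain i where i: "u $ i \<noteq> 0" by (auto simp: vec_eq_iff)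
  have "to_ac ((A *v u) $ k) = c * to_ac (u $ k)" for k using eq unfolding Au by (simp add: vec_eq_iff)
  note eqk = this
  define \<alpha> where "\<alpha> = (A *v u) $ i / u $ i"
  have "c = to_ac \<alpha>" using eqk[of i] i by (simp add: \<alpha>_def)
  then have "to_ac ((A *v u) $ k) = to_ac (\<alpha> * u $ k)" for k using eqk[of k] by simp
  then have "(A *v u) $ k = \<alpha> * u $ k" for k unfolding to_ac_eq_iff .
  then have "A *v u = \<alpha> *s u" by (simp add: vec_eq_iff)
  then show ?thesis using that \<open>u \<noteq> 0\<close> by blast
qed

text \<open>
  A unipotent element would fix a vertex, hence have finite order, which is impossible in
  characteristic 0. So every nontrivial element is diagonalizable.
\<close>

lemma two_eigenvectors:
  fixes A :: "'a::padic_field^2^2"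
  assumes \<Gamma>: "discrete_subgroup \<Gamma>" "fixed_points_rational \<Gamma>"
    and A: "invertible A" "cls A \<in> \<Gamma>" "cls A \<noteq> \<one>\<^bsub>PGL2\<^esub>"
  obtains e1 e2 \<alpha> \<beta> where "cr e1 e2 \<noteq> 0" "\<alpha> \<noteq> \<beta>" "A *v e1 = \<alpha> *s e1" "A *v e2 = \<beta> *s e2"
proof -
  have sub: "subgroup \<Gamma> PGL2" using \<Gamma> by (simp add: discrete_subgroup_def)
  obtain e1 \<alpha> where e1: "e1 \<noteq> 0" "A *v e1 = \<alpha> *s e1" using rational_eigenvector[OF \<Gamma>(2) A(2,3)] .
  have a0: "\<alpha> \<noteq> 0"
  proof
    assume "\<alpha> = 0"
    then have "A *v e1 = A *v 0" using e1(2) by simp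
    then show False using matrix_inj[OF A(1)] e1(1) by blast
  qed
  obtain w where w: "cr e1 w \<noteq> 0" using cr_exists[OF e1(1)] by blast
  define \<delta> \<beta> where "\<delta> = cr (A *v w) w / cr e1 w" and "\<beta> = cr e1 (A *v w) / cr e1 w"
  have Aw: "A *v w = \<delta> *s e1 + \<beta> *s w" unfolding \<delta>_def \<beta>_def by (rule cr_coords[OF w])
  show ?thesis
  proof (cases "\<beta> = \<alpha>")
    case False
    \<comment> \<open>Chosen to make \<open>w + t *s e1\<close> an eigenvector.\<close>
    define t where "t = \<delta> / (\<beta> - \<alpha>)"
    have t: "\<delta> + t * \<alpha> = \<beta> * t" using False by (simp add: t_def field_simps)
    have "A *v (1 *s w + t *s e1) = 1 *s (\<delta> *s e1 + \<beta> *s w) + t *s (\<alpha> *s e1)" by (simp only: matrix_comb Aw e1)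
    also have "\<dots> = (\<delta> + t * \<alpha>) *s e1 + \<beta> *s w" by (simp add: vec_eq_iff algebra_simps)
    also have "\<dots> = \<beta> *s (1 *s w + t *s e1)" unfolding t by (simp add: vec_eq_iff algebra_simps)
    finally show ?thesis using that[of e1 "1 *s w + t *s e1" \<alpha> \<beta>] w False e1 by simp
  next
    case True
    show ?thesis
    proof (cases "\<delta> = 0")
      case True
      have "A *v x = mat \<alpha> *v x" for x
      proof -
        have x: "x = (cr x w / cr e1 w) *s e1 + (cr e1 x / cr e1 w) *s w" by (rule cr_coords[OF w])
        have "A *v ((cr x w / cr e1 w) *s e1 + (cr e1 x / cr e1 w) *s w) = \<alpha> *s ((cr x w / cr e1 w) *s e1 + (cr e1 x / cr e1 w) *s w)"
          unfolding matrix_comb Aw e1(2) using True \<open>\<beta> = \<alpha>\<close> by (simp add: vec_eq_iff algebra_simps)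
        then show ?thesis using x mat_mult_vec by metis
      qed
      then have "A = mat \<alpha>" by (simp add: matrix_eq)
      then show ?thesis using A(3) a0 cls_eq_one_iff by blast
    next
      case False
      \<comment> \<open>Rescaled so that \<open>A\<close> acts on \<open>e1\<close> and
        \<open>e2\<close> as \<open>\<alpha>\<close> times the unipotent matrix with entry 1, which
        preserves \<open>lat e1 e2\<close>.\<close>
      define e2 where "e2 = (\<alpha> / \<delta>) *s w"
      have e12: "cr e1 e2 \<noteq> 0" using w a0 False by (simp add: e2_def)
      have Ae2: "A *v e2 = \<alpha> *s (e2 + e1)"
        using False True by (simp add: e2_def vector_scalar_commute Aw vec_eq_iff algebra_simps)
      let ?S = "{g \<in> \<Gamma>. vertex_act g (vtx e1 e2) = vtx e1 e2}"
      define B where "B n = ((**) A ^^ n) (mat 1)" for n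
      have B_Suc: "B (Suc n) = A ** B n" and B_0: "B 0 = mat 1" for n by (simp_all add: B_def)
      have Binv: "invertible (B n)" for n
        by (induction n) (simp_all add: B_0 B_Suc A(1) invertible_mult invertible_mat)
      have "vtx (A *v e1) (A *v e2) = vtx e1 e2"
      proof -
        have "vtx (A *v e1) (A *v e2) = vtx e1 (e2 + e1)" unfolding e1(2) Ae2 by (rule vtx_scale[OF a0])
        moreover have "lat e1 (e2 + e1) = lat e1 e2"
        proof (rule lat_eqI)
          show "e2 + e1 \<in> lat e1 e2" using latI[of 1 1 e1 e2] by (simp add: add.commute)
          show "e2 \<in> lat e1 (e2 + e1)" using latI[of "-1" 1 e1 "e2 + e1"] by simp
        qed simp_all
        ultimately show ?thesis by (simp add: vtx_def)
      qed
      then have "cls (B n) \<in> ?S" for n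
      proof (induction n)
        case 0
        show ?case using subgroup.one_closed[OF sub] by (simp add: B_0 cls_one[symmetric] vertex_act_cls)
      next
        case (Suc n)
        have "cls (B (Suc n)) = cls A \<otimes>\<^bsub>PGL2\<^esub> cls (B n)" using A(1) Binv by (simp add: B_Suc cls_mult)
        then show ?case using Suc A(2) subgroup.m_closed[OF sub] by (auto simp: vertex_act_mult vertex_act_cls)
      qed
      \<comment> \<open>All powers of \<open>A\<close> fix this vertex, so two of them define the
        same element. Comparing their action on \<open>e1\<close> and \<open>e2\<close> makes the
        exponents equal in the field, which has characteristic 0.\<close>
      then have "range (\<lambda>n. cls (B n)) \<subseteq> ?S" by blast
      then have "finite (range (\<lambda>n. cls (B n)))" using finite_stabilizer[OF \<Gamma>(1) e12] finite_subset by blast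
      then have "\<not> inj (\<lambda>n. cls (B n))" using finite_imageD infinite_UNIV_nat by blast
      then obtain m n where mn: "cls (B m) = cls (B n)" "m \<noteq> n" by (auto simp: inj_on_def)
      have B1: "B n *v e1 = \<alpha> ^ n *s e1" for n
        by (induction n) (simp_all add: B_0 B_Suc e1 vector_scalar_commute vector_smult_assoc mult.commute flip: matrix_vector_mul_assoc)
      have B2: "B n *v e2 = \<alpha> ^ n *s (e2 + of_nat n *s e1)" for n
      proof (induction n)
        case 0
        show ?case by (simp add: B_0)
      next
        case (Suc n)
        have "B (Suc n) *v e2 = \<alpha> ^ n *s (A *v (1 *s e2 + of_nat n *s e1))"
          using Suc by (simp only: B_Suc matrix_vector_mul_assoc[symmetric] vector_scalar_commute vector_smult_lid)
        also have "\<dots> = \<alpha> ^ Suc n *s (e2 + of_nat (Suc n) *s e1)"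
          unfolding matrix_comb Ae2 e1(2) by (simp add: vec_eq_iff algebra_simps)
        finally show ?case .
      qed
      obtain c where c: "c \<noteq> 0" "B n = mat c ** B m" using cls_self[of "B n"] mn(1) unfolding cls_def by blast
      have "\<alpha> ^ n *s e1 = (c * \<alpha> ^ m) *s e1"
      proof -
        have "B n *v e1 = c *s (B m *v e1)" unfolding c(2) by (simp add: mat_mult_vec flip: matrix_vector_mul_assoc)
        then show ?thesis by (simp only: B1 vector_smult_assoc)
      qed
      then have ca: "\<alpha> ^ n = c * \<alpha> ^ m" using e1(1) by (metis vec.scale_cancel_right)
      have "\<alpha> ^ n *s (e2 + of_nat n *s e1) = (c * \<alpha> ^ m) *s (e2 + of_nat m *s e1)"
      proof -
        have "B n *v e2 = c *s (B m *v e2)" unfolding c(2) by (simp add: mat_mult_vec flip: matrix_vector_mul_assoc)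
        then show ?thesis by (simp only: B2 vector_smult_assoc)
      qed
      then have "(of_nat n :: 'a) *s e1 = of_nat m *s e1" unfolding ca[symmetric] using a0 by simp
      then have "(of_nat n :: 'a) = of_nat m" using e1(1) by (metis vec.scale_cancel_right)
      then show ?thesis using mn(2) by simp
    qed
  qed
qed

section \<open>Mirrors and the tree of a discrete group\<close>

lemma (in group) conj_eq_one:
  assumes "g \<in> carrier G" "h \<in> carrier G" "h \<otimes> g \<otimes> inv h = \<one>"
  shows "g = \<one>"
proof -
  have "h \<otimes> g = (h \<otimes> g \<otimes> inv h) \<otimes> h" using assms(1,2) by (simp add: m_assoc)
  also have "\<dots> = h \<otimes> \<one>" using assms by simp
  finally show ?thesis using assms(1,2) by (simp only: l_cancel one_closed)
qed

lemma eigen_independent: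
  assumes "e1 \<noteq> 0" "e2 \<noteq> 0" "\<alpha> \<noteq> \<beta>" "A *v e1 = \<alpha> *s e1" "A *v e2 = \<beta> *s (e2 :: 'a::field^2)"
  shows "cr e1 e2 \<noteq> 0"
proof
  assume "cr e1 e2 = 0"
  then obtain c where c: "e2 = c *s e1" using cr_eq_0_iff[OF assms(1)] by blast
  have "\<beta> *s e2 = c *s (A *v e1)" using assms(5) c by (simp add: vector_scalar_commute)
  also have "\<dots> = \<alpha> *s e2" by (simp add: assms(4) c vector_smult_assoc mult.commute)
  finally have "\<beta> *s e2 = \<alpha> *s e2" .
  then show False using assms(2,3) by (simp add: vec.scale_cancel_right)
qed

lemma elliptic_iff:
  assumes "g \<in> carrier PGL2"
  shows "elliptic g \<longleftrightarrow> (\<exists>A \<alpha> \<beta> e1 e2. invertible A \<and> g = cls A \<and> \<alpha> \<noteq> \<beta> \<and> absv \<alpha> = absv \<beta> \<and>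
      cr e1 e2 \<noteq> 0 \<and> A *v e1 = \<alpha> *s e1 \<and> A *v e2 = \<beta> *s e2)"
proof
  assume "elliptic g"
  then obtain A a b v w where *: "A \<in> g" "a \<noteq> b" "absv a = absv b" "v \<noteq> 0" "A *v v = a *s v" "w \<noteq> 0" "A *v w = b *s w"
    unfolding elliptic_def by blast
  then show "\<exists>A \<alpha> \<beta> e1 e2. invertible A \<and> g = cls A \<and> \<alpha> \<noteq> \<beta> \<and> absv \<alpha> = absv \<beta> \<and>
      cr e1 e2 \<noteq> 0 \<and> A *v e1 = \<alpha> *s e1 \<and> A *v e2 = \<beta> *s e2"
    using cls_eqI[OF assms *(1)] eigen_independent[of v w a b A] by blast
next
  assume "\<exists>A \<alpha> \<beta> e1 e2. invertible A \<and> g = cls A \<and> \<alpha> \<noteq> \<beta> \<and> absv \<alpha> = absv \<beta> \<and>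
      cr e1 e2 \<noteq> 0 \<and> A *v e1 = \<alpha> *s e1 \<and> A *v e2 = \<beta> *s e2"
  then obtain A \<alpha> \<beta> e1 e2 where "g = cls A" "\<alpha> \<noteq> \<beta>" "absv \<alpha> = absv \<beta>" "cr e1 e2 \<noteq> 0" "A *v e1 = \<alpha> *s e1" "A *v e2 = \<beta> *s e2"
    by blast
  moreover from this have "e1 \<noteq> 0" "e2 \<noteq> 0" by auto
  ultimately show "elliptic g" unfolding elliptic_def using cls_self by blast
qed

lemma mirror_eq: "mirror g = \<lparr>verts = ends_verts (\<Union>(fixed_points g)), edges = ends_edges (\<Union>(fixed_points g)), endpoints = id\<rparr>"
  unfolding mirror_def by (rule tree_of_ends_eq[OF fixed_points_P1])

lemma eigenvector_cases:
  assumes A: "cr e1 e2 \<noteq> 0" "\<alpha> \<noteq> \<beta>" "A *v e1 = \<alpha> *s e1" "A *v e2 = \<beta> *s (e2 :: 'a::field^2)"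
    and x: "A *v x = c *s x"
  shows "(\<exists>a. x = a *s e1) \<or> (\<exists>b. x = b *s e2)"
proof -
  define a b where "a = cr x e2 / cr e1 e2" and "b = cr e1 x / cr e1 e2"
  have xx: "x = a *s e1 + b *s e2" unfolding a_def b_def by (rule cr_coords[OF A(1)])
  have "(a * \<alpha>) *s e1 + (b * \<beta>) *s e2 = (c * a) *s e1 + (c * b) *s e2"
    using x unfolding xx matrix_comb A(3,4) by (simp add: vector_smult_assoc vec.scale_right_distrib)
  from arg_cong[OF this, of "\<lambda>y. cr y e2"] arg_cong[OF this, of "\<lambda>y. cr e1 y"]
  have "a * \<alpha> = c * a" "b * \<beta> = c * b" using A(1) by simp_all
  then have "a = 0 \<or> b = 0" using A(2) by (auto simp: mult.commute)
  then show ?thesis using xx by auto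
qed

text \<open>The only fixed points are the two eigenlines, and a common scalar of a pair of vectors
  does not change the vertex.\<close>

lemma mirror_verts:
  assumes A: "invertible A" "cr e1 e2 \<noteq> (0 :: 'a::padic_field)" "\<alpha> \<noteq> \<beta>" "A *v e1 = \<alpha> *s e1" "A *v e2 = \<beta> *s e2"
  shows "verts (mirror (cls A)) = {vtx e1 (c *s e2) | c. c \<noteq> 0}"
proof (intro Set.equalityI subsetI)
  fix x assume "x \<in> verts (mirror (cls A))"
  then obtain u v where uv: "x = vtx u v" "u \<in> \<Union>(fixed_points (cls A))" "v \<in> \<Union>(fixed_points (cls A))" "cr u v \<noteq> 0"
    unfolding mirror_eq ends_verts_def by auto
  then have "u \<noteq> 0" "v \<noteq> 0" by auto
  then have "\<exists>c. A *v u = c *s u" "\<exists>c. A *v v = c *s v" using fixed_points_iff[OF A(1)] uv(2,3) by blast+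
  then have "((\<exists>a. u = a *s e1) \<or> (\<exists>b. u = b *s e2)) \<and> ((\<exists>a. v = a *s e1) \<or> (\<exists>b. v = b *s e2))"
    using eigenvector_cases[OF A(2-5)] by blast
  then consider a b where "u = a *s e1" "v = b *s e2" | a b where "u = b *s e2" "v = a *s e1"
    using uv(4) by auto
  then show "x \<in> {vtx e1 (c *s e2) | c. c \<noteq> 0}"
  proof cases
    case 1
    then have ab: "a \<noteq> 0" "b \<noteq> 0" using uv(4) by auto
    have "v = a *s ((b / a) *s e2)" using 1 ab by (simp add: vector_smult_assoc)
    then have "x = vtx e1 ((b / a) *s e2)" using uv(1) 1 vtx_scale[OF ab(1)] by metis
    then show ?thesis using ab by (intro CollectI exI[of _ "b / a"]) simp
  next
    case 2
    then have ab: "a \<noteq> 0" "b \<noteq> 0" using uv(4) by auto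
    have "u = a *s ((b / a) *s e2)" using 2 ab by (simp add: vector_smult_assoc)
    then have "x = vtx e1 ((b / a) *s e2)" using uv(1) 2 vtx_scale[OF ab(1)] vtx_commute by metis
    then show ?thesis using ab by (intro CollectI exI[of _ "b / a"]) simp
  qed
next
  fix x assume "x \<in> {vtx e1 (c *s e2) | c. c \<noteq> 0}"
  then obtain c where c: "c \<noteq> 0" "x = vtx e1 (c *s e2)" by blast
  have nz: "e1 \<noteq> 0" "c *s e2 \<noteq> 0" using A(2) c(1) by auto
  have "A *v (c *s e2) = \<beta> *s (c *s e2)" using A(5) by (simp add: vector_scalar_commute vector_smult_assoc mult.commute)
  then have "e1 \<in> \<Union>(fixed_points (cls A))" "c *s e2 \<in> \<Union>(fixed_points (cls A))"
    using fixed_points_iff[OF A(1) nz(1)] fixed_points_iff[OF A(1) nz(2)] A(4) by blast+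
  moreover have "cr e1 (c *s e2) \<noteq> 0" using A(2) c(1) by simp
  ultimately have "x \<in> ends_verts (\<Union>(fixed_points (cls A)))" unfolding ends_verts_def using c(2) by blast
  then show "x \<in> verts (mirror (cls A))" by (simp add: mirror_eq)
qed

text \<open>Relative to \<open>e1\<close>, the vector \<open>e2\<close> is multiplied by
  \<open>\<beta> / \<alpha>\<close>, a unit, which does not change the lattice.\<close>

lemma elliptic_fixes_mirror:
  assumes g: "g \<in> carrier PGL2" "elliptic g" and x: "x \<in> verts (mirror g)"
  shows "vertex_act g x = x"
proof -
  obtain A \<alpha> \<beta> e1 e2 where A: "invertible A" "g = cls A" "\<alpha> \<noteq> \<beta>" "absv \<alpha> = absv \<beta>"
    "cr e1 e2 \<noteq> 0" "A *v e1 = \<alpha> *s e1" "A *v e2 = \<beta> *s e2" using g(2) unfolding elliptic_iff[OF g(1)] by blast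
  then obtain c where c: "c \<noteq> 0" "x = vtx e1 (c *s e2)" using x mirror_verts[OF A(1,5,3,6,7)] by auto
  have a0: "\<alpha> \<noteq> 0" using A(3,4) by (metis absv_eq_0)
  have "vertex_act g x = vtx (\<alpha> *s e1) (\<alpha> *s ((\<beta> / \<alpha>) *s (c *s e2)))"
    using A a0 by (simp add: c(2) vertex_act_cls vector_scalar_commute vector_smult_assoc mult_ac)
  also have "\<dots> = vtx e1 ((\<beta> / \<alpha>) *s (c *s e2))" by (rule vtx_scale[OF a0])
  also have "\<dots> = vtx (1 *s e1) ((\<beta> / \<alpha>) *s (c *s e2))" by simp
  also have "\<dots> = vtx e1 (c *s e2)" unfolding vtx_def using A(4) a0 by (subst lat_units) (auto simp: absv_divide)
  finally show ?thesis by (simp add: c(2))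
qed

lemma fixed_points_conj:
  assumes "invertible A" "invertible B" "A ** C = mat 1" "C ** A = mat 1" "x \<noteq> (0 :: 'a::field^2)"
  shows "x \<in> \<Union>(fixed_points (cls B)) \<Longrightarrow> A *v x \<in> \<Union>(fixed_points (cls (A ** B ** C)))"
proof -
  assume "x \<in> \<Union>(fixed_points (cls B))"
  then obtain c where c: "B *v x = c *s x" using fixed_points_iff[OF assms(2,5)] by blast
  have iC: "invertible C" using assms by (auto simp: invertible_def)
  have inv: "invertible (A ** B ** C)" using assms(1,2) iC by (simp add: invertible_mult)
  have "C *v (A *v x) = x" by (simp add: matrix_vector_mul_assoc assms(4))
  then have "(A ** B ** C) *v (A *v x) = c *s (A *v x)"
    using c by (simp add: vector_scalar_commute flip: matrix_vector_mul_assoc)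
  moreover have "A *v x \<noteq> 0" using matrix_inj[OF assms(1), of x 0] assms(5) by simp
  ultimately show ?thesis using iffD2[OF fixed_points_iff[OF inv] exI[of _ c]] by simp
qed

lemma ends_act:
  assumes A: "invertible A" and UV: "\<And>x. x \<in> U \<Longrightarrow> x \<noteq> 0 \<Longrightarrow> A *v x \<in> V"
  shows "x \<in> ends_verts U \<Longrightarrow> vertex_act (cls A) x \<in> ends_verts V"
    and "e \<in> ends_edges U \<Longrightarrow> vertex_act (cls A) ` e \<in> ends_edges V"
proof -
  have *: "A *v u \<in> V \<and> A *v v \<in> V \<and> cr (A *v u) (A *v v) \<noteq> 0" if "u \<in> U" "v \<in> U" "cr u v \<noteq> 0" for u v
  proof -
    have "u \<noteq> 0" "v \<noteq> 0" using that by auto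
    then show ?thesis using that UV cr_matrix_nonzero[OF A] by blast
  qed
  show "x \<in> ends_verts U \<Longrightarrow> vertex_act (cls A) x \<in> ends_verts V"
    using * unfolding ends_verts_def by (fastforce simp: vertex_act_cls)
  assume "e \<in> ends_edges U"
  then obtain u v where uv: "e = {vtx u v, vtx u (unif *s v)}" "u \<in> U" "v \<in> U" "cr u v \<noteq> 0" unfolding ends_edges_def by blast
  then have "vertex_act (cls A) ` e = {vtx (A *v u) (A *v v), vtx (A *v u) (unif *s (A *v v))}"
    by (simp add: vertex_act_cls vector_scalar_commute)
  then show "vertex_act (cls A) ` e \<in> ends_edges V" using *[OF uv(2-4)] unfolding ends_edges_def by blast
qed

lemma conj_matrix:
  assumes g: "g \<in> carrier PGL2" and h: "h \<in> carrier PGL2"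
  obtains A B C where "invertible A" "invertible B" "h = cls A" "g = cls B" "A ** C = mat 1" "C ** A = mat 1"
    "h \<otimes>\<^bsub>PGL2\<^esub> g \<otimes>\<^bsub>PGL2\<^esub> inv\<^bsub>PGL2\<^esub> h = cls (A ** B ** C)"
proof -
  obtain A where A: "invertible A" "h = cls A" using h by (rule PGL2_cases)
  obtain B where B: "invertible B" "g = cls B" using g by (rule PGL2_cases)
  obtain C where C: "invertible C" "inv\<^bsub>PGL2\<^esub> (cls A) = cls C" "A ** C = mat 1" "C ** A = mat 1"
    using inv_cls[OF A(1)] by blast
  have "h \<otimes>\<^bsub>PGL2\<^esub> g \<otimes>\<^bsub>PGL2\<^esub> inv\<^bsub>PGL2\<^esub> h = cls (A ** B ** C)"
    using A B C by (simp add: cls_mult invertible_mult)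
  then show ?thesis using that A B C by blast
qed

lemma mirror_conj:
  assumes g: "g \<in> carrier PGL2" and h: "h \<in> carrier PGL2"
  shows "x \<in> verts (mirror g) \<Longrightarrow> vertex_act h x \<in> verts (mirror (h \<otimes>\<^bsub>PGL2\<^esub> g \<otimes>\<^bsub>PGL2\<^esub> inv\<^bsub>PGL2\<^esub> h))"
    and "e \<in> edges (mirror g) \<Longrightarrow> vertex_act h ` e \<in> edges (mirror (h \<otimes>\<^bsub>PGL2\<^esub> g \<otimes>\<^bsub>PGL2\<^esub> inv\<^bsub>PGL2\<^esub> h))"
proof -
  obtain A B C where *: "invertible A" "invertible B" "h = cls A" "g = cls B" "A ** C = mat 1" "C ** A = mat 1"
    "h \<otimes>\<^bsub>PGL2\<^esub> g \<otimes>\<^bsub>PGL2\<^esub> inv\<^bsub>PGL2\<^esub> h = cls (A ** B ** C)" using conj_matrix[OF g h] .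
  have "A *v x \<in> \<Union>(fixed_points (cls (A ** B ** C)))" if "x \<in> \<Union>(fixed_points (cls B))" "x \<noteq> 0" for x
    using fixed_points_conj[OF *(1,2,5,6)] that by blast
  note key = this
  have c: "h \<otimes>\<^bsub>PGL2\<^esub> g \<otimes>\<^bsub>PGL2\<^esub> inv\<^bsub>PGL2\<^esub> h = cls (A ** B ** C)" by (rule *(7))
  show "vertex_act h x \<in> verts (mirror (h \<otimes>\<^bsub>PGL2\<^esub> g \<otimes>\<^bsub>PGL2\<^esub> inv\<^bsub>PGL2\<^esub> h))" if "x \<in> verts (mirror g)"
    unfolding c unfolding mirror_eq *(3) ugraph.simps
    by (rule ends_act(1)[OF *(1) key]) (use that in \<open>simp_all add: mirror_eq *(4)\<close>)
  show "vertex_act h ` e \<in> edges (mirror (h \<otimes>\<^bsub>PGL2\<^esub> g \<otimes>\<^bsub>PGL2\<^esub> inv\<^bsub>PGL2\<^esub> h))" if "e \<in> edges (mirror g)"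
    unfolding c unfolding mirror_eq *(3) ugraph.simps
    by (rule ends_act(2)[OF *(1) key]) (use that in \<open>simp_all add: mirror_eq *(4)\<close>)
qed

lemma elliptic_conj:
  assumes g: "g \<in> carrier PGL2" "elliptic g" and h: "h \<in> carrier PGL2"
  shows "elliptic (h \<otimes>\<^bsub>PGL2\<^esub> g \<otimes>\<^bsub>PGL2\<^esub> inv\<^bsub>PGL2\<^esub> h)"
proof -
  obtain B \<alpha> \<beta> e1 e2 where B: "invertible B" "g = cls B" "\<alpha> \<noteq> \<beta>" "absv \<alpha> = absv \<beta>"
    "cr e1 e2 \<noteq> 0" "B *v e1 = \<alpha> *s e1" "B *v e2 = \<beta> *s e2" using g(2) unfolding elliptic_iff[OF g(1)] by blast
  obtain A where A: "invertible A" "h = cls A" using h by (rule PGL2_cases)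
  obtain C where C: "invertible C" "inv\<^bsub>PGL2\<^esub> (cls A) = cls C" "A ** C = mat 1" "C ** A = mat 1"
    using inv_cls[OF A(1)] by blast
  have eq: "h \<otimes>\<^bsub>PGL2\<^esub> g \<otimes>\<^bsub>PGL2\<^esub> inv\<^bsub>PGL2\<^esub> h = cls (A ** B ** C)"
    using A B C by (simp add: cls_mult invertible_mult)
  have ev: "(A ** B ** C) *v (A *v x) = c *s (A *v x)" if "B *v x = c *s x" for x c
  proof -
    have "C *v (A *v x) = x" by (simp add: matrix_vector_mul_assoc C(4))
    then show ?thesis using that by (simp add: vector_scalar_commute flip: matrix_vector_mul_assoc)
  qed
  have "cr (A *v e1) (A *v e2) \<noteq> 0" using B(5) cr_matrix_nonzero[OF A(1)] by blast
  moreover have "invertible (A ** B ** C)" using A B C by (simp add: invertible_mult)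
  moreover have c: "h \<otimes>\<^bsub>PGL2\<^esub> g \<otimes>\<^bsub>PGL2\<^esub> inv\<^bsub>PGL2\<^esub> h \<in> carrier PGL2" using g h by simp
  ultimately show ?thesis unfolding elliptic_iff[OF c] using eq ev[OF B(6)] ev[OF B(7)] B(3,4) by blast
qed

lemma mirror_nonempty:
  assumes "g \<in> carrier PGL2" "elliptic g"
  shows "edges (mirror g) \<noteq> {}" "verts (mirror g) \<noteq> {}"
proof -
  obtain A \<alpha> \<beta> e1 e2 where A: "invertible A" "g = cls A" "\<alpha> \<noteq> \<beta>" "absv \<alpha> = absv \<beta>"
    "cr e1 e2 \<noteq> 0" "A *v e1 = \<alpha> *s e1" "A *v e2 = \<beta> *s e2" using assms(2) unfolding elliptic_iff[OF assms(1)] by blast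
  then have nz: "e1 \<noteq> 0" "e2 \<noteq> 0" by auto
  have "e1 \<in> \<Union>(fixed_points g)" "e2 \<in> \<Union>(fixed_points g)"
    unfolding A(2) using iffD2[OF fixed_points_iff[OF A(1) nz(1)] exI[of "\<lambda>c. A *v e1 = c *s e1", OF A(6)]]
      iffD2[OF fixed_points_iff[OF A(1) nz(2)] exI[of "\<lambda>c. A *v e2 = c *s e2", OF A(7)]] .
  then have "vtx e1 e2 \<in> ends_verts (\<Union>(fixed_points g))"
    "{vtx e1 e2, vtx e1 (unif *s e2)} \<in> ends_edges (\<Union>(fixed_points g))"
    using A(5) unfolding ends_edges_def ends_verts_def by blast+
  then show "edges (mirror g) \<noteq> {}" "verts (mirror g) \<noteq> {}" by (auto simp: mirror_eq)
qed

section \<open>Connectedness of trees spanned by ends\<close>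

lemma ends_verts_bt: "ends_verts U \<subseteq> verts bt_tree"
proof
  fix x assume "x \<in> ends_verts U"
  then show "x \<in> verts bt_tree" unfolding ends_verts_def verts_bt_iff by blast
qed

lemma ends_edges_bt: "ends_edges U \<subseteq> edges bt_tree"
proof
  fix x assume "x \<in> ends_edges U"
  then show "x \<in> edges bt_tree" unfolding ends_edges_def edges_bt_vtx by blast
qed

lemma ends_edges_verts:
  assumes U: "\<And>c x. x \<in> U \<Longrightarrow> c *s x \<in> U" and e: "e \<in> ends_edges U"
  shows "\<exists>x\<in>ends_verts U. \<exists>y\<in>ends_verts U. e = {x, y}"
proof -
  obtain u v where uv: "e = {vtx u v, vtx u (unif *s v)}" "u \<in> U" "v \<in> U" "cr u v \<noteq> 0"
    using e unfolding ends_edges_def by blast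
  moreover have "unif *s v \<in> U" "cr u (unif *s v) \<noteq> 0" using U uv by auto
  ultimately show ?thesis unfolding ends_verts_def by blast
qed

lemma ends_mono: "U \<subseteq> V \<Longrightarrow> ends_verts U \<subseteq> ends_verts V" "U \<subseteq> V \<Longrightarrow> ends_edges U \<subseteq> ends_edges V"
  unfolding ends_verts_def ends_edges_def by blast+

lemma line_edge_ends:
  assumes "\<And>c x. x \<in> U \<Longrightarrow> c *s x \<in> U" "u \<in> U" "v \<in> U" "cr u v \<noteq> 0"
  shows "line_edge (\<lambda>n. vtx u (unif powi n *s v)) n \<in> ends_edges U"
proof -
  have "unif powi n *s v \<in> U" "cr u (unif powi n *s v) \<noteq> 0" using assms by auto
  then show ?thesis unfolding line_edge_def unif_powi_add_1 ends_edges_def using assms(2) by blast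
qed

text \<open>Units do not change the lattice, so only the valuation of \<open>c\<close>
  matters.\<close>

lemma vtx_powi:
  assumes "c \<noteq> 0"
  obtains n :: int where "vtx u (c *s v) = vtx u (unif powi n *s (v :: 'a::padic_field^2))"
proof -
  obtain n :: int and d where d: "absv d = 1" "c = d * unif powi n" using unif_decomposition[OF assms] .
  have "lat (1 *s u) (d *s (unif powi n *s v)) = lat u (unif powi n *s v)" by (rule lat_units) (use d in auto)
  then have "vtx u (c *s v) = vtx u (unif powi n *s v)" by (simp add: vtx_def d(2) vector_smult_assoc)
  then show ?thesis using that by blast
qed

text \<open>Lines with the common end \<open>pt u\<close> coincide near it: write \<open>v\<close>
  in terms of \<open>u\<close> and \<open>w\<close>; after scaling by a high power of
  \<open>unif\<close> the component along \<open>u\<close> is integral and is absorbed by the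
  lattice.\<close>

lemma lines_meet:
  assumes "cr u v \<noteq> 0" "cr u w \<noteq> (0 :: 'a::padic_field)"
  obtains N and b where "b \<noteq> 0" "\<And>n. n \<ge> N \<Longrightarrow> vtx u (unif ^ n *s v) = vtx u ((unif ^ n * b) *s w)"
proof -
  define a b where "a = cr v w / cr u w" and "b = cr u v / cr u w"
  have v: "v = a *s u + b *s w" unfolding a_def b_def by (rule cr_coords[OF assms(2)])
  have b: "b \<noteq> 0" using assms by (simp add: b_def)
  have "(if a = 0 then 1 else inverse (absv a)) > 0" by simp
  then obtain N where N: "absv (unif :: 'a) ^ N < (if a = 0 then 1 else inverse (absv a))"
    by (rule unif_power_small)
  have "vtx u (unif ^ n *s v) = vtx u ((unif ^ n * b) *s w)" if "n \<ge> N" for n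
  proof -
    have "absv (unif :: 'a) ^ n \<le> absv (unif :: 'a) ^ N" using that absv_unif[where 'a = 'a] by (intro power_decreasing) auto
    then have "absv (unif ^ n * a) \<le> 1"
    proof (cases "a = 0")
      case False
      assume *: "absv (unif :: 'a) ^ n \<le> absv (unif :: 'a) ^ N"
      have "absv (unif ^ n * a) \<le> absv (unif :: 'a) ^ N * absv a"
        unfolding absv_mult absv_power by (rule mult_right_mono[OF *]) simp
      also have "\<dots> \<le> inverse (absv a) * absv a" using N False by (intro mult_right_mono) auto
      also have "\<dots> = 1" using False by simp
      finally show ?thesis .
    qed simp
    note a1 = this
    have eq: "unif ^ n *s v = (unif ^ n * a) *s u + (unif ^ n * b) *s w"
      unfolding v by (simp add: vec.scale_right_distrib vector_smult_assoc)
    have "lat u (unif ^ n *s v) = lat u ((unif ^ n * b) *s w)"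
    proof (rule lat_eqI)
      show "unif ^ n *s v \<in> lat u ((unif ^ n * b) *s w)"
        using latI[OF a1, of 1 u "(unif ^ n * b) *s w"] unfolding eq by simp
      show "(unif ^ n * b) *s w \<in> lat u (unif ^ n *s v)"
        using latI[of "- (unif ^ n * a)" 1 u "unif ^ n *s v"] a1 unfolding eq by simp
    qed simp_all
    then show ?thesis by (simp add: vtx_def)
  qed
  then show ?thesis using that b by blast
qed

lemma line_connected:
  assumes U: "\<And>c x. x \<in> U \<Longrightarrow> c *s x \<in> U" and uv: "u \<in> U" "v \<in> U" "cr u v \<noteq> 0" and c: "c \<noteq> 0" "d \<noteq> 0"
  shows "(vtx u (c *s v), vtx u (d *s v)) \<in> (adj (ends_edges U))\<^sup>*"
proof -
  let ?f = "\<lambda>n :: int. vtx u (unif powi n *s v)"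
  obtain m where m: "vtx u (c *s v) = ?f m" using vtx_powi[OF c(1)] .
  obtain n where n: "vtx u (d *s v) = ?f n" using vtx_powi[OF c(2)] .
  have *: "(?f a, ?f b) \<in> (adj (ends_edges U))\<^sup>*" if "a \<le> b" for a b
    using line_reach[OF that, of ?f] line_edge_ends[OF U uv] by blast
  show ?thesis
  proof (cases "m \<le> n")
    case True
    then show ?thesis using * m n by simp
  next
    case False
    then have "(?f n, ?f m) \<in> (adj (ends_edges U))\<^sup>*" using * by simp
    then show ?thesis unfolding m n by (rule adj_rtrancl_sym)
  qed
qed

text \<open>Two lines with a common end merge, and lines with ends in different directions are
  linked by the line joining an end of one to an end of the other.\<close>

lemma ends_connected:
  assumes U: "\<And>c x. x \<in> U \<Longrightarrow> c *s x \<in> U" and x: "x \<in> ends_verts U" and y: "y \<in> ends_verts U"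
  shows "(x, y) \<in> (adj (ends_edges (U :: ('a::padic_field^2) set)))\<^sup>*"
proof -
  let ?R = "(adj (ends_edges U))\<^sup>*"
  have b: "(vtx u v, vtx u w) \<in> ?R" if uvw: "u \<in> U" "v \<in> U" "w \<in> U" "cr u v \<noteq> 0" "cr u w \<noteq> 0" for u v w
  proof -
    obtain N b where N: "b \<noteq> 0" "\<And>n. n \<ge> N \<Longrightarrow> vtx u (unif ^ n *s v) = vtx u ((unif ^ n * b) *s w)"
      using lines_meet[OF uvw(4,5)] by metis
    have "(vtx u (1 *s v), vtx u (unif ^ N *s v)) \<in> ?R" by (rule line_connected[OF U uvw(1,2,4)]) simp_all
    moreover have "(vtx u ((unif ^ N * b) *s w), vtx u (1 *s w)) \<in> ?R" by (rule line_connected[OF U uvw(1,3,5)]) (use N(1) in simp_all)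
    ultimately show ?thesis using N(2)[of N] by (simp add: rtrancl_trans)
  qed
  obtain u v where uv: "x = vtx u v" "u \<in> U" "v \<in> U" "cr u v \<noteq> 0" using x unfolding ends_verts_def by blast
  obtain u' v' where uv': "y = vtx u' v'" "u' \<in> U" "v' \<in> U" "cr u' v' \<noteq> 0" using y unfolding ends_verts_def by blast
  show ?thesis
  proof (cases "cr u u' = 0")
    case False
    then have "(vtx u v, vtx u u') \<in> ?R" "(vtx u' u, vtx u' v') \<in> ?R"
      using uv uv' by (auto intro!: b simp: cr_swap[of u u'])
    then show ?thesis unfolding uv(1) uv'(1) using vtx_commute[of u u'] by (metis rtrancl_trans)
  next
    case True
    have "u \<noteq> 0" using uv(4) by auto
    then obtain c where c: "u' = c *s u" using True cr_eq_0_iff by blast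
    then have nz: "c \<noteq> 0" "cr u v' \<noteq> 0" using uv'(4) by auto
    have "(vtx u v, vtx u v') \<in> ?R" using uv uv' nz by (intro b)
    moreover have "(vtx u (1 *s v'), vtx u (inverse c *s v')) \<in> ?R"
      by (rule line_connected[OF U uv(2) uv'(3) nz(2)]) (use nz in simp_all)
    moreover have "vtx u' v' = vtx u (inverse c *s v')"
    proof -
      have "vtx (c *s u) (c *s (inverse c *s v')) = vtx u (inverse c *s v')" by (rule vtx_scale[OF nz(1)])
      then show ?thesis using nz(1) c by (simp add: vector_smult_assoc)
    qed
    ultimately show ?thesis unfolding uv(1) uv'(1) by (simp add: rtrancl_trans)
  qed
qed

lemma bt_verts_inj:
  assumes g: "g \<in> carrier PGL2"
  shows "inj_on (vertex_act g) (verts bt_tree)"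
proof (rule inj_on_inverseI)
  fix x :: "'a::padic_field vertex" assume x: "x \<in> verts bt_tree"
  have "vertex_act (inv\<^bsub>PGL2\<^esub> g) (vertex_act g x) = vertex_act (inv\<^bsub>PGL2\<^esub> g \<otimes>\<^bsub>PGL2\<^esub> g) x" by (simp only: vertex_act_mult)
  also have "\<dots> = x" using g x by (simp add: vertex_act_one)
  finally show "vertex_act (inv\<^bsub>PGL2\<^esub> g) (vertex_act g x) = x" .
qed

section \<open>The tree of a discrete group and minimal subtrees\<close>

definition fix_ends :: "('a::padic_field^2^2) set set \<Rightarrow> ('a^2) set" where
  "fix_ends \<Gamma> = \<Union>(\<Union>\<gamma>\<in>\<Gamma> - {\<one>\<^bsub>PGL2\<^esub>}. fixed_points \<gamma>)"

text \<open>From here on limits of fixed points have disappeared: every end that has to be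
  considered is fixed by a nontrivial element.\<close>

lemma T_star_eq: "T_star \<Gamma> = \<lparr>verts = ends_verts (fix_ends \<Gamma>), edges = ends_edges (fix_ends \<Gamma>), endpoints = id\<rparr>"
proof -
  have "(\<Union>\<gamma>\<in>\<Gamma> - {\<one>\<^bsub>PGL2\<^esub>}. fixed_points \<gamma>) \<subseteq> P1" using fixed_points_P1 by blast
  then show ?thesis unfolding T_star_def fix_ends_def by (simp add: tree_of_ends_closure tree_of_ends_eq)
qed

lemma fix_ends_scale: "x \<in> fix_ends \<Gamma> \<Longrightarrow> c *s x \<in> fix_ends \<Gamma>"
  unfolding fix_ends_def using fixed_points_P1 P1_scale by blast

lemma fixed_points_fix_ends: "\<gamma> \<in> \<Gamma> - {\<one>\<^bsub>PGL2\<^esub>} \<Longrightarrow> \<Union>(fixed_points \<gamma>) \<subseteq> fix_ends \<Gamma>"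
  unfolding fix_ends_def by blast

lemma fix_ends_act:
  assumes \<Gamma>: "subgroup \<Gamma> PGL2" and A: "invertible A" "cls A \<in> \<Gamma>" and x: "x \<in> fix_ends \<Gamma>" "x \<noteq> 0"
  shows "A *v x \<in> fix_ends \<Gamma>"
proof -
  obtain g where g: "g \<in> \<Gamma>" "g \<noteq> \<one>\<^bsub>PGL2\<^esub>" "x \<in> \<Union>(fixed_points g)" using x(1) unfolding fix_ends_def by blast
  have gc: "g \<in> carrier PGL2" using g(1) subgroup.subset[OF \<Gamma>] by blast
  obtain B where B: "invertible B" "g = cls B" using gc by (rule PGL2_cases)
  obtain C where C: "invertible C" "inv\<^bsub>PGL2\<^esub> (cls A) = cls C" "A ** C = mat 1" "C ** A = mat 1"
    using inv_cls[OF A(1)] by blast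
  have eq: "cls A \<otimes>\<^bsub>PGL2\<^esub> g \<otimes>\<^bsub>PGL2\<^esub> inv\<^bsub>PGL2\<^esub> (cls A) = cls (A ** B ** C)"
    using A B C by (simp add: cls_mult invertible_mult)
  have "A *v x \<in> \<Union>(fixed_points (cls (A ** B ** C)))"
    using fixed_points_conj[OF A(1) B(1) C(3,4) x(2)] g(3) B(2) by blast
  moreover have "cls (A ** B ** C) \<in> \<Gamma>" unfolding eq[symmetric] using A(2) g(1) \<Gamma>
    by (simp add: subgroup.m_closed subgroup.m_inv_closed)
  moreover have "cls (A ** B ** C) \<noteq> \<one>\<^bsub>PGL2\<^esub>"
  proof
    assume "cls (A ** B ** C) = \<one>\<^bsub>PGL2\<^esub>"
    then have "g = \<one>\<^bsub>PGL2\<^esub>" using PGL2.conj_eq_one[OF gc cls_in_carrier[OF A(1)]] eq by simp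
    then show False using g(2) by blast
  qed
  ultimately show ?thesis using fixed_points_fix_ends by blast
qed

lemma T_star_act:
  assumes \<Gamma>: "subgroup \<Gamma> PGL2" and g: "g \<in> \<Gamma>"
  shows "x \<in> verts (T_star \<Gamma>) \<Longrightarrow> vertex_act g x \<in> verts (T_star \<Gamma>)"
    and "e \<in> edges (T_star \<Gamma>) \<Longrightarrow> vertex_act g ` e \<in> edges (T_star \<Gamma>)"
proof -
  have "g \<in> carrier PGL2" using g subgroup.subset[OF \<Gamma>] by blast
  then obtain A where A: "invertible A" "g = cls A" by (rule PGL2_cases)
  have UV: "A *v x \<in> fix_ends \<Gamma>" if "x \<in> fix_ends \<Gamma>" "x \<noteq> 0" for x
    using fix_ends_act[OF \<Gamma> A(1)] that g A(2) by simp
  show "x \<in> verts (T_star \<Gamma>) \<Longrightarrow> vertex_act g x \<in> verts (T_star \<Gamma>)"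
    "e \<in> edges (T_star \<Gamma>) \<Longrightarrow> vertex_act g ` e \<in> edges (T_star \<Gamma>)"
    unfolding T_star_eq A(2) using ends_act[OF A(1) UV] by simp_all
qed

lemma T_star_subtree: "is_subtree (T_star \<Gamma>) bt_tree"
proof -
  let ?X = "T_star \<Gamma>"
  have graph: "is_graph ?X" unfolding is_graph_def T_star_eq ugraph.simps id_apply
    by (rule ballI, rule ends_edges_verts) (rule fix_ends_scale)
  have adj: "{(x, y). \<exists>e\<in>edges ?X. endpoints ?X e = {x, y}} = adj (edges ?X)"
    by (auto simp: adj_def T_star_eq)
  have "connected_graph ?X" unfolding connected_graph_def adj unfolding T_star_eq ugraph.simps
    by (intro ballI, rule ends_connected) (rule fix_ends_scale)
  moreover have "\<not> circuit ?X vs es" for vs es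
    by (rule forest_no_circuit[OF bt_forest]) (use ends_edges_bt in \<open>auto simp: T_star_eq\<close>)
  moreover have "verts ?X \<subseteq> verts bt_tree" "edges ?X \<subseteq> edges bt_tree"
    using ends_verts_bt ends_edges_bt by (simp_all add: T_star_eq)
  moreover have "endpoints ?X e = endpoints bt_tree e" for e by (simp add: T_star_eq bt_tree_def)
  ultimately show ?thesis using graph unfolding is_subtree_def is_subgraph_def is_tree_def by blast
qed

lemma mirror_subgraph:
  assumes "\<gamma> \<in> \<Gamma> - {\<one>\<^bsub>PGL2\<^esub>}"
  shows "is_subgraph (mirror \<gamma>) (T_star \<Gamma>)"
proof -
  have scale: "c *s x \<in> \<Union>(fixed_points \<gamma>)" if "x \<in> \<Union>(fixed_points \<gamma>)" for c x
    using that fixed_points_P1 P1_scale by blast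
  have "is_graph (mirror \<gamma>)" unfolding is_graph_def mirror_eq 
    using ends_edges_verts[of "\<Union>(fixed_points \<gamma>)"] scale by simp
  then show ?thesis using ends_mono[OF fixed_points_fix_ends[OF assms]]
    by (simp add: is_subgraph_def mirror_eq T_star_eq)
qed

text \<open>An edge is the set of its extremities, so an edge common to all subtrees of the family
  has both of them in each member. Hence the intersection is a graph.\<close>

lemma minimal_subtree_least:
  assumes "is_subtree H bt_tree" "\<forall>Y\<in>\<M>. is_subgraph Y H"
  shows "is_subgraph (minimal_subtree \<M>) H"
proof -
  define \<H> where "\<H> = {H. is_subtree H bt_tree \<and> (\<forall>Y\<in>\<M>. is_subgraph Y H)}"
  have H: "H \<in> \<H>" using assms by (simp add: \<H>_def)
  have eq: "minimal_subtree \<M> = \<lparr>verts = (\<Inter>H\<in>\<H>. verts H), edges = (\<Inter>H\<in>\<H>. edges H), endpoints = id\<rparr>"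
    by (simp add: minimal_subtree_def \<H>_def Let_def)
  have ends: "endpoints H' e = e \<and> (\<exists>u\<in>verts H'. \<exists>v\<in>verts H'. e = {u, v})" if "H' \<in> \<H>" "e \<in> edges H'" for H' e
  proof -
    have "is_subgraph H' bt_tree" using that by (simp add: \<H>_def is_subtree_def)
    then have "endpoints H' e = e" "is_graph H'" using that(2) by (auto simp: is_subgraph_def bt_tree_def)
    then show ?thesis using that(2) unfolding is_graph_def by metis
  qed
  have "is_graph (minimal_subtree \<M>)" unfolding is_graph_def eq
  proof
    fix e assume "e \<in> edges \<lparr>verts = (\<Inter>H\<in>\<H>. verts H), edges = (\<Inter>H\<in>\<H>. edges H), endpoints = id\<rparr>"
    then have e: "e \<in> edges H'" if "H' \<in> \<H>" for H' using that by simp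
    then obtain u v where uv: "e = {u, v}" using ends[OF H e[OF H]] by blast
    have "u \<in> verts H' \<and> v \<in> verts H'" if "H' \<in> \<H>" for H'
      using ends[OF that e[OF that]] unfolding uv by (auto simp: doubleton_eq_iff)
    then show "\<exists>u\<in>verts \<lparr>verts = (\<Inter>H\<in>\<H>. verts H), edges = (\<Inter>H\<in>\<H>. edges H), endpoints = id\<rparr>.
      \<exists>v\<in>verts \<lparr>verts = (\<Inter>H\<in>\<H>. verts H), edges = (\<Inter>H\<in>\<H>. edges H), endpoints = id\<rparr>.
      endpoints \<lparr>verts = (\<Inter>H\<in>\<H>. verts H), edges = (\<Inter>H\<in>\<H>. edges H), endpoints = id\<rparr> e = {u, v}"
      using uv by (intro bexI[of _ u] bexI[of _ v]) auto
  qed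
  moreover have "verts (minimal_subtree \<M>) \<subseteq> verts H" "edges (minimal_subtree \<M>) \<subseteq> edges H"
    unfolding eq using H by auto
  moreover have "endpoints (minimal_subtree \<M>) e = endpoints H e" if "e \<in> edges (minimal_subtree \<M>)" for e
  proof -
    have "e \<in> edges H" using that H unfolding eq by auto
    then show ?thesis using ends[OF H] by (simp add: eq)
  qed
  ultimately show ?thesis unfolding is_subgraph_def by blast
qed

lemma minimal_subtree_contains:
  "Y \<in> \<M> \<Longrightarrow> verts Y \<subseteq> verts (minimal_subtree \<M>) \<and> edges Y \<subseteq> edges (minimal_subtree \<M>)"
  by (auto simp: minimal_subtree_def Let_def is_subgraph_def)

text \<open>A nontrivial element has two independent eigenvectors; fixing a vertex forces the
  eigenvalues to have the same absolute value.\<close>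

lemma stabilizer_elliptic:
  assumes \<Gamma>: "discrete_subgroup \<Gamma>" "fixed_points_rational \<Gamma>" and g: "g \<in> \<Gamma>" "g \<noteq> \<one>\<^bsub>PGL2\<^esub>"
    and x: "x \<in> verts bt_tree" "vertex_act g x = x"
  shows "elliptic g"
proof -
  have gc: "g \<in> carrier PGL2" using g(1) \<Gamma>(1) subgroup.subset by (auto simp: discrete_subgroup_def)
  then obtain A where A: "invertible A" "g = cls A" by (rule PGL2_cases)
  obtain e1 e2 \<alpha> \<beta> where e: "cr e1 e2 \<noteq> 0" "\<alpha> \<noteq> \<beta>" "A *v e1 = \<alpha> *s e1" "A *v e2 = \<beta> *s e2"
    using two_eigenvectors[OF \<Gamma> A(1)] g A(2) by metis
  obtain u v where uv: "cr u v \<noteq> 0" "x = vtx u v" using x(1) unfolding verts_bt_iff by blast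
  then have "vertex_act (cls A) (vtx u v) = vtx u v" using x(2) A(2) by simp
  then obtain c where c: "c \<noteq> 0" "(*v) A ` lat u v = (*s) c ` lat u v" by (rule vertex_fix_lat[OF uv(1)])
  have "e1 \<noteq> 0" "e2 \<noteq> 0" using e(1) by auto
  then have "absv \<alpha> = absv \<beta>" using vertex_fix_eigenvalue[OF A(1) uv(1) c] e by metis
  then show ?thesis unfolding elliptic_iff[OF gc] using A e by blast
qed

section \<open>The induced tree of groups\<close>

lemma edge_act_mult: "edge_act (g \<otimes>\<^bsub>PGL2\<^esub> h) \<sigma> = edge_act g (edge_act h \<sigma>)"
  by (simp add: edge_act_def image_image vertex_act_mult)

lemma orbit_act_eq:
  assumes K: "subgroup K PGL2" and mult: "\<And>g h y. \<phi> (g \<otimes>\<^bsub>PGL2\<^esub> h) y = \<phi> g (\<phi> h y)" and g: "g \<in> K"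
  shows "orbit (PGL2_sub K) \<phi> (\<phi> g x) = orbit (PGL2_sub K) \<phi> x"
proof (intro Set.equalityI subsetI)
  fix y assume "y \<in> orbit (PGL2_sub K) \<phi> (\<phi> g x)"
  then obtain h where h: "h \<in> K" "y = \<phi> (h \<otimes>\<^bsub>PGL2\<^esub> g) x" by (auto simp: orbit_def mult)
  then show "y \<in> orbit (PGL2_sub K) \<phi> x" using subgroup.m_closed[OF K h(1) g] by (auto simp: orbit_def)
next
  fix y assume "y \<in> orbit (PGL2_sub K) \<phi> x"
  then obtain h where h: "h \<in> K" "y = \<phi> h x" by (auto simp: orbit_def)
  have c: "h \<in> carrier PGL2" "g \<in> carrier PGL2" using subgroup.subset[OF K] h g by auto
  define k where "k = h \<otimes>\<^bsub>PGL2\<^esub> inv\<^bsub>PGL2\<^esub> g"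
  have "k \<in> K" using h g by (simp add: k_def subgroup.m_closed[OF K] subgroup.m_inv_closed[OF K])
  moreover have "k \<otimes>\<^bsub>PGL2\<^esub> g = h" using c by (simp add: k_def PGL2.m_assoc)
  then have "y = \<phi> k (\<phi> g x)" using h by (simp flip: mult)
  ultimately show "y \<in> orbit (PGL2_sub K) \<phi> (\<phi> g x)" by (auto simp: orbit_def)
qed

lemma vertex_stabilizer_eq: "vertex_stabilizer H w = {g \<in> H. vertex_act g w = w}"
  by (simp add: vertex_stabilizer_def stabilizer_def)

lemma edge_stabilizer_eq: "edge_stabilizer H \<sigma> = {g \<in> H. \<forall>w\<in>\<sigma>. vertex_act g w = w}"
  by (auto simp: edge_stabilizer_def vertex_stabilizer_eq)

lemma subgroup_pointwise_stabilizer: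
  assumes \<Gamma>: "subgroup \<Gamma> PGL2" and \<sigma>: "\<sigma> \<subseteq> verts bt_tree"
  shows "subgroup {g \<in> \<Gamma>. \<forall>w\<in>\<sigma>. vertex_act g w = w} PGL2"
proof (rule PGL2.subgroupI)
  show "{g \<in> \<Gamma>. \<forall>w\<in>\<sigma>. vertex_act g w = w} \<subseteq> carrier PGL2" using subgroup.subset[OF \<Gamma>] by blast
  show "{g \<in> \<Gamma>. \<forall>w\<in>\<sigma>. vertex_act g w = w} \<noteq> {}"
    using subgroup.one_closed[OF \<Gamma>] vertex_act_one \<sigma> by blast
next
  fix g assume g: "g \<in> {g \<in> \<Gamma>. \<forall>w\<in>\<sigma>. vertex_act g w = w}"
  then have gc: "g \<in> carrier PGL2" using subgroup.subset[OF \<Gamma>] by blast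
  have "vertex_act (inv\<^bsub>PGL2\<^esub> g) w = w" if w: "w \<in> \<sigma>" for w
  proof -
    have "vertex_act (inv\<^bsub>PGL2\<^esub> g) w = vertex_act (inv\<^bsub>PGL2\<^esub> g) (vertex_act g w)" using g w by simp
    also have "\<dots> = vertex_act \<one>\<^bsub>PGL2\<^esub> w" using gc by (simp flip: vertex_act_mult)
    also have "\<dots> = w" using vertex_act_one w \<sigma> by blast
    finally show ?thesis .
  qed
  then show "inv\<^bsub>PGL2\<^esub> g \<in> {g \<in> \<Gamma>. \<forall>w\<in>\<sigma>. vertex_act g w = w}"
    using g subgroup.m_inv_closed[OF \<Gamma>] by blast
next
  fix g h assume "g \<in> {g \<in> \<Gamma>. \<forall>w\<in>\<sigma>. vertex_act g w = w}" "h \<in> {g \<in> \<Gamma>. \<forall>w\<in>\<sigma>. vertex_act g w = w}"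
  then show "g \<otimes>\<^bsub>PGL2\<^esub> h \<in> {g \<in> \<Gamma>. \<forall>w\<in>\<sigma>. vertex_act g w = w}"
    using subgroup.m_closed[OF \<Gamma>] by (simp add: vertex_act_mult)
qed

lemma subtree_facts:
  assumes "is_subtree H bt_tree"
  shows "edges H \<subseteq> edges bt_tree" "verts H \<subseteq> verts bt_tree" "e \<in> edges H \<Longrightarrow> endpoints H e = e"
    "e \<in> edges H \<Longrightarrow> \<exists>x\<in>verts H. \<exists>y\<in>verts H. e = {x, y}"
    "x \<in> verts H \<Longrightarrow> y \<in> verts H \<Longrightarrow> (x, y) \<in> (adj (edges H))\<^sup>*"
proof -
  have sg: "is_subgraph H bt_tree" and tr: "is_tree H" using assms by (auto simp: is_subtree_def)
  show "edges H \<subseteq> edges bt_tree" "verts H \<subseteq> verts bt_tree" using sg by (auto simp: is_subgraph_def)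
  have ep: "endpoints H e = e" if "e \<in> edges H" for e using sg that by (auto simp: is_subgraph_def bt_tree_def)
  show "e \<in> edges H \<Longrightarrow> endpoints H e = e" by (rule ep)
  show "\<exists>x\<in>verts H. \<exists>y\<in>verts H. e = {x, y}" if "e \<in> edges H"
    using sg that ep[OF that] unfolding is_subgraph_def is_graph_def by metis
  have "{(x, y). \<exists>e\<in>edges H. endpoints H e = {x, y}} = adj (edges H)"
    using ep unfolding adj_def by (metis (no_types, lifting))
  then show "x \<in> verts H \<Longrightarrow> y \<in> verts H \<Longrightarrow> (x, y) \<in> (adj (edges H))\<^sup>*"
    using tr by (simp add: is_tree_def connected_graph_def)
qed

lemma (in group) generate_subgroup_self:
  assumes H: "subgroup H G"
  shows "generate G H = H"
proof
  show "generate G H \<subseteq> H" by (rule generate_subgroup_incl[OF order_refl H])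
  show "H \<subseteq> generate G H" using generate.incl by (rule subsetI)
qed

locale discrete_section =
  fixes \<Gamma> :: "('k::padic_field^2^2) set set" and \<iota> :: "'k vertex set \<Rightarrow> 'k vertex"
  assumes discrete: "discrete_subgroup \<Gamma>"
    and finitely_generated: "finitely_generated_group (PGL2_sub \<Gamma>)"
    and rational: "fixed_points_rational \<Gamma>"
    and quotient_tree: "is_tree (quotient_graph \<Gamma> (T_star \<Gamma>))"
    and section_\<iota>: "is_section \<Gamma> (T_star \<Gamma>) \<iota>"
begin

abbreviation "XV \<equiv> verts (T_star \<Gamma>)"
abbreviation "XE \<equiv> edges (T_star \<Gamma>)"
abbreviation "T \<equiv> quotient_graph \<Gamma> (T_star \<Gamma>)"
abbreviation "\<G> \<equiv> induced_tree_of_groups \<Gamma> \<iota>"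
abbreviation "\<iota>e e \<equiv> \<iota> ` endpoints T e"
abbreviation "orb \<equiv> orbit (PGL2_sub \<Gamma>) vertex_act"
abbreviation "eorb \<equiv> orbit (PGL2_sub \<Gamma>) edge_act"

lemma sub: "subgroup \<Gamma> PGL2"
  using discrete by (simp add: discrete_subgroup_def)

lemma \<Gamma>_carrier: "g \<in> \<Gamma> \<Longrightarrow> g \<in> carrier PGL2"
  using subgroup.subset[OF sub] by blast

lemma base_\<G>: "base \<G> = T"
  by (simp add: induced_tree_of_groups_def Let_def)

lemma verts_T: "verts T = orb ` XV" and edges_T: "edges T = eorb ` XE"
  by (auto simp: quotient_graph_def orbits_def)

lemma \<iota>_vert: "v \<in> verts T \<Longrightarrow> \<iota> v \<in> XV" and orb_\<iota>: "v \<in> verts T \<Longrightarrow> orb (\<iota> v) = v"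
  and \<iota>_edge: "e \<in> edges T \<Longrightarrow> \<iota>e e \<in> XE" and eorb_\<iota>: "e \<in> edges T \<Longrightarrow> eorb (\<iota>e e) = e"
  using section_\<iota> by (auto simp: is_section_def)

lemma T_graph: "is_graph T"
  using quotient_tree by (simp add: is_tree_def)

lemma endpoints_T: "e \<in> edges T \<Longrightarrow> \<exists>u\<in>verts T. \<exists>v\<in>verts T. endpoints T e = {u, v}"
  using T_graph by (simp add: is_graph_def)

lemma XV_bt: "x \<in> XV \<Longrightarrow> x \<in> verts bt_tree" and XE_bt: "XE \<subseteq> edges bt_tree"
  using ends_verts_bt ends_edges_bt by (auto simp: T_star_eq)

lemma XE_endpoints: "e \<in> XE \<Longrightarrow> \<exists>x\<in>XV. \<exists>y\<in>XV. e = {x, y}"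
  unfolding T_star_eq ugraph.simps by (rule ends_edges_verts) (rule fix_ends_scale)

lemma X_conn: "x \<in> XV \<Longrightarrow> y \<in> XV \<Longrightarrow> (x, y) \<in> (adj XE)\<^sup>*"
  unfolding T_star_eq ugraph.simps by (rule ends_connected) (rule fix_ends_scale)

lemma X_act: "g \<in> \<Gamma> \<Longrightarrow> x \<in> XV \<Longrightarrow> vertex_act g x \<in> XV" "g \<in> \<Gamma> \<Longrightarrow> e \<in> XE \<Longrightarrow> vertex_act g ` e \<in> XE"
  using T_star_act[OF sub] by blast+

lemma self_orbit:
  shows "x \<in> XV \<Longrightarrow> x \<in> orb x" "e \<in> XE \<Longrightarrow> e \<in> eorb e"
proof -
  have 1: "\<one>\<^bsub>PGL2\<^esub> \<in> \<Gamma>" using sub by (rule subgroup.one_closed)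
  show "x \<in> orb x" if "x \<in> XV" using that vertex_act_one[OF XV_bt] 1 unfolding orbit_def by force
  show "e \<in> eorb e" if e: "e \<in> XE"
  proof -
    obtain x y where "x \<in> XV" "y \<in> XV" "e = {x, y}" using XE_endpoints[OF e] by blast
    then have "edge_act \<one>\<^bsub>PGL2\<^esub> e = e" using vertex_act_one[OF XV_bt] by (simp add: edge_act_def)
    then show ?thesis using 1 unfolding orbit_def by force
  qed
qed

text \<open>The section serves as fundamental domain: two of its vertices in one orbit have the same
  image in the quotient and are therefore equal.\<close>

sublocale fa0: forest_action "PGL2_sub \<Gamma>" vertex_act XV XE "\<iota> ` verts (base \<G>)"
    "(\<lambda>e. \<iota> ` endpoints (base \<G>) e) ` edges (base \<G>)"
proof unfold_locales
  interpret G: group "PGL2_sub \<Gamma>" using PGL2.subgroup_imp_group[OF sub] .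
  show "g \<otimes>\<^bsub>PGL2_sub \<Gamma>\<^esub> h \<in> carrier (PGL2_sub \<Gamma>)" if "g \<in> carrier (PGL2_sub \<Gamma>)" "h \<in> carrier (PGL2_sub \<Gamma>)" for g h
    using that by (rule G.m_closed)
  show "g \<otimes>\<^bsub>PGL2_sub \<Gamma>\<^esub> h \<otimes>\<^bsub>PGL2_sub \<Gamma>\<^esub> k = g \<otimes>\<^bsub>PGL2_sub \<Gamma>\<^esub> (h \<otimes>\<^bsub>PGL2_sub \<Gamma>\<^esub> k)"
    if "g \<in> carrier (PGL2_sub \<Gamma>)" "h \<in> carrier (PGL2_sub \<Gamma>)" "k \<in> carrier (PGL2_sub \<Gamma>)" for g h k
    using that by (rule G.m_assoc)
  show "\<one>\<^bsub>PGL2_sub \<Gamma>\<^esub> \<in> carrier (PGL2_sub \<Gamma>)" by (rule G.one_closed)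
  show "\<one>\<^bsub>PGL2_sub \<Gamma>\<^esub> \<otimes>\<^bsub>PGL2_sub \<Gamma>\<^esub> g = g" if "g \<in> carrier (PGL2_sub \<Gamma>)" for g using that by (rule G.l_one)
  show "g \<otimes>\<^bsub>PGL2_sub \<Gamma>\<^esub> \<one>\<^bsub>PGL2_sub \<Gamma>\<^esub> = g" if "g \<in> carrier (PGL2_sub \<Gamma>)" for g using that by (rule G.r_one)
  show "carrier (PGL2_sub \<Gamma>) \<subseteq> Units (PGL2_sub \<Gamma>)" using G.Units_eq by simp
  show "vertex_act \<one>\<^bsub>PGL2_sub \<Gamma>\<^esub> x = x" if "x \<in> XV" for x using vertex_act_one[OF XV_bt[OF that]] by simp
  show "vertex_act (g \<otimes>\<^bsub>PGL2_sub \<Gamma>\<^esub> h) x = vertex_act g (vertex_act h x)" for g h x by (simp add: vertex_act_mult)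
  show "vertex_act g x \<in> XV" if "g \<in> carrier (PGL2_sub \<Gamma>)" "x \<in> XV" for g x using X_act that by simp
  show "vertex_act g ` e \<in> XE" if "g \<in> carrier (PGL2_sub \<Gamma>)" "e \<in> XE" for g e using X_act that by simp
  show "e \<subseteq> XV" if "e \<in> XE" for e using XE_endpoints[OF that] by blast
  show "\<exists>x y. e = {x, y}" if "e \<in> XE" for e using XE_endpoints[OF that] by blast
  show "forest XE" using forest_subset[OF bt_forest XE_bt] .
  show "(x, y) \<in> (adj XE)\<^sup>*" if "x \<in> XV" "y \<in> XV" for x y using X_conn that .
  show "\<iota> ` verts (base \<G>) \<subseteq> XV" using \<iota>_vert by (auto simp: base_\<G>)
  show "\<exists>g\<in>carrier (PGL2_sub \<Gamma>). \<exists>s\<in>\<iota> ` verts (base \<G>). x = vertex_act g s" if x: "x \<in> XV" for x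
  proof -
    have v: "orb x \<in> verts T" using x verts_T by blast
    then have "x \<in> orb (\<iota> (orb x))" using self_orbit(1)[OF x] orb_\<iota> by simp
    then obtain g where "g \<in> \<Gamma>" "x = vertex_act g (\<iota> (orb x))" unfolding orbit_def by auto
    then show ?thesis using v by (intro bexI[of _ g] bexI[of _ "\<iota> (orb x)"]) (auto simp: base_\<G>)
  qed
  show "s = t" if st: "s \<in> \<iota> ` verts (base \<G>)" "t \<in> \<iota> ` verts (base \<G>)" "g \<in> carrier (PGL2_sub \<Gamma>)" "t = vertex_act g s" for s t g
  proof -
    obtain v w where vw: "v \<in> verts T" "w \<in> verts T" "s = \<iota> v" "t = \<iota> w" using st(1,2) by (auto simp: base_\<G>)
    have "g \<in> \<Gamma>" using st(3) by simp
    have "orb t = orb s" unfolding st(4) by (rule orbit_act_eq[OF sub vertex_act_mult \<open>g \<in> \<Gamma>\<close>])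
    then have "w = v" using orb_\<iota> vw by simp
    then show ?thesis using vw by simp
  qed
  show "(\<lambda>e. \<iota> ` endpoints (base \<G>) e) ` edges (base \<G>) \<subseteq> XE" using \<iota>_edge by (auto simp: base_\<G>)
  show "e \<subseteq> \<iota> ` verts (base \<G>)" if "e \<in> (\<lambda>e. \<iota> ` endpoints (base \<G>) e) ` edges (base \<G>)" for e
    using that endpoints_T unfolding base_\<G> by fastforce
  show "\<exists>g\<in>carrier (PGL2_sub \<Gamma>). \<exists>e'\<in>(\<lambda>e. \<iota> ` endpoints (base \<G>) e) ` edges (base \<G>). e = vertex_act g ` e'" if e: "e \<in> XE" for e
  proof -
    have v: "eorb e \<in> edges T" using e edges_T by blast
    then have "e \<in> eorb (\<iota>e (eorb e))" using self_orbit(2)[OF e] eorb_\<iota> by simp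
    then obtain g where "g \<in> \<Gamma>" "e = vertex_act g ` \<iota>e (eorb e)" unfolding orbit_def edge_act_def by auto
    then show ?thesis using v unfolding base_\<G> by (intro bexI[of _ g] bexI[of _ "\<iota>e (eorb e)"]) auto
  qed
qed

lemma Stab_eq: "fa0.Stab x = {g \<in> \<Gamma>. vertex_act g x = x}"
  by (simp add: fa0.Stab_def)

lemma vgroup_\<G>: "vgroup \<G> v = PGL2_sub (fa0.Stab (\<iota> v))"
  by (simp add: induced_tree_of_groups_def Let_def vertex_stabilizer_eq Stab_eq)

lemma egroup_\<G>: "egroup \<G> e = PGL2_sub {g \<in> \<Gamma>. \<forall>w\<in>\<iota>e e. vertex_act g w = w}"
  by (simp add: induced_tree_of_groups_def Let_def edge_stabilizer_eq)

lemma incl_\<G>: "incl \<G> e v g = g"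
  by (simp add: induced_tree_of_groups_def Let_def)

lemma \<iota>_inj: "inj_on \<iota> (verts T)"
  using orb_\<iota> by (metis inj_onI)

sublocale fa: forest_action_amalgam "PGL2_sub \<Gamma>" vertex_act XV XE \<G> \<iota>
proof unfold_locales
  show "inj_on \<iota> (verts (base \<G>))" using \<iota>_inj by (simp add: base_\<G>)
  show "is_graph (base \<G>)" using T_graph by (simp add: base_\<G>)
qed (simp_all add: vgroup_\<G> egroup_\<G> incl_\<G> base_\<G>)

lemma Stab_finite: "x \<in> XV \<Longrightarrow> finite (fa0.Stab x)"
proof -
  assume "x \<in> XV"
  then obtain u v where "cr u v \<noteq> 0" "x = vtx u v" using XV_bt unfolding verts_bt_iff by blast
  then show ?thesis unfolding Stab_eq using finite_stabilizer[OF discrete] by simp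
qed

lemma Stab_subgroup: "x \<in> XV \<Longrightarrow> subgroup (fa0.Stab x) PGL2"
  using subgroup_pointwise_stabilizer[OF sub, of "{x}"] XV_bt by (simp add: Stab_eq)

lemma edge_Stab_subgroup: "e \<in> edges T \<Longrightarrow> subgroup {g \<in> \<Gamma>. \<forall>w\<in>\<iota>e e. vertex_act g w = w} PGL2"
proof -
  assume e: "e \<in> edges T"
  obtain x y where "x \<in> XV" "y \<in> XV" "\<iota>e e = {x, y}" using XE_endpoints[OF \<iota>_edge[OF e]] by blast
  then have "\<iota>e e \<subseteq> verts bt_tree" using XV_bt by simp
  then show ?thesis by (rule subgroup_pointwise_stabilizer[OF sub])
qed

lemma Stab_elliptic: "x \<in> XV \<Longrightarrow> g \<in> fa0.Stab x \<Longrightarrow> g \<noteq> \<one>\<^bsub>PGL2\<^esub> \<Longrightarrow> elliptic g"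
  using stabilizer_elliptic[OF discrete rational _ _ XV_bt] by (simp add: Stab_eq)

lemma is_tree_of_groups_\<G>: "is_tree_of_groups \<G>"
  unfolding is_tree_of_groups_def
proof (intro conjI ballI)
  show "is_tree (base \<G>)" using quotient_tree by (simp add: base_\<G>)
next
  fix v assume "v \<in> verts (base \<G>)"
  then have v: "\<iota> v \<in> XV" using \<iota>_vert by (simp add: base_\<G>)
  show "group (vgroup \<G> v)" "finite (carrier (vgroup \<G> v))"
    using PGL2.subgroup_imp_group[OF Stab_subgroup[OF v]] Stab_finite[OF v] by (simp_all add: vgroup_\<G>)
next
  fix e assume "e \<in> edges (base \<G>)"
  then have e: "e \<in> edges T" by (simp add: base_\<G>)
  have le: "{g \<in> \<Gamma>. \<forall>w\<in>\<iota>e e. vertex_act g w = w} \<subseteq> fa0.Stab (\<iota> v)" if "v \<in> endpoints T e" for v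
    using that by (auto simp: Stab_eq)
  show "group (egroup \<G> e)"
    using PGL2.subgroup_imp_group[OF edge_Stab_subgroup[OF e]] by (simp add: egroup_\<G>)
  obtain u where u: "u \<in> endpoints T e" "u \<in> verts T" using endpoints_T[OF e] by blast
  show "finite (carrier (egroup \<G> e))"
    using finite_subset[OF le[OF u(1)] Stab_finite[OF \<iota>_vert[OF u(2)]]] by (simp add: egroup_\<G>)
  fix v assume "v \<in> endpoints (base \<G>) e"
  then show "incl \<G> e v \<in> mon (egroup \<G> e) (vgroup \<G> v)"
    using le[of v] by (auto simp: mon_def hom_def inj_on_def incl_\<G> egroup_\<G> vgroup_\<G> base_\<G>)
qed

text \<open>A nontrivial element has two fixed points, and the line joining them provides a vertex.
  This settles the degenerate case of an empty tree, whose amalgam is trivial.\<close>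

lemma trivial_if_empty: "verts T \<noteq> {} \<or> \<Gamma> = {\<one>\<^bsub>PGL2\<^esub>}"
proof (rule ccontr)
  assume *: "\<not> ?thesis"
  then obtain g where g: "g \<in> \<Gamma>" "g \<noteq> \<one>\<^bsub>PGL2\<^esub>" using subgroup.one_closed[OF sub] by blast
  obtain A where A: "invertible A" "g = cls A" using \<Gamma>_carrier[OF g(1)] by (rule PGL2_cases)
  obtain e1 e2 \<alpha> \<beta> where e: "cr e1 e2 \<noteq> 0" "\<alpha> \<noteq> \<beta>" "A *v e1 = \<alpha> *s e1" "A *v e2 = \<beta> *s e2"
    using two_eigenvectors[OF discrete rational A(1)] g A(2) by metis
  have nz: "e1 \<noteq> 0" "e2 \<noteq> 0" using e(1) by auto
  have "e1 \<in> \<Union>(fixed_points g)" "e2 \<in> \<Union>(fixed_points g)"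
    unfolding A(2) using iffD2[OF fixed_points_iff[OF A(1) nz(1)] exI[of "\<lambda>c. A *v e1 = c *s e1", OF e(3)]]
      iffD2[OF fixed_points_iff[OF A(1) nz(2)] exI[of "\<lambda>c. A *v e2 = c *s e2", OF e(4)]] .
  then have "e1 \<in> fix_ends \<Gamma>" "e2 \<in> fix_ends \<Gamma>" using fixed_points_fix_ends[of g \<Gamma>] g by blast+
  then have "vtx e1 e2 \<in> XV" using e(1) unfolding T_star_eq ugraph.simps ends_verts_def by blast
  then show False using * verts_T by blast
qed

text \<open>Some nontrivial element fixes the end \<open>x\<close>, and the line to its other fixed
  point lies in \<open>Y\<close>. If the element is elliptic, this line is its mirror; if it is
  hyperbolic, the line is its axis and \<open>invariant_contains_axis\<close> applies.\<close>

lemma invariant_subtree_line: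
  assumes Y: "Y \<subseteq> XV" "YE \<subseteq> XE" "Y \<noteq> {}" "\<forall>g\<in>\<Gamma>. \<forall>x\<in>Y. vertex_act g x \<in> Y"
      "\<forall>g\<in>\<Gamma>. \<forall>e\<in>YE. vertex_act g ` e \<in> YE" "\<forall>e\<in>YE. e \<subseteq> Y" "\<forall>x\<in>Y. \<forall>y\<in>Y. (x, y) \<in> (adj YE)\<^sup>*"
    and mir: "\<And>g. g \<in> \<Gamma> - {\<one>\<^bsub>PGL2\<^esub>} \<Longrightarrow> elliptic g \<Longrightarrow> verts (mirror g) \<subseteq> Y"
    and x: "x \<in> fix_ends \<Gamma>" "x \<noteq> 0"
  obtains w where "cr x w \<noteq> 0" "\<And>c. c \<noteq> 0 \<Longrightarrow> vtx x (c *s w) \<in> Y"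
proof -
  obtain g where g: "g \<in> \<Gamma>" "g \<noteq> \<one>\<^bsub>PGL2\<^esub>" "x \<in> \<Union>(fixed_points g)" using x(1) unfolding fix_ends_def by blast
  obtain A where A: "invertible A" "g = cls A" using \<Gamma>_carrier[OF g(1)] by (rule PGL2_cases)
  obtain e1 e2 \<alpha> \<beta> where e: "cr e1 e2 \<noteq> 0" "\<alpha> \<noteq> \<beta>" "A *v e1 = \<alpha> *s e1" "A *v e2 = \<beta> *s e2"
    using two_eigenvectors[OF discrete rational A(1)] g A(2) by metis
  obtain c0 where c0: "A *v x = c0 *s x" using g(3) fixed_points_iff[OF A(1) x(2)] A(2) by blast
  \<comment> \<open>Of the two eigenlines \<open>x\<close> spans one; \<open>w\<close> is taken from
    the other.\<close>
  have "\<exists>w \<beta>. cr x w \<noteq> 0 \<and> c0 \<noteq> \<beta> \<and> A *v w = \<beta> *s w"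
  proof -
    have scale: "c0 = \<gamma>" if "x = a *s y" "A *v y = \<gamma> *s y" for a y \<gamma>
    proof -
      have "A *v x = a *s (\<gamma> *s y)" using that by (simp add: vector_scalar_commute)
      also have "\<dots> = \<gamma> *s x" by (simp add: that(1) vector_smult_assoc mult.commute)
      finally have "c0 *s x = \<gamma> *s x" using c0 by simp
      then show ?thesis using x(2) by (simp only: vec.scale_cancel_right) blast
    qed
    from eigenvector_cases[OF e c0] show ?thesis
    proof (elim disjE exE)
      fix a assume a: "x = a *s e1"
      have "a \<noteq> 0" using a x(2) by auto
      then have "cr x e2 \<noteq> 0" unfolding a using e(1) by simp
      moreover have "c0 = \<alpha>" by (rule scale[OF a e(3)])
      ultimately show ?thesis using e(2,4) by (intro exI[of _ e2] exI[of _ \<beta>]) simp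
    next
      fix a assume a: "x = a *s e2"
      have "a \<noteq> 0" using a x(2) by auto
      moreover have "cr e2 e1 \<noteq> 0" using e(1) cr_swap[of e2 e1] by simp
      ultimately have "cr x e1 \<noteq> 0" unfolding a by simp
      moreover have "c0 = \<beta>" by (rule scale[OF a e(4)])
      ultimately show ?thesis using e(2,3) by (intro exI[of _ e1] exI[of _ \<alpha>]) simp
    qed
  qed
  then obtain w \<beta>' where w: "cr x w \<noteq> 0" "c0 \<noteq> \<beta>'" "A *v w = \<beta>' *s w" by blast
  have w0: "w \<noteq> 0" using w(1) by auto
  have gU: "\<Union>(fixed_points g) \<subseteq> fix_ends \<Gamma>" using fixed_points_fix_ends g by blast
  have "w \<in> \<Union>(fixed_points g)"
    unfolding A(2) by (rule iffD2[OF fixed_points_iff[OF A(1) w0] exI[of "\<lambda>c. A *v w = c *s w", OF w(3)]])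
  then have wU: "w \<in> fix_ends \<Gamma>" using gU by blast
  have "\<forall>c. c \<noteq> 0 \<longrightarrow> vtx x (c *s w) \<in> Y"
  proof (cases "absv c0 = absv \<beta>'")
    case True
    then have "elliptic g" unfolding elliptic_iff[OF \<Gamma>_carrier[OF g(1)]] using A w c0 by blast
    then have "verts (mirror g) \<subseteq> Y" using mir g by blast
    then show ?thesis unfolding A(2) mirror_verts[OF A(1) w(1,2) c0 w(3)] by blast
  next
    case False
    let ?f = "\<lambda>n :: int. vtx x (unif powi n *s w)"
    have nz: "c0 \<noteq> 0" "\<beta>' \<noteq> 0"
      using matrix_inj[OF A(1), of x 0] matrix_inj[OF A(1), of w 0] x(2) w0 c0 w(3) by auto
    \<comment> \<open>The valuation \<open>j\<close> of the ratio of the eigenvalues is the signed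
      translation length along the line; it is nonzero because their absolute values differ.\<close>
    have "\<beta>' / c0 \<noteq> 0" using nz by simp
    then obtain j :: int and d where d: "absv d = 1" "\<beta>' / c0 = d * unif powi j"
      by (rule unif_decomposition)
    have "j \<noteq> 0"
    proof
      assume "j = 0"
      then have "absv (\<beta>' / c0) = 1" unfolding d(2) by (simp add: d(1))
      then show False using False nz by (simp add: absv_divide)
    qed
    have gf: "vertex_act g (?f n) = ?f (n + j)" for n
    proof -
      have eq: "\<beta>' = c0 * (d * unif powi j)" using d(2) nz(1) by (simp add: field_simps)
      have "vertex_act g (?f n) = vtx (c0 *s x) (c0 *s (d *s (unif powi (n + j) *s w)))"
        using c0 w(3) by (simp add: A(2) vertex_act_cls vector_scalar_commute vector_smult_assoc eq power_int_add mult_ac)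
      also have "\<dots> = vtx (1 *s x) (d *s (unif powi (n + j) *s w))" unfolding vtx_scale[OF nz(1)] by simp
      also have "\<dots> = ?f (n + j)" unfolding vtx_def using d(1) by (subst lat_units) simp_all
      finally show ?thesis .
    qed
    define g' where "g' = inv\<^bsub>PGL2_sub \<Gamma>\<^esub> g"
    have g': "g' \<in> \<Gamma>" using g(1) fa0.inv_closed[of g] by (simp add: g'_def)
    have fedge: "line_edge ?f n \<in> XE" for n
      unfolding T_star_eq ugraph.simps by (rule line_edge_ends[OF fix_ends_scale x(1) wU w(1)])
    have fX: "?f n \<in> XV" for n using fedge[of n] XE_endpoints unfolding line_edge_def by (fastforce simp: doubleton_eq_iff)
    have g'f: "vertex_act g' (?f n) = ?f (n - j)" for n
      using gf[of "n - j"] fa0.act_inv[of g "?f (n - j)"] g(1) fX[of "n - j"] by (simp add: g'_def)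
    have inj: "inj_on (vertex_act h) (\<Union>XE)" if "h \<in> \<Gamma>" for h
      by (rule inj_on_subset[OF bt_verts_inj[OF \<Gamma>_carrier[OF that]]]) (use fa0.XE_subset XV_bt in blast)
    have finj: "inj ?f" by (rule line_vtx_inj[OF w(1)])
    obtain y where y: "y \<in> Y" using Y(3) by blast
    have yf: "(y, ?f 0) \<in> (adj XE)\<^sup>*" using X_conn fX y Y(1) by blast
    \<comment> \<open>\<open>invariant_contains_axis\<close> wants a positive shift, so the sign of
      \<open>j\<close> decides whether \<open>g\<close> or its inverse is the map moving
      downwards.\<close>
    have "line_edge ?f n \<in> YE" for n
    proof (cases "j < 0")
      case True
      show ?thesis
        by (rule invariant_contains_axis[of XE ?f YE "- j" "vertex_act g" "vertex_act g'" Y y])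
          (use fa0.XE_forest finj fedge Y True gf g'f X_act g(1) g' inj y yf in auto)
    next
      case False
      then have "j > 0" using \<open>j \<noteq> 0\<close> by simp
      then show ?thesis
        by (intro invariant_contains_axis[of XE ?f YE j "vertex_act g'" "vertex_act g" Y y])
          (use fa0.XE_forest finj fedge Y gf g'f X_act g(1) g' inj y yf in auto)
    qed
    then have fY: "?f n \<in> Y" for n using Y(6) unfolding line_edge_def by blast
    show ?thesis
    proof (intro allI impI)
      fix c :: 'k assume c: "c \<noteq> 0"
      obtain n :: int where "vtx x (c *s w) = vtx x (unif powi n *s w)" by (rule vtx_powi[OF c])
      then show "vtx x (c *s w) \<in> Y" using fY by simp
    qed
  qed
  then show ?thesis using that w(1) by blast
qed

lemma mirror_conj_sub:
  assumes g: "g \<in> \<Gamma>" and h: "h \<in> \<Gamma>"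
  shows "h \<otimes>\<^bsub>PGL2_sub \<Gamma>\<^esub> g \<otimes>\<^bsub>PGL2_sub \<Gamma>\<^esub> inv\<^bsub>PGL2_sub \<Gamma>\<^esub> h = h \<otimes>\<^bsub>PGL2\<^esub> g \<otimes>\<^bsub>PGL2\<^esub> inv\<^bsub>PGL2\<^esub> h"
  using PGL2.m_inv_consistent[OF sub h] by simp

text \<open>If the edge were missing, \<open>cut_off_edge\<close> would give an invariant subtree
  \<open>YE\<close> without it. The ends \<open>u\<close> and \<open>v\<close> of a line through the
  edge are fixed points, so by \<open>invariant_subtree_line\<close> this subtree contains a line to
  each of them. These merge with the line from \<open>v\<close> to \<open>u\<close> on both sides of
  the edge, and convexity puts the edge into \<open>YE\<close> after all.\<close>

lemma section_edge_in_subtree: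
  assumes H: "is_subtree H bt_tree"
    and mir: "\<And>v g. v \<in> verts T \<Longrightarrow> g \<in> fa0.Stab (\<iota> v) \<Longrightarrow> g \<noteq> \<one>\<^bsub>PGL2\<^esub> \<Longrightarrow> elliptic g \<Longrightarrow> verts (mirror g) \<subseteq> verts H"
    and e: "e \<in> edges T"
  shows "\<iota>e e \<in> edges H"
proof (rule ccontr)
  assume nH: "\<iota>e e \<notin> edges H"
  \<comment> \<open>Mirrors are meant for elliptic elements; the empty set in all other cases lets
    \<open>cut_off_edge\<close> quantify over the whole group.\<close>
  define M where "M g = (if elliptic g then verts (mirror g) else {})" for g :: "('k^2^2) set"
  have Mg: "M g = verts (mirror g)" if "elliptic g" for g using that by (simp add: M_def)
  have "\<exists>Y YE. Y \<subseteq> XV \<and> YE \<subseteq> XE - {\<iota>e e} \<and> Y \<noteq> {} \<and>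
      (\<forall>g\<in>carrier (PGL2_sub \<Gamma>). \<forall>x\<in>Y. vertex_act g x \<in> Y) \<and> (\<forall>g\<in>carrier (PGL2_sub \<Gamma>). \<forall>e\<in>YE. vertex_act g ` e \<in> YE) \<and>
      (\<forall>e\<in>YE. e \<subseteq> Y) \<and> (\<forall>x\<in>Y. \<forall>y\<in>Y. (x, y) \<in> (adj YE)\<^sup>*) \<and>
      (\<forall>g\<in>carrier (PGL2_sub \<Gamma>) - {\<one>\<^bsub>PGL2_sub \<Gamma>\<^esub>}. M g \<subseteq> Y)"
  proof (rule fa0.cut_off_edge[OF bt_forest XE_bt subtree_facts(1)[OF H] _ nH])
    show "\<iota>e e \<in> (\<lambda>e. \<iota> ` endpoints (base \<G>) e) ` edges (base \<G>)" using e by (simp add: base_\<G>)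
    show "(x, y) \<in> (adj (edges H))\<^sup>*" if "x \<in> verts H" "y \<in> verts H" for x y by (rule subtree_facts(5)[OF H that])
    show "x \<in> XV \<and> vertex_act g x = x" if g: "g \<in> carrier (PGL2_sub \<Gamma>) - {\<one>\<^bsub>PGL2_sub \<Gamma>\<^esub>}" and x: "x \<in> M g" for g x
    proof -
      have ell: "elliptic g" and xm: "x \<in> verts (mirror g)" using x by (auto simp: M_def split: if_splits)
      have "is_subgraph (mirror g) (T_star \<Gamma>)" using mirror_subgraph[of g \<Gamma>] g by simp
      then show ?thesis using elliptic_fixes_mirror[OF _ ell xm] \<Gamma>_carrier[of g] g xm by (auto simp: is_subgraph_def)
    qed
    show "vertex_act h x \<in> M (h \<otimes>\<^bsub>PGL2_sub \<Gamma>\<^esub> g \<otimes>\<^bsub>PGL2_sub \<Gamma>\<^esub> inv\<^bsub>PGL2_sub \<Gamma>\<^esub> h)"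
      if g: "g \<in> carrier (PGL2_sub \<Gamma>) - {\<one>\<^bsub>PGL2_sub \<Gamma>\<^esub>}" and h: "h \<in> carrier (PGL2_sub \<Gamma>)" and x: "x \<in> M g" for g h x
    proof -
      have ell: "elliptic g" and xm: "x \<in> verts (mirror g)" using x by (auto simp: M_def split: if_splits)
      have gh: "g \<in> \<Gamma>" "h \<in> \<Gamma>" using g h by auto
      show ?thesis unfolding mirror_conj_sub[OF gh]
        using mirror_conj(1)[OF \<Gamma>_carrier[OF gh(1)] \<Gamma>_carrier[OF gh(2)] xm]
          elliptic_conj[OF \<Gamma>_carrier[OF gh(1)] ell \<Gamma>_carrier[OF gh(2)]] by (simp add: Mg)
    qed
    show "M g \<noteq> {} \<and> M g \<subseteq> verts H" if s: "s \<in> \<iota> ` verts (base \<G>)" and g: "g \<in> fa0.Stab s - {\<one>\<^bsub>PGL2_sub \<Gamma>\<^esub>}" for s g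
    proof -
      obtain v where v: "v \<in> verts T" "s = \<iota> v" using s by (auto simp: base_\<G>)
      have gs: "g \<in> fa0.Stab (\<iota> v)" "g \<noteq> \<one>\<^bsub>PGL2\<^esub>" using g v by auto
      have ell: "elliptic g" using Stab_elliptic[OF \<iota>_vert[OF v(1)] gs] .
      have "g \<in> \<Gamma>" using gs by (simp add: Stab_eq)
      then show ?thesis unfolding Mg[OF ell] using mirror_nonempty(2)[OF \<Gamma>_carrier ell] mir[OF v(1) gs ell] by blast
    qed
  qed
  then obtain Y YE where Y0: "Y \<subseteq> XV" "YE \<subseteq> XE - {\<iota>e e}" "Y \<noteq> {}"
    "\<forall>g\<in>carrier (PGL2_sub \<Gamma>). \<forall>x\<in>Y. vertex_act g x \<in> Y" "\<forall>g\<in>carrier (PGL2_sub \<Gamma>). \<forall>e\<in>YE. vertex_act g ` e \<in> YE"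
    "\<forall>e\<in>YE. e \<subseteq> Y" "\<forall>x\<in>Y. \<forall>y\<in>Y. (x, y) \<in> (adj YE)\<^sup>*"
    "\<forall>g\<in>carrier (PGL2_sub \<Gamma>) - {\<one>\<^bsub>PGL2_sub \<Gamma>\<^esub>}. M g \<subseteq> Y" by (elim exE conjE)
  have Y: "\<forall>g\<in>\<Gamma>. \<forall>x\<in>Y. vertex_act g x \<in> Y" "\<forall>g\<in>\<Gamma>. \<forall>e\<in>YE. vertex_act g ` e \<in> YE" "YE \<subseteq> XE"
    using Y0 by auto
  have Ym: "verts (mirror g) \<subseteq> Y" if "g \<in> \<Gamma> - {\<one>\<^bsub>PGL2\<^esub>}" "elliptic g" for g
    using bspec[OF Y0(8), of g] that Mg[of g] by auto
  note line = invariant_subtree_line[OF Y0(1) Y(3) Y0(3) Y(1,2) Y0(6,7) Ym]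
  have "\<iota>e e \<in> ends_edges (fix_ends \<Gamma>)" using \<iota>_edge[OF e] by (simp add: T_star_eq)
  then obtain u v where uv: "\<iota>e e = {vtx u v, vtx u (unif *s v)}" "u \<in> fix_ends \<Gamma>" "v \<in> fix_ends \<Gamma>" "cr u v \<noteq> 0"
    unfolding ends_edges_def by blast
  have nz: "u \<noteq> 0" "v \<noteq> 0" "cr v u \<noteq> 0" using uv(4) cr_swap[of v u] by auto
  obtain w where w: "cr u w \<noteq> 0" "\<And>c. c \<noteq> 0 \<Longrightarrow> vtx u (c *s w) \<in> Y" using line[OF _ _ uv(2) nz(1)] by blast
  obtain w' where w': "cr v w' \<noteq> 0" "\<And>c. c \<noteq> 0 \<Longrightarrow> vtx v (c *s w') \<in> Y" using line[OF _ _ uv(3) nz(2)] by blast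
  obtain N b where N: "b \<noteq> 0" "\<And>n. n \<ge> N \<Longrightarrow> vtx u (unif ^ n *s v) = vtx u ((unif ^ n * b) *s w)"
    using lines_meet[OF uv(4) w(1)] by metis
  obtain N' b' where N': "b' \<noteq> 0" "\<And>n. n \<ge> N' \<Longrightarrow> vtx v (unif ^ n *s u) = vtx v ((unif ^ n * b') *s w')"
    using lines_meet[OF nz(3) w'(1)] by metis
  let ?f = "\<lambda>n :: int. vtx u (unif powi n *s v)"
  \<comment> \<open>The edge joins the positions 0 and 1, so the point on the right is taken at
    \<open>Suc N\<close>, which is at least 1, while \<open>- N'\<close> is at most 0.\<close>
  have "?f (int (Suc N)) \<in> Y" using N(2)[of "Suc N"] w(2)[of "unif ^ Suc N * b"] N(1) by (simp only: power_int_of_nat) simp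
  moreover have "?f (- int N') \<in> Y" unfolding vtx_flip using N'(2)[of N'] w'(2)[of "unif ^ N' * b'"] N'(1) by simp
  ultimately have conn: "(?f (- int N'), ?f (int (Suc N))) \<in> (adj YE)\<^sup>*" using Y0(7) by blast
  have "line_edge ?f n \<in> XE" for n
    unfolding T_star_eq ugraph.simps by (rule line_edge_ends[OF fix_ends_scale uv(2-4)])
  then have "line_edge ?f 0 \<in> YE"
    by (intro forest_convex_line[OF fa0.XE_forest line_vtx_inj[OF uv(4)] _ Y(3) conn]) simp_all
  moreover have "line_edge ?f 0 = \<iota>e e" by (simp add: line_edge_def uv(1))
  ultimately show False using Y0(2) by auto
qed

section \<open>The conditions of an admissible embedding\<close>

abbreviation "TT \<equiv> T_tilde (verts T) (\<lambda>v. fa0.Stab (\<iota> v))"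

lemma T_star_finite_subgraph:
  assumes v: "v \<in> verts T"
  shows "is_subgraph (T_star_finite (fa0.Stab (\<iota> v))) (T_star \<Gamma>)"
  unfolding T_star_finite_def
proof (rule minimal_subtree_least[OF T_star_subtree], intro ballI)
  fix Z assume "Z \<in> {mirror \<gamma> | \<gamma>. \<gamma> \<in> fa0.Stab (\<iota> v) - {\<one>\<^bsub>PGL2\<^esub>} \<and> elliptic \<gamma>}"
  then obtain \<gamma> where "Z = mirror \<gamma>" "\<gamma> \<in> \<Gamma> - {\<one>\<^bsub>PGL2\<^esub>}" by (auto simp: Stab_eq)
  then show "is_subgraph Z (T_star \<Gamma>)" using mirror_subgraph by blast
qed

lemma TT_subgraph: "is_subgraph TT (T_star \<Gamma>)"
  unfolding T_tilde_def by (rule minimal_subtree_least[OF T_star_subtree]) (use T_star_finite_subgraph in auto)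

text \<open>Every vertex of the tree lies on a line, hence on an edge. So containment of the
  vertices of the section follows from that of its edges.\<close>

lemma section_edge_exists:
  assumes v: "v \<in> verts T"
  shows "\<exists>e\<in>edges T. v \<in> endpoints T e"
proof -
  have "\<iota> v \<in> ends_verts (fix_ends \<Gamma>)" using \<iota>_vert[OF v] by (simp add: T_star_eq)
  then obtain x y where xy: "\<iota> v = vtx x y" "x \<in> fix_ends \<Gamma>" "y \<in> fix_ends \<Gamma>" "cr x y \<noteq> 0" unfolding ends_verts_def by blast
  then have "{vtx x y, vtx x (unif *s y)} \<in> ends_edges (fix_ends \<Gamma>)" unfolding ends_edges_def by blast
  then have d: "{vtx x y, vtx x (unif *s y)} \<in> XE" by (simp add: T_star_eq)
  have "\<iota> v \<in> \<iota> ` verts (base \<G>)" using v by (simp add: base_\<G>)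
  from fa0.edge_at_S[OF this d] obtain e where e: "e \<in> edges T" "\<iota> v \<in> \<iota>e e" using xy(1) by (auto simp: base_\<G>)
  then obtain w where "w \<in> endpoints T e" "\<iota> v = \<iota> w" by blast
  then have "w = v" using endpoints_T[OF e(1)] v \<iota>_inj by (auto dest: inj_onD)
  then show ?thesis using e(1) \<open>w \<in> endpoints T e\<close> by blast
qed

lemma image_graph_is_graph: "is_graph (image_graph \<iota> T)"
  unfolding is_graph_def
proof
  fix d assume "d \<in> edges (image_graph \<iota> T)"
  then obtain e where e: "e \<in> edges T" "d = \<iota>e e" by (auto simp: image_graph_def)
  then obtain u v where "u \<in> verts T" "v \<in> verts T" "endpoints T e = {u, v}" using endpoints_T by blast
  then show "\<exists>u\<in>verts (image_graph \<iota> T). \<exists>v\<in>verts (image_graph \<iota> T). endpoints (image_graph \<iota> T) d = {u, v}"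
    using e(2) by (auto simp: image_graph_def)
qed

text \<open>Every subtree that competes for \<open>TT\<close> contains the mirrors of all vertex
  stabilizers, so it contains each edge of the section by
  \<open>section_edge_in_subtree\<close>.\<close>

lemma image_graph_TT: "is_subgraph (image_graph \<iota> T) TT"
proof -
  define \<H> where "\<H> = {H. is_subtree H bt_tree \<and> (\<forall>Y\<in>(\<lambda>v. T_star_finite (fa0.Stab (\<iota> v))) ` verts T. is_subgraph Y H)}"
  have TT: "TT = \<lparr>verts = (\<Inter>H\<in>\<H>. verts H), edges = (\<Inter>H\<in>\<H>. edges H), endpoints = id\<rparr>"
    by (simp add: T_tilde_def minimal_subtree_def \<H>_def Let_def)
  have edge: "\<iota>e e \<in> edges H" if H: "H \<in> \<H>" and e: "e \<in> edges T" for H e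
  proof (rule section_edge_in_subtree[OF _ _ e])
    show "is_subtree H bt_tree" using H by (simp add: \<H>_def)
    fix v g assume v: "v \<in> verts T" and g: "g \<in> fa0.Stab (\<iota> v)" "g \<noteq> \<one>\<^bsub>PGL2\<^esub>" "elliptic g"
    have "verts (mirror g) \<subseteq> verts (T_star_finite (fa0.Stab (\<iota> v)))"
      unfolding T_star_finite_def by (rule conjunct1[OF minimal_subtree_contains]) (use g in blast)
    also have "\<dots> \<subseteq> verts H" using H v by (simp add: \<H>_def is_subgraph_def)
    finally show "verts (mirror g) \<subseteq> verts H" .
  qed
  have vert: "\<iota> v \<in> verts H" if H: "H \<in> \<H>" and v: "v \<in> verts T" for H v
  proof -
    obtain e where e: "e \<in> edges T" "v \<in> endpoints T e" using section_edge_exists[OF v] by blast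
    have "is_subtree H bt_tree" using H by (simp add: \<H>_def)
    from subtree_facts(4)[OF this edge[OF H e(1)]] obtain x y where "x \<in> verts H" "y \<in> verts H" "\<iota>e e = {x, y}" by blast
    moreover have "\<iota> v \<in> \<iota>e e" using e(2) by blast
    ultimately show ?thesis by auto
  qed
  have "edges (image_graph \<iota> T) \<subseteq> edges TT" "verts (image_graph \<iota> T) \<subseteq> verts TT"
    unfolding TT image_graph_def ugraph.simps using edge vert by auto
  moreover have "endpoints (image_graph \<iota> T) d = endpoints TT d" for d by (simp add: TT image_graph_def)
  ultimately show ?thesis using image_graph_is_graph by (simp add: is_subgraph_def)
qed

lemma image_graph_bt: "is_subgraph (image_graph \<iota> T) bt_tree"
proof -
  have "verts (image_graph \<iota> T) \<subseteq> verts bt_tree" using \<iota>_vert XV_bt by (auto simp: image_graph_def)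
  moreover have "edges (image_graph \<iota> T) \<subseteq> edges bt_tree" using \<iota>_edge XE_bt by (auto simp: image_graph_def)
  ultimately show ?thesis using image_graph_is_graph by (simp add: is_subgraph_def image_graph_def bt_tree_def)
qed

lemma generate_stabilizers_PGL2:
  assumes "verts T \<noteq> {}"
  shows "generate PGL2 (\<Union>v\<in>verts T. fa0.Stab (\<iota> v)) = \<Gamma>"
proof -
  have le: "(\<Union>v\<in>verts T. fa0.Stab (\<iota> v)) \<subseteq> \<Gamma>" by (auto simp: Stab_eq)
  have "generate (PGL2_sub \<Gamma>) (\<Union>s\<in>\<iota> ` verts T. fa0.Stab s) = \<Gamma>"
    using fa0.generate_stabilizers assms by (simp add: base_\<G>)
  then show ?thesis using PGL2.generate_consistent[OF le sub] by simp
qed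

text \<open>Some element of \<open>\<Gamma>\<close> moves an edge of the mirror into the section,
  and conjugation by that element moves the mirror along.\<close>

lemma mirror_meets_section:
  assumes v: "v \<in> verts T" and \<gamma>: "\<gamma> \<in> fa0.Stab (\<iota> v) - {\<one>\<^bsub>PGL2\<^esub>}"
  shows "\<exists>\<delta>\<in>\<Gamma>. elliptic (\<delta> \<otimes>\<^bsub>PGL2\<^esub> \<gamma> \<otimes>\<^bsub>PGL2\<^esub> inv\<^bsub>PGL2\<^esub> \<delta>) \<and>
      edges (mirror (\<delta> \<otimes>\<^bsub>PGL2\<^esub> \<gamma> \<otimes>\<^bsub>PGL2\<^esub> inv\<^bsub>PGL2\<^esub> \<delta>)) \<inter> edges (image_graph \<iota> T) \<noteq> {}"
proof -
  have g: "\<gamma> \<in> \<Gamma>" "\<gamma> \<noteq> \<one>\<^bsub>PGL2\<^esub>" using \<gamma> by (auto simp: Stab_eq)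
  have ell: "elliptic \<gamma>" using Stab_elliptic[OF \<iota>_vert[OF v]] \<gamma> by blast
  obtain d where d: "d \<in> edges (mirror \<gamma>)" using mirror_nonempty(1)[OF \<Gamma>_carrier[OF g(1)] ell] by blast
  have "is_subgraph (mirror \<gamma>) (T_star \<Gamma>)" using mirror_subgraph[of \<gamma> \<Gamma>] g by simp
  then have dX: "d \<in> XE" using d by (auto simp: is_subgraph_def)
  from fa0.SE_exists[OF dX] obtain h e where h: "h \<in> \<Gamma>" "e \<in> edges T" "d = vertex_act h ` \<iota>e e" by (auto simp: base_\<G>)
  define \<delta> where "\<delta> = inv\<^bsub>PGL2_sub \<Gamma>\<^esub> h"
  have \<delta>: "\<delta> \<in> \<Gamma>" using fa0.inv_closed[of h] h(1) by (simp add: \<delta>_def)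
  have "vertex_act \<delta> ` d = \<iota>e e"
  proof -
    have "vertex_act \<delta> ` vertex_act h ` \<iota>e e = (\<lambda>x. x) ` \<iota>e e"
      unfolding image_image by (rule image_cong) (use fa0.act_inv[of h] h(1) fa0.XE_subset[OF \<iota>_edge[OF h(2)]] in \<open>auto simp: \<delta>_def subset_iff\<close>)
    then show ?thesis using h(3) by simp
  qed
  moreover have "vertex_act \<delta> ` d \<in> edges (mirror (\<delta> \<otimes>\<^bsub>PGL2\<^esub> \<gamma> \<otimes>\<^bsub>PGL2\<^esub> inv\<^bsub>PGL2\<^esub> \<delta>))"
    by (rule mirror_conj(2)[OF \<Gamma>_carrier[OF g(1)] \<Gamma>_carrier[OF \<delta>] d])
  moreover have "\<iota>e e \<in> edges (image_graph \<iota> T)" using h(2) by (auto simp: image_graph_def)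
  ultimately show ?thesis using \<delta> elliptic_conj[OF \<Gamma>_carrier[OF g(1)] ell \<Gamma>_carrier[OF \<delta>]] by auto
qed

text \<open>The groups attached to the section are full stabilizers in \<open>\<Gamma>\<close>.
  Elements of the other ones that fix \<open>\<iota> v\<close> therefore lie in its stabilizer
  already, and \<open>u = v\<close> gives all of it.\<close>

lemma G_tilde_vertex_eq:
  assumes v: "v \<in> verts T"
  shows "G_tilde_vertex (verts T) (\<lambda>v. fa0.Stab (\<iota> v)) (\<iota> v) = fa0.Stab (\<iota> v)"
proof -
  have "(\<Union>u\<in>verts T. vertex_stabilizer (fa0.Stab (\<iota> u)) (\<iota> v)) = fa0.Stab (\<iota> v)"
    using v by (auto simp: vertex_stabilizer_eq Stab_eq)
  moreover have "generate PGL2 (fa0.Stab (\<iota> v)) = fa0.Stab (\<iota> v)"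
    by (rule PGL2.generate_subgroup_self[OF Stab_subgroup[OF \<iota>_vert[OF v]]])
  ultimately show ?thesis by (simp add: G_tilde_vertex_def)
qed

lemma G_tilde_edge_eq:
  assumes e: "e \<in> edges T"
  shows "G_tilde_edge (verts T) (\<lambda>v. fa0.Stab (\<iota> v)) (\<iota>e e) = {g \<in> \<Gamma>. \<forall>w\<in>\<iota>e e. vertex_act g w = w}"
proof -
  obtain u where u: "u \<in> verts T" "u \<in> endpoints T e" using endpoints_T[OF e] by blast
  have "(\<Union>u\<in>verts T. edge_stabilizer (fa0.Stab (\<iota> u)) (\<iota>e e)) = {g \<in> \<Gamma>. \<forall>w\<in>\<iota>e e. vertex_act g w = w}"
    using u by (auto simp: edge_stabilizer_eq Stab_eq)
  moreover have "generate PGL2 {g \<in> \<Gamma>. \<forall>w\<in>\<iota>e e. vertex_act g w = w} = {g \<in> \<Gamma>. \<forall>w\<in>\<iota>e e. vertex_act g w = w}"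
    by (rule PGL2.generate_subgroup_self[OF edge_Stab_subgroup[OF e]])
  ultimately show ?thesis by (simp add: G_tilde_edge_def)
qed

text \<open>An orbit under the stabilizer determines the orbit under \<open>\<Gamma>\<close> and
  hence the edge of the quotient. Conversely, \<open>edge_at_S\<close> moves any edge at
  \<open>\<iota> v\<close> into the section by an element of the stabilizer.\<close>

lemma star_bijection:
  assumes v: "v \<in> verts T"
  shows "bij_betw (\<lambda>e. orbit (PGL2_sub (fa0.Stab (\<iota> v))) edge_act (\<iota>e e)) (star T v)
    (orbits (PGL2_sub (fa0.Stab (\<iota> v)))
       (\<Union>\<tau>\<in>star TT (\<iota> v). orbit (PGL2_sub (fa0.Stab (\<iota> v))) edge_act \<tau>) edge_act)"
proof -
  let ?S = "fa0.Stab (\<iota> v)"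
  let ?o = "orbit (PGL2_sub ?S) edge_act"
  have S: "subgroup ?S PGL2" using Stab_subgroup[OF \<iota>_vert[OF v]] .
  have S\<Gamma>: "g \<in> \<Gamma>" if "g \<in> ?S" for g using that by (simp add: Stab_eq)
  have oeq: "?o (edge_act g d) = ?o d" if "g \<in> ?S" for g d by (rule orbit_act_eq[OF S edge_act_mult that])
  have self: "d \<in> ?o d" if d: "d \<in> XE" for d
  proof -
    obtain x y where "x \<in> XV" "y \<in> XV" "d = {x, y}" using XE_endpoints[OF d] by blast
    then have "edge_act \<one>\<^bsub>PGL2\<^esub> d = d" using vertex_act_one[OF XV_bt] by (simp add: edge_act_def)
    then show ?thesis using subgroup.one_closed[OF S] unfolding orbit_def by force
  qed
  have TTX: "edges TT \<subseteq> XE" and TTe: "endpoints TT = id"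
    using TT_subgraph by (auto simp: is_subgraph_def T_tilde_def minimal_subtree_def Let_def)
  have "inj_on (\<lambda>e. ?o (\<iota>e e)) (star T v)"
  proof (rule inj_onI)
    fix e e' assume e: "e \<in> star T v" "e' \<in> star T v" "?o (\<iota>e e) = ?o (\<iota>e e')"
    then have ee: "e \<in> edges T" "e' \<in> edges T" by (auto simp: star_def)
    have "\<iota>e e \<in> ?o (\<iota>e e')" using self[OF \<iota>_edge[OF ee(1)]] e(3) by simp
    then obtain g where g: "g \<in> ?S" "\<iota>e e = edge_act g (\<iota>e e')" by (auto simp: orbit_def)
    have "eorb (\<iota>e e) = eorb (\<iota>e e')" unfolding g(2) by (rule orbit_act_eq[OF sub edge_act_mult S\<Gamma>[OF g(1)]])
    then show "e = e'" using eorb_\<iota> ee by simp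
  qed
  moreover have "(\<lambda>e. ?o (\<iota>e e)) ` star T v = orbits (PGL2_sub ?S) (\<Union>\<tau>\<in>star TT (\<iota> v). ?o \<tau>) edge_act"
  proof (intro Set.equalityI subsetI)
    fix D assume "D \<in> (\<lambda>e. ?o (\<iota>e e)) ` star T v"
    then obtain e where e: "e \<in> edges T" "v \<in> endpoints T e" "D = ?o (\<iota>e e)" by (auto simp: star_def)
    have "\<iota>e e \<in> edges TT" using image_graph_TT e(1) by (auto simp: is_subgraph_def image_graph_def)
    then have "\<iota>e e \<in> star TT (\<iota> v)" using e(2) TTe by (simp add: star_def)
    then show "D \<in> orbits (PGL2_sub ?S) (\<Union>\<tau>\<in>star TT (\<iota> v). ?o \<tau>) edge_act"
      using self[OF \<iota>_edge[OF e(1)]] e(3) unfolding orbits_def by blast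
  next
    fix D assume "D \<in> orbits (PGL2_sub ?S) (\<Union>\<tau>\<in>star TT (\<iota> v). ?o \<tau>) edge_act"
    then obtain \<tau> d where \<tau>: "\<tau> \<in> star TT (\<iota> v)" "d \<in> ?o \<tau>" "D = ?o d" unfolding orbits_def by blast
    then obtain g where "g \<in> ?S" "d = edge_act g \<tau>" by (auto simp: orbit_def)
    then have D: "D = ?o \<tau>" using \<tau>(3) oeq by simp
    have \<tau>X: "\<tau> \<in> XE" "\<iota> v \<in> \<tau>" using \<tau>(1) TTX TTe by (auto simp: star_def)
    have "\<iota> v \<in> \<iota> ` verts (base \<G>)" using v by (simp add: base_\<G>)
    from fa0.edge_at_S[OF this \<tau>X] obtain h e where h: "h \<in> ?S" "e \<in> edges T" "\<iota> v \<in> \<iota>e e" "\<tau> = edge_act h (\<iota>e e)"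
      by (auto simp: base_\<G> edge_act_def)
    have "D = ?o (\<iota>e e)" unfolding D h(4) by (rule oeq[OF h(1)])
    moreover have "v \<in> endpoints T e"
    proof -
      obtain w where w: "w \<in> endpoints T e" "\<iota> v = \<iota> w" using h(3) by blast
      then have "w = v" using endpoints_T[OF h(2)] v \<iota>_inj by (auto dest: inj_onD)
      then show ?thesis using w by simp
    qed
    ultimately show "D \<in> (\<lambda>e. ?o (\<iota>e e)) ` star T v" using h(2) by (auto simp: star_def)
  qed
  ultimately show ?thesis unfolding bij_betw_def by blast
qed

lemma admissible_embedding_\<G>: "admissible_embedding \<G> \<iota> (\<lambda>v g. g)"
proof -
  have G: "(\<lambda>v. (\<lambda>g. g) ` carrier (vgroup \<G> v)) = (\<lambda>v. fa0.Stab (\<iota> v))" by (simp add: vgroup_\<G>)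
  have mon: "(\<lambda>g. g) \<in> mon (vgroup \<G> v) PGL2" if "v \<in> verts T" for v
    using \<Gamma>_carrier by (auto simp: mon_def hom_def vgroup_\<G> Stab_eq)
  have G': "(\<Union>v\<in>endpoints T e. (\<lambda>s. incl \<G> e v s) ` carrier (egroup \<G> e)) = {g \<in> \<Gamma>. \<forall>w\<in>\<iota>e e. vertex_act g w = w}"
    if "e \<in> edges T" for e
    using endpoints_T[OF that] by (auto simp: incl_\<G> egroup_\<G>)
  have ii: "\<forall>v\<in>verts T. \<forall>\<gamma>\<in>fa0.Stab (\<iota> v) - {\<one>\<^bsub>PGL2\<^esub>}. \<exists>\<delta>\<in>generate PGL2 (\<Union>v\<in>verts T. fa0.Stab (\<iota> v)).
          elliptic (\<delta> \<otimes>\<^bsub>PGL2\<^esub> \<gamma> \<otimes>\<^bsub>PGL2\<^esub> inv\<^bsub>PGL2\<^esub> \<delta>) \<and>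
          edges (mirror (\<delta> \<otimes>\<^bsub>PGL2\<^esub> \<gamma> \<otimes>\<^bsub>PGL2\<^esub> inv\<^bsub>PGL2\<^esub> \<delta>)) \<inter> edges (image_graph \<iota> T) \<noteq> {}"
  proof (intro ballI)
    fix v \<gamma> assume v: "v \<in> verts T" "\<gamma> \<in> fa0.Stab (\<iota> v) - {\<one>\<^bsub>PGL2\<^esub>}"
    then have "generate PGL2 (\<Union>v\<in>verts T. fa0.Stab (\<iota> v)) = \<Gamma>" using generate_stabilizers_PGL2 by blast
    then show "\<exists>\<delta>\<in>generate PGL2 (\<Union>v\<in>verts T. fa0.Stab (\<iota> v)).
          elliptic (\<delta> \<otimes>\<^bsub>PGL2\<^esub> \<gamma> \<otimes>\<^bsub>PGL2\<^esub> inv\<^bsub>PGL2\<^esub> \<delta>) \<and>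
          edges (mirror (\<delta> \<otimes>\<^bsub>PGL2\<^esub> \<gamma> \<otimes>\<^bsub>PGL2\<^esub> inv\<^bsub>PGL2\<^esub> \<delta>)) \<inter> edges (image_graph \<iota> T) \<noteq> {}"
      using mirror_meets_section[OF v] by simp
  qed
  show ?thesis
    unfolding admissible_embedding_def Let_def base_\<G> G
  proof (intro conjI)
    show "\<forall>v\<in>verts T. (\<lambda>g. g) \<in> mon (vgroup \<G> v) PGL2" using mon by blast
    show "\<forall>e\<in>edges T. \<forall>v\<in>endpoints T e. \<forall>w\<in>endpoints T e. \<forall>s\<in>carrier (egroup \<G> e). incl \<G> e v s = incl \<G> e w s"
      by (simp add: incl_\<G>)
    show "\<forall>e\<in>edges T. G_tilde_edge (verts T) (\<lambda>v. fa0.Stab (\<iota> v)) (\<iota>e e) =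
        (\<Union>v\<in>endpoints T e. (\<lambda>s. incl \<G> e v s) ` carrier (egroup \<G> e))"
      using G' G_tilde_edge_eq by simp
  qed (use \<iota>_inj image_graph_bt image_graph_TT ii G_tilde_vertex_eq star_bijection in blast)+
qed

lemma star_admissible_\<G>: "star_admissible TYPE('k) \<G>"
  unfolding star_admissible_def
proof (intro conjI exI)
  show "is_tree_of_groups \<G>" by (rule is_tree_of_groups_\<G>)
  show "admissible_embedding \<G> \<iota> (\<lambda>v g. g)" by (rule admissible_embedding_\<G>)
  show "finitely_generated_group (amalgam \<G>)"
    using fa.finitely_generated_amalgam finitely_generated trivial_if_empty by (simp add: base_\<G>)
qed

end

theorem lemma3p5:
  fixes \<Gamma> :: "('k::padic_field^2^2) set set"
    and \<iota> :: "'k vertex set \<Rightarrow> 'k vertex"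
  assumes "discrete_subgroup \<Gamma>"
    and "finitely_generated_group (PGL2_sub \<Gamma>)"
    and "fixed_points_rational \<Gamma>"
    and "is_tree (quotient_graph \<Gamma> (T_star \<Gamma>))"
    and "is_section \<Gamma> (T_star \<Gamma>) \<iota>"
  shows "star_admissible TYPE('k) (induced_tree_of_groups \<Gamma> \<iota>)"
proof -
  interpret discrete_section \<Gamma> \<iota> using assms by unfold_locales
  show ?thesis by (rule star_admissible_\<G>)
qed

end
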